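(* Let $n\ge 2$, $m=n-1$, and let $\Omega\subset\mathbb R^n$ be a bounded open convex set with nonempty interior and $\operatorname{diam}\Omega=1$, with coordinates $(x,y)\in\mathbb R\times\mathbb R^{m}$ chosen so that $(0,0),(1,0)\in\overline\Omega$, and let $\varepsilon>0$ be such that $\Omega\subset(0,1)\times B^{m}_\varepsilon(0)$. Let $T=A_\Omega^{-1}$ and $S=JA_N^{-1}P$, as bounded self-adjoint operators on $\mathcal H_\Omega=\{g\in L^2(\Omega):\int_\Omega g=0\}$. Then, in the sense of quadratic forms on $\mathcal H_\Omega$, $$0\le T-S\le 16^n\varepsilon^2 I,$$ where $I$ is the identity operator.
   Context: $B^m_\varepsilon(0)$ is the open ball of radius $\varepsilon$ centered at $0$ in $\mathbb R^m$. For $0<x<1$, $\Omega_x=\{y\in\mathbb R^{m}:(x,y)\in\Omega\}$ and $h(x)=|\Omega_x|$ is its $m$-dimensional Lebesgue measure. Set $$(J\phi)(x,y)=\phi(x),\qquad (Pz)(x)=\frac1{h(x)}\int_{\Omega_x}z(x,y)\,dy,$$ so $J:L^2((0,1),h\,dx)\to L^2(\Omega)$ is an isometry and $P=J^*$. Let $$\mathcal V_h=\Big\{v\in W^{1,2}_{\mathrm{loc}}(0,1):\int_0^1h(|v|^2+|v'|^2)\,dx<\infty\Big\},\qquad \mathcal H_N=\Big\{f\in L^2(h\,dx):\int_0^1hf\,dx=0\Big\}.$$ $P$ maps $\mathcal H_\Omega$ to $\mathcal H_N$ and $J$ maps $\mathcal H_N$ to $\mathcal H_\Omega$. The operators $A_\Omega$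 and $A_N$ are the positive Neumann operators restricted to the mean-zero spaces. Their inverses are the solution operators: for $g\in\mathcal H_\Omega$, $u=A_\Omega^{-1}g$ is the unique $u\in H^1(\Omega)\cap\mathcal H_\Omega$ with $\int_\Omega\nabla u\cdot\nabla z=\int_\Omega gz$ for all $z\in H^1(\Omega)$; for $f\in\mathcal H_N$, $v=A_N^{-1}f$ is the unique $v\in\mathcal V_h\cap\mathcal H_N$ with $\int_0^1hv'\phi'\,dx=\int_0^1hf\phi\,dx$ for all $\phi\in\mathcal V_h$. *)

theory Defs
  imports "HOL-Analysis.Analysis"
begin

section \<open>Square-integrable functions\<close>

text \<open>
  Elements of an \<open>L\<^sup>2\<close> space are represented by functions, and no quotient by almost everywhere
  equality is formed: everything below depends only on the class of a function. The base measure
  is \<open>lborel\<close>, so representatives are Borel; each Lebesgue class contains one.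
\<close>

abbreviation lborel_on :: "'a::euclidean_space set \<Rightarrow> 'a measure" where
  "lborel_on U \<equiv> restrict_space lborel U"

definition L2 :: "'a measure \<Rightarrow> ('a \<Rightarrow> 'b::euclidean_space) set" where
  "L2 M = {f \<in> borel_measurable M. integrable M (\<lambda>x. (norm (f x))\<^sup>2)}"

definition L2_inner :: "'a measure \<Rightarrow> ('a \<Rightarrow> 'b::euclidean_space) \<Rightarrow> ('a \<Rightarrow> 'b) \<Rightarrow> real" where
  "L2_inner M f g = (\<integral>x. f x \<bullet> g x \<partial>M)"

definition L2_mean_zero :: "'a measure \<Rightarrow> ('a \<Rightarrow> real) set" where
  "L2_mean_zero M = {f \<in> L2 M. (\<integral>x. f x \<partial>M) = 0}"

definition L2_loc :: "'a::euclidean_space set \<Rightarrow> ('a \<Rightarrow> 'b::euclidean_space) set" where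
  "L2_loc U = {f \<in> borel_measurable (lborel_on U).
     \<forall>K. compact K \<and> K \<subseteq> U \<longrightarrow> f \<in> L2 (lborel_on K)}"


section \<open>Weak gradients and Sobolev spaces\<close>

fun C_k :: "nat \<Rightarrow> ('a::euclidean_space \<Rightarrow> real) \<Rightarrow> bool" where
  "C_k 0 f \<longleftrightarrow> continuous_on UNIV f"
| "C_k (Suc k) f \<longleftrightarrow> (\<forall>x. f differentiable (at x)) \<and>
     (\<forall>i\<in>Basis. C_k k (\<lambda>x. frechet_derivative f (at x) i))"

definition test_functions :: "'a::euclidean_space set \<Rightarrow> ('a \<Rightarrow> real) set" where
  "test_functions U = {\<phi>. (\<forall>k. C_k k \<phi>) \<and>
     compact (closure {x. \<phi> x \<noteq> 0}) \<and> closure {x. \<phi> x \<noteq> 0} \<subseteq> U}"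

definition has_weak_gradient ::
    "'a::euclidean_space set \<Rightarrow> ('a \<Rightarrow> real) \<Rightarrow> ('a \<Rightarrow> 'a) \<Rightarrow> bool" where
  "has_weak_gradient U u G \<longleftrightarrow> (\<forall>\<phi>\<in>test_functions U. \<forall>i\<in>Basis.
     (\<integral>x. u x * frechet_derivative \<phi> (at x) i \<partial>lborel_on U) =
     - (\<integral>x. (G x \<bullet> i) * \<phi> x \<partial>lborel_on U))"

text \<open>
  A representative of the weak gradient, which is unique up to null sets for open \<open>U\<close>. On
  \<open>U \<subseteq> \<real>\<close> the only basis vector is \<open>1\<close>, and \<open>weak_grad U v\<close> is the weak derivative \<open>v'\<close>.
\<close>

definition weak_grad :: "'a::euclidean_space set \<Rightarrow> ('a \<Rightarrow> real) \<Rightarrow> 'a \<Rightarrow> 'a" where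
  "weak_grad U u = (SOME G. G \<in> L2_loc U \<and> has_weak_gradient U u G)"

definition W12_loc :: "'a::euclidean_space set \<Rightarrow> ('a \<Rightarrow> real) set" where
  "W12_loc U = {u \<in> L2_loc U. \<exists>G\<in>L2_loc U. has_weak_gradient U u G}"

definition H1 :: "'a::euclidean_space set \<Rightarrow> ('a \<Rightarrow> real) set" where
  "H1 U = {u \<in> L2 (lborel_on U). \<exists>G\<in>L2 (lborel_on U). has_weak_gradient U u G}"


section \<open>Reduction to the first coordinate\<close>

definition slice :: "(real \<times> 'a) set \<Rightarrow> real \<Rightarrow> 'a set" where
  "slice \<Omega> x = {y. (x, y) \<in> \<Omega>}"

definition slice_vol :: "(real \<times> 'a::euclidean_space) set \<Rightarrow> real \<Rightarrow> real" where
  "slice_vol \<Omega> x = measure lborel (slice \<Omega> x)"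

text \<open>The measure \<open>h dx\<close> on \<open>(0,1)\<close>, with \<open>h = slice_vol \<Omega>\<close>.\<close>

definition weighted :: "(real \<times> 'a::euclidean_space) set \<Rightarrow> real measure" where
  "weighted \<Omega> = density (lborel_on {0<..<1}) (\<lambda>x. ennreal (slice_vol \<Omega> x))"

definition J :: "(real \<Rightarrow> real) \<Rightarrow> real \<times> 'a \<Rightarrow> real" where
  "J \<phi> = (\<lambda>(x, y). \<phi> x)"

definition P :: "(real \<times> 'a::euclidean_space) set \<Rightarrow> (real \<times> 'a \<Rightarrow> real) \<Rightarrow> real \<Rightarrow> real" where
  "P \<Omega> z x = 1 / slice_vol \<Omega> x * (\<integral>y. z (x, y) \<partial>lborel_on (slice \<Omega> x))"

definition V_h :: "(real \<times> 'a::euclidean_space) set \<Rightarrow> (real \<Rightarrow> real) set" where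
  "V_h \<Omega> = {v \<in> W12_loc {0<..<1}.
     (\<integral>\<^sup>+x. ennreal (\<bar>v x\<bar>\<^sup>2 + \<bar>weak_grad {0<..<1} v x\<bar>\<^sup>2) \<partial>weighted \<Omega>) < \<infinity>}"

definition H_Omega :: "(real \<times> 'a::euclidean_space) set \<Rightarrow> (real \<times> 'a \<Rightarrow> real) set" where
  "H_Omega \<Omega> = L2_mean_zero (lborel_on \<Omega>)"

definition H_N :: "(real \<times> 'a::euclidean_space) set \<Rightarrow> (real \<Rightarrow> real) set" where
  "H_N \<Omega> = L2_mean_zero (weighted \<Omega>)"


section \<open>Solution operators of the Neumann problems\<close>

text \<open>The choice is only among almost everywhere equal functions.\<close>

definition A_Omega_inv ::
    "(real \<times> 'a::euclidean_space) set \<Rightarrow> (real \<times> 'a \<Rightarrow> real) \<Rightarrow> real \<times> 'a \<Rightarrow> real" where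
  "A_Omega_inv \<Omega> g = (SOME u. u \<in> H1 \<Omega> \<inter> H_Omega \<Omega> \<and>
     (\<forall>z\<in>H1 \<Omega>. L2_inner (lborel_on \<Omega>) (weak_grad \<Omega> u) (weak_grad \<Omega> z) =
                L2_inner (lborel_on \<Omega>) g z))"

definition A_N_inv ::
    "(real \<times> 'a::euclidean_space) set \<Rightarrow> (real \<Rightarrow> real) \<Rightarrow> real \<Rightarrow> real" where
  "A_N_inv \<Omega> f = (SOME v. v \<in> V_h \<Omega> \<inter> H_N \<Omega> \<and>
     (\<forall>\<phi>\<in>V_h \<Omega>.
        L2_inner (weighted \<Omega>) (weak_grad {0<..<1} v) (weak_grad {0<..<1} \<phi>) =
        L2_inner (weighted \<Omega>) f \<phi>))"

text \<open>The order of operators on \<open>H_Omega \<Omega>\<close> in the sense of quadratic forms.\<close>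

definition form_le :: "(real \<times> 'a::euclidean_space) set \<Rightarrow>
    ((real \<times> 'a \<Rightarrow> real) \<Rightarrow> real \<times> 'a \<Rightarrow> real) \<Rightarrow>
    ((real \<times> 'a \<Rightarrow> real) \<Rightarrow> real \<times> 'a \<Rightarrow> real) \<Rightarrow> bool" where
  "form_le \<Omega> A B \<longleftrightarrow> (\<forall>g\<in>H_Omega \<Omega>.
     L2_inner (lborel_on \<Omega>) (A g) g \<le> L2_inner (lborel_on \<Omega>) (B g) g)"

end

theory Submission
  imports Defs
begin

text \<open>
  Let \<open>u = T g\<close> and \<open>v = A\<^sub>N\<^sup>-\<^sup>1 (P g)\<close>, put \<open>r = u - J v\<close> and let \<open>R\<close> be its weak gradient, which is
  \<open>\<nabla>u - (v', 0)\<close>. Since \<open>J \<phi>\<close> has the weak gradient \<open>(\<phi>', 0)\<close> and \<open>P\<close> is the adjoint of \<open>J\<close>, the weak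
  equations for \<open>u\<close> and \<open>v\<close> show that \<open>R\<close> is orthogonal to \<open>(\<phi>', 0)\<close> for all \<open>\<phi>\<close> in the energy space of
  the interval, and that \<open>\<parallel>R\<parallel>\<^sup>2 = \<langle>g, r\<rangle> = \<langle>(T - S) g, g\<rangle>\<close>. So the form is nonnegative, and it remains to
  prove the dual estimate \<open>|\<langle>g, r\<rangle>| \<le> 4\<^sup>n \<epsilon> \<parallel>g\<parallel> \<parallel>R\<parallel>\<close>: it gives \<open>\<parallel>R\<parallel> \<le> 4\<^sup>n \<epsilon> \<parallel>g\<parallel>\<close>, and squaring yields
  the theorem (\<open>solution_operators_close\<close>).

  For the dual estimate write \<open>g = g\<^sub>0 + J f\<close> with \<open>f = P g\<close>. The part \<open>g\<^sub>0\<close> is orthogonal to all functions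
  of \<open>x\<close>, so it is paired with \<open>r - J (P r)\<close> only, and the Poincare inequality on the slices, convex sets of
  diameter at most \<open>2 \<epsilon>\<close>, bounds the norm of this oscillation by a multiple of \<open>\<epsilon> \<parallel>\<nabla>\<^sub>y r\<parallel>\<close>
  (\<open>slice_oscillation_le\<close>). For the part \<open>f\<close>, let \<open>F\<close> be the primitive of \<open>h f\<close>; it vanishes at both ends
  because \<open>h f\<close> has mean zero. Integration by parts turns \<open>\<langle>f, P r\<rangle>\<close> into the pairing of \<open>- F\<close> with \<open>(P r)'\<close>,
  and \<open>(P r)'\<close> is the slice average of \<open>\<partial>\<^sub>x r\<close> plus a contribution of the moving boundary of the slice. The
  first term gives, up to the sign, \<open>\<langle>J (F / h), \<partial>\<^sub>x r\<rangle>\<close>, which vanishes by the orthogonality of \<open>R\<close>. The boundary term does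
  not change if a constant is subtracted from \<open>r\<close> on the slice, so it sees the oscillation of \<open>r\<close> along the
  slice only, and this is where \<open>\<epsilon>\<close> is gained.

  The size of the boundary term comes from convexity. Since \<open>(0, 0)\<close> and \<open>(1, 0)\<close> lie in the closure of
  \<open>\<Omega>\<close>, the slices at \<open>x\<close> and \<open>x - t\<close> contain copies of each other scaled by \<open>1 - t / \<rho>\<close> with
  \<open>\<rho> = min x (1 - x)\<close>. Comparing integrals over a set and over a scaled copy by a change of variables bounds
  the boundary term by \<open>1 / \<rho>\<close> times the slice average of \<open>m |r - P r| + \<epsilon> |\<nabla>\<^sub>y r|\<close>
  (\<open>slice_average_difference\<close>, \<open>slice_average_pairing\<close>). Difference quotients are used instead of derivatives
  of slice averages, so no regularity of the boundary enters. The singular factor \<open>1 / \<rho>\<close> is absorbed by a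
  Hardy inequality for \<open>F\<close> (\<open>Hardy_slab\<close>), available because the same scaling shows that, up to the factor
  \<open>2\<^sup>m\<close>, \<open>h\<close> increases on \<open>(0, 1/2]\<close> and decreases on \<open>[1/2, 1)\<close>. The resulting constants are collected in
  \<open>sixteen_power_bound\<close>.

  All this is done for functions that are continuously differentiable on the whole space and for bounded \<open>f\<close>
  supported inside \<open>(0, 1)\<close>. The extension uses the density of the former in \<open>H\<^sup>1\<close> of a bounded open convex
  set (\<open>H1_smooth_approx\<close>), obtained by averaging \<open>u\<close> over contractions of the set into itself. The existence of
  both solutions follows from one Riesz-type theorem for weighted domains (\<open>Neumann_solvable\<close>), whose Poincare
  inequality holds on \<open>\<Omega>\<close> by convexity and on the interval by means of the isometry \<open>J\<close>.
\<close>

section \<open>Smooth functions and bumps\<close>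

text \<open>The direction comes before the point, so that \<open>pd f i\<close> is a function.\<close>

abbreviation (input) pd :: "('a::euclidean_space \<Rightarrow> real) \<Rightarrow> 'a \<Rightarrow> 'a \<Rightarrow> real" where
  "pd f i x \<equiv> frechet_derivative f (at x) i"

lemma pd_eqI: "(f has_derivative f') (at x) \<Longrightarrow> pd f i x = f' i"
  using frechet_derivative_at by metis

lemma has_derivative_pd: "f differentiable (at x) \<Longrightarrow> (f has_derivative (\<lambda>i. pd f i x)) (at x)"
  by (simp add: frechet_derivative_works)

lemma C_k_SucD: "C_k (Suc k) f \<Longrightarrow> C_k k f"
proof (induction k arbitrary: f)
  case 0
  then show ?case
    by (auto simp: continuous_on_eq_continuous_within
        intro!: differentiable_imp_continuous_within)
next
  case (Suc k)
  then show ?case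
    by (metis C_k.simps(2))
qed

lemma C_k_const: "C_k k (\<lambda>x. c)"
  by (induction k arbitrary: c) (auto simp: frechet_derivative_const)

lemma C_k_add: "C_k k f \<Longrightarrow> C_k k g \<Longrightarrow> C_k k (\<lambda>x. f x + g x)"
proof (induction k arbitrary: f g)
  case 0
  then show ?case by (auto intro: continuous_intros)
next
  case (Suc k)
  have "pd (\<lambda>x. f x + g x) i = (\<lambda>x. pd f i x + pd g i x)" for i
    using Suc.prems by (intro ext pd_eqI) (auto intro!: derivative_eq_intros has_derivative_pd)
  then show ?case
    using Suc by (auto intro: Suc.IH)
qed

lemma C_k_mult: "C_k k f \<Longrightarrow> C_k k g \<Longrightarrow> C_k k (\<lambda>x. f x * g x)"
proof (induction k arbitrary: f g)
  case 0
  then show ?case by (auto intro: continuous_intros)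
next
  case (Suc k)
  have "pd (\<lambda>x. f x * g x) i = (\<lambda>x. f x * pd g i x + pd f i x * g x)" for i
    using Suc.prems by (intro ext pd_eqI) (auto intro!: derivative_eq_intros has_derivative_pd)
  moreover have "C_k k (\<lambda>x. f x * pd g i x + pd f i x * g x)" if "i \<in> Basis" for i
    using Suc.prems that C_k_SucD[OF Suc.prems(1)] C_k_SucD[OF Suc.prems(2)]
    by (intro C_k_add Suc.IH) auto
  ultimately show ?case
    using Suc by (auto intro!: differentiable_mult)
qed

lemma C_k_inner: "C_k k (\<lambda>x. x \<bullet> a)"
proof (cases k)
  case (Suc j)
  have "pd (\<lambda>x. x \<bullet> a) i = (\<lambda>x. i \<bullet> a)" for i :: 'a
    by (rule ext, rule pd_eqI) (auto intro!: derivative_eq_intros)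
  then show ?thesis
    using Suc by (auto simp: C_k_const intro!: derivative_intros)
qed (auto intro: continuous_intros)

text \<open>The scalar factor makes the class of functions closed under partial derivatives.\<close>

lemma C_k_affine: "C_k k f \<Longrightarrow> C_k k (\<lambda>x. b * f (c *\<^sub>R x + a))"
proof (induction k arbitrary: f b)
  case 0
  then show ?case
    by (auto intro!: continuous_intros continuous_on_compose2[where f="\<lambda>x. c *\<^sub>R x + a"])
next
  case (Suc k)
  have d: "((\<lambda>x. b * f (c *\<^sub>R x + a)) has_derivative
      (\<lambda>h. b * frechet_derivative f (at (c *\<^sub>R x + a)) (c *\<^sub>R h))) (at x)" for x
  proof -
    have "(f has_derivative frechet_derivative f (at (c *\<^sub>R x + a))) (at (c *\<^sub>R x + a))"
      using Suc.prems frechet_derivative_works by auto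
    then show ?thesis
      by (auto intro!: derivative_eq_intros has_derivative_compose[where g=f and f="\<lambda>x. c *\<^sub>R x + a", rotated])
  qed
  have "pd (\<lambda>x. b * f (c *\<^sub>R x + a)) i = (\<lambda>x. (b * c) * pd f i (c *\<^sub>R x + a))" for i
  proof
    fix x
    have "linear (frechet_derivative f (at (c *\<^sub>R x + a)))"
      using Suc.prems by (auto intro: linear_frechet_derivative)
    then show "pd (\<lambda>x. b * f (c *\<^sub>R x + a)) i x = (b * c) * pd f i (c *\<^sub>R x + a)"
      by (simp add: pd_eqI[OF d] linear_cmul)
  qed
  moreover have "C_k k (\<lambda>x. (b * c) * pd f i (c *\<^sub>R x + a))" if "i \<in> Basis" for i
    using Suc.prems that by (intro Suc.IH) auto
  ultimately show ?case
    using d unfolding C_k.simps differentiable_def by metis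
qed

text \<open>
  Polynomials in \<open>1/t\<close> times \<open>exp (-1/t)\<close>, extended by zero to \<open>t \<le> 0\<close>: a family of functions
  closed under differentiation, whose member for \<open>p = 1\<close> is the standard flat function.
\<close>

definition flat :: "real poly \<Rightarrow> real \<Rightarrow> real" where
  "flat p t = (if t > 0 then poly p (1 / t) * exp (- 1 / t) else 0)"

lemma poly_exp_tendsto_0: "((\<lambda>s. poly p s * exp (- s)) \<longlongrightarrow> (0::real)) at_top"
proof -
  have "((\<lambda>s. \<Sum>i\<le>degree p. coeff p i * (s ^ i / exp s)) \<longlongrightarrow> (\<Sum>i\<le>degree p. coeff p i * 0)) at_top"
    by (intro tendsto_intros tendsto_power_div_exp_0)
  then show ?thesis
    by (simp add: poly_altdef sum_distrib_right exp_minus divide_inverse mult.assoc)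
qed

lemma flat_derivative:
  "(flat p has_real_derivative flat ([:0, 0, 1:] * (p - pderiv p)) t) (at t)"
proof -
  consider "t > 0" | "t < 0" | "t = 0" by linarith
  then show ?thesis
  proof cases
    case 1
    have "((\<lambda>t. poly p (1 / t) * exp (- 1 / t)) has_real_derivative
        flat ([:0, 0, 1:] * (p - pderiv p)) t) (at t)"
      using 1 unfolding flat_def
      by (auto intro!: derivative_eq_intros DERIV_chain2[where g="\<lambda>t. 1 / t" and f="poly p"]
          simp: field_simps power2_eq_square)
    then show ?thesis
      by (rule has_field_derivative_transform_within_open[of _ _ _ "{0<..}"])
        (use 1 in \<open>auto simp: flat_def\<close>)
  next
    case 2
    have "((\<lambda>t. 0) has_real_derivative flat ([:0, 0, 1:] * (p - pderiv p)) t) (at t)"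
      using 2 by (simp add: flat_def)
    then show ?thesis
      by (rule has_field_derivative_transform_within_open[of _ _ _ "{..<0}"])
        (use 2 in \<open>auto simp: flat_def\<close>)
  next
    case 3
    have "((\<lambda>s. poly ([:0, 1:] * p) s * exp (- s)) \<longlongrightarrow> 0) at_top"
      by (rule poly_exp_tendsto_0)
    then have "((\<lambda>t. poly ([:0, 1:] * p) (inverse t) * exp (- inverse t)) \<longlongrightarrow> 0) (at_right 0)"
      by (rule filterlim_compose) (rule filterlim_inverse_at_top_right)
    then have r: "((\<lambda>t. flat p t / t) \<longlongrightarrow> 0) (at_right 0)"
      by (rule Lim_transform_eventually)
        (auto simp: eventually_at_filter flat_def field_simps)
    have l: "((\<lambda>t. flat p t / t) \<longlongrightarrow> 0) (at_left 0)"
      by (rule Lim_transform_eventually[OF tendsto_const])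
        (auto simp: eventually_at_filter flat_def)
    have "((\<lambda>h. (flat p (0 + h) - flat p 0) / h) \<longlongrightarrow> 0) (at 0)"
      using filterlim_split_at[OF l r] by (simp add: flat_def)
    then have "(flat p has_real_derivative 0) (at 0)"
      by (simp add: DERIV_def)
    then show ?thesis
      using 3 by (simp add: flat_def)
  qed
qed

text \<open>
  \<open>R\<close> is the square of the radius. The differentiated family \<open>flat p\<close> carries the induction on \<open>k\<close>:
  a partial derivative is again of this form, times a linear factor.
\<close>

lemma C_k_flat_radial: "C_k k (\<lambda>x. flat p (R - (x - c) \<bullet> (x - c)))"
proof (induction k arbitrary: p)
  case 0
  have "continuous_on UNIV (flat p)"
    by (rule DERIV_continuous_on) (rule flat_derivative[THEN DERIV_subset], simp)
  then have "continuous_on UNIV (\<lambda>x. flat p (R - (x - c) \<bullet> (x - c)))"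
    by (rule continuous_on_compose2) (auto intro!: continuous_intros)
  then show ?case by simp
next
  case (Suc k)
  let ?q = "[:0, 0, 1:] * (p - pderiv p)"
  have d: "((\<lambda>x. flat p (R - (x - c) \<bullet> (x - c))) has_derivative
     (\<lambda>h. flat ?q (R - (x - c) \<bullet> (x - c)) * (- 2 * ((x - c) \<bullet> h)))) (at x)" for x
  proof -
    have "((\<lambda>x. R - (x - c) \<bullet> (x - c)) has_derivative (\<lambda>h. - 2 * ((x - c) \<bullet> h))) (at x)"
      by (auto intro!: derivative_eq_intros simp: inner_commute)
    from has_derivative_compose[OF this flat_derivative[unfolded has_field_derivative_def]]
    show ?thesis .
  qed
  have "C_k k (\<lambda>x. flat ?q (R - (x - c) \<bullet> (x - c)) * (- 2 * (x \<bullet> i + - (c \<bullet> i))))" for i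
    by (intro C_k_mult C_k_add C_k_inner C_k_const Suc.IH)
  moreover have "pd (\<lambda>x. flat p (R - (x - c) \<bullet> (x - c))) i =
      (\<lambda>x. flat ?q (R - (x - c) \<bullet> (x - c)) * (- 2 * (x \<bullet> i + - (c \<bullet> i))))" for i
    by (rule ext, simp only: pd_eqI[OF d]) (simp add: inner_diff_left)
  moreover have "\<forall>x. (\<lambda>x. flat p (R - (x - c) \<bullet> (x - c))) differentiable (at x)"
    using d unfolding differentiable_def by blast
  ultimately show ?case
    by simp
qed


section \<open>Test functions\<close>

lemma test_functionsD:
  assumes "\<phi> \<in> test_functions U"
  shows "C_k k \<phi>" "\<phi> differentiable (at x)" "continuous_on A \<phi>"
    "(\<phi> has_derivative (\<lambda>i. pd \<phi> i x)) (at x)"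
    "compact (closure {x. \<phi> x \<noteq> 0})" "closure {x. \<phi> x \<noteq> 0} \<subseteq> U" "\<phi> \<in> borel_measurable borel"
proof -
  have *: "C_k k \<phi>" for k using assms by (auto simp: test_functions_def)
  show "C_k k \<phi>" by (rule *)
  show d: "\<phi> differentiable (at x)" for x using *[of "Suc 0"] by simp
  have "continuous_on UNIV \<phi>" using *[of 0] by simp
  then show "continuous_on A \<phi>" "\<phi> \<in> borel_measurable borel"
    by (auto intro: continuous_on_subset borel_measurable_continuous_onI)
  show "(\<phi> has_derivative (\<lambda>i. pd \<phi> i x)) (at x)"
    using d by (rule has_derivative_pd)
qed (use assms in \<open>auto simp: test_functions_def\<close>)

lemma test_function_outside: "\<phi> \<in> test_functions U \<Longrightarrow> x \<notin> U \<Longrightarrow> \<phi> x = 0"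
  using closure_subset[of "{x. \<phi> x \<noteq> 0}"] by (auto simp: test_functions_def)

lemma test_functions_mono: "U \<subseteq> V \<Longrightarrow> test_functions U \<subseteq> test_functions V"
  by (auto simp: test_functions_def)

lemma pd_test_function:
  assumes "\<phi> \<in> test_functions U" "i \<in> Basis"
  shows "(\<lambda>x. pd \<phi> i x) \<in> test_functions U"
proof -
  let ?K = "closure {x. \<phi> x \<noteq> 0}"
  have z: "pd \<phi> i x = 0" if "x \<notin> ?K" for x
  proof -
    have "(\<phi> has_derivative (\<lambda>_. 0)) (at x)"
      by (rule has_derivative_transform_within_open[of "\<lambda>_. 0" _ _ _ "- ?K"])
        (use that closure_subset[of "{x. \<phi> x \<noteq> 0}"] in auto)
    then show ?thesis by (rule pd_eqI)
  qed
  have sub: "closure {x. pd \<phi> i x \<noteq> 0} \<subseteq> ?K"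
    by (rule closure_minimal) (use z in auto)
  moreover have "C_k k (\<lambda>x. pd \<phi> i x)" for k
    using test_functionsD(1)[OF assms(1), of "Suc k"] assms(2) by simp
  moreover have "compact (closure {x. pd \<phi> i x \<noteq> 0})"
    using sub test_functionsD(5)[OF assms(1)] by (metis closed_closure compact_Int_closed inf.absorb_iff2)
  ultimately show ?thesis
    using test_functionsD(6)[OF assms(1)] by (auto simp: test_functions_def)
qed

lemma test_function_bounded:
  assumes "\<phi> \<in> test_functions U"
  obtains B where "B > 0" "\<And>x. \<bar>\<phi> x\<bar> \<le> B"
proof -
  let ?K = "closure {x. \<phi> x \<noteq> 0}"
  have "bounded (\<phi> ` ?K)"
    by (intro compact_imp_bounded compact_continuous_image test_functionsD[OF assms])
  then obtain B where B: "B > 0" "\<And>x. x \<in> ?K \<Longrightarrow> \<bar>\<phi> x\<bar> \<le> B"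
    by (auto simp: bounded_pos)
  have "\<bar>\<phi> x\<bar> \<le> B" for x
    using B closure_subset[of "{x. \<phi> x \<noteq> 0}"] by (cases "\<phi> x = 0") auto
  with B(1) that show ?thesis by blast
qed

lemma test_function_integrable_on:
  assumes "\<phi> \<in> test_functions U"
  shows "integrable lborel \<phi>"
proof -
  let ?K = "closure {x. \<phi> x \<noteq> 0}"
  have "integrable lborel (\<lambda>x. indicator ?K x *\<^sub>R \<phi> x)"
    by (intro borel_integrable_compact test_functionsD[OF assms])
  moreover have "(\<lambda>x. indicator ?K x *\<^sub>R \<phi> x) = \<phi>"
    using closure_subset[of "{x. \<phi> x \<noteq> 0}"] by (auto simp: indicator_def fun_eq_iff)
  ultimately show ?thesis by simp
qed

definition grad :: "('a::euclidean_space \<Rightarrow> real) \<Rightarrow> 'a \<Rightarrow> 'a" where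
  "grad \<phi> x = (\<Sum>i\<in>Basis. pd \<phi> i x *\<^sub>R i)"

lemma grad_inner_Basis: "i \<in> Basis \<Longrightarrow> grad \<phi> x \<bullet> i = pd \<phi> i x"
  by (simp add: grad_def)

lemma has_derivative_grad:
  assumes "\<phi> \<in> test_functions U"
  shows "(\<phi> has_derivative (\<lambda>h. grad \<phi> x \<bullet> h)) (at x)"
proof -
  have l: "linear (\<lambda>h. pd \<phi> h x)"
    using test_functionsD(4)[OF assms] by (rule has_derivative_linear)
  have "pd \<phi> h x = grad \<phi> x \<bullet> h" for h
  proof -
    have "pd \<phi> h x = pd \<phi> (\<Sum>i\<in>Basis. (h \<bullet> i) *\<^sub>R i) x"
      by (simp add: euclidean_representation)
    also have "\<dots> = (\<Sum>i\<in>Basis. (h \<bullet> i) * pd \<phi> i x)"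
      using l by (simp add: linear_sum linear_cmul)
    also have "\<dots> = grad \<phi> x \<bullet> h"
      by (subst inner_commute) (simp add: grad_def inner_sum_right mult.commute)
    finally show ?thesis .
  qed
  then show ?thesis
    using test_functionsD(4)[OF assms, of x] by simp
qed

lemma grad_bounded:
  assumes "\<phi> \<in> test_functions U"
  obtains B where "B > 0" "\<And>x. norm (grad \<phi> x) \<le> B"
proof -
  have "\<exists>B. \<forall>x. \<bar>pd \<phi> i x\<bar> \<le> B" if "i \<in> Basis" for i
    using test_function_bounded[OF pd_test_function[OF assms that]] by metis
  then obtain B where B: "\<And>i x. i \<in> Basis \<Longrightarrow> \<bar>pd \<phi> i x\<bar> \<le> B i"
    by metis
  have "norm (grad \<phi> x) \<le> (\<Sum>i\<in>Basis. B i)" for x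
    unfolding grad_def by (rule order_trans[OF norm_sum]) (auto intro!: sum_mono B)
  then have "norm (grad \<phi> x) \<le> \<bar>\<Sum>i\<in>Basis. B i\<bar> + 1" for x
    by (smt (verit))
  then show ?thesis by (rule that[rotated]) auto
qed

lemma test_function_Lipschitz:
  assumes "\<phi> \<in> test_functions U"
  obtains L where "L > 0" "\<And>x y. \<bar>\<phi> x - \<phi> y\<bar> \<le> L * norm (x - y)"
proof -
  obtain B where B: "B > 0" "\<And>x. norm (grad \<phi> x) \<le> B"
    using grad_bounded[OF assms] by metis
  have "norm (\<phi> x - \<phi> y) \<le> B * norm (x - y)" for x y
  proof (rule differentiable_bound[of UNIV])
    show "onorm (\<lambda>h. grad \<phi> x \<bullet> h) \<le> B" for x
      by (rule onorm_bound)
        (use B(1) order_trans[OF Cauchy_Schwarz_ineq2 mult_right_mono[OF B(2)]] in auto)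
  qed (auto intro: has_derivative_grad[OF assms])
  then show ?thesis
    using B(1) that by force
qed

text \<open>
  First derivatives of a test function are test functions, hence Lipschitz; the quadratic error term in
  the first-order expansion below comes from this bound.
\<close>

lemma grad_Lipschitz:
  assumes "\<phi> \<in> test_functions U"
  obtains L where "L > 0" "\<And>x y. norm (grad \<phi> x - grad \<phi> y) \<le> L * norm (x - y)"
proof -
  have "\<exists>B. \<forall>x y. \<bar>pd \<phi> i x - pd \<phi> i y\<bar> \<le> B * norm (x - y)" if "i \<in> Basis" for i
    using test_function_Lipschitz[OF pd_test_function[OF assms that]] by metis
  then obtain B where B: "\<And>i x y. i \<in> Basis \<Longrightarrow> \<bar>pd \<phi> i x - pd \<phi> i y\<bar> \<le> B i * norm (x - y)"
    by metis
  have "norm (grad \<phi> x - grad \<phi> y) \<le> (\<Sum>i\<in>Basis. B i) * norm (x - y)" for x y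
    unfolding grad_def sum_subtractf[symmetric] sum_distrib_right scaleR_diff_left[symmetric]
    by (rule order_trans[OF norm_sum]) (auto intro!: sum_mono B)
  moreover have "(\<Sum>i\<in>Basis. B i) * norm (x - y) \<le> (\<bar>\<Sum>i\<in>Basis. B i\<bar> + 1) * norm (x - y)" for x y :: 'a
    by (rule mult_right_mono) auto
  ultimately show ?thesis
    using that[of "\<bar>\<Sum>i\<in>Basis. B i\<bar> + 1"] order_trans by (metis abs_ge_zero add_nonneg_pos zero_less_one)
qed

lemma test_function_Taylor:
  assumes "\<phi> \<in> test_functions U"
  obtains L where "L > 0" "\<And>x y. \<bar>\<phi> y - \<phi> x - grad \<phi> x \<bullet> (y - x)\<bar> \<le> L * (norm (y - x))\<^sup>2"
proof -
  obtain L where L: "L > 0" "\<And>x y. norm (grad \<phi> x - grad \<phi> y) \<le> L * norm (x - y)"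
    using grad_Lipschitz[OF assms] by metis
  have "\<bar>\<phi> y - \<phi> x - grad \<phi> x \<bullet> (y - x)\<bar> \<le> L * (norm (y - x))\<^sup>2" for x y
  proof -
    let ?S = "cball x (norm (y - x))"
    have "norm ((\<phi> y - grad \<phi> x \<bullet> y) - (\<phi> x - grad \<phi> x \<bullet> x)) \<le> L * norm (y - x) * norm (y - x)"
    proof (rule differentiable_bound[of ?S])
      fix z assume z: "z \<in> ?S"
      show "((\<lambda>y. \<phi> y - grad \<phi> x \<bullet> y) has_derivative (\<lambda>h. (grad \<phi> z - grad \<phi> x) \<bullet> h)) (at z within ?S)"
        by (auto intro!: derivative_eq_intros has_derivative_grad[OF assms, THEN has_derivative_at_withinI]
            simp: inner_diff_left)
      have "norm (grad \<phi> z - grad \<phi> x) \<le> L * norm (z - x)" by (rule L)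
      also have "\<dots> \<le> L * norm (y - x)"
        using z L(1) by (auto simp: dist_norm norm_minus_commute)
      finally have "norm (grad \<phi> z - grad \<phi> x) \<le> L * norm (y - x)" .
      then show "onorm (\<lambda>h. (grad \<phi> z - grad \<phi> x) \<bullet> h) \<le> L * norm (y - x)"
        by (intro onorm_bound)
          (use L(1) order_trans[OF Cauchy_Schwarz_ineq2 mult_right_mono] in auto)
    qed (auto simp: dist_norm norm_minus_commute)
    then show ?thesis
      by (simp add: power2_eq_square algebra_simps)
  qed
  then show ?thesis using L(1) that by blast
qed

lemma pd_affine:
  assumes "\<phi> \<in> test_functions U"
  shows "pd (\<lambda>q. \<phi> (c *\<^sub>R q + a)) i q = c * pd \<phi> i (c *\<^sub>R q + a)"
proof -
  have "((\<lambda>q. \<phi> (c *\<^sub>R q + a)) has_derivative (\<lambda>h. grad \<phi> (c *\<^sub>R q + a) \<bullet> (c *\<^sub>R h))) (at q)"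
    by (rule has_derivative_compose[OF _ has_derivative_grad[OF assms]])
      (auto intro!: derivative_eq_intros)
  then have "pd (\<lambda>q. \<phi> (c *\<^sub>R q + a)) i q = c * (grad \<phi> (c *\<^sub>R q + a) \<bullet> i)"
    by (simp add: pd_eqI)
  also have "grad \<phi> (c *\<^sub>R q + a) \<bullet> i = pd \<phi> i (c *\<^sub>R q + a)"
    using pd_eqI[OF has_derivative_grad[OF assms]] by simp
  finally show ?thesis .
qed

lemma test_function_affine:
  assumes "\<phi> \<in> test_functions U" "c \<noteq> 0" and sub: "\<And>q. c *\<^sub>R q + a \<in> U \<Longrightarrow> q \<in> V"
  shows "(\<lambda>q. \<phi> (c *\<^sub>R q + a)) \<in> test_functions V"
proof -
  let ?K = "closure {x. \<phi> x \<noteq> 0}"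
  let ?g = "\<lambda>q. c *\<^sub>R q + a"
  let ?h = "\<lambda>x. (1 / c) *\<^sub>R (x - a)"
  have K: "compact (?h ` ?K)"
    by (intro compact_continuous_image continuous_intros test_functionsD[OF assms(1)])
  have *: "q \<in> ?h ` ?K" if "?g q \<in> ?K" for q
    by (rule image_eqI[OF _ that]) (use assms(2) in simp)
  have sub': "closure {q. \<phi> (?g q) \<noteq> 0} \<subseteq> ?h ` ?K"
    by (rule closure_minimal)
      (use * closure_subset[of "{x. \<phi> x \<noteq> 0}"] K compact_imp_closed in blast)+
  have "?h ` ?K \<subseteq> V"
    using assms(2) test_functionsD(6)[OF assms(1)] by (auto intro!: sub)
  moreover have "C_k k (\<lambda>q. \<phi> (?g q))" for k
    using C_k_affine[OF test_functionsD(1)[OF assms(1)], of k 1 c a] by simp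
  moreover have "compact (closure {q. \<phi> (?g q) \<noteq> 0})"
    using sub' K by (metis closed_closure compact_Int_closed inf.absorb_iff2)
  ultimately show ?thesis
    using sub' by (auto simp: test_functions_def)
qed

lemma bump_exists:
  fixes U :: "'a::euclidean_space set"
  assumes "open U" "U \<noteq> {}"
  obtains \<eta> where "\<eta> \<in> test_functions U" "\<And>x. \<eta> x \<ge> 0" "integral\<^sup>L lborel \<eta> = 1"
proof -
  obtain c where "c \<in> U" using assms by auto
  then obtain r where r: "r > 0" "cball c r \<subseteq> U"
    using assms(1) by (meson open_contains_cball)
  define \<beta> where "\<beta> x = flat 1 (r\<^sup>2 - (x - c) \<bullet> (x - c))" for x :: 'a
  have nz: "\<beta> x \<noteq> 0 \<longleftrightarrow> x \<in> ball c r" for x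
  proof -
    have "(x - c) \<bullet> (x - c) < r\<^sup>2 \<longleftrightarrow> norm (x - c) < r"
      using r(1) by (metis abs_norm_cancel abs_of_pos power2_norm_eq_inner real_sqrt_abs real_sqrt_less_iff)
    then show ?thesis by (auto simp: \<beta>_def flat_def dist_norm norm_minus_commute)
  qed
  have nn: "\<beta> x \<ge> 0" for x by (simp add: \<beta>_def flat_def)
  have "closure {x. \<beta> x \<noteq> 0} \<subseteq> cball c r"
    by (rule closure_minimal) (auto simp: nz)
  then have t: "\<beta> \<in> test_functions U"
    using r(2) compact_cball[of c r] C_k_flat_radial[of _ 1 "r\<^sup>2" c]
    unfolding test_functions_def \<beta>_def
    by (auto intro: bounded_subset[OF bounded_cball] dest: order_trans[OF closure_subset])
  have I: "integrable lborel \<beta>" by (rule test_function_integrable_on[OF t])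
  have "integral\<^sup>L lborel \<beta> \<noteq> 0"
  proof
    assume "integral\<^sup>L lborel \<beta> = 0"
    then have "AE x in lborel. \<beta> x = 0"
      using integral_nonneg_eq_0_iff_AE[OF I] nn by auto
    then have "AE x in lborel. x \<notin> ball c r" by eventually_elim (use nz in auto)
    then have "emeasure lborel (ball c r) = 0"
      by (subst (asm) AE_iff_measurable[where N="ball c r"]) auto
    then show False
      using open_not_negligible[of "ball c r"] r(1)
      by (simp add: negligible_iff_emeasure0 emeasure_completion)
  qed
  moreover have "integral\<^sup>L lborel \<beta> \<ge> 0" using nn by simp
  ultimately have pos: "integral\<^sup>L lborel \<beta> > 0" by simp
  let ?c = "1 / integral\<^sup>L lborel \<beta>"
  have "C_k k (\<lambda>x. ?c * \<beta> x)" for k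
    by (intro C_k_mult C_k_const test_functionsD[OF t])
  then have "(\<lambda>x. ?c * \<beta> x) \<in> test_functions U"
    using t pos by (simp add: test_functions_def)
  then show ?thesis
    by (rule that) (use nn pos in auto)
qed

section \<open>Square-integrable functions\<close>

lemma L2_measurable[measurable_dest]: "f \<in> L2 M \<Longrightarrow> f \<in> borel_measurable M"
  by (simp add: L2_def)

lemma L2_integrable_square: "f \<in> L2 M \<Longrightarrow> integrable M (\<lambda>x. (norm (f x))\<^sup>2)"
  by (simp add: L2_def)

lemma L2_iff_nn:
  "f \<in> L2 M \<longleftrightarrow> f \<in> borel_measurable M \<and> (\<integral>\<^sup>+x. ennreal ((norm (f x))\<^sup>2) \<partial>M) < \<infinity>"
  by (auto simp: L2_def integrable_iff_bounded)

lemma L2_zero: "(\<lambda>x. 0) \<in> L2 M"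
  by (simp add: L2_def)

lemma L2_scale: "f \<in> L2 M \<Longrightarrow> (\<lambda>x. c *\<^sub>R f x) \<in> L2 M"
  by (auto simp: L2_def power_mult_distrib)

lemma L2_add:
  assumes "f \<in> L2 M" "g \<in> L2 M"
  shows "(\<lambda>x. f x + g x) \<in> L2 M"
proof -
  have [measurable]: "f \<in> borel_measurable M" "g \<in> borel_measurable M"
    using assms by (auto simp: L2_def)
  have "integrable M (\<lambda>x. 2 * (norm (f x))\<^sup>2 + 2 * (norm (g x))\<^sup>2)"
    using assms by (auto simp: L2_def)
  then have "integrable M (\<lambda>x. (norm (f x + g x))\<^sup>2)"
  proof (rule Bochner_Integration.integrable_bound)
    have "(norm (f x + g x))\<^sup>2 \<le> 2 * (norm (f x))\<^sup>2 + 2 * (norm (g x))\<^sup>2" for x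
    proof -
      have "(norm (f x + g x))\<^sup>2 \<le> (norm (f x) + norm (g x))\<^sup>2"
        by (intro power_mono norm_triangle_ineq) auto
      also have "\<dots> \<le> 2 * (norm (f x))\<^sup>2 + 2 * (norm (g x))\<^sup>2"
        using sum_squares_bound[of "norm (f x)" "norm (g x)"] by (simp add: power2_sum)
      finally show ?thesis .
    qed
    then show "AE x in M. norm ((norm (f x + g x))\<^sup>2) \<le> norm (2 * (norm (f x))\<^sup>2 + 2 * (norm (g x))\<^sup>2)"
      by simp
  qed measurable
  then show ?thesis
    by (simp add: L2_def)
qed

lemma L2_diff: "f \<in> L2 M \<Longrightarrow> g \<in> L2 M \<Longrightarrow> (\<lambda>x. f x - g x) \<in> L2 M"
  using L2_add[of f M "\<lambda>x. -1 *\<^sub>R g x"] L2_scale[of g M "-1"] by simp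

lemma L2_add_scale: "f \<in> L2 M \<Longrightarrow> g \<in> L2 M \<Longrightarrow> (\<lambda>x. f x + c *\<^sub>R g x) \<in> L2 M"
  by (intro L2_add L2_scale)

lemma L2_cong_AE:
  assumes "AE x in M. f x = g x" "g \<in> borel_measurable M" "f \<in> L2 M"
  shows "g \<in> L2 M"
proof -
  have "(\<integral>\<^sup>+x. ennreal ((norm (g x))\<^sup>2) \<partial>M) = (\<integral>\<^sup>+x. ennreal ((norm (f x))\<^sup>2) \<partial>M)"
    by (rule nn_integral_cong_AE) (use assms(1) in eventually_elim, simp)
  then show ?thesis
    using assms by (simp add: L2_iff_nn)
qed

lemma L2_dominated:
  assumes "f \<in> L2 M" "g \<in> borel_measurable M" "\<And>x. x \<in> space M \<Longrightarrow> norm (g x) \<le> norm (f x)"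
  shows "g \<in> L2 M"
proof -
  have "(\<integral>\<^sup>+x. ennreal ((norm (g x))\<^sup>2) \<partial>M) \<le> (\<integral>\<^sup>+x. ennreal ((norm (f x))\<^sup>2) \<partial>M)"
    by (intro nn_integral_mono ennreal_leI power_mono assms) auto
  then show ?thesis
    using assms(1,2) by (auto simp: L2_iff_nn)
qed

lemma L2_norm_prod_integrable:
  assumes "f \<in> L2 M" "g \<in> L2 M"
  shows "integrable M (\<lambda>x. norm (f x) * norm (g x))"
proof -
  have [measurable]: "f \<in> borel_measurable M" "g \<in> borel_measurable M"
    using assms by (auto simp: L2_def)
  have "integrable M (\<lambda>x. (norm (f x))\<^sup>2 + (norm (g x))\<^sup>2)"
    using assms by (auto simp: L2_def)
  then show ?thesis
  proof (rule Bochner_Integration.integrable_bound)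
    have "norm (f x) * norm (g x) \<le> (norm (f x))\<^sup>2 + (norm (g x))\<^sup>2" for x
      using sum_squares_bound[of "norm (f x)" "norm (g x)"]
        mult_nonneg_nonneg[OF norm_ge_zero norm_ge_zero, of "f x" "g x"] by linarith
    then show "AE x in M. norm (norm (f x) * norm (g x)) \<le> norm ((norm (f x))\<^sup>2 + (norm (g x))\<^sup>2)"
      by (simp add: abs_mult)
  qed measurable
qed

lemma L2_inner_integrable:
  assumes "f \<in> L2 M" "g \<in> L2 M"
  shows "integrable M (\<lambda>x. f x \<bullet> g x)"
proof -
  have [measurable]: "f \<in> borel_measurable M" "g \<in> borel_measurable M"
    using assms by (auto simp: L2_def)
  show ?thesis
    by (rule Bochner_Integration.integrable_bound[OF L2_norm_prod_integrable[OF assms]])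
      (auto simp: abs_mult Cauchy_Schwarz_ineq2)
qed

lemma L2_mult_integrable:
  fixes f g :: "'a \<Rightarrow> real"
  shows "f \<in> L2 M \<Longrightarrow> g \<in> L2 M \<Longrightarrow> integrable M (\<lambda>x. f x * g x)"
  using L2_inner_integrable[of f M g] by simp

definition L2_norm :: "'a measure \<Rightarrow> ('a \<Rightarrow> 'b::euclidean_space) \<Rightarrow> real" where
  "L2_norm M f = sqrt (\<integral>x. (norm (f x))\<^sup>2 \<partial>M)"

lemma L2_norm_nonneg[simp]: "L2_norm M f \<ge> 0"
  by (simp add: L2_norm_def)

lemma L2_norm_square: "(L2_norm M f)\<^sup>2 = (\<integral>x. (norm (f x))\<^sup>2 \<partial>M)"
  by (simp add: L2_norm_def)

lemma L2_norm_square_inner: "(L2_norm M f)\<^sup>2 = L2_inner M f f"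
  by (simp add: L2_norm_square L2_inner_def power2_norm_eq_inner)

lemma L2_norm_nn:
  "f \<in> L2 M \<Longrightarrow> ennreal ((L2_norm M f)\<^sup>2) = (\<integral>\<^sup>+x. ennreal ((norm (f x))\<^sup>2) \<partial>M)"
  by (simp add: L2_norm_square nn_integral_eq_integral[OF L2_integrable_square])

lemma L2_norm_scale: "L2_norm M (\<lambda>x. c *\<^sub>R f x) = \<bar>c\<bar> * L2_norm M f"
  by (simp add: L2_norm_def power_mult_distrib real_sqrt_mult)

lemma L2_norm_minus_commute: "L2_norm M (\<lambda>x. f x - g x) = L2_norm M (\<lambda>x. g x - f x)"
  by (simp add: L2_norm_def norm_minus_commute)

lemma L2_norm_cong_AE:
  assumes "AE x in M. f x = g x" "g \<in> borel_measurable M" "f \<in> borel_measurable M"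
  shows "L2_norm M f = L2_norm M g"
  unfolding L2_norm_def
  by (intro arg_cong[where f=sqrt] integral_cong_AE) (use assms in auto)

lemma L2_norm_Cauchy_Schwarz:
  assumes "f \<in> L2 M" "g \<in> L2 M"
  shows "(\<integral>x. norm (f x) * norm (g x) \<partial>M) \<le> L2_norm M f * L2_norm M g"
proof -
  have [measurable]: "f \<in> borel_measurable M" "g \<in> borel_measurable M"
    using assms by (auto simp: L2_def)
  let ?I = "\<integral>x. norm (f x) * norm (g x) \<partial>M"
  have "ennreal (?I\<^sup>2) = (\<integral>\<^sup>+x. ennreal (norm (f x)) * ennreal (norm (g x)) \<partial>M)\<^sup>2"
    by (subst ennreal_power[symmetric], simp,
        subst nn_integral_eq_integral[OF L2_norm_prod_integrable[OF assms], symmetric])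
      (auto simp: ennreal_mult)
  also have "\<dots> \<le> (\<integral>\<^sup>+x. ennreal (norm (f x)) ^ 2 \<partial>M) * (\<integral>\<^sup>+x. ennreal (norm (g x)) ^ 2 \<partial>M)"
    by (rule Cauchy_Schwarz_nn_integral) auto
  also have "\<dots> = ennreal ((L2_norm M f)\<^sup>2 * (L2_norm M g)\<^sup>2)"
    using assms by (simp add: L2_norm_nn ennreal_power ennreal_mult)
  finally have "?I\<^sup>2 \<le> (L2_norm M f * L2_norm M g)\<^sup>2"
    by (simp add: power_mult_distrib)
  then show ?thesis
    by (rule power2_le_imp_le) simp
qed

lemma L2_inner_Cauchy_Schwarz:
  assumes "f \<in> L2 M" "g \<in> L2 M"
  shows "\<bar>L2_inner M f g\<bar> \<le> L2_norm M f * L2_norm M g"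
proof -
  have "\<bar>L2_inner M f g\<bar> \<le> (\<integral>x. norm (f x \<bullet> g x) \<partial>M)"
    unfolding L2_inner_def by (metis integral_norm_bound real_norm_def)
  also have "\<dots> \<le> (\<integral>x. norm (f x) * norm (g x) \<partial>M)"
    by (intro integral_mono integrable_norm L2_inner_integrable L2_norm_prod_integrable assms)
      (auto simp: Cauchy_Schwarz_ineq2)
  also have "\<dots> \<le> L2_norm M f * L2_norm M g"
    by (rule L2_norm_Cauchy_Schwarz[OF assms])
  finally show ?thesis .
qed

lemma L2_inner_commute: "L2_inner M f g = L2_inner M g f"
  by (simp add: L2_inner_def inner_commute)

lemma L2_inner_add_scale:
  assumes "f \<in> L2 M" "g \<in> L2 M" "h \<in> L2 M"
  shows "L2_inner M (\<lambda>x. f x + c *\<^sub>R g x) h = L2_inner M f h + c * L2_inner M g h"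
  using assms by (simp add: L2_inner_def inner_add_left L2_inner_integrable)

lemma L2_inner_diff:
  assumes "f \<in> L2 M" "g \<in> L2 M" "h \<in> L2 M"
  shows "L2_inner M (\<lambda>x. f x - g x) h = L2_inner M f h - L2_inner M g h"
  using assms by (simp add: L2_inner_def inner_diff_left L2_inner_integrable)

lemma L2_inner_cong_AE:
  assumes "AE x in M. f x = f' x" "AE x in M. g x = g' x"
    "f \<in> borel_measurable M" "f' \<in> borel_measurable M" "g \<in> borel_measurable M" "g' \<in> borel_measurable M"
  shows "L2_inner M f g = L2_inner M f' g'"
  unfolding L2_inner_def
  by (rule integral_cong_AE) (use assms in auto)

lemma L2_norm_triangle:
  assumes "f \<in> L2 M" "g \<in> L2 M"
  shows "L2_norm M (\<lambda>x. f x + g x) \<le> L2_norm M f + L2_norm M g"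
proof (rule power2_le_imp_le)
  have "(L2_norm M (\<lambda>x. f x + g x))\<^sup>2 = (\<integral>x. (norm (f x))\<^sup>2 + 2 * (f x \<bullet> g x) + (norm (g x))\<^sup>2 \<partial>M)"
    unfolding L2_norm_square
    by (intro Bochner_Integration.integral_cong)
      (auto simp: power2_norm_eq_inner inner_add_left inner_add_right inner_commute)
  also have "\<dots> = (L2_norm M f)\<^sup>2 + 2 * L2_inner M f g + (L2_norm M g)\<^sup>2"
    using L2_inner_integrable[OF assms] L2_integrable_square[OF assms(1)] L2_integrable_square[OF assms(2)]
    by (simp add: L2_norm_square L2_inner_def)
  also have "\<dots> \<le> (L2_norm M f + L2_norm M g)\<^sup>2"
    using L2_inner_Cauchy_Schwarz[OF assms] by (simp add: power2_sum)
  finally show "(L2_norm M (\<lambda>x. f x + g x))\<^sup>2 \<le> (L2_norm M f + L2_norm M g)\<^sup>2" .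
qed simp

text \<open>
  The Riesz--Fischer theorem. Along a subsequence with \<open>\<parallel>f (r (k+1)) - f (r k)\<parallel>\<^sup>2 \<le> 8\<^sup>-\<^sup>k\<close>
  the sum of \<open>4\<^sup>k |f (r (k+1)) - f (r k)|\<^sup>2\<close> has finite integral, hence the subsequence
  converges almost everywhere, and Fatou's lemma identifies its limit as the limit in norm.
\<close>

lemma L2_complete:
  fixes f :: "nat \<Rightarrow> 'a \<Rightarrow> 'b::euclidean_space"
  assumes f: "\<And>n. f n \<in> L2 M"
    and cauchy: "\<And>e. e > 0 \<Longrightarrow> \<exists>N. \<forall>m\<ge>N. \<forall>n\<ge>N. L2_norm M (\<lambda>x. f m x - f n x) < e"
  obtains g where "g \<in> L2 M" "(\<lambda>n. L2_norm M (\<lambda>x. f n x - g x)) \<longlonglongrightarrow> 0"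
proof -
  have [measurable]: "f n \<in> borel_measurable M" for n
    using f by (auto simp: L2_def)
  have "\<exists>N. \<forall>m\<ge>N. \<forall>n\<ge>N. L2_norm M (\<lambda>x. f m x - f n x) < (1 / 8) ^ k" for k :: nat
    by (rule cauchy) simp
  then obtain N where N: "\<And>k m n. m \<ge> N k \<Longrightarrow> n \<ge> N k \<Longrightarrow> L2_norm M (\<lambda>x. f m x - f n x) < (1 / 8) ^ k"
    by metis
  define r where "r k = (\<Sum>j\<le>k. N j) + k" for k
  have rN: "r k \<ge> N k" and rk: "r k \<ge> k" for k
    using member_le_sum[of k "{..k}" N] by (auto simp: r_def)
  have rS: "r (Suc k) \<ge> N k" for k
    using member_le_sum[of k "{..Suc k}" N] by (auto simp: r_def)
  define d where "d k x = f (r (Suc k)) x - f (r k) x" for k x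
  have dL: "d k \<in> L2 M" for k unfolding d_def by (intro L2_diff f)
  have [measurable]: "d k \<in> borel_measurable M" for k using dL by (auto simp: L2_def)
  have dn: "L2_norm M (d k) \<le> (1 / 8) ^ k" for k
    unfolding d_def using N[OF rS rN] by (simp add: less_imp_le)
  have "(\<integral>\<^sup>+x. (\<Sum>k. ennreal (4 ^ k * (norm (d k x))\<^sup>2)) \<partial>M) = (\<Sum>k. \<integral>\<^sup>+x. ennreal (4 ^ k * (norm (d k x))\<^sup>2) \<partial>M)"
    by (rule nn_integral_suminf) measurable
  also have "\<dots> = (\<Sum>k. ennreal (4 ^ k * (L2_norm M (d k))\<^sup>2))"
    by (intro suminf_cong) (simp add: ennreal_mult nn_integral_cmult L2_norm_nn[OF dL])
  also have "\<dots> \<le> (\<Sum>k. ennreal ((1 / 2) ^ k))"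
  proof (intro suminf_le ennreal_leI allI)
    fix k
    have "(L2_norm M (d k))\<^sup>2 \<le> ((1 / 8) ^ k)\<^sup>2" by (intro power_mono dn) simp
    also have "\<dots> = (1 / 64) ^ k" by (simp add: power_mult[symmetric] power2_eq_square power_mult_distrib[symmetric])
    finally have "4 ^ k * (L2_norm M (d k))\<^sup>2 \<le> 4 ^ k * (1 / 64) ^ k" by simp
    also have "\<dots> = (1 / 16) ^ k" by (simp add: power_mult_distrib[symmetric])
    also have "\<dots> \<le> (1 / 2) ^ k" by (rule power_mono) auto
    finally show "4 ^ k * (L2_norm M (d k))\<^sup>2 \<le> (1 / 2) ^ k" .
  qed auto
  also have "\<dots> = ennreal (\<Sum>k. (1 / 2) ^ k)"
    by (rule suminf_ennreal2) (auto intro: summable_geometric)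
  also have "\<dots> < \<infinity>" by simp
  finally have "(\<integral>\<^sup>+x. (\<Sum>k. ennreal (4 ^ k * (norm (d k x))\<^sup>2)) \<partial>M) \<noteq> \<infinity>" by simp
  then have "AE x in M. (\<Sum>k. ennreal (4 ^ k * (norm (d k x))\<^sup>2)) \<noteq> \<infinity>"
    by (rule nn_integral_PInf_AE[rotated]) measurable
  then have conv: "AE x in M. convergent (\<lambda>k. f (r k) x)"
  proof eventually_elim
    case (elim x)
    have "summable (\<lambda>k. 4 ^ k * (norm (d k x))\<^sup>2)"
      by (rule summable_suminf_not_top) (use elim in auto)
    then have "(\<lambda>k. 4 ^ k * (norm (d k x))\<^sup>2) \<longlonglongrightarrow> 0"
      by (rule summable_LIMSEQ_zero)
    then have "\<forall>\<^sub>F k in sequentially. 4 ^ k * (norm (d k x))\<^sup>2 < 1"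
      by (rule order_tendstoD) simp
    then have ev: "\<forall>\<^sub>F k in sequentially. norm (d k x) \<le> (1 / 2) ^ k"
    proof eventually_elim
      case (elim k)
      have "(2 ^ k * norm (d k x))\<^sup>2 \<le> 1\<^sup>2"
        using elim by (simp add: power_mult_distrib power_mult[symmetric] mult.commute[of k] power_mult)
      then have "2 ^ k * norm (d k x) \<le> 1"
        by (rule power2_le_imp_le) simp
      then show ?case by (simp add: field_simps power_divide)
    qed
    have "summable (\<lambda>k. d k x)"
      by (rule summable_comparison_test_ev[OF ev]) (simp add: summable_geometric)
    then have "convergent (\<lambda>n. \<Sum>k<n. d k x)"
      by (simp add: summable_iff_convergent)
    moreover have "(\<Sum>k<n. d k x) = f (r n) x - f (r 0) x" for n
      unfolding d_def by (rule sum_lessThan_telescope)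
    ultimately have "convergent (\<lambda>n. f (r n) x - f (r 0) x + f (r 0) x)"
      by (intro convergent_add convergent_const) simp
    then show ?case by simp
  qed
  define g where "g x = lim (\<lambda>k. f (r k) x)" for x
  have [measurable]: "g \<in> borel_measurable M"
    unfolding g_def by measurable
  have lim: "AE x in M. (\<lambda>k. f (r k) x) \<longlonglongrightarrow> g x"
    using conv by eventually_elim (simp add: g_def convergent_LIMSEQ_iff)
  have fatou: "(\<integral>\<^sup>+x. ennreal ((norm (f n x - g x))\<^sup>2) \<partial>M) \<le> ennreal (((1 / 8) ^ k)\<^sup>2)" if n: "n \<ge> N k" for n k
  proof -
    have "(\<integral>\<^sup>+x. ennreal ((norm (f n x - g x))\<^sup>2) \<partial>M)
        = (\<integral>\<^sup>+x. liminf (\<lambda>j. ennreal ((norm (f n x - f (r j) x))\<^sup>2)) \<partial>M)"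
    proof (rule nn_integral_cong_AE, use lim in eventually_elim)
      case (elim x)
      have "(\<lambda>j. ennreal ((norm (f n x - f (r j) x))\<^sup>2)) \<longlonglongrightarrow> ennreal ((norm (f n x - g x))\<^sup>2)"
        by (intro tendsto_intros tendsto_ennrealI elim)
      then show ?case by (simp only: lim_imp_Liminf[OF sequentially_bot])
    qed
    also have "\<dots> \<le> liminf (\<lambda>j. \<integral>\<^sup>+x. ennreal ((norm (f n x - f (r j) x))\<^sup>2) \<partial>M)"
      by (rule nn_integral_liminf) measurable
    also have "\<dots> \<le> ennreal (((1 / 8) ^ k)\<^sup>2)"
    proof (rule Liminf_le)
      have "\<forall>\<^sub>F j in sequentially. r j \<ge> N k"
        using rk by (intro eventually_sequentiallyI[of "N k"]) (meson order_trans)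
      then show "\<forall>\<^sub>F j in sequentially. (\<integral>\<^sup>+x. ennreal ((norm (f n x - f (r j) x))\<^sup>2) \<partial>M) \<le> ennreal (((1 / 8) ^ k)\<^sup>2)"
      proof eventually_elim
        case (elim j)
        have "(L2_norm M (\<lambda>x. f n x - f (r j) x))\<^sup>2 \<le> ((1 / 8) ^ k)\<^sup>2"
          using N[OF n elim] by (intro power_mono) auto
        then show ?case
          by (subst L2_norm_nn[symmetric]) (auto intro: L2_diff f ennreal_leI)
      qed
    qed simp
    finally show ?thesis .
  qed
  have "(\<lambda>x. f (N 0) x - g x) \<in> L2 M"
    using fatou[of 0 "N 0"] by (auto simp: L2_iff_nn intro: le_less_trans)
  from L2_diff[OF f[of "N 0"] this] have g: "g \<in> L2 M" by simp
  have *: "L2_norm M (\<lambda>x. f n x - g x) \<le> (1 / 8) ^ k" if "n \<ge> N k" for n k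
  proof (rule power2_le_imp_le)
    show "(L2_norm M (\<lambda>x. f n x - g x))\<^sup>2 \<le> ((1 / 8) ^ k)\<^sup>2"
      using fatou[OF that] by (subst (asm) L2_norm_nn[symmetric]) (auto intro: L2_diff f g)
  qed simp
  have "(\<lambda>n. L2_norm M (\<lambda>x. f n x - g x)) \<longlonglongrightarrow> 0"
  proof (rule LIMSEQ_I)
    fix e :: real assume "e > 0"
    then obtain k where k: "(1 / 8 :: real) ^ k < e"
      using real_arch_pow_inv[of e "1 / 8"] by auto
    have "\<forall>n\<ge>N k. norm (L2_norm M (\<lambda>x. f n x - g x) - 0) < e"
      using * k by (auto intro: le_less_trans)
    then show "\<exists>N. \<forall>n\<ge>N. norm (L2_norm M (\<lambda>x. f n x - g x) - 0) < e" by blast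
  qed
  with g that show ?thesis by blast
qed

lemma L2_inner_tendsto:
  fixes f :: "nat \<Rightarrow> 'c \<Rightarrow> 'b::euclidean_space"
  assumes "\<And>n. f n \<in> L2 M" "g \<in> L2 M" "h \<in> L2 M" "(\<lambda>n. L2_norm M (\<lambda>x. f n x - g x)) \<longlonglongrightarrow> 0"
  shows "(\<lambda>n. L2_inner M (f n) h) \<longlonglongrightarrow> L2_inner M g h"
proof -
  have "(\<lambda>n. L2_norm M (\<lambda>x. f n x - g x) * L2_norm M h) \<longlonglongrightarrow> 0 * L2_norm M h"
    by (intro tendsto_intros assms)
  then have lim0: "(\<lambda>n. L2_norm M (\<lambda>x. f n x - g x) * L2_norm M h) \<longlonglongrightarrow> 0" by simp
  have "(\<lambda>n. L2_inner M (f n) h - L2_inner M g h) \<longlonglongrightarrow> 0"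
  proof (rule Lim_null_comparison[OF _ lim0])
    have "\<bar>L2_inner M (f n) h - L2_inner M g h\<bar> \<le> L2_norm M (\<lambda>x. f n x - g x) * L2_norm M h" for n
      using L2_inner_Cauchy_Schwarz[OF L2_diff[OF assms(1,2)] assms(3), of n]
        L2_inner_diff[OF assms(1,2,3), of n] by simp
    then show "\<forall>\<^sub>F n in sequentially. norm (L2_inner M (f n) h - L2_inner M g h) \<le> L2_norm M (\<lambda>x. f n x - g x) * L2_norm M h"
      by simp
  qed
  then show ?thesis by (simp add: LIM_zero_iff)
qed

lemma L2_norm_tendsto:
  fixes f :: "nat \<Rightarrow> 'c \<Rightarrow> 'b::euclidean_space"
  assumes "\<And>n. f n \<in> L2 M" "g \<in> L2 M" "(\<lambda>n. L2_norm M (\<lambda>x. f n x - g x)) \<longlonglongrightarrow> 0"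
  shows "(\<lambda>n. L2_norm M (f n)) \<longlonglongrightarrow> L2_norm M g"
proof -
  have "(\<lambda>n. L2_norm M (f n) - L2_norm M g) \<longlonglongrightarrow> 0"
  proof (rule Lim_null_comparison[OF _ assms(3)])
    have "norm (L2_norm M (f n) - L2_norm M g) \<le> L2_norm M (\<lambda>x. f n x - g x)" for n
      using L2_norm_triangle[OF L2_diff[OF assms(1,2)] assms(2), of n]
        L2_norm_triangle[OF L2_diff[OF assms(2,1)] assms(1), of n n] L2_norm_minus_commute[of M "f n" g]
      by simp
    then show "\<forall>\<^sub>F n in sequentially. norm (L2_norm M (f n) - L2_norm M g) \<le> L2_norm M (\<lambda>x. f n x - g x)"
      by simp
  qed
  then show ?thesis by (simp add: LIM_zero_iff)
qed

section \<open>Lebesgue measure on a set and approximation in the mean\<close>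

lemma cball_in_borel[measurable]: "cball a r \<in> sets borel"
  by (rule borel_closed) simp

lemma borel_measurable_lborel_on_iff:
  fixes f :: "'a::euclidean_space \<Rightarrow> 'b::real_normed_vector"
  assumes "U \<in> sets borel"
  shows "f \<in> borel_measurable (lborel_on U) \<longleftrightarrow> (\<lambda>x. indicator U x *\<^sub>R f x) \<in> borel_measurable borel"
  using assms by (simp add: borel_measurable_restrict_space_iff)

lemma integral_lborel_on:
  fixes f :: "'a::euclidean_space \<Rightarrow> 'b::{banach, second_countable_topology}"
  assumes "U \<in> sets borel"
  shows "integral\<^sup>L (lborel_on U) f = (\<integral>x. indicator U x *\<^sub>R f x \<partial>lborel)"
  using assms by (simp add: integral_restrict_space)

lemma nn_integral_lborel_on:
  "U \<in> sets borel \<Longrightarrow> (\<integral>\<^sup>+x. f x \<partial>lborel_on U) = (\<integral>\<^sup>+x. f x * indicator U x \<partial>lborel)"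
  by (simp add: nn_integral_restrict_space)

lemma integrable_lborel_on:
  fixes f :: "'a::euclidean_space \<Rightarrow> 'b::{banach, second_countable_topology}"
  shows "U \<in> sets borel \<Longrightarrow> integrable (lborel_on U) f \<longleftrightarrow> integrable lborel (\<lambda>x. indicator U x *\<^sub>R f x)"
  by (simp add: integrable_restrict_space)

lemma L2_lborel_on_iff:
  assumes "U \<in> sets borel"
  shows "f \<in> L2 (lborel_on U) \<longleftrightarrow> (\<lambda>x. indicator U x *\<^sub>R f x) \<in> L2 lborel"
proof -
  have "(\<lambda>x. (norm (indicator U x *\<^sub>R f x))\<^sup>2) = (\<lambda>x. indicator U x *\<^sub>R (norm (f x))\<^sup>2)"
    by (auto simp: indicator_def)
  then show ?thesis
    using assms by (simp add: L2_def borel_measurable_lborel_on_iff integrable_lborel_on)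
qed

lemma L2_lborel_on_integrable:
  assumes "bounded U" "open U" "f \<in> L2 (lborel_on U)"
  shows "integrable (lborel_on U) f"
proof -
  have "emeasure lborel U < \<infinity>"
    using assms by (intro emeasure_bounded_finite)
  then have "(\<lambda>x. 1::real) \<in> L2 (lborel_on U)"
    using assms(2) by (simp add: L2_def integrable_lborel_on)
  from L2_norm_prod_integrable[OF assms(3) this]
  have "integrable (lborel_on U) (\<lambda>x. norm (f x))" by simp
  then show ?thesis
    using assms(3) by (subst (asm) integrable_norm_iff) (auto simp: L2_def)
qed

lemma nn_integral_affine:
  fixes t :: "'a::euclidean_space"
  assumes "c \<noteq> 0" "f \<in> borel_measurable borel"
  shows "(\<integral>\<^sup>+x. f x \<partial>lborel) = ennreal (\<bar>c\<bar> ^ DIM('a)) * (\<integral>\<^sup>+x. f (t + c *\<^sub>R x) \<partial>lborel)"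
  using assms
  by (subst lborel_affine[OF assms(1), of t])
    (simp add: nn_integral_density nn_integral_distr nn_integral_cmult)

lemma integral_affine:
  fixes t :: "'a::euclidean_space" and f :: "'a \<Rightarrow> real"
  assumes "c \<noteq> 0" "f \<in> borel_measurable borel"
  shows "(\<integral>x. f x \<partial>lborel) = \<bar>c\<bar> ^ DIM('a) * (\<integral>x. f (t + c *\<^sub>R x) \<partial>lborel)"
  using assms
  by (subst lborel_affine[OF assms(1), of t])
    (simp add: integral_density integral_distr)

lemma square_add3_le: "(a + b + c)\<^sup>2 \<le> 3 * (a\<^sup>2 + b\<^sup>2 + c\<^sup>2)" for a b c :: real
  using sum_squares_bound[of a b] sum_squares_bound[of a c] sum_squares_bound[of b c]
  by (simp add: power2_eq_square algebra_simps)

text \<open>Truncation in height and in space, with dominated convergence.\<close>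

lemma L2_approx_bounded:
  fixes u :: "'a::euclidean_space \<Rightarrow> real"
  assumes u: "u \<in> L2 lborel" and "e > 0"
  obtains k v where "k > 0" "v \<in> borel_measurable borel" "\<And>x. \<bar>v x\<bar> \<le> k" "\<And>x. norm x > k \<Longrightarrow> v x = 0"
    "(\<integral>\<^sup>+x. ennreal ((u x - v x)\<^sup>2) \<partial>lborel) < ennreal e"
proof -
  have [measurable]: "u \<in> borel_measurable borel" using u by (simp add: L2_def)
  define v where "v n x = indicator (cball 0 (real n)) x * max (- real n) (min (real n) (u x))" for n x
  have [measurable]: "v n \<in> borel_measurable borel" for n
    unfolding v_def
    by (intro borel_measurable_times borel_measurable_indicator borel_measurable_max borel_measurable_min) auto
  have "(\<lambda>n. \<integral>\<^sup>+x. ennreal ((u x - v n x)\<^sup>2) \<partial>lborel) \<longlonglongrightarrow> (\<integral>\<^sup>+x. 0 \<partial>(lborel::'a measure))"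
  proof (rule nn_integral_dominated_convergence[where w="\<lambda>x. ennreal ((u x)\<^sup>2)"])
    show "AE x in lborel. ennreal ((u x - v n x)\<^sup>2) \<le> ennreal ((u x)\<^sup>2)" for n
    proof (intro AE_I2 ennreal_leI)
      fix x
      have "\<bar>u x - v n x\<bar> \<le> \<bar>u x\<bar>" by (auto simp: v_def indicator_def)
      then show "(u x - v n x)\<^sup>2 \<le> (u x)\<^sup>2" by (rule abs_le_square_iff[THEN iffD1])
    qed
    show "(\<integral>\<^sup>+ x. ennreal ((u x)\<^sup>2) \<partial>lborel) < \<infinity>"
      using u by (simp add: L2_iff_nn)
    show "AE x in lborel. (\<lambda>n. ennreal ((u x - v n x)\<^sup>2)) \<longlonglongrightarrow> 0"
    proof (rule AE_I2)
      fix x :: 'a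
      obtain N where N: "real N \<ge> norm x + \<bar>u x\<bar>" using real_arch_simple by blast
      have "v n x = u x" if "n \<ge> N" for n
      proof -
        have "\<bar>u x\<bar> \<le> real n" "norm x \<le> real n" using N that norm_ge_zero[of x] by linarith+
        then show ?thesis by (auto simp: v_def indicator_def)
      qed
      then have "\<forall>\<^sub>F n in sequentially. 0 = ennreal ((u x - v n x)\<^sup>2)"
        by (intro eventually_sequentiallyI[of N]) simp
      then show "(\<lambda>n. ennreal ((u x - v n x)\<^sup>2)) \<longlonglongrightarrow> 0"
        by (rule Lim_transform_eventually[OF tendsto_const])
    qed
  qed measurable
  then have "\<forall>\<^sub>F n in sequentially. (\<integral>\<^sup>+x. ennreal ((u x - v n x)\<^sup>2) \<partial>lborel) < ennreal e"
    by (rule order_tendstoD) (use \<open>e > 0\<close> in simp)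
  then have "\<forall>\<^sub>F n in sequentially. (\<integral>\<^sup>+x. ennreal ((u x - v n x)\<^sup>2) \<partial>lborel) < ennreal e \<and> n > 0"
    using eventually_gt_at_top[of 0] by eventually_elim simp
  then obtain n where n: "(\<integral>\<^sup>+x. ennreal ((u x - v n x)\<^sup>2) \<partial>lborel) < ennreal e" "n > 0"
    using eventually_happens[of _ sequentially] by auto
  show ?thesis
    by (rule that[of "real n" "v n"]) (use n in \<open>auto simp: v_def indicator_def\<close>)
qed

text \<open>Continuous functions of compact support are dense in \<open>L\<^sup>2\<close>.\<close>

lemma L2_approx_continuous:
  fixes u :: "'a::euclidean_space \<Rightarrow> real"
  assumes u: "u \<in> L2 lborel" and "e > 0"
  obtains R c where "R > 0" "continuous_on UNIV c" "\<And>x. norm x > R \<Longrightarrow> c x = 0"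
    "(\<integral>\<^sup>+x. ennreal ((u x - c x)\<^sup>2) \<partial>lborel) < ennreal e"
proof -
  have [measurable]: "u \<in> borel_measurable borel" using u by (simp add: L2_def)
  obtain k v where v: "k > 0" "v \<in> borel_measurable borel" "\<And>x. \<bar>v x\<bar> \<le> k" "\<And>x. norm x > k \<Longrightarrow> v x = 0"
    "(\<integral>\<^sup>+x. ennreal ((u x - v x)\<^sup>2) \<partial>lborel) < ennreal (e / 4)"
  proof (rule L2_approx_bounded[OF u, of "e / 4"])
    show "e / 4 > 0" using \<open>e > 0\<close> by simp
  qed blast
  note [measurable] = v(2)
  have "v measurable_on UNIV"
    by (rule lebesgue_measurable_imp_measurable_on_real) (auto intro: measurable_completion)
  then obtain N g where N: "negligible N" and g: "\<And>n. continuous_on UNIV (g n)"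
      and lim: "\<And>x. x \<notin> N \<Longrightarrow> (\<lambda>n. g n x) \<longlonglongrightarrow> v x"
    by (auto simp: measurable_on_def)
  define \<kappa> where "\<kappa> x = max 0 (min 1 (k + 1 - norm x))" for x :: 'a
  define c where "c n x = max (- k) (min k (g n x)) * \<kappa> x" for n x
  have cc: "continuous_on UNIV (c n)" for n
    unfolding c_def \<kappa>_def by (intro continuous_intros g)
  have [measurable]: "c n \<in> borel_measurable borel" for n
    by (rule borel_measurable_continuous_onI[OF cc])
  have v\<kappa>: "v x * \<kappa> x = v x" for x
    using v(4)[of x] by (cases "norm x > k") (auto simp: \<kappa>_def)
  have "(\<lambda>n. \<integral>\<^sup>+x. ennreal ((v x - c n x)\<^sup>2) \<partial>lborel) \<longlonglongrightarrow> (\<integral>\<^sup>+x. 0 \<partial>(lborel::'a measure))"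
  proof (rule nn_integral_dominated_convergence[where w="\<lambda>x. ennreal ((2 * k)\<^sup>2) * indicator (cball 0 (k + 1)) x"])
    show "AE x in lborel. ennreal ((v x - c n x)\<^sup>2) \<le> ennreal ((2 * k)\<^sup>2) * indicator (cball 0 (k + 1)) x" for n
    proof (intro AE_I2)
      fix x :: 'a
      show "ennreal ((v x - c n x)\<^sup>2) \<le> ennreal ((2 * k)\<^sup>2) * indicator (cball 0 (k + 1)) x"
      proof (cases "norm x \<le> k + 1")
        case True
        have "\<bar>max (- k) (min k (g n x))\<bar> * \<bar>\<kappa> x\<bar> \<le> k * 1"
          using v(1) by (intro mult_mono) (auto simp: \<kappa>_def)
        then have "\<bar>c n x\<bar> \<le> k" by (simp add: c_def abs_mult)
        then have "\<bar>v x - c n x\<bar> \<le> \<bar>2 * k\<bar>" using v(3)[of x] by linarith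
        then have "(v x - c n x)\<^sup>2 \<le> (2 * k)\<^sup>2" by (rule abs_le_square_iff[THEN iffD1])
        then show ?thesis using True by (simp add: ennreal_leI)
      next
        case False
        then have "\<kappa> x = 0" "v x = 0" using v(1,4) by (auto simp: \<kappa>_def)
        then show ?thesis by (simp add: c_def)
      qed
    qed
    have "emeasure lborel (cball (0::'a) (k + 1)) < \<infinity>"
      by (intro emeasure_bounded_finite) auto
    then show "(\<integral>\<^sup>+ x. ennreal ((2 * k)\<^sup>2) * indicator (cball (0::'a) (k + 1)) x \<partial>lborel) < \<infinity>"
      by (subst nn_integral_cmult_indicator) (auto simp: ennreal_mult_less_top)
    have "N \<in> null_sets lebesgue" using N negligible_iff_null_sets by blast
    then have "AE x in lebesgue. x \<notin> N" by (rule AE_not_in)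
    then have "AE x in lborel. x \<notin> N" by (simp add: AE_completion_iff)
    then show "AE x in lborel. (\<lambda>n. ennreal ((v x - c n x)\<^sup>2)) \<longlonglongrightarrow> 0"
    proof eventually_elim
      case (elim x)
      have "(\<lambda>n. (v x - c n x)\<^sup>2) \<longlonglongrightarrow> (v x - max (- k) (min k (v x)) * \<kappa> x)\<^sup>2"
        unfolding c_def by (intro tendsto_intros lim elim)
      moreover have "max (- k) (min k (v x)) = v x" using v(3)[of x] by auto
      ultimately have "(\<lambda>n. (v x - c n x)\<^sup>2) \<longlonglongrightarrow> 0" using v\<kappa> by simp
      from tendsto_ennrealI[OF this] show ?case by simp
    qed
  qed measurable
  then have "\<forall>\<^sub>F n in sequentially. (\<integral>\<^sup>+x. ennreal ((v x - c n x)\<^sup>2) \<partial>lborel) < ennreal (e / 4)"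
    by (rule order_tendstoD) (use \<open>e > 0\<close> in simp)
  then obtain n where n: "(\<integral>\<^sup>+x. ennreal ((v x - c n x)\<^sup>2) \<partial>lborel) < ennreal (e / 4)"
    using eventually_happens[of _ sequentially] by auto
  have "(\<integral>\<^sup>+x. ennreal ((u x - c n x)\<^sup>2) \<partial>lborel)
      \<le> (\<integral>\<^sup>+x. 2 * ennreal ((u x - v x)\<^sup>2) + 2 * ennreal ((v x - c n x)\<^sup>2) \<partial>lborel)"
  proof (rule nn_integral_mono)
    fix x
    have "(u x - c n x)\<^sup>2 \<le> 2 * (u x - v x)\<^sup>2 + 2 * (v x - c n x)\<^sup>2"
      using sum_squares_bound[of "u x - v x" "v x - c n x"] by (simp add: power2_eq_square algebra_simps)
    then have "ennreal ((u x - c n x)\<^sup>2) \<le> ennreal (2 * (u x - v x)\<^sup>2 + 2 * (v x - c n x)\<^sup>2)"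
      by (rule ennreal_leI)
    then show "ennreal ((u x - c n x)\<^sup>2) \<le> 2 * ennreal ((u x - v x)\<^sup>2) + 2 * ennreal ((v x - c n x)\<^sup>2)"
      by (simp add: ennreal_mult)
  qed
  also have "\<dots> = 2 * (\<integral>\<^sup>+x. ennreal ((u x - v x)\<^sup>2) \<partial>lborel) + 2 * (\<integral>\<^sup>+x. ennreal ((v x - c n x)\<^sup>2) \<partial>lborel)"
    by (simp add: nn_integral_add nn_integral_cmult)
  also have "\<dots> < 2 * ennreal (e / 4) + 2 * ennreal (e / 4)"
    using v(5) n by (intro add_strict_mono ennreal_mult_strict_left_mono) auto
  also have "\<dots> = ennreal e"
    using \<open>e > 0\<close> by (simp add: ennreal_mult[of 2, symmetric, simplified] ennreal_plus[symmetric] del: ennreal_plus)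
  finally have "(\<integral>\<^sup>+x. ennreal ((u x - c n x)\<^sup>2) \<partial>lborel) < ennreal e" .
  then show ?thesis
    using v(1) by (intro that[of "k + 1" "c n"] cc) (auto simp: c_def \<kappa>_def)
qed

text \<open>
  Moving the argument a little way towards points of a bounded set changes a function little in
  \<open>L\<^sup>2\<close>: this is uniform continuity for continuous functions of compact support, and the change of
  variables keeps the approximation error under control.
\<close>

lemma L2_continuity_affine:
  fixes u :: "'a::euclidean_space \<Rightarrow> real"
  assumes u: "u \<in> L2 lborel" and "e > 0" "S > 0"
  obtains d where "0 < d" "d < 1" "\<And>\<delta> s. 0 < \<delta> \<Longrightarrow> \<delta> < d \<Longrightarrow> norm s \<le> S \<Longrightarrow>
    (\<integral>\<^sup>+p. ennreal ((u ((1 - \<delta>) *\<^sub>R p + \<delta> *\<^sub>R s) - u p)\<^sup>2) \<partial>lborel) \<le> ennreal e"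
proof -
  have [measurable]: "u \<in> borel_measurable borel" using u by (simp add: L2_def)
  define D where "D = (2::real) ^ DIM('a)"
  have D: "D \<ge> 1" by (simp add: D_def)
  define e1 where "e1 = e / (12 * D)"
  have e1: "e1 > 0" using \<open>e > 0\<close> D by (simp add: e1_def)
  obtain R c where R: "R > 0" and c: "continuous_on UNIV c" and c0: "\<And>x. norm x > R \<Longrightarrow> c x = 0"
    and uc: "(\<integral>\<^sup>+x. ennreal ((u x - c x)\<^sup>2) \<partial>lborel) < ennreal e1"
    using L2_approx_continuous[OF u e1] by blast
  note [measurable] = borel_measurable_continuous_onI[OF c]
  define R' where "R' = 2 * (R + S)"
  define V where "V = measure lborel (cball (0::'a) R')"
  have V: "emeasure lborel (cball (0::'a) R') = ennreal V" "V \<ge> 0"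
    using emeasure_bounded_finite[OF bounded_cball, of "0::'a" R']
    by (simp_all add: V_def emeasure_eq_ennreal_measure less_top)
  define e2 where "e2 = sqrt (e / (6 * (V + 1)))"
  have e2: "e2 > 0" using \<open>e > 0\<close> V(2) by (simp add: e2_def)
  have "uniformly_continuous_on (cball 0 (R' + S)) c"
    by (rule compact_uniformly_continuous) (auto intro: continuous_on_subset[OF c])
  then obtain d0 where d0: "d0 > 0" "\<And>x y. x \<in> cball 0 (R' + S) \<Longrightarrow> y \<in> cball 0 (R' + S) \<Longrightarrow> dist y x < d0 \<Longrightarrow> dist (c y) (c x) < e2"
    using e2 unfolding uniformly_continuous_on_def by metis
  define d where "d = min (1 / 2) (d0 / (R' + S + 1))"
  have RS: "R' > 0" "R' \<ge> R" using R \<open>S > 0\<close> by (auto simp: R'_def)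
  have d: "0 < d" "d \<le> 1 / 2" "d \<le> d0 / (R' + S + 1)"
    using d0(1) RS \<open>S > 0\<close> unfolding d_def by (simp_all add: min_def)
  show ?thesis
  proof (rule that[of d])
    fix \<delta> :: real and s :: 'a assume \<delta>: "0 < \<delta>" "\<delta> < d" and s: "norm s \<le> S"
    let ?A = "\<lambda>p. (1 - \<delta>) *\<^sub>R p + \<delta> *\<^sub>R s"
    have \<delta>2: "1 - \<delta> \<ge> 1 / 2" "\<delta> \<le> 1" using \<delta> d by auto
    have 1: "(\<integral>\<^sup>+p. ennreal ((u (?A p) - c (?A p))\<^sup>2) \<partial>lborel) \<le> ennreal (D * e1)"
    proof -
      have "(1 / 2) ^ DIM('a) \<le> (1 - \<delta>) ^ DIM('a)" using \<delta>2 by (intro power_mono) auto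
      then have "1 \<le> D * (1 - \<delta>) ^ DIM('a)" by (simp add: D_def field_simps)
      then have "1 \<le> ennreal (D * (1 - \<delta>) ^ DIM('a))" using ennreal_leI by fastforce
      from mult_right_mono[OF this]
      have "(\<integral>\<^sup>+p. ennreal ((u (?A p) - c (?A p))\<^sup>2) \<partial>lborel)
          \<le> ennreal (D * (1 - \<delta>) ^ DIM('a)) * (\<integral>\<^sup>+p. ennreal ((u (?A p) - c (?A p))\<^sup>2) \<partial>lborel)"
        by simp
      also have "\<dots> = ennreal D * (ennreal ((1 - \<delta>) ^ DIM('a)) * (\<integral>\<^sup>+p. ennreal ((u (?A p) - c (?A p))\<^sup>2) \<partial>lborel))"
        using D \<delta>2 by (simp add: ennreal_mult mult.assoc)
      also have "ennreal ((1 - \<delta>) ^ DIM('a)) * (\<integral>\<^sup>+p. ennreal ((u (?A p) - c (?A p))\<^sup>2) \<partial>lborel)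
          = (\<integral>\<^sup>+x. ennreal ((u x - c x)\<^sup>2) \<partial>lborel)"
        using \<delta>2 by (subst (2) nn_integral_affine[of "1 - \<delta>" _ "\<delta> *\<^sub>R s"]) (auto simp: add.commute)
      also have "\<dots> \<le> ennreal e1" using uc by simp
      finally show ?thesis using D e1 by (simp add: ennreal_mult mult_left_mono)
    qed
    have 2: "(\<integral>\<^sup>+p. ennreal ((c (?A p) - c p)\<^sup>2) \<partial>lborel) \<le> ennreal (e2\<^sup>2 * V)"
    proof -
      have "(\<integral>\<^sup>+p. ennreal ((c (?A p) - c p)\<^sup>2) \<partial>lborel) \<le> (\<integral>\<^sup>+p. ennreal (e2\<^sup>2) * indicator (cball (0::'a) R') p \<partial>lborel)"
      proof (rule nn_integral_mono)
        fix p :: 'a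
        have ds: "norm (\<delta> *\<^sub>R s) \<le> S" "norm (\<delta> *\<^sub>R s) \<le> \<delta> * S"
          using s \<delta> \<delta>2 mult_left_le_one_le[of S \<delta>] \<open>S > 0\<close>
          by (auto simp: mult_left_mono order_trans[OF mult_left_mono])
        show "ennreal ((c (?A p) - c p)\<^sup>2) \<le> ennreal (e2\<^sup>2) * indicator (cball 0 R') p"
        proof (cases "norm p \<le> R'")
          case True
          have "norm ((1 - \<delta>) *\<^sub>R p) \<le> R'"
            using True \<delta> \<delta>2 mult_left_le_one_le[of "norm p" "1 - \<delta>"] by simp
          then have "norm (?A p) \<le> R' + S"
            using ds by (metis add_mono norm_triangle_le)
          moreover have "dist (?A p) p < d0"
          proof -
            have "?A p - p = \<delta> *\<^sub>R (s - p)" by (simp add: algebra_simps)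
            then have "dist (?A p) p = \<delta> * norm (s - p)" using \<delta> by (simp add: dist_norm)
            also have "\<dots> \<le> \<delta> * (R' + S + 1)"
              using True s \<delta> norm_triangle_ineq4[of s p] by (intro mult_left_mono) linarith+
            also have "\<dots> < d * (R' + S + 1)" using \<delta> RS \<open>S > 0\<close> by (intro mult_strict_right_mono) auto
            also have "\<dots> \<le> d0" using d(3) RS \<open>S > 0\<close> by (simp add: field_simps)
            finally show ?thesis .
          qed
          ultimately have "dist (c (?A p)) (c p) < e2"
            using True \<open>S > 0\<close> by (intro d0) auto
          then have "\<bar>c (?A p) - c p\<bar> \<le> \<bar>e2\<bar>" by (simp add: dist_norm)
          then have "(c (?A p) - c p)\<^sup>2 \<le> e2\<^sup>2" by (rule abs_le_square_iff[THEN iffD1])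
          then show ?thesis using True by (simp add: ennreal_leI)
        next
          case False
          have "(1 / 2) * norm p \<le> (1 - \<delta>) * norm p" using \<delta>2 by (intro mult_right_mono) auto
          then have "norm ((1 - \<delta>) *\<^sub>R p) > R + S"
            using False \<delta>2 by (simp add: R'_def)
          then have "norm (?A p) > R"
            using ds(1) norm_diff_ineq[of "(1 - \<delta>) *\<^sub>R p" "\<delta> *\<^sub>R s"] by linarith
          moreover have "norm p > R" using False RS by simp
          ultimately show ?thesis by (simp add: c0)
        qed
      qed
      also have "\<dots> = ennreal (e2\<^sup>2 * V)" using V by (subst nn_integral_cmult_indicator) (auto simp: ennreal_mult)
      finally show ?thesis .
    qed
    have "(\<integral>\<^sup>+p. ennreal ((u (?A p) - u p)\<^sup>2) \<partial>lborel)
      \<le> (\<integral>\<^sup>+p. 3 * (ennreal ((u (?A p) - c (?A p))\<^sup>2) + ennreal ((c (?A p) - c p)\<^sup>2) + ennreal ((u p - c p)\<^sup>2)) \<partial>lborel)"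
    proof (rule nn_integral_mono)
      fix p
      have "(u (?A p) - u p)\<^sup>2 = ((u (?A p) - c (?A p)) + (c (?A p) - c p) + (- (u p - c p)))\<^sup>2" by simp
      also have "\<dots> \<le> 3 * ((u (?A p) - c (?A p))\<^sup>2 + (c (?A p) - c p)\<^sup>2 + (u p - c p)\<^sup>2)"
        using square_add3_le[of "u (?A p) - c (?A p)" "c (?A p) - c p" "- (u p - c p)"]
        by (simp only: power2_minus)
      finally have "ennreal ((u (?A p) - u p)\<^sup>2) \<le> ennreal (3 * ((u (?A p) - c (?A p))\<^sup>2 + (c (?A p) - c p)\<^sup>2 + (u p - c p)\<^sup>2))"
        by (rule ennreal_leI)
      then show "ennreal ((u (?A p) - u p)\<^sup>2)
          \<le> 3 * (ennreal ((u (?A p) - c (?A p))\<^sup>2) + ennreal ((c (?A p) - c p)\<^sup>2) + ennreal ((u p - c p)\<^sup>2))"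
        by (simp add: ennreal_mult)
    qed
    also have "\<dots> = 3 * ((\<integral>\<^sup>+p. ennreal ((u (?A p) - c (?A p))\<^sup>2) \<partial>lborel)
        + (\<integral>\<^sup>+p. ennreal ((c (?A p) - c p)\<^sup>2) \<partial>lborel) + (\<integral>\<^sup>+p. ennreal ((u p - c p)\<^sup>2) \<partial>lborel))"
      by (subst nn_integral_cmult, measurable) (simp add: nn_integral_add)
    also have "\<dots> \<le> 3 * (ennreal (D * e1) + ennreal (e2\<^sup>2 * V) + ennreal e1)"
      using 1 2 uc by (intro mult_left_mono add_mono) auto
    also have "\<dots> = ennreal (3 * (D * e1 + e2\<^sup>2 * V + e1))"
      using D e1 V by (simp add: ennreal_mult)
    also have "\<dots> \<le> ennreal e"
    proof (rule ennreal_leI)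
      have "D * e1 = e / 12" using D by (simp add: e1_def)
      moreover have "e1 \<le> e / 12" using D \<open>e > 0\<close> by (simp add: e1_def field_simps)
      moreover have "e2\<^sup>2 * V \<le> e / 6"
      proof -
        have "e2\<^sup>2 * V = e * (V / (V + 1)) / 6" using V(2) \<open>e > 0\<close> by (simp add: e2_def)
        also have "\<dots> \<le> e * 1 / 6"
          using V(2) \<open>e > 0\<close> by (intro divide_right_mono mult_left_mono) (auto simp: divide_simps)
        finally show ?thesis by simp
      qed
      ultimately have "D * e1 + e2\<^sup>2 * V + e1 \<le> e / 12 + e / 6 + e / 12" by (intro add_mono) auto
      then show "3 * (D * e1 + e2\<^sup>2 * V + e1) \<le> e" by (simp add: field_simps)
    qed
    finally show "(\<integral>\<^sup>+p. ennreal ((u (?A p) - u p)\<^sup>2) \<partial>lborel) \<le> ennreal e" .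
  qed (use d in auto)
qed

section \<open>Mollification towards the interior of a convex set\<close>

lemma has_derivative_quadraticI:
  fixes f :: "'a::euclidean_space \<Rightarrow> real"
  assumes "bounded_linear f'" and le: "\<And>y. \<bar>f y - f x - f' (y - x)\<bar> \<le> C * (norm (y - x))\<^sup>2"
  shows "(f has_derivative f') (at x)"
  unfolding has_derivative_iff_norm
proof
  show "((\<lambda>y. norm (f y - f x - f' (y - x)) / norm (y - x)) \<longlongrightarrow> 0) (at x)"
  proof (rule tendsto_sandwich[OF always_eventually always_eventually tendsto_const])
    have "((\<lambda>y. C * norm (y - x)) \<longlongrightarrow> C * norm (x - x)) (at x)"
      by (intro tendsto_intros)
    then show "((\<lambda>y. C * norm (y - x)) \<longlongrightarrow> 0) (at x)" by simp
    show "\<forall>y. norm (f y - f x - f' (y - x)) / norm (y - x) \<le> C * norm (y - x)"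
    proof
      fix y
      show "norm (f y - f x - f' (y - x)) / norm (y - x) \<le> C * norm (y - x)"
      proof (cases "y = x")
        case False
        then show ?thesis using le[of y] by (simp add: divide_le_eq power2_eq_square mult.assoc)
      qed simp
    qed
  qed simp
qed fact

lemma continuous_grad: "\<phi> \<in> test_functions U \<Longrightarrow> continuous_on UNIV (grad \<phi>)"
  unfolding grad_def
  by (intro continuous_on_sum continuous_on_scaleR continuous_on_const test_functionsD(3)[OF pd_test_function])

text \<open>
  The variable \<open>p\<close> enters only through the kernel, so \<open>u\<close> need not be regular. The parameters \<open>a\<close> and
  \<open>b\<close> cover the kernels that appear when the average below is written as an integral against \<open>u\<close>.
\<close>

lemma convolution_C1:
  fixes u :: "'a::euclidean_space \<Rightarrow> real" and a b :: real
  assumes u: "integrable lborel u" and \<eta>: "\<eta> \<in> test_functions B"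
  defines "Z \<equiv> \<lambda>p. \<integral>q. (u q * b) *\<^sub>R grad \<eta> (a *\<^sub>R q + b *\<^sub>R p) \<partial>lborel"
  shows "((\<lambda>p. \<integral>q. u q * \<eta> (a *\<^sub>R q + b *\<^sub>R p) \<partial>lborel) has_derivative (\<lambda>h. Z p \<bullet> h)) (at p)"
    and "continuous_on UNIV Z"
    and "i \<in> Basis \<Longrightarrow> Z p \<bullet> i = (\<integral>q. u q * (b * pd \<eta> i (a *\<^sub>R q + b *\<^sub>R p)) \<partial>lborel)"
proof -
  have [measurable]: "u \<in> borel_measurable borel" using u by auto
  have [measurable]: "\<eta> \<in> borel_measurable borel" "grad \<eta> \<in> borel_measurable borel"
    using \<eta> by (auto intro: borel_measurable_continuous_onI continuous_grad test_functionsD)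
  let ?e = "\<lambda>p q. a *\<^sub>R q + b *\<^sub>R p"
  let ?z = "\<lambda>p. \<integral>q. u q * \<eta> (?e p q) \<partial>lborel"
  obtain C where C: "C > 0" "\<And>x. \<bar>\<eta> x\<bar> \<le> C" using test_function_bounded[OF \<eta>] by blast
  obtain C' where C': "C' > 0" "\<And>x. norm (grad \<eta> x) \<le> C'" using grad_bounded[OF \<eta>] by blast
  obtain L where L: "L > 0" "\<And>x y. norm (grad \<eta> x - grad \<eta> y) \<le> L * norm (x - y)"
    using grad_Lipschitz[OF \<eta>] by blast
  obtain L' where L': "L' > 0" "\<And>x y. \<bar>\<eta> y - \<eta> x - grad \<eta> x \<bullet> (y - x)\<bar> \<le> L' * (norm (y - x))\<^sup>2"
    using test_function_Taylor[OF \<eta>] by blast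
  have i1: "integrable lborel (\<lambda>q. u q * \<eta> (?e p q))" for p
    by (rule Bochner_Integration.integrable_bound[of _ "\<lambda>q. C * u q"])
      (use u C in \<open>auto simp: abs_mult mult.commute[of C] intro!: mult_left_mono\<close>)
  have i2: "integrable lborel (\<lambda>q. (u q * b) *\<^sub>R grad \<eta> (?e p q))" for p
  proof (rule Bochner_Integration.integrable_bound[of _ "\<lambda>q. C' * (b * u q)"])
    have "\<bar>b * u q\<bar> * norm (grad \<eta> (?e p q)) \<le> \<bar>b * u q\<bar> * C'" for q
      by (intro mult_left_mono C') simp
    then show "AE q in lborel. norm ((u q * b) *\<^sub>R grad \<eta> (?e p q)) \<le> norm (C' * (b * u q))"
      using C' by (simp add: abs_mult mult_ac)
  qed (use u in auto)
  have Zh: "Z p \<bullet> h = (\<integral>q. u q * b * (grad \<eta> (?e p q) \<bullet> h) \<partial>lborel)" for p h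
    unfolding Z_def by (subst integral_inner_left[symmetric]) (use i2 in auto)
  have i3: "integrable lborel (\<lambda>q. u q * b * (grad \<eta> (?e p q) \<bullet> h))" for p h
    using integrable_inner_left[OF i2[of p], of h] by simp
  show "i \<in> Basis \<Longrightarrow> Z p \<bullet> i = (\<integral>q. u q * (b * pd \<eta> i (?e p q)) \<partial>lborel)"
    by (simp add: Zh grad_inner_Basis mult.assoc)
  show "(?z has_derivative (\<lambda>h. Z p \<bullet> h)) (at p)"
  proof (rule has_derivative_quadraticI)
    fix y
    have eq: "?z y - ?z p - Z p \<bullet> (y - p)
       = (\<integral>q. u q * \<eta> (?e y q) - u q * \<eta> (?e p q) - u q * b * (grad \<eta> (?e p q) \<bullet> (y - p)) \<partial>lborel)"
      using i1 i3 by (simp add: Zh)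
    have "\<bar>?z y - ?z p - Z p \<bullet> (y - p)\<bar> \<le> (\<integral>q. \<bar>u q\<bar> * (L' * (\<bar>b\<bar> * norm (y - p))\<^sup>2) \<partial>lborel)"
      unfolding eq
    proof (rule order_trans[OF integral_abs_bound], rule integral_mono)
      fix q
      have "u q * \<eta> (?e y q) - u q * \<eta> (?e p q) - u q * b * (grad \<eta> (?e p q) \<bullet> (y - p))
          = u q * (\<eta> (?e y q) - \<eta> (?e p q) - grad \<eta> (?e p q) \<bullet> (?e y q - ?e p q))"
        by (simp add: algebra_simps)
      moreover have "norm (?e y q - ?e p q) = \<bar>b\<bar> * norm (y - p)"
        by (simp flip: scaleR_diff_right)
      ultimately show "\<bar>u q * \<eta> (?e y q) - u q * \<eta> (?e p q) - u q * b * (grad \<eta> (?e p q) \<bullet> (y - p))\<bar>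
          \<le> \<bar>u q\<bar> * (L' * (\<bar>b\<bar> * norm (y - p))\<^sup>2)"
        using L'(2)[of "?e y q" "?e p q"] by (simp add: abs_mult mult_left_mono)
    qed (use i1 i3 u in auto)
    also have "\<dots> = ((\<integral>q. \<bar>u q\<bar> \<partial>lborel) * L' * b\<^sup>2) * (norm (y - p))\<^sup>2"
      by (simp add: power_mult_distrib)
    finally show "\<bar>?z y - ?z p - Z p \<bullet> (y - p)\<bar> \<le> ((\<integral>q. \<bar>u q\<bar> \<partial>lborel) * L' * b\<^sup>2) * (norm (y - p))\<^sup>2" .
  qed (rule bounded_linear_inner_right)
  show "continuous_on UNIV Z"
  proof (rule continuous_on_subset[OF lipschitz_on_continuous_on])
    show "((\<integral>q. \<bar>u q\<bar> \<partial>lborel) * \<bar>b\<bar> * L * \<bar>b\<bar>)-lipschitz_on UNIV Z"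
    proof (rule lipschitz_onI)
      fix x y
      have eq: "Z x - Z y = (\<integral>q. (u q * b) *\<^sub>R (grad \<eta> (?e x q) - grad \<eta> (?e y q)) \<partial>lborel)"
        using i2 by (simp add: Z_def scaleR_diff_right)
      have "norm (Z x - Z y) \<le> (\<integral>q. \<bar>u q\<bar> * (\<bar>b\<bar> * (L * (\<bar>b\<bar> * norm (x - y)))) \<partial>lborel)"
        unfolding eq
      proof (rule order_trans[OF integral_norm_bound], rule integral_mono)
        fix q
        have "norm (?e x q - ?e y q) = \<bar>b\<bar> * norm (x - y)"
          by (simp flip: scaleR_diff_right)
        then have "norm (grad \<eta> (?e x q) - grad \<eta> (?e y q)) \<le> L * (\<bar>b\<bar> * norm (x - y))"
          using L(2) by metis
        then show "norm ((u q * b) *\<^sub>R (grad \<eta> (?e x q) - grad \<eta> (?e y q))) \<le> \<bar>u q\<bar> * (\<bar>b\<bar> * (L * (\<bar>b\<bar> * norm (x - y))))"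
          by (simp add: abs_mult mult.assoc mult_left_mono)
        show "integrable lborel (\<lambda>q. norm ((u q * b) *\<^sub>R (grad \<eta> (?e x q) - grad \<eta> (?e y q))))"
          using i2 by (simp add: scaleR_diff_right del: norm_scaleR)
      qed (use u in auto)
      also have "\<dots> = ((\<integral>q. \<bar>u q\<bar> \<partial>lborel) * \<bar>b\<bar> * L * \<bar>b\<bar>) * dist x y"
        by (simp add: dist_norm mult.assoc)
      finally show "dist (Z x) (Z y) \<le> ((\<integral>q. \<bar>u q\<bar> \<partial>lborel) * \<bar>b\<bar> * L * \<bar>b\<bar>) * dist x y"
        by (simp add: dist_norm)
    qed (use L in \<open>auto intro!: mult_nonneg_nonneg\<close>)
  qed simp
qed

text \<open>
  Averages of \<open>u\<close> over the points \<open>(1 - \<delta>) p + \<delta> s\<close> with density \<open>\<eta> s\<close>. If \<open>\<eta>\<close> lives in a convex set,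
  then for \<open>p\<close> in that set only values inside it enter: unlike a convolution, this average needs no
  shrinking of the domain.
\<close>

definition mollify :: "real \<Rightarrow> ('a::euclidean_space \<Rightarrow> real) \<Rightarrow> ('a \<Rightarrow> real) \<Rightarrow> 'a \<Rightarrow> real" where
  "mollify \<delta> \<eta> u p = (\<integral>s. u ((1 - \<delta>) *\<^sub>R p + \<delta> *\<^sub>R s) * \<eta> s \<partial>lborel)"

lemma mollify_alt:
  fixes u :: "'a::euclidean_space \<Rightarrow> real"
  assumes "\<delta> > 0" and [measurable]: "u \<in> borel_measurable borel" "\<eta> \<in> borel_measurable borel"
  shows "mollify \<delta> \<eta> u p = (1 / \<delta>) ^ DIM('a) *
    (\<integral>q. u q * \<eta> ((1 / \<delta>) *\<^sub>R q + (- (1 - \<delta>) / \<delta>) *\<^sub>R p) \<partial>lborel)"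
proof -
  have *: "(1 / \<delta>) *\<^sub>R ((1 - \<delta>) *\<^sub>R p + \<delta> *\<^sub>R s) + (- (1 - \<delta>) / \<delta>) *\<^sub>R p = s" for s
    using assms(1) by (simp add: scaleR_add_right flip: scaleR_add_left, simp add: field_simps)
  have "(\<integral>q. u q * \<eta> ((1 / \<delta>) *\<^sub>R q + (- (1 - \<delta>) / \<delta>) *\<^sub>R p) \<partial>lborel) = \<bar>\<delta>\<bar> ^ DIM('a) * mollify \<delta> \<eta> u p"
    unfolding mollify_def
    using assms(1) by (subst integral_affine[of \<delta> _ "(1 - \<delta>) *\<^sub>R p"]) (simp, measurable, unfold *, simp)
  then show ?thesis
    using assms(1) by (simp add: power_divide)
qed

lemma L2_affine:
  fixes u :: "'a::euclidean_space \<Rightarrow> real"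
  assumes "u \<in> L2 lborel" "c \<noteq> 0"
  shows "(\<lambda>x. u (t + c *\<^sub>R x)) \<in> L2 lborel"
proof -
  have [measurable]: "u \<in> borel_measurable borel" using assms by (simp add: L2_def)
  have "ennreal (\<bar>c\<bar> ^ DIM('a)) * (\<integral>\<^sup>+x. ennreal ((u (t + c *\<^sub>R x))\<^sup>2) \<partial>lborel) < \<infinity>"
    using assms by (subst nn_integral_affine[OF assms(2), symmetric]) (auto simp: L2_iff_nn)
  moreover have "ennreal (\<bar>c\<bar> ^ DIM('a)) \<noteq> 0" using assms(2) by (simp add: ennreal_eq_0_iff not_le)
  ultimately show ?thesis
    by (auto simp: L2_iff_nn ennreal_mult_less_top)
qed

lemma test_function_L2: "\<phi> \<in> test_functions U \<Longrightarrow> \<phi> \<in> L2 lborel"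
proof -
  assume \<phi>: "\<phi> \<in> test_functions U"
  obtain C where C: "C > 0" "\<And>x. \<bar>\<phi> x\<bar> \<le> C" using test_function_bounded[OF \<phi>] by blast
  have "integrable lborel (\<lambda>x. (\<phi> x)\<^sup>2)"
  proof (rule Bochner_Integration.integrable_bound[of _ "\<lambda>x. C * \<phi> x"])
    have "\<bar>\<phi> x\<bar> * \<bar>\<phi> x\<bar> \<le> C * \<bar>\<phi> x\<bar>" for x
      by (intro mult_right_mono C) simp
    then show "AE x in lborel. norm ((\<phi> x)\<^sup>2) \<le> norm (C * \<phi> x)"
      using C by (simp add: abs_mult power2_eq_square)
  qed (use test_function_integrable_on[OF \<phi>] test_functionsD(7)[OF \<phi>] in auto)
  then show ?thesis
    using test_functionsD(7)[OF \<phi>] by (simp add: L2_def)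
qed

text \<open>
  By Jensen's inequality the squared error is at most the average of the squared changes of \<open>u\<close> under the
  affine maps involved, and these tend to zero uniformly.
\<close>

lemma mollify_tendsto:
  fixes u :: "'a::euclidean_space \<Rightarrow> real"
  assumes u: "u \<in> L2 lborel" and B: "bounded B" and \<eta>: "\<eta> \<in> test_functions B"
    and nn: "\<And>x. \<eta> x \<ge> 0" and one: "integral\<^sup>L lborel \<eta> = 1" and "e > 0"
  obtains d where "0 < d" "d < 1" "\<And>\<delta>. 0 < \<delta> \<Longrightarrow> \<delta> < d \<Longrightarrow>
    (\<integral>\<^sup>+p. ennreal ((mollify \<delta> \<eta> u p - u p)\<^sup>2) \<partial>lborel) \<le> ennreal e"
proof -
  have [measurable]: "u \<in> borel_measurable borel" using u by (simp add: L2_def)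
  note [measurable] = test_functionsD(7)[OF \<eta>]
  obtain S where S: "S > 0" "\<And>s. s \<in> B \<Longrightarrow> norm s \<le> S" using B by (auto simp: bounded_pos)
  have one': "(\<integral>\<^sup>+s. ennreal (\<eta> s) \<partial>lborel) = 1"
    using nn_integral_eq_integral[OF test_function_integrable_on[OF \<eta>]] nn one by simp
  obtain d where d: "0 < d" "d < 1" and dL: "\<And>\<delta> s. 0 < \<delta> \<Longrightarrow> \<delta> < d \<Longrightarrow> norm s \<le> S \<Longrightarrow>
    (\<integral>\<^sup>+p. ennreal ((u ((1 - \<delta>) *\<^sub>R p + \<delta> *\<^sub>R s) - u p)\<^sup>2) \<partial>lborel) \<le> ennreal e"
    using L2_continuity_affine[OF u \<open>e > 0\<close> S(1)] by blast
  show ?thesis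
  proof (rule that[OF d])
    fix \<delta> assume \<delta>: "0 < \<delta>" "\<delta> < d"
    let ?w = "\<lambda>p s. u ((1 - \<delta>) *\<^sub>R p + \<delta> *\<^sub>R s) - u p"
    have pointwise: "ennreal ((mollify \<delta> \<eta> u p - u p)\<^sup>2) \<le> (\<integral>\<^sup>+s. ennreal ((?w p s)\<^sup>2) * ennreal (\<eta> s) \<partial>lborel)" for p
    proof -
      have i1: "integrable lborel (\<lambda>s. u ((1 - \<delta>) *\<^sub>R p + \<delta> *\<^sub>R s) * \<eta> s)"
        by (intro L2_mult_integrable L2_affine u test_function_L2[OF \<eta>]) (use \<delta> in simp)
      have i2: "integrable lborel (\<lambda>s. u p * \<eta> s)"
        using test_function_integrable_on[OF \<eta>] by simp
      have eq: "(\<lambda>s. u ((1 - \<delta>) *\<^sub>R p + \<delta> *\<^sub>R s) * \<eta> s - u p * \<eta> s) = (\<lambda>s. ?w p s * \<eta> s)"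
        by (simp add: left_diff_distrib)
      have "mollify \<delta> \<eta> u p - u p = (\<integral>s. ?w p s * \<eta> s \<partial>lborel)"
        unfolding mollify_def eq[symmetric] using i1 i2 one by simp
      then have "ennreal \<bar>mollify \<delta> \<eta> u p - u p\<bar> \<le> (\<integral>\<^sup>+s. ennreal (norm (?w p s * \<eta> s)) \<partial>lborel)"
        using integral_norm_bound_ennreal[of lborel "\<lambda>s. ?w p s * \<eta> s"] Bochner_Integration.integrable_diff[OF i1 i2]
        unfolding eq by simp
      also have "\<dots> = (\<integral>\<^sup>+s. ennreal (\<bar>?w p s\<bar> * sqrt (\<eta> s)) * ennreal (sqrt (\<eta> s)) \<partial>lborel)"
        by (intro nn_integral_cong) (use nn in \<open>simp add: abs_mult ennreal_mult[symmetric] mult.assoc\<close>)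
      finally have "(ennreal \<bar>mollify \<delta> \<eta> u p - u p\<bar>)\<^sup>2 \<le> (\<integral>\<^sup>+s. ennreal (\<bar>?w p s\<bar> * sqrt (\<eta> s)) * ennreal (sqrt (\<eta> s)) \<partial>lborel)\<^sup>2"
        by (rule power_mono) simp
      also have "\<dots> \<le> (\<integral>\<^sup>+s. ennreal (\<bar>?w p s\<bar> * sqrt (\<eta> s)) ^ 2 \<partial>lborel) * (\<integral>\<^sup>+s. ennreal (sqrt (\<eta> s)) ^ 2 \<partial>lborel)"
        by (rule Cauchy_Schwarz_nn_integral) auto
      also have "\<dots> = (\<integral>\<^sup>+s. ennreal ((?w p s)\<^sup>2) * ennreal (\<eta> s) \<partial>lborel)"
        using nn by (simp add: ennreal_power power_mult_distrib one' ennreal_mult)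
      finally show ?thesis by (simp add: ennreal_power)
    qed
    have "(\<integral>\<^sup>+p. ennreal ((mollify \<delta> \<eta> u p - u p)\<^sup>2) \<partial>lborel)
        \<le> (\<integral>\<^sup>+p. (\<integral>\<^sup>+s. ennreal ((?w p s)\<^sup>2) * ennreal (\<eta> s) \<partial>lborel) \<partial>lborel)"
      by (intro nn_integral_mono pointwise)
    also have "\<dots> = (\<integral>\<^sup>+s. (\<integral>\<^sup>+p. ennreal ((?w p s)\<^sup>2) * ennreal (\<eta> s) \<partial>lborel) \<partial>lborel)"
      by (rule lborel_pair.Fubini') measurable
    also have "\<dots> = (\<integral>\<^sup>+s. (\<integral>\<^sup>+p. ennreal ((?w p s)\<^sup>2) \<partial>lborel) * ennreal (\<eta> s) \<partial>lborel)"
      by (intro nn_integral_cong nn_integral_multc) measurable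
    also have "\<dots> \<le> (\<integral>\<^sup>+s. ennreal e * ennreal (\<eta> s) \<partial>lborel)"
    proof (rule nn_integral_mono)
      fix s
      show "(\<integral>\<^sup>+p. ennreal ((?w p s)\<^sup>2) \<partial>lborel) * ennreal (\<eta> s) \<le> ennreal e * ennreal (\<eta> s)"
      proof (cases "s \<in> B")
        case True
        then show ?thesis using dL[OF \<delta> S(2)[OF True]] by (rule_tac mult_right_mono) auto
      qed (simp add: test_function_outside[OF \<eta>])
    qed
    also have "\<dots> = ennreal e" by (simp add: nn_integral_cmult one')
    finally show "(\<integral>\<^sup>+p. ennreal ((mollify \<delta> \<eta> u p - u p)\<^sup>2) \<partial>lborel) \<le> ennreal e" .
  qed
qed

text \<open>
  What makes this average commute with weak derivatives up to the boundary: for \<open>p\<close> in \<open>B\<close> the kernel is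
  supported inside \<open>B\<close>, whatever \<open>\<delta>\<close>.
\<close>

lemma mollify_kernel_test_function:
  fixes p :: "'a::euclidean_space"
  assumes "convex B" "\<eta> \<in> test_functions B" "p \<in> B" "0 < \<delta>" "\<delta> < 1"
  shows "(\<lambda>q. \<eta> ((1 / \<delta>) *\<^sub>R q + (- (1 - \<delta>) / \<delta>) *\<^sub>R p)) \<in> test_functions B"
proof (rule test_function_affine[OF assms(2)])
  fix q assume q: "(1 / \<delta>) *\<^sub>R q + (- (1 - \<delta>) / \<delta>) *\<^sub>R p \<in> B"
  have "q = (1 - \<delta>) *\<^sub>R p + \<delta> *\<^sub>R ((1 / \<delta>) *\<^sub>R q + (- (1 - \<delta>) / \<delta>) *\<^sub>R p)"
    using assms(4) by (simp add: scaleR_add_right flip: scaleR_add_left)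
  also have "\<dots> \<in> B"
    using assms(4,5) by (intro convexD[OF assms(1,3) q]) auto
  finally show "q \<in> B" .
qed (use assms in simp)

lemma integral_mult_test_function:
  fixes f :: "'a::euclidean_space \<Rightarrow> real"
  assumes "\<phi> \<in> test_functions B" "B \<subseteq> U" "U \<in> sets borel"
  shows "(\<integral>x. f x * \<phi> x \<partial>lborel_on U) = (\<integral>x. (indicator B x * f x) * \<phi> x \<partial>lborel)"
  using assms(2,3) test_function_outside[OF assms(1)]
  by (subst integral_lborel_on) (auto intro!: Bochner_Integration.integral_cong simp: indicator_def)

section \<open>Weak gradients\<close>

text \<open>
  The fundamental lemma of the calculus of variations: all averages \<open>mollify \<delta> \<eta> g\<close> vanish on \<open>B\<close>,
  and they converge to \<open>g\<close>.
\<close>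

lemma weak_zero_imp_AE_zero_convex:
  fixes g :: "'a::euclidean_space \<Rightarrow> real"
  assumes B: "open B" "convex B" "bounded B" "B \<noteq> {}" and g: "g \<in> L2 (lborel_on B)"
    and 0: "\<And>\<phi>. \<phi> \<in> test_functions B \<Longrightarrow> (\<integral>x. g x * \<phi> x \<partial>lborel_on B) = 0"
  shows "AE x in lborel. x \<in> B \<longrightarrow> g x = 0"
proof -
  have [measurable]: "B \<in> sets borel" using B by simp
  define u where "u x = indicator B x * g x" for x
  have "u = (\<lambda>x. indicator B x *\<^sub>R g x)" by (simp add: u_def fun_eq_iff)
  then have u: "u \<in> L2 lborel" using g by (simp add: L2_lborel_on_iff)
  have [measurable]: "u \<in> borel_measurable borel" using u by (simp add: L2_def)
  obtain \<eta> where \<eta>: "\<eta> \<in> test_functions B" "\<And>x. \<eta> x \<ge> 0" "integral\<^sup>L lborel \<eta> = 1"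
    using bump_exists[OF B(1,4)] by blast
  have z: "mollify \<delta> \<eta> u p = 0" if "p \<in> B" "0 < \<delta>" "\<delta> < 1" for p \<delta>
  proof -
    note t = mollify_kernel_test_function[OF B(2) \<eta>(1) that]
    have "(\<integral>q. u q * \<eta> ((1 / \<delta>) *\<^sub>R q + (- (1 - \<delta>) / \<delta>) *\<^sub>R p) \<partial>lborel) = 0"
      using 0[OF t] integral_mult_test_function[OF t, of B g] by (simp add: u_def)
    then show ?thesis
      using that test_functionsD(7)[OF \<eta>(1)] by (subst mollify_alt) auto
  qed
  have "(\<integral>\<^sup>+p. ennreal ((u p)\<^sup>2) \<partial>lborel) \<le> ennreal e" if e: "e > 0" for e
  proof -
    obtain d where d: "0 < d" "d < 1" "\<And>\<delta>. 0 < \<delta> \<Longrightarrow> \<delta> < d \<Longrightarrow>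
        (\<integral>\<^sup>+p. ennreal ((mollify \<delta> \<eta> u p - u p)\<^sup>2) \<partial>lborel) \<le> ennreal e"
      using mollify_tendsto[OF u B(3) \<eta> e] by blast
    have "(\<integral>\<^sup>+p. ennreal ((u p)\<^sup>2) \<partial>lborel) \<le> (\<integral>\<^sup>+p. ennreal ((mollify (d / 2) \<eta> u p - u p)\<^sup>2) \<partial>lborel)"
    proof (intro nn_integral_mono)
      fix p show "ennreal ((u p)\<^sup>2) \<le> ennreal ((mollify (d / 2) \<eta> u p - u p)\<^sup>2)"
        using z[of p "d / 2"] d by (cases "p \<in> B") (auto simp: u_def)
    qed
    also have "\<dots> \<le> ennreal e" using d by auto
    finally show ?thesis .
  qed
  then have "(\<integral>\<^sup>+p. ennreal ((u p)\<^sup>2) \<partial>lborel) = 0"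
    by (metis ennreal_le_epsilon add_0 le_zero_eq zero_less_one)
  then have "AE p in lborel. ennreal ((u p)\<^sup>2) = 0"
    by (subst (asm) nn_integral_0_iff_AE) auto
  then show ?thesis by eventually_elim (auto simp: u_def)
qed

lemma L2_lborel_on_subset:
  assumes "A \<subseteq> B" "A \<in> sets borel" "B \<in> sets borel" "f \<in> L2 (lborel_on B)"
  shows "f \<in> L2 (lborel_on A)"
proof -
  have [measurable]: "(\<lambda>x. indicator B x *\<^sub>R f x) \<in> borel_measurable borel"
    using L2_measurable[OF assms(4)] assms(3) by (simp add: borel_measurable_lborel_on_iff)
  have eq: "indicator A x *\<^sub>R f x = indicator A x *\<^sub>R (indicator B x *\<^sub>R f x)" for x
    using assms(1) by (auto simp: indicator_def)
  have "(\<lambda>x. indicator A x *\<^sub>R f x) \<in> borel_measurable borel"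
    unfolding eq using assms(2) by measurable
  moreover have "(\<lambda>x. indicator B x *\<^sub>R f x) \<in> L2 lborel"
    using assms by (simp add: L2_lborel_on_iff)
  ultimately have "(\<lambda>x. indicator A x *\<^sub>R f x) \<in> L2 lborel"
    by (rule_tac L2_dominated) (use assms(1) in \<open>auto simp: indicator_def\<close>)
  then show ?thesis
    using assms by (simp add: L2_lborel_on_iff)
qed

lemma L2_lborel_onI:
  assumes "f \<in> L2 lborel" "A \<in> sets borel"
  shows "f \<in> L2 (lborel_on A)"
proof -
  have [measurable]: "f \<in> borel_measurable borel" using assms by (simp add: L2_def)
  show ?thesis
    using assms(2) by (auto simp: L2_lborel_on_iff indicator_def intro!: L2_dominated[OF assms(1)])
qed

lemma L2_component: "f \<in> L2 M \<Longrightarrow> (\<lambda>x. f x \<bullet> c) \<in> L2 M"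
proof -
  assume f: "f \<in> L2 M"
  have [measurable]: "f \<in> borel_measurable M" using f by (simp add: L2_def)
  show ?thesis
  proof (rule L2_dominated[OF L2_scale[OF f, of "norm c"]])
    show "norm (f x \<bullet> c) \<le> norm (norm c *\<^sub>R f x)" for x
      using Cauchy_Schwarz_ineq2[of "f x" c] by (simp add: mult.commute)
  qed measurable
qed

lemma L2_locD: "f \<in> L2_loc U \<Longrightarrow> compact K \<Longrightarrow> K \<subseteq> U \<Longrightarrow> f \<in> L2 (lborel_on K)"
  "f \<in> L2_loc U \<Longrightarrow> f \<in> borel_measurable (lborel_on U)"
  by (auto simp: L2_loc_def)

text \<open>Local: the open set is a countable union of balls, to which the preceding lemma applies.\<close>

lemma weak_gradient_unique:
  fixes U :: "'a::euclidean_space set"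
  assumes U: "open U" and G: "G \<in> L2_loc U" "has_weak_gradient U u G"
    and G': "G' \<in> L2_loc U" "has_weak_gradient U u G'"
  shows "AE x in lborel_on U. G x = G' x"
proof -
  have Ub: "U \<in> sets borel" using U by simp
  have ball: "AE x in lborel. x \<in> ball c r \<longrightarrow> G x = G' x" if r: "r > 0" "cball c r \<subseteq> U" for c r
  proof -
    let ?B = "ball c r"
    have "AE x in lborel. x \<in> ?B \<longrightarrow> (G x - G' x) \<bullet> i = 0" if i: "i \<in> Basis" for i
    proof (rule weak_zero_imp_AE_zero_convex)
      have L: "G \<in> L2 (lborel_on ?B)" "G' \<in> L2 (lborel_on ?B)"
        using r L2_locD(1)[OF G(1), of "cball c r"] L2_locD(1)[OF G'(1), of "cball c r"]
        by (auto intro: L2_lborel_on_subset[of _ "cball c r"])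
      show "(\<lambda>x. (G x - G' x) \<bullet> i) \<in> L2 (lborel_on ?B)"
        by (intro L2_component L2_diff L)
      fix \<phi> assume \<phi>: "\<phi> \<in> test_functions ?B"
      have \<phi>U: "\<phi> \<in> test_functions U" using \<phi> test_functions_mono[of ?B U] r by force
      have "(\<integral>x. (G x \<bullet> i) * \<phi> x \<partial>lborel_on U) = (\<integral>x. (G' x \<bullet> i) * \<phi> x \<partial>lborel_on U)"
        using G(2) G'(2) \<phi>U i by (fastforce simp: has_weak_gradient_def)
      moreover have "(\<integral>x. f x * \<phi> x \<partial>lborel_on U) = (\<integral>x. f x * \<phi> x \<partial>lborel_on ?B)" for f
        using integral_mult_test_function[OF \<phi> order_refl, of f] integral_mult_test_function[OF \<phi> _ Ub, of f] r
        by force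
      ultimately have "(\<integral>x. (G x \<bullet> i) * \<phi> x \<partial>lborel_on ?B) = (\<integral>x. (G' x \<bullet> i) * \<phi> x \<partial>lborel_on ?B)" by simp
      moreover have "\<phi> \<in> L2 (lborel_on ?B)"
        by (intro L2_lborel_onI test_function_L2[OF \<phi>]) simp
      ultimately show "(\<integral>x. ((G x - G' x) \<bullet> i) * \<phi> x \<partial>lborel_on ?B) = 0"
        using L2_mult_integrable[OF L2_component[OF L(1)], of \<phi> i] L2_mult_integrable[OF L2_component[OF L(2)], of \<phi> i]
        by (simp add: inner_diff_left left_diff_distrib)
    qed (use r in auto)
    then have "AE x in lborel. \<forall>i\<in>Basis. x \<in> ?B \<longrightarrow> (G x - G' x) \<bullet> i = 0"
      by (subst AE_finite_all) auto
    then show ?thesis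
      by eventually_elim (simp add: euclidean_eq_iff[where 'a='a] inner_diff_left)
  qed
  let ?F = "{ball c r |c r. r > 0 \<and> cball c r \<subseteq> U}"
  obtain F' where F': "F' \<subseteq> ?F" "countable F'" "\<Union>F' = \<Union>?F"
    using Lindelof[of ?F] by auto
  have "\<Union>?F = U"
    using U by (auto simp: open_contains_cball) (metis centre_in_ball open_contains_cball)
  then have UF: "U = \<Union>F'" using F' by simp
  have "AE x in lborel. \<forall>B\<in>F'. x \<in> B \<longrightarrow> G x = G' x"
    using F'(1) ball by (subst AE_ball_countable[OF F'(2)]) auto
  then have "AE x in lborel. x \<in> U \<longrightarrow> G x = G' x"
    by eventually_elim (auto simp: UF)
  then show ?thesis
    using Ub by (subst AE_restrict_space_iff) auto
qed

lemma test_function_localize: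
  fixes f :: "'a::euclidean_space \<Rightarrow> real"
  assumes "\<phi> \<in> test_functions U" "U \<in> sets borel"
  shows "(\<lambda>x. indicator U x *\<^sub>R (f x * \<phi> x)) = (\<lambda>x. indicator (closure {x. \<phi> x \<noteq> 0}) x *\<^sub>R (f x * \<phi> x))"
  using test_function_outside[OF assms(1)] closure_subset[of "{x. \<phi> x \<noteq> 0}"]
  by (auto simp: indicator_def fun_eq_iff)

lemma L2_loc_mult_test_integrable:
  fixes f :: "'a::euclidean_space \<Rightarrow> real"
  assumes "f \<in> L2_loc U" "\<phi> \<in> test_functions U" "U \<in> sets borel"
  shows "integrable (lborel_on U) (\<lambda>x. f x * \<phi> x)"
proof -
  let ?K = "closure {x. \<phi> x \<noteq> 0}"
  have "integrable (lborel_on ?K) (\<lambda>x. f x * \<phi> x)"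
    by (intro L2_mult_integrable L2_locD(1)[OF assms(1)] test_functionsD[OF assms(2)]
        L2_lborel_onI test_function_L2[OF assms(2)]) simp
  then show ?thesis
    using assms(3) by (simp add: integrable_lborel_on test_function_localize[OF assms(2,3)] del: real_scaleR_def)
qed

lemma L2_imp_L2_loc:
  assumes "f \<in> L2 (lborel_on U)" "U \<in> sets borel"
  shows "f \<in> L2_loc U"
  unfolding L2_loc_def
proof (intro CollectI conjI allI impI)
  show "f \<in> borel_measurable (lborel_on U)" using assms(1) by (rule L2_measurable)
  fix K assume "compact K \<and> K \<subseteq> U"
  then show "f \<in> L2 (lborel_on K)"
    by (intro L2_lborel_on_subset[OF _ _ assms(2,1)]) (auto intro: borel_compact)
qed

lemma L2_loc_component: "G \<in> L2_loc U \<Longrightarrow> (\<lambda>x. G x \<bullet> i) \<in> L2_loc U"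
  by (auto simp: L2_loc_def intro!: L2_component borel_measurable_inner)

lemma has_weak_gradient_add_scale:
  assumes U: "U \<in> sets borel" and "u \<in> L2_loc U" "v \<in> L2_loc U" "G \<in> L2_loc U" "H \<in> L2_loc U"
    and wu: "has_weak_gradient U u G" and wv: "has_weak_gradient U v H"
  shows "has_weak_gradient U (\<lambda>x. u x + c * v x) (\<lambda>x. G x + c *\<^sub>R H x)"
  unfolding has_weak_gradient_def
proof (intro ballI)
  fix \<phi> and i :: 'a assume \<phi>: "\<phi> \<in> test_functions U" and i: "i \<in> Basis"
  note p = pd_test_function[OF \<phi> i]
  have I: "integrable (lborel_on U) (\<lambda>x. u x * pd \<phi> i x)" "integrable (lborel_on U) (\<lambda>x. v x * pd \<phi> i x)"
    "integrable (lborel_on U) (\<lambda>x. (G x \<bullet> i) * \<phi> x)" "integrable (lborel_on U) (\<lambda>x. (H x \<bullet> i) * \<phi> x)"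
    using assms by (auto intro!: L2_loc_mult_test_integrable L2_loc_component \<phi> p)
  have "(\<integral>x. (u x + c * v x) * pd \<phi> i x \<partial>lborel_on U)
      = (\<integral>x. u x * pd \<phi> i x + c * (v x * pd \<phi> i x) \<partial>lborel_on U)"
    by (simp add: algebra_simps)
  also have "\<dots> = (\<integral>x. u x * pd \<phi> i x \<partial>lborel_on U) + c * (\<integral>x. v x * pd \<phi> i x \<partial>lborel_on U)"
    using I by simp
  also have "\<dots> = - (\<integral>x. (G x \<bullet> i) * \<phi> x \<partial>lborel_on U) + c * - (\<integral>x. (H x \<bullet> i) * \<phi> x \<partial>lborel_on U)"
    using wu wv \<phi> i by (simp add: has_weak_gradient_def)
  also have "\<dots> = - (\<integral>x. (G x \<bullet> i) * \<phi> x + c * ((H x \<bullet> i) * \<phi> x) \<partial>lborel_on U)"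
    using I by simp
  also have "\<dots> = - (\<integral>x. ((G x + c *\<^sub>R H x) \<bullet> i) * \<phi> x \<partial>lborel_on U)"
    by (simp add: algebra_simps)
  finally show "(\<integral>x. (u x + c * v x) * pd \<phi> i x \<partial>lborel_on U) = - (\<integral>x. ((G x + c *\<^sub>R H x) \<bullet> i) * \<phi> x \<partial>lborel_on U)" .
qed

text \<open>
  The integral of a partial derivative is the limit of integrals of difference quotients, and
  these vanish by translation invariance.
\<close>

lemma integral_pd_test_function:
  fixes U :: "'a::euclidean_space set"
  assumes \<phi>: "\<phi> \<in> test_functions U" and i: "i \<in> Basis"
  shows "(\<integral>x. pd \<phi> i x \<partial>lborel) = 0"
proof -
  obtain S where S: "S > 0" "\<And>x. x \<in> closure {x. \<phi> x \<noteq> 0} \<Longrightarrow> norm x \<le> S"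
    using compact_imp_bounded[OF test_functionsD(5)[OF \<phi>]] unfolding bounded_pos by blast
  have S\<phi>: "\<phi> x = 0" if "norm x > S" for x
    using S(2)[of x] closure_subset[of "{x. \<phi> x \<noteq> 0}"] that by force
  have Sp: "pd \<phi> i x = 0" if "norm x > S" for x
  proof -
    have "(\<phi> has_derivative (\<lambda>_. 0)) (at x)"
      by (rule has_derivative_transform_within_open[of "\<lambda>_. 0" _ _ _ "- cball 0 S"])
        (use that S\<phi> in auto)
    then show ?thesis by (rule pd_eqI)
  qed
  obtain L where L: "L > 0" "\<And>x y. \<bar>\<phi> y - \<phi> x - grad \<phi> x \<bullet> (y - x)\<bar> \<le> L * (norm (y - x))\<^sup>2"
    using test_function_Taylor[OF \<phi>] by blast
  define V where "V = measure lborel (cball (0::'a) (S + 1))"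
  have fin: "emeasure lborel (cball (0::'a) (S + 1)) < \<infinity>" by (intro emeasure_bounded_finite) auto
  note I\<phi> = test_function_integrable_on[OF \<phi>] and Ip = test_function_integrable_on[OF pd_test_function[OF \<phi> i]]
  have bound: "\<bar>\<integral>x. pd \<phi> i x \<partial>lborel\<bar> \<le> L * V * t" if t: "0 < t" "t \<le> 1" for t
  proof -
    have ti: "(\<integral>x. \<phi> (x + t *\<^sub>R i) \<partial>lborel) = (\<integral>x. \<phi> x \<partial>lborel)"
      using integral_affine[of 1 \<phi> "t *\<^sub>R i"] test_functionsD(7)[OF \<phi>] by (simp add: add.commute)
    have It: "integrable lborel (\<lambda>x. \<phi> (x + t *\<^sub>R i))"
      using test_function_integrable_on[OF test_function_affine[OF \<phi>, of 1 "t *\<^sub>R i" UNIV]] by simp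
    have "(\<integral>x. \<phi> (x + t *\<^sub>R i) - \<phi> x - t * pd \<phi> i x \<partial>lborel) = - (t * (\<integral>x. pd \<phi> i x \<partial>lborel))"
      using ti It I\<phi> Ip by simp
    then have "t * \<bar>\<integral>x. pd \<phi> i x \<partial>lborel\<bar> = \<bar>\<integral>x. \<phi> (x + t *\<^sub>R i) - \<phi> x - t * pd \<phi> i x \<partial>lborel\<bar>"
      using t by (simp add: abs_mult)
    also have "\<dots> \<le> (\<integral>x. L * t\<^sup>2 * indicator (cball (0::'a) (S + 1)) x \<partial>lborel)"
    proof (rule order_trans[OF integral_abs_bound], rule integral_mono)
      fix x
      show "\<bar>\<phi> (x + t *\<^sub>R i) - \<phi> x - t * pd \<phi> i x\<bar> \<le> L * t\<^sup>2 * indicator (cball 0 (S + 1)) x"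
      proof (cases "norm x \<le> S + 1")
        case True
        then show ?thesis
          using L(2)[of "x + t *\<^sub>R i" x] t i by (simp add: grad_inner_Basis)
      next
        case False
        have "norm x - norm (t *\<^sub>R i) \<le> norm (x + t *\<^sub>R i)" by (rule norm_diff_ineq)
        then have "norm (x + t *\<^sub>R i) > S" "norm x > S" using False t i by auto
        then show ?thesis using False by (simp add: S\<phi> Sp)
      qed
    qed (use It I\<phi> Ip fin in \<open>auto intro!: Bochner_Integration.integrable_mult_right integrable_real_indicator\<close>)
    also have "\<dots> = L * t\<^sup>2 * V" using fin by (simp add: V_def)
    finally show ?thesis using t by (simp add: power2_eq_square mult_ac)
  qed
  have "\<bar>\<integral>x. pd \<phi> i x \<partial>lborel\<bar> \<le> 0 + e" if "e > 0" for e
  proof -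
    have VL: "L * V \<ge> 0" using L(1) by (simp add: V_def)
    define t where "t = min 1 (e / (L * V + 1))"
    have "0 < t" "t \<le> 1" using that VL by (auto simp: t_def)
    then have "\<bar>\<integral>x. pd \<phi> i x \<partial>lborel\<bar> \<le> L * V * t" by (rule bound)
    also have "\<dots> \<le> L * V * (e / (L * V + 1))" using VL by (intro mult_left_mono) (auto simp: t_def)
    also have "\<dots> \<le> e" using VL that by (simp add: field_simps)
    finally show ?thesis by simp
  qed
  then have "\<bar>\<integral>x. pd \<phi> i x \<partial>lborel\<bar> \<le> 0" by (rule field_le_epsilon)
  then show ?thesis by simp
qed

lemma has_weak_gradient_const:
  assumes "U \<in> sets borel"
  shows "has_weak_gradient U (\<lambda>x. c) (\<lambda>x. 0)"
  unfolding has_weak_gradient_def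
proof (intro ballI)
  fix \<phi> and i :: 'a assume \<phi>: "\<phi> \<in> test_functions U" and i: "i \<in> Basis"
  have "(\<integral>x. c * pd \<phi> i x \<partial>lborel_on U) = (\<integral>x. c * pd \<phi> i x \<partial>lborel)"
    using assms test_function_outside[OF pd_test_function[OF \<phi> i]]
    by (subst integral_lborel_on[OF assms], intro Bochner_Integration.integral_cong refl)
      (auto simp: indicator_def)
  then show "(\<integral>x. c * pd \<phi> i x \<partial>lborel_on U) = - (\<integral>x. (0 \<bullet> i) * \<phi> x \<partial>lborel_on U)"
    using integral_pd_test_function[OF \<phi> i] by simp
qed

lemma weak_grad_works:
  assumes "u \<in> W12_loc U"
  shows "weak_grad U u \<in> L2_loc U" "has_weak_gradient U u (weak_grad U u)"
proof -
  have "\<exists>G. G \<in> L2_loc U \<and> has_weak_gradient U u G"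
    using assms by (auto simp: W12_loc_def)
  from someI_ex[OF this] show "weak_grad U u \<in> L2_loc U" "has_weak_gradient U u (weak_grad U u)"
    unfolding weak_grad_def by auto
qed

lemma weak_grad_AE_eq:
  assumes "open U" "u \<in> L2_loc U" "G \<in> L2_loc U" "has_weak_gradient U u G"
  shows "AE x in lborel_on U. weak_grad U u x = G x"
proof (rule weak_gradient_unique[OF assms(1) _ _ assms(3,4)])
  have "u \<in> W12_loc U" using assms by (auto simp: W12_loc_def)
  then show "weak_grad U u \<in> L2_loc U" "has_weak_gradient U u (weak_grad U u)"
    by (rule weak_grad_works)+
qed

text \<open>
  The approximation is \<open>mollify \<delta> \<eta> u\<close>. On \<open>B\<close> its gradient is \<open>1 - \<delta>\<close> times the average of the weak
  gradient of \<open>u\<close>, since the kernels are test functions on \<open>B\<close>; both averages converge in the mean. The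
  approximations are differentiable on the whole space, which spares all boundary arguments later on.
\<close>

lemma H1_smooth_approx:
  fixes B :: "'a::euclidean_space set"
  assumes B: "open B" "convex B" "bounded B" "B \<noteq> {}" and u: "u \<in> L2 (lborel_on B)"
    and G: "G \<in> L2 (lborel_on B)" and w: "has_weak_gradient B u G" and "e > 0"
  obtains z Z where "\<And>p. (z has_derivative (\<lambda>h. Z p \<bullet> h)) (at p)" "continuous_on UNIV Z"
    "L2_norm (lborel_on B) (\<lambda>x. z x - u x) < e" "L2_norm (lborel_on B) (\<lambda>x. Z x - G x) < e"
proof -
  have Bb[measurable]: "B \<in> sets borel" using B by simp
  obtain \<eta> where \<eta>: "\<eta> \<in> test_functions B" "\<And>x. \<eta> x \<ge> 0" "integral\<^sup>L lborel \<eta> = 1"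
    using bump_exists[OF B(1,4)] by blast
  note [measurable] = test_functionsD(7)[OF \<eta>(1)]
  define u' where "u' x = indicator B x * u x" for x
  define g where "g i x = indicator B x * (G x \<bullet> i)" for i x
  have u'e: "u' = (\<lambda>x. indicator B x *\<^sub>R u x)" and ge: "g i = (\<lambda>x. indicator B x *\<^sub>R (G x \<bullet> i))" for i
    by (simp_all add: u'_def g_def fun_eq_iff)
  have u': "u' \<in> L2 lborel" using u Bb unfolding u'e by (simp only: L2_lborel_on_iff)
  have u'I: "integrable lborel u'"
    using L2_lborel_on_integrable[OF B(3,1) u] Bb unfolding u'e by (simp only: integrable_lborel_on)
  have g: "g i \<in> L2 lborel" for i
    using L2_component[OF G, of i] Bb unfolding ge by (simp only: L2_lborel_on_iff)
  have [measurable]: "u' \<in> borel_measurable borel" "g i \<in> borel_measurable borel" for i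
    using u' g by (auto simp: L2_def)
  define D where "D = real DIM('a)"
  have D: "D \<ge> 1" by (simp add: D_def)
  define N where "N = (\<Sum>i\<in>Basis. (L2_norm lborel (g i))\<^sup>2)"
  have N: "N \<ge> 0" by (auto simp: N_def intro: sum_nonneg)
  define e' where "e' = e\<^sup>2 / (8 * D)"
  have e': "e' > 0" "2 * (D * e') = e\<^sup>2 / 4" using \<open>e > 0\<close> D by (auto simp: e'_def)
  obtain d0 where d0: "0 < d0" "d0 < 1" "\<And>\<delta>. 0 < \<delta> \<Longrightarrow> \<delta> < d0 \<Longrightarrow>
        (\<integral>\<^sup>+p. ennreal ((mollify \<delta> \<eta> u' p - u' p)\<^sup>2) \<partial>lborel) \<le> ennreal e'"
    using mollify_tendsto[OF u' B(3) \<eta> e'(1)] by blast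
  have "\<exists>d. 0 < d \<and> (\<forall>\<delta>. 0 < \<delta> \<longrightarrow> \<delta> < d \<longrightarrow>
        (\<integral>\<^sup>+p. ennreal ((mollify \<delta> \<eta> (g i) p - g i p)\<^sup>2) \<partial>lborel) \<le> ennreal e')" for i
    using mollify_tendsto[OF g B(3) \<eta> e'(1), of i] by metis
  then obtain d where d: "\<And>i. 0 < d i" "\<And>i \<delta>. 0 < \<delta> \<Longrightarrow> \<delta> < d i \<Longrightarrow>
        (\<integral>\<^sup>+p. ennreal ((mollify \<delta> \<eta> (g i) p - g i p)\<^sup>2) \<partial>lborel) \<le> ennreal e'"
    by metis
  define d1 where "d1 = Min (d ` Basis)"
  have d1: "d1 > 0" "\<And>i. i \<in> Basis \<Longrightarrow> d1 \<le> d i" using d(1) by (auto simp: d1_def)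
  define q where "q = e\<^sup>2 / (8 * (N + 1))"
  define \<delta> where "\<delta> = min (min d0 d1) q / 2"
  have "q > 0" using \<open>e > 0\<close> N by (simp add: q_def)
  then have \<delta>: "0 < \<delta>" "\<delta> < d0" "\<delta> < d1" "\<delta> < 1" "\<delta> \<le> q"
    using d0(1,2) d1(1) unfolding \<delta>_def by (simp_all add: min_def)
  let ?a = "1 / \<delta>" and ?b = "- (1 - \<delta>) / \<delta>"
  define s where "s = ?a ^ DIM('a)"
  define z where "z = mollify \<delta> \<eta> u'"
  define Zc where "Zc p = (\<integral>q. (u' q * ?b) *\<^sub>R grad \<eta> (?a *\<^sub>R q + ?b *\<^sub>R p) \<partial>lborel)" for p
  define Z where "Z p = s *\<^sub>R Zc p" for p
  note cc = convolution_C1[where b = "?b" and a = "?a", OF u'I \<eta>(1), folded Zc_def]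
  have ze: "z p = s * (\<integral>q. u' q * \<eta> (?a *\<^sub>R q + ?b *\<^sub>R p) \<partial>lborel)" for p
    unfolding z_def s_def by (rule mollify_alt) (use \<delta> in auto)
  have zd: "(z has_derivative (\<lambda>h. Z p \<bullet> h)) (at p)" for p
    using has_derivative_mult_right[OF cc(1)[of p], of s] unfolding ze[abs_def] Z_def by simp
  have Zc: "continuous_on UNIV Z"
    unfolding Z_def by (intro continuous_intros cc(2))
  have [measurable]: "Z \<in> borel_measurable borel" by (rule borel_measurable_continuous_onI[OF Zc])
  have "continuous_on UNIV z"
    using zd by (meson continuous_at_imp_continuous_on has_derivative_continuous)
  then have [measurable]: "z \<in> borel_measurable borel" by (rule borel_measurable_continuous_onI)
  have ZG: "Z p \<bullet> i = (1 - \<delta>) * mollify \<delta> \<eta> (g i) p" if p: "p \<in> B" and i: "i \<in> Basis" for p i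
  proof -
    let ?\<phi> = "\<lambda>q. \<eta> (?a *\<^sub>R q + ?b *\<^sub>R p)"
    have t: "?\<phi> \<in> test_functions B"
      by (rule mollify_kernel_test_function[OF B(2) \<eta>(1) p]) (use \<delta> in auto)
    have pdt: "pd ?\<phi> i q = ?a * pd \<eta> i (?a *\<^sub>R q + ?b *\<^sub>R p)" for q
      by (rule pd_affine[OF \<eta>(1)])
    have "(\<integral>q. u' q * (?b * pd \<eta> i (?a *\<^sub>R q + ?b *\<^sub>R p)) \<partial>lborel) = (\<integral>q. (- (1 - \<delta>)) * (u' q * pd ?\<phi> i q) \<partial>lborel)"
      unfolding pdt by (intro Bochner_Integration.integral_cong refl) simp
    also have "\<dots> = (- (1 - \<delta>)) * (\<integral>q. u' q * pd ?\<phi> i q \<partial>lborel)"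
      by (rule integral_mult_right_zero)
    also have "(\<integral>q. u' q * pd ?\<phi> i q \<partial>lborel) = (\<integral>q. u q * pd ?\<phi> i q \<partial>lborel_on B)"
      unfolding u'_def by (rule integral_mult_test_function[OF pd_test_function[OF t i] order_refl Bb, symmetric])
    also have "\<dots> = - (\<integral>q. (G q \<bullet> i) * ?\<phi> q \<partial>lborel_on B)"
      using w t i by (simp add: has_weak_gradient_def)
    also have "(\<integral>q. (G q \<bullet> i) * ?\<phi> q \<partial>lborel_on B) = (\<integral>q. g i q * ?\<phi> q \<partial>lborel)"
      unfolding g_def by (rule integral_mult_test_function[OF t order_refl Bb])
    finally have "Zc p \<bullet> i = (1 - \<delta>) * (\<integral>q. g i q * ?\<phi> q \<partial>lborel)"
      using cc(3)[OF i, of p] by (simp only: mult_minus_left mult_minus_right minus_minus)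
    moreover have "mollify \<delta> \<eta> (g i) p = s * (\<integral>q. g i q * ?\<phi> q \<partial>lborel)"
      unfolding s_def by (rule mollify_alt) (use \<delta> in auto)
    ultimately show ?thesis by (simp add: Z_def)
  qed
  have e2: "e\<^sup>2 > 0" using \<open>e > 0\<close> by simp
  have normI: "L2_norm (lborel_on B) f < e"
    if m: "f \<in> borel_measurable (lborel_on B)" and le: "(\<integral>\<^sup>+x. ennreal ((norm (f x))\<^sup>2) * indicator B x \<partial>lborel) \<le> ennreal (e\<^sup>2 / 2)"
    for f :: "'a \<Rightarrow> 'b::euclidean_space"
  proof -
    have le': "(\<integral>\<^sup>+x. ennreal ((norm (f x))\<^sup>2) \<partial>lborel_on B) \<le> ennreal (e\<^sup>2 / 2)"
      using le by (simp add: nn_integral_lborel_on)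
    then have "f \<in> L2 (lborel_on B)" using m by (auto simp: L2_iff_nn intro: le_less_trans)
    then have "ennreal ((L2_norm (lborel_on B) f)\<^sup>2) \<le> ennreal (e\<^sup>2 / 2)" using le' by (simp add: L2_norm_nn)
    then have "(L2_norm (lborel_on B) f)\<^sup>2 \<le> e\<^sup>2 / 2" using e2 by (simp add: ennreal_le_iff)
    then have "(L2_norm (lborel_on B) f)\<^sup>2 < e\<^sup>2" using e2 by linarith
    then show ?thesis using \<open>e > 0\<close> by (simp add: power2_less_imp_less)
  qed
  show ?thesis
  proof (rule that[OF zd Zc])
    show "L2_norm (lborel_on B) (\<lambda>x. z x - u x) < e"
    proof (rule normI)
      show "(\<lambda>x. z x - u x) \<in> borel_measurable (lborel_on B)"
        by (rule borel_measurable_diff[OF measurable_restrict_space1 L2_measurable[OF u]]) simp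
      have "(\<integral>\<^sup>+x. ennreal ((norm (z x - u x))\<^sup>2) * indicator B x \<partial>lborel) \<le> (\<integral>\<^sup>+p. ennreal ((mollify \<delta> \<eta> u' p - u' p)\<^sup>2) \<partial>lborel)"
        by (intro nn_integral_mono) (auto simp: z_def u'_def indicator_def)
      also have "\<dots> \<le> ennreal e'" using d0 \<delta> by auto
      also have "\<dots> \<le> ennreal (e\<^sup>2 / 2)"
      proof (rule ennreal_leI)
        have "1 * e' \<le> D * e'" using D e' by (intro mult_right_mono) auto
        then show "e' \<le> e\<^sup>2 / 2" using e' e2 by linarith
      qed
      finally show "(\<integral>\<^sup>+x. ennreal ((norm (z x - u x))\<^sup>2) * indicator B x \<partial>lborel) \<le> ennreal (e\<^sup>2 / 2)" .
    qed
    show "L2_norm (lborel_on B) (\<lambda>x. Z x - G x) < e"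
    proof (rule normI)
      show "(\<lambda>x. Z x - G x) \<in> borel_measurable (lborel_on B)"
        by (rule borel_measurable_diff[OF measurable_restrict_space1 L2_measurable[OF G]]) simp
      let ?M = "\<lambda>i. mollify \<delta> \<eta> (g i)"
      have "(\<integral>\<^sup>+x. ennreal ((norm (Z x - G x))\<^sup>2) * indicator B x \<partial>lborel)
          \<le> (\<integral>\<^sup>+x. (\<Sum>i\<in>Basis. 2 * ennreal ((?M i x - g i x)\<^sup>2) + ennreal (2 * \<delta>\<^sup>2) * ennreal ((g i x)\<^sup>2)) \<partial>lborel)"
      proof (rule nn_integral_mono)
        fix x
        show "ennreal ((norm (Z x - G x))\<^sup>2) * indicator B x
          \<le> (\<Sum>i\<in>Basis. 2 * ennreal ((?M i x - g i x)\<^sup>2) + ennreal (2 * \<delta>\<^sup>2) * ennreal ((g i x)\<^sup>2))"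
        proof (cases "x \<in> B")
          case True
          have "(norm (Z x - G x))\<^sup>2 = (\<Sum>i\<in>Basis. ((Z x - G x) \<bullet> i)\<^sup>2)"
            unfolding power2_norm_eq_inner by (subst euclidean_inner) (simp add: power2_eq_square)
          also have "\<dots> \<le> (\<Sum>i\<in>Basis. 2 * (?M i x - g i x)\<^sup>2 + 2 * \<delta>\<^sup>2 * (g i x)\<^sup>2)"
          proof (rule sum_mono)
            fix i :: 'a assume i: "i \<in> Basis"
            have "(Z x - G x) \<bullet> i = (1 - \<delta>) * (?M i x - g i x) - \<delta> * g i x"
              using True i by (simp add: inner_diff_left ZG g_def algebra_simps)
            also have "\<dots>\<^sup>2 \<le> 2 * ((1 - \<delta>) * (?M i x - g i x))\<^sup>2 + 2 * (\<delta> * g i x)\<^sup>2"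
              using sum_squares_bound[of "(1 - \<delta>) * (?M i x - g i x)" "- (\<delta> * g i x)"]
              by (simp add: power2_diff)
            also have "\<dots> \<le> 2 * (?M i x - g i x)\<^sup>2 + 2 * \<delta>\<^sup>2 * (g i x)\<^sup>2"
            proof -
              have "(1 - \<delta>)\<^sup>2 \<le> 1" using \<delta> by (simp add: power_le_one)
              then have "(1 - \<delta>)\<^sup>2 * (?M i x - g i x)\<^sup>2 \<le> 1 * (?M i x - g i x)\<^sup>2" by (intro mult_right_mono) auto
              then show ?thesis by (simp add: power_mult_distrib)
            qed
            finally show "((Z x - G x) \<bullet> i)\<^sup>2 \<le> 2 * (?M i x - g i x)\<^sup>2 + 2 * \<delta>\<^sup>2 * (g i x)\<^sup>2" .
          qed
          finally have "ennreal ((norm (Z x - G x))\<^sup>2) \<le> ennreal (\<Sum>i\<in>Basis. 2 * (?M i x - g i x)\<^sup>2 + 2 * \<delta>\<^sup>2 * (g i x)\<^sup>2)"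
            by (rule ennreal_leI)
          also have "\<dots> = (\<Sum>i\<in>Basis. 2 * ennreal ((?M i x - g i x)\<^sup>2) + ennreal (2 * \<delta>\<^sup>2) * ennreal ((g i x)\<^sup>2))"
            by (subst sum_ennreal[symmetric]) (auto simp: ennreal_mult)
          finally show ?thesis using True by simp
        qed simp
      qed
      also have "\<dots> = (\<Sum>i\<in>Basis. 2 * (\<integral>\<^sup>+x. ennreal ((?M i x - g i x)\<^sup>2) \<partial>lborel) + ennreal (2 * \<delta>\<^sup>2) * (\<integral>\<^sup>+x. ennreal ((g i x)\<^sup>2) \<partial>lborel))"
      proof -
        have [measurable]: "?M i \<in> borel_measurable borel" for i
          unfolding mollify_def by measurable
        show ?thesis
          by (simp add: nn_integral_sum nn_integral_add nn_integral_cmult)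
      qed
      also have "\<dots> \<le> (\<Sum>i\<in>Basis. 2 * ennreal e' + ennreal (2 * \<delta>\<^sup>2) * ennreal ((L2_norm lborel (g i))\<^sup>2))"
      proof (intro sum_mono add_mono mult_left_mono)
        fix i :: 'a assume "i \<in> Basis"
        then show "(\<integral>\<^sup>+x. ennreal ((?M i x - g i x)\<^sup>2) \<partial>lborel) \<le> ennreal e'"
          using d(2)[of \<delta> i] \<delta> d1(2)[of i] by force
        show "(\<integral>\<^sup>+x. ennreal ((g i x)\<^sup>2) \<partial>lborel) \<le> ennreal ((L2_norm lborel (g i))\<^sup>2)"
          by (simp add: L2_norm_nn[OF g])
      qed auto
      also have "\<dots> = ennreal (\<Sum>i\<in>(Basis::'a set). 2 * e' + (2 * \<delta>\<^sup>2) * (L2_norm lborel (g i))\<^sup>2)"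
        using e' by (subst sum_ennreal[symmetric]) (auto simp: ennreal_mult)
      also have "\<dots> = ennreal (2 * (D * e') + 2 * \<delta>\<^sup>2 * N)"
        by (simp add: sum.distrib D_def N_def sum_distrib_left mult.left_commute)
      also have "\<dots> \<le> ennreal (e\<^sup>2 / 2)"
      proof (rule ennreal_leI)
        have "\<delta>\<^sup>2 \<le> \<delta> * 1" unfolding power2_eq_square using \<delta> by (intro mult_left_mono) auto
        then have "\<delta>\<^sup>2 * N \<le> (e\<^sup>2 / (8 * (N + 1))) * N" using \<delta> N unfolding q_def by (intro mult_right_mono) auto
        also have "\<dots> \<le> e\<^sup>2 / 8"
          using N e2 by (simp add: field_simps)
        finally show "2 * (D * e') + 2 * \<delta>\<^sup>2 * N \<le> e\<^sup>2 / 2" using e'(2) by simp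
      qed
      finally show "(\<integral>\<^sup>+x. ennreal ((norm (Z x - G x))\<^sup>2) * indicator B x \<partial>lborel) \<le> ennreal (e\<^sup>2 / 2)" .
    qed
  qed
qed

section \<open>Weak solutions of Neumann problems\<close>

text \<open>
  The Riesz representation theorem for a positive semidefinite form \<open>B\<close> on a set \<open>V\<close> closed
  under \<open>lin u t v = u + t v\<close>: a minimising sequence of \<open>B u u - 2 l u\<close> is a Cauchy sequence by the
  parallelogram law, and its limit represents \<open>l\<close>. The operation is a parameter because function
  spaces are not instances of the class of vector spaces.
\<close>

lemma Riesz_representation_form:
  fixes V :: "'v set" and B :: "'v \<Rightarrow> 'v \<Rightarrow> real" and l :: "'v \<Rightarrow> real" and lin :: "'v \<Rightarrow> real \<Rightarrow> 'v \<Rightarrow> 'v"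
  assumes V: "V \<noteq> {}"
    and lin: "\<And>u v t. u \<in> V \<Longrightarrow> v \<in> V \<Longrightarrow> lin u t v \<in> V"
    and sym: "\<And>u v. B u v = B v u"
    and Blin: "\<And>u v z t. u \<in> V \<Longrightarrow> v \<in> V \<Longrightarrow> z \<in> V \<Longrightarrow> B (lin u t v) z = B u z + t * B v z"
    and pos: "\<And>u. u \<in> V \<Longrightarrow> B u u \<ge> 0"
    and llin: "\<And>u v t. u \<in> V \<Longrightarrow> v \<in> V \<Longrightarrow> l (lin u t v) = l u + t * l v"
    and bound: "\<And>u. u \<in> V \<Longrightarrow> (l u)\<^sup>2 \<le> C * B u u"
    and complete: "\<And>f. (\<And>n. f n \<in> V) \<Longrightarrow>
      (\<And>e. e > 0 \<Longrightarrow> \<exists>N. \<forall>m\<ge>N. \<forall>n\<ge>N. B (lin (f m) (-1) (f n)) (lin (f m) (-1) (f n)) < e) \<Longrightarrow>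
      \<exists>u\<in>V. (\<lambda>n. B (lin (f n) (-1) u) (lin (f n) (-1) u)) \<longlonglongrightarrow> (0::real)"
  shows "\<exists>u\<in>V. \<forall>z\<in>V. B u z = l z"
proof -
  define E where "E u = B u u - 2 * l u" for u
  have Blin2: "B z (lin u t v) = B z u + t * B z v" if "u \<in> V" "v \<in> V" "z \<in> V" for u v z t
    using Blin[OF that] by (simp add: sym)
  have Bquad: "B (lin u t v) (lin u t v) = B u u + 2 * t * B u v + t\<^sup>2 * B v v" if "u \<in> V" "v \<in> V" for u v t
    using that by (simp add: Blin Blin2 lin sym[of v u] power2_eq_square algebra_simps)
  have CS: "(B u v)\<^sup>2 \<le> B u u * B v v" if "u \<in> V" "v \<in> V" for u v
  proof -
    have q: "0 \<le> B u u + 2 * t * B u v + t\<^sup>2 * B v v" for t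
      using pos[OF lin[OF that], of t] Bquad[OF that, of t] by simp
    show ?thesis
    proof (cases "B v v = 0")
      case True
      have "B u v = 0"
      proof (rule ccontr)
        assume "B u v \<noteq> 0"
        then show False using q[of "- (B u u + 1) / (2 * B u v)"] True pos[OF that(1)] by (simp add: field_simps)
      qed
      then show ?thesis using True by simp
    next
      case False
      then have "B v v > 0" using pos[OF that(2)] by simp
      then show ?thesis using q[of "- B u v / B v v"]
        by (simp add: field_simps power2_eq_square)
    qed
  qed
  define D where "D = \<bar>C\<bar>"
  have bound': "(l u)\<^sup>2 \<le> D * B u u" if "u \<in> V" for u
    using bound[OF that] mult_right_mono[OF abs_ge_self[of C] pos[OF that]] by (simp add: D_def)
  have Elow: "E u \<ge> - D" if "u \<in> V" for u
  proof -
    have "(2 * l u)\<^sup>2 \<le> 4 * (D * B u u)" using bound'[OF that] by (simp add: power_mult_distrib)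
    also have "\<dots> \<le> (D + B u u)\<^sup>2"
      using sum_squares_bound[of D "B u u"] by (simp add: power2_sum)
    finally have "\<bar>2 * l u\<bar> \<le> \<bar>D + B u u\<bar>" by (rule abs_le_square_iff[THEN iffD2])
    then show ?thesis using pos[OF that] by (auto simp: E_def D_def)
  qed
  define m where "m = Inf (E ` V)"
  have bdd: "bdd_below (E ` V)" using Elow by (rule bdd_belowI2)
  have mE: "m \<le> E u" if "u \<in> V" for u
    unfolding m_def using that bdd by (auto intro: cInf_lower)
  have "\<exists>u\<in>V. E u < m + 1 / real (Suc n)" for n
  proof -
    have "Inf (E ` V) < m + 1 / real (Suc n)" by (simp add: m_def)
    then show ?thesis using cInf_less_iff[OF _ bdd] V by auto
  qed
  then obtain f where f: "\<And>n. f n \<in> V" "\<And>n. E (f n) < m + 1 / real (Suc n)" by metis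
  let ?d = "\<lambda>u v. lin u (-1) v"
  have par: "B (?d u v) (?d u v) \<le> 2 * (E u - m) + 2 * (E v - m)" if "u \<in> V" "v \<in> V" for u v
  proof -
    let ?h = "lin u (1 / 2) (?d v u)"
    have "E ?h = (B u u + 2 * B u v + B v v) / 4 - (l u + l v)"
      unfolding E_def using that
      by (simp add: Bquad lin llin Blin Blin2 sym[of v u] power2_eq_square field_simps)
    moreover have "m \<le> E ?h" using that by (intro mE lin)
    ultimately show ?thesis
      using that by (simp add: E_def Bquad field_simps)
  qed
  have "\<exists>u\<in>V. (\<lambda>n. B (?d (f n) u) (?d (f n) u)) \<longlonglongrightarrow> 0"
  proof (rule complete[OF f(1)])
    fix e :: real assume "e > 0"
    then obtain N where N: "N > 0" "1 / real N < e / 4"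
      using real_arch_inverse[of "e / 4"] by (auto simp: inverse_eq_divide)
    have small: "E (f n) - m < e / 4" if "n \<ge> N" for n
    proof -
      have "1 / real (Suc n) \<le> 1 / real N" using that N(1) by (intro divide_left_mono) auto
      then show ?thesis using f(2)[of n] N(2) by linarith
    qed
    have "B (?d (f p) (f n)) (?d (f p) (f n)) < e" if "p \<ge> N" "n \<ge> N" for p n
    proof -
      have "2 * (E (f p) - m) + 2 * (E (f n) - m) < 2 * (e / 4) + 2 * (e / 4)"
        using that by (intro add_strict_mono mult_strict_left_mono small) auto
      also have "\<dots> = e" by simp
      finally show ?thesis using par[OF f(1) f(1), of p n] by (rule le_less_trans[rotated])
    qed
    then show "\<exists>N. \<forall>p\<ge>N. \<forall>n\<ge>N. B (?d (f p) (f n)) (?d (f p) (f n)) < e" by blast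
  qed
  then obtain u where u: "u \<in> V" and lim: "(\<lambda>n. B (?d (f n) u) (?d (f n) u)) \<longlonglongrightarrow> 0" by blast
  have "B u z = l z" if z: "z \<in> V" for z
  proof -
    have conv: "(\<lambda>n. B (f n) z) \<longlonglongrightarrow> B u z"
    proof -
      have "(\<lambda>n. sqrt (B (?d (f n) u) (?d (f n) u) * B z z)) \<longlonglongrightarrow> sqrt (0 * B z z)"
        by (intro tendsto_intros lim)
      then have lim0: "(\<lambda>n. sqrt (B (?d (f n) u) (?d (f n) u) * B z z)) \<longlonglongrightarrow> 0" by simp
      have "(\<lambda>n. B (f n) z - B u z) \<longlonglongrightarrow> 0"
      proof (rule Lim_null_comparison[OF _ lim0])
        have "norm (B (f n) z - B u z) \<le> sqrt (B (?d (f n) u) (?d (f n) u) * B z z)" for n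
        proof (rule real_le_rsqrt)
          show "(norm (B (f n) z - B u z))\<^sup>2 \<le> B (?d (f n) u) (?d (f n) u) * B z z"
            using CS[OF lin[OF f(1) u] z, of n "-1"] Blin[OF f(1) u z, of n "-1"] by simp
        qed
        then show "\<forall>\<^sub>F n in sequentially. norm (B (f n) z - B u z) \<le> sqrt (B (?d (f n) u) (?d (f n) u) * B z z)"
          by simp
      qed
      then show ?thesis by (simp add: LIM_zero_iff)
    qed
    have ge: "0 \<le> 2 * t * (B u z - l z) + t\<^sup>2 * B z z" for t
    proof -
      have "- (1 / real (Suc n)) \<le> 2 * t * (B (f n) z - l z) + t\<^sup>2 * B z z" for n
      proof -
        have "m \<le> E (lin (f n) t z)" using f z by (intro mE lin)
        also have "\<dots> = E (f n) + 2 * t * (B (f n) z - l z) + t\<^sup>2 * B z z"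
          using f(1) z by (simp add: E_def Bquad llin algebra_simps)
        finally show ?thesis using f(2)[of n] by linarith
      qed
      moreover have "(\<lambda>n. 2 * t * (B (f n) z - l z) + t\<^sup>2 * B z z) \<longlonglongrightarrow> 2 * t * (B u z - l z) + t\<^sup>2 * B z z"
        by (intro tendsto_intros conv)
      moreover have "(\<lambda>n. - (1 / real (Suc n))) \<longlonglongrightarrow> - 0"
        by (intro tendsto_minus) (rule LIMSEQ_Suc[OF lim_1_over_n])
      ultimately show ?thesis by (metis (no_types, lifting) LIMSEQ_le minus_zero)
    qed
    show ?thesis
    proof (rule ccontr)
      assume ne: "B u z \<noteq> l z"
      define k where "k = B u z - l z"
      have k: "k \<noteq> 0" using ne by (simp add: k_def)
      define s where "s = 1 / (B z z + 1)"
      have s: "s > 0" "s * B z z < 2" using pos[OF z] by (auto simp: s_def field_simps)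
      have "0 \<le> (k * k * s) * (s * B z z - 2)"
        using ge[of "- k * s"] by (simp add: k_def power2_eq_square algebra_simps)
      moreover have "(k * k * s) * (s * B z z - 2) < 0"
        using s k by (intro mult_pos_neg) (auto simp: zero_less_mult_iff)
      ultimately show False by simp
    qed
  qed
  with u show ?thesis by blast
qed

text \<open>
  A domain with a weight bounded below on compact subsets. Both Neumann problems are of this
  kind: on \<open>\<Omega>\<close> with weight \<open>1\<close>, and on \<open>(0, 1)\<close> with weight \<open>h\<close>.
\<close>

locale weighted_domain =
  fixes U :: "'a::euclidean_space set" and w :: "'a \<Rightarrow> real"
  assumes open_U: "open U"
    and w_measurable: "w \<in> borel_measurable (lborel_on U)"
    and w_pos: "\<And>x. x \<in> U \<Longrightarrow> w x > 0"
    and w_locally_bounded_below: "\<And>K. compact K \<Longrightarrow> K \<subseteq> U \<Longrightarrow> \<exists>c>0. \<forall>x\<in>K. c \<le> w x"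
    and w_finite: "(\<integral>\<^sup>+x. ennreal (w x) \<partial>lborel_on U) < \<infinity>"
begin

definition M :: "'a measure" where "M = density (lborel_on U) (\<lambda>x. ennreal (w x))"

text \<open>
  For the weight \<open>1\<close> this is the Sobolev space of the domain, for the weight \<open>h\<close> on the unit interval
  it is the energy space of the reduced problem.
\<close>

definition sob :: "('a \<Rightarrow> real) set" where
  "sob = {u \<in> W12_loc U. u \<in> L2 M \<and> weak_grad U u \<in> L2 M}"

lemma U_borel[measurable]: "U \<in> sets borel"
  using open_U by simp

lemma sets_M: "sets M = sets (lborel_on U)"
  by (simp add: M_def)

lemma space_M: "space M = U"
  by (simp add: M_def)

lemma measurable_M[simp]: "borel_measurable M = borel_measurable (lborel_on U)"
  by (rule measurable_cong_sets) (simp_all add: sets_M)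

lemma AE_M: "(AE x in lborel_on U. Q x) \<Longrightarrow> AE x in M. Q x"
  unfolding M_def using w_measurable by (subst AE_density) auto

lemma finite_M: "finite_measure M"
proof (rule finite_measureI)
  have "emeasure M (space M) = (\<integral>\<^sup>+x. ennreal (w x) * indicator (space M) x \<partial>lborel_on U)"
    using w_measurable sets.top[of M] unfolding sets_M unfolding M_def
    by (subst emeasure_density) auto
  also have "\<dots> = (\<integral>\<^sup>+x. ennreal (w x) \<partial>lborel_on U)"
    by (intro nn_integral_cong) (auto simp: space_M)
  finally show "emeasure M (space M) \<noteq> \<infinity>" using w_finite by simp
qed

lemma nn_integral_M:
  "f \<in> borel_measurable (lborel_on U) \<Longrightarrow> (\<integral>\<^sup>+x. f x \<partial>M) = (\<integral>\<^sup>+x. ennreal (w x) * f x \<partial>lborel_on U)"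
  unfolding M_def using w_measurable by (subst nn_integral_density) auto

lemma integral_M:
  "f \<in> borel_measurable (lborel_on U) \<Longrightarrow> (\<integral>x. f x \<partial>M) = (\<integral>x. w x * f x \<partial>lborel_on U)" for f :: "'a \<Rightarrow> real"
  unfolding M_def using w_measurable w_pos
  by (subst integral_density) (auto intro!: AE_I2 less_imp_le)

lemma L2_M_const: "(\<lambda>x. c) \<in> L2 M"
proof -
  interpret finite_measure M by (rule finite_M)
  show ?thesis by (simp add: L2_def)
qed

lemma L2_M_integrable: "f \<in> L2 M \<Longrightarrow> integrable M f" for f :: "'a \<Rightarrow> real"
  using L2_mult_integrable[OF _ L2_M_const[of 1]] by simp

lemma L2_M_imp_L2_loc:
  assumes f: "f \<in> L2 M"
  shows "f \<in> L2_loc U"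
  unfolding L2_loc_def
proof (intro CollectI conjI allI impI)
  show m: "f \<in> borel_measurable (lborel_on U)" using f by (simp add: L2_def)
  fix K assume K: "compact K \<and> K \<subseteq> U"
  then obtain c where c: "c > 0" "\<And>x. x \<in> K \<Longrightarrow> c \<le> w x"
    using w_locally_bounded_below[of K] by auto
  have Kb[measurable]: "K \<in> sets borel" using K by (auto intro: borel_compact)
  have "(\<lambda>x. indicator K x *\<^sub>R (indicator U x *\<^sub>R f x)) \<in> borel_measurable borel"
    using m unfolding borel_measurable_lborel_on_iff[OF U_borel] by measurable
  moreover have "(\<lambda>x. indicator K x *\<^sub>R (indicator U x *\<^sub>R f x)) = (\<lambda>x. indicator K x *\<^sub>R f x)"
    using K by (auto simp: indicator_def fun_eq_iff)
  ultimately have mK: "f \<in> borel_measurable (lborel_on K)"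
    by (simp add: borel_measurable_lborel_on_iff Kb del: indicator_scaleR_eq_if)
  have "ennreal c * (\<integral>\<^sup>+x. ennreal ((norm (f x))\<^sup>2) \<partial>lborel_on K)
      = (\<integral>\<^sup>+x. ennreal c * ennreal ((norm (f x))\<^sup>2) \<partial>lborel_on K)"
    using mK by (subst nn_integral_cmult) auto
  also have "\<dots> \<le> (\<integral>\<^sup>+x. ennreal (w x) * ennreal ((norm (f x))\<^sup>2) \<partial>lborel_on U)"
    unfolding nn_integral_lborel_on[OF Kb] nn_integral_lborel_on[OF U_borel]
  proof (rule nn_integral_mono)
    fix x
    show "ennreal c * ennreal ((norm (f x))\<^sup>2) * indicator K x \<le> ennreal (w x) * ennreal ((norm (f x))\<^sup>2) * indicator U x"
    proof (cases "x \<in> K")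
      case True
      then have "ennreal c \<le> ennreal (w x)" "x \<in> U" using c(2) K by (auto intro: ennreal_leI)
      then show ?thesis using True by (simp add: mult_right_mono)
    qed simp
  qed
  also have "\<dots> = (\<integral>\<^sup>+x. ennreal ((norm (f x))\<^sup>2) \<partial>M)"
    using m by (subst nn_integral_M) auto
  also have "\<dots> < \<infinity>" using f by (simp add: L2_iff_nn)
  finally have "(\<integral>\<^sup>+x. ennreal ((norm (f x))\<^sup>2) \<partial>lborel_on K) < \<infinity>"
    using c(1) by (auto simp: ennreal_mult_less_top)
  then show "f \<in> L2 (lborel_on K)" using mK by (simp add: L2_iff_nn)
qed

text \<open>The weak gradient of the definition may be replaced by any square-integrable one, by uniqueness.\<close>

lemma sob_iff:
  "u \<in> sob \<longleftrightarrow> u \<in> L2 M \<and> (\<exists>G\<in>L2 M. has_weak_gradient U u G)"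
proof
  assume "u \<in> sob"
  then show "u \<in> L2 M \<and> (\<exists>G\<in>L2 M. has_weak_gradient U u G)"
    using weak_grad_works(2)[of u U] by (auto simp: sob_def)
next
  assume "u \<in> L2 M \<and> (\<exists>G\<in>L2 M. has_weak_gradient U u G)"
  then obtain G where uG: "u \<in> L2 M" "G \<in> L2 M" "has_weak_gradient U u G" by blast
  note loc = L2_M_imp_L2_loc[OF uG(1)] L2_M_imp_L2_loc[OF uG(2)]
  have W: "u \<in> W12_loc U" using loc uG(3) by (auto simp: W12_loc_def)
  have "AE x in M. weak_grad U u x = G x"
    by (rule AE_M[OF weak_grad_AE_eq[OF open_U loc uG(3)]])
  then have ae: "AE x in M. G x = weak_grad U u x" by eventually_elim simp
  have "weak_grad U u \<in> borel_measurable M"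
    using L2_locD(2)[OF weak_grad_works(1)[OF W]] by simp
  from L2_cong_AE[OF ae this uG(2)]
  show "u \<in> sob" using W uG by (simp add: sob_def)
qed

lemma sob_weak_grad_AE:
  assumes "u \<in> L2 M" "G \<in> L2 M" "has_weak_gradient U u G"
  shows "AE x in M. weak_grad U u x = G x"
  by (rule AE_M[OF weak_grad_AE_eq[OF open_U L2_M_imp_L2_loc[OF assms(1)] L2_M_imp_L2_loc[OF assms(2)] assms(3)]])

lemma sobD:
  assumes "u \<in> sob"
  shows "u \<in> L2 M" "weak_grad U u \<in> L2 M" "has_weak_gradient U u (weak_grad U u)"
  using assms weak_grad_works(2)[of u U] by (auto simp: sob_def)

lemma sob_add_scale:
  assumes "u \<in> sob" "v \<in> sob"
  shows "(\<lambda>x. u x + c * v x) \<in> sob"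
    and "AE x in M. weak_grad U (\<lambda>x. u x + c * v x) x = weak_grad U u x + c *\<^sub>R weak_grad U v x"
proof -
  have w: "has_weak_gradient U (\<lambda>x. u x + c * v x) (\<lambda>x. weak_grad U u x + c *\<^sub>R weak_grad U v x)"
    by (intro has_weak_gradient_add_scale U_borel L2_M_imp_L2_loc sobD assms)
  have 1: "(\<lambda>x. u x + c * v x) \<in> L2 M"
    using L2_add_scale[OF sobD(1)[OF assms(1)] sobD(1)[OF assms(2)], of c] by simp
  have 2: "(\<lambda>x. weak_grad U u x + c *\<^sub>R weak_grad U v x) \<in> L2 M"
    by (intro L2_add_scale sobD assms)
  show "(\<lambda>x. u x + c * v x) \<in> sob" using 1 2 w by (auto simp: sob_iff)
  show "AE x in M. weak_grad U (\<lambda>x. u x + c * v x) x = weak_grad U u x + c *\<^sub>R weak_grad U v x"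
    by (rule sob_weak_grad_AE[OF 1 2 w])
qed

lemma sob_const:
  shows "(\<lambda>x. c) \<in> sob" and "AE x in M. weak_grad U (\<lambda>x. c) x = 0"
  using sob_weak_grad_AE[OF L2_M_const L2_zero has_weak_gradient_const[OF U_borel]]
    has_weak_gradient_const[OF U_borel] L2_M_const
  by (auto simp: sob_iff intro!: bexI[of _ "\<lambda>x. 0"] L2_zero)

lemma weak_grad_measurable: "u \<in> sob \<Longrightarrow> weak_grad U u \<in> borel_measurable (lborel_on U)"
  using sobD(2)[of u] by (simp add: L2_def)

definition gform :: "('a \<Rightarrow> real) \<Rightarrow> ('a \<Rightarrow> real) \<Rightarrow> real" where
  "gform u v = L2_inner M (weak_grad U u) (weak_grad U v)"

lemma gform_commute: "gform u v = gform v u"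
  by (simp add: gform_def L2_inner_commute)

lemma gform_nonneg: "gform u u \<ge> 0"
  unfolding gform_def L2_norm_square_inner[symmetric] by simp

lemma gform_add_scale:
  assumes "u \<in> sob" "v \<in> sob" "z \<in> sob"
  shows "gform (\<lambda>x. u x + c * v x) z = gform u z + c * gform v z"
proof -
  have "gform (\<lambda>x. u x + c * v x) z = L2_inner M (\<lambda>x. weak_grad U u x + c *\<^sub>R weak_grad U v x) (weak_grad U z)"
    unfolding gform_def
    using sobD(2)[OF sob_add_scale(1)[OF assms(1,2), of c]] sobD(2)[OF assms(3)]
      L2_add_scale[OF sobD(2)[OF assms(1)] sobD(2)[OF assms(2)], of c]
    by (intro L2_inner_cong_AE sob_add_scale assms) (auto simp: L2_def)
  then show ?thesis
    unfolding gform_def using assms by (simp add: L2_inner_add_scale sobD)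
qed

text \<open>
  Test functions divided by the weight are square integrable, so the defining identities of a weak
  gradient are continuous in the weighted norm and weak gradients are closed under limits.
\<close>

lemma test_function_div_weight:
  assumes \<phi>: "\<phi> \<in> test_functions U"
  shows "(\<lambda>x. \<phi> x / w x) \<in> L2 M"
    and "f \<in> borel_measurable (lborel_on U) \<Longrightarrow> (\<integral>x. f x * \<phi> x \<partial>lborel_on U) = L2_inner M f (\<lambda>x. \<phi> x / w x)"
proof -
  have m\<phi>[measurable]: "\<phi> \<in> borel_measurable (lborel_on U)"
    using test_functionsD(7)[OF \<phi>] by (auto intro: measurable_restrict_space1)
  note [measurable] = w_measurable
  let ?K = "closure {x. \<phi> x \<noteq> 0}"
  obtain c where c: "c > 0" "\<And>x. x \<in> ?K \<Longrightarrow> c \<le> w x"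
    using w_locally_bounded_below[OF test_functionsD(5,6)[OF \<phi>]] by auto
  have "(\<integral>\<^sup>+x. ennreal ((norm (\<phi> x / w x))\<^sup>2) \<partial>M) = (\<integral>\<^sup>+x. ennreal (w x) * ennreal ((norm (\<phi> x / w x))\<^sup>2) \<partial>lborel_on U)"
    by (rule nn_integral_M) measurable
  also have "\<dots> \<le> (\<integral>\<^sup>+x. ennreal ((1 / c) * (\<phi> x)\<^sup>2) \<partial>lborel_on U)"
  proof (rule nn_integral_mono)
    fix x assume "x \<in> space (lborel_on U)"
    then have wp: "w x > 0" using w_pos by simp
    show "ennreal (w x) * ennreal ((norm (\<phi> x / w x))\<^sup>2) \<le> ennreal ((1 / c) * (\<phi> x)\<^sup>2)"
    proof (cases "\<phi> x = 0")
      case False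
      then have "c \<le> w x" using c closure_subset[of "{x. \<phi> x \<noteq> 0}"] by auto
      then have "1 / w x \<le> 1 / c" using c(1) by (intro divide_left_mono) auto
      then have "(1 / w x) * (\<phi> x)\<^sup>2 \<le> (1 / c) * (\<phi> x)\<^sup>2" by (intro mult_right_mono) auto
      moreover have "w x * (norm (\<phi> x / w x))\<^sup>2 = (1 / w x) * (\<phi> x)\<^sup>2"
        using wp by (simp add: power2_eq_square)
      ultimately show ?thesis using wp by (simp add: ennreal_mult[symmetric] ennreal_leI)
    qed simp
  qed
  also have "\<dots> < \<infinity>"
  proof -
    have "(\<lambda>x. sqrt (1 / c) *\<^sub>R \<phi> x) \<in> L2 (lborel_on U)"
      by (intro L2_scale L2_lborel_onI test_function_L2[OF \<phi>] U_borel)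
    then show ?thesis using c(1) by (simp add: L2_iff_nn power_mult_distrib power_divide)
  qed
  finally show "(\<lambda>x. \<phi> x / w x) \<in> L2 M" by (simp add: L2_iff_nn)
  assume [measurable]: "f \<in> borel_measurable (lborel_on U)"
  have "L2_inner M f (\<lambda>x. \<phi> x / w x) = (\<integral>x. w x * (f x * (\<phi> x / w x)) \<partial>lborel_on U)"
    unfolding L2_inner_def inner_real_def by (rule integral_M) measurable
  also have "\<dots> = (\<integral>x. f x * \<phi> x \<partial>lborel_on U)"
  proof (rule Bochner_Integration.integral_cong[OF refl])
    fix x assume "x \<in> space (lborel_on U)"
    then have wp: "w x > 0" using w_pos by simp
    then show "w x * (f x * (\<phi> x / w x)) = f x * \<phi> x" by simp
  qed
  finally show "(\<integral>x. f x * \<phi> x \<partial>lborel_on U) = L2_inner M f (\<lambda>x. \<phi> x / w x)" by simp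
qed

lemma weak_gradient_closed:
  assumes f: "\<And>n. f n \<in> sob" and u: "u \<in> L2 M" and G: "G \<in> L2 M"
    and fu: "(\<lambda>n. L2_norm M (\<lambda>x. f n x - u x)) \<longlonglongrightarrow> 0"
    and fG: "(\<lambda>n. L2_norm M (\<lambda>x. weak_grad U (f n) x - G x)) \<longlonglongrightarrow> 0"
  shows "has_weak_gradient U u G"
  unfolding has_weak_gradient_def
proof (intro ballI)
  fix \<phi> and i :: 'a assume \<phi>: "\<phi> \<in> test_functions U" and i: "i \<in> Basis"
  note p = pd_test_function[OF \<phi> i]
  have m: "u \<in> borel_measurable (lborel_on U)" "G \<in> borel_measurable (lborel_on U)"
    using u G by (auto simp: L2_def)
  have mf: "f n \<in> borel_measurable (lborel_on U)" "weak_grad U (f n) \<in> borel_measurable (lborel_on U)" for n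
    using sobD(1,2)[OF f[of n]] by (auto simp: L2_def)
  have i0: "norm i = 1" using i by simp
  have lim1: "(\<lambda>n. \<integral>x. f n x * pd \<phi> i x \<partial>lborel_on U) \<longlonglongrightarrow> (\<integral>x. u x * pd \<phi> i x \<partial>lborel_on U)"
    unfolding test_function_div_weight(2)[OF p mf(1)] test_function_div_weight(2)[OF p m(1)]
    by (rule L2_inner_tendsto[OF sobD(1)[OF f] u test_function_div_weight(1)[OF p] fu])
  have lim2: "(\<lambda>n. \<integral>x. (weak_grad U (f n) x \<bullet> i) * \<phi> x \<partial>lborel_on U) \<longlonglongrightarrow> (\<integral>x. (G x \<bullet> i) * \<phi> x \<partial>lborel_on U)"
  proof -
    have t: "(\<lambda>x. (\<phi> x / w x) *\<^sub>R i) \<in> L2 M"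
      using test_function_div_weight(1)[OF \<phi>] i0 by (auto simp: L2_def power_divide)
    have eq: "(\<integral>x. (H x \<bullet> i) * \<phi> x \<partial>lborel_on U) = L2_inner M H (\<lambda>x. (\<phi> x / w x) *\<^sub>R i)"
      if H: "H \<in> borel_measurable (lborel_on U)" for H
    proof -
      have "(\<integral>x. (H x \<bullet> i) * \<phi> x \<partial>lborel_on U) = L2_inner M (\<lambda>x. H x \<bullet> i) (\<lambda>x. \<phi> x / w x)"
        by (rule test_function_div_weight(2)[OF \<phi>]) (use H in measurable)
      then show ?thesis by (simp add: L2_inner_def mult.commute)
    qed
    show ?thesis
      unfolding eq[OF mf(2)] eq[OF m(2)]
      by (rule L2_inner_tendsto[OF sobD(2)[OF f] G t fG])
  qed
  have "(\<integral>x. f n x * pd \<phi> i x \<partial>lborel_on U) = - (\<integral>x. (weak_grad U (f n) x \<bullet> i) * \<phi> x \<partial>lborel_on U)" for n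
    using sobD(3)[OF f[of n]] \<phi> i by (simp add: has_weak_gradient_def)
  then have "(\<lambda>n. - (\<integral>x. (weak_grad U (f n) x \<bullet> i) * \<phi> x \<partial>lborel_on U)) \<longlonglongrightarrow> (\<integral>x. u x * pd \<phi> i x \<partial>lborel_on U)"
    using lim1 by simp
  then show "(\<integral>x. u x * pd \<phi> i x \<partial>lborel_on U) = - (\<integral>x. (G x \<bullet> i) * \<phi> x \<partial>lborel_on U)"
    using tendsto_minus[OF lim2] LIMSEQ_unique by blast
qed

text \<open>
  Given the Poincare inequality, the Neumann problem with mean-zero data is solvable: on mean-zero
  functions the Dirichlet form is then complete and controls the right-hand side, and testing with
  constants is trivial.
\<close>

theorem Neumann_solvable:
  assumes poincare: "\<And>u. u \<in> sob \<Longrightarrow> (\<integral>x. u x \<partial>M) = 0 \<Longrightarrow> (L2_norm M u)\<^sup>2 \<le> C * gform u u"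
    and g: "g \<in> L2_mean_zero M"
  shows "\<exists>u\<in>sob. (\<integral>x. u x \<partial>M) = 0 \<and> (\<forall>z\<in>sob. gform u z = L2_inner M g z)"
proof -
  have gL: "g \<in> L2 M" and g0: "(\<integral>x. g x \<partial>M) = 0" using g by (auto simp: L2_mean_zero_def)
  define V where "V = {u \<in> sob. (\<integral>x. u x \<partial>M) = 0}"
  let ?lin = "\<lambda>(u::'a \<Rightarrow> real) t v x. u x + t * v x"
  define D where "D = \<bar>C\<bar>"
  have poincare': "(L2_norm M u)\<^sup>2 \<le> D * gform u u" if "u \<in> V" for u
    using poincare[of u] that mult_right_mono[OF abs_ge_self gform_nonneg, of C u] by (auto simp: V_def D_def)
  have linV: "?lin u t v \<in> V" if "u \<in> V" "v \<in> V" for u v t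
    using that sob_add_scale(1)[of u v t] sobD(1)[of u] sobD(1)[of v] by (auto simp: V_def L2_M_integrable)
  have "\<exists>u\<in>V. \<forall>z\<in>V. gform u z = L2_inner M g z"
  proof (rule Riesz_representation_form[where lin = ?lin and C = "(L2_norm M g)\<^sup>2 * D"])
    show "V \<noteq> {}" using sob_const(1)[of 0] by (auto simp: V_def intro!: exI[of _ "\<lambda>x. 0"])
    show "?lin u t v \<in> V" if "u \<in> V" "v \<in> V" for u v t by (rule linV[OF that])
    show "gform u v = gform v u" for u v by (rule gform_commute)
    show "gform (?lin u t v) z = gform u z + t * gform v z" if "u \<in> V" "v \<in> V" "z \<in> V" for u v z t
      using that by (intro gform_add_scale) (auto simp: V_def)
    show "gform u u \<ge> 0" for u by (rule gform_nonneg)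
    show "L2_inner M g (?lin u t v) = L2_inner M g u + t * L2_inner M g v" if "u \<in> V" "v \<in> V" for u v t
      using that L2_inner_add_scale[OF sobD(1) sobD(1) gL, of u v t]
      by (auto simp: V_def L2_inner_commute[of M g])
    show "(L2_inner M g u)\<^sup>2 \<le> (L2_norm M g)\<^sup>2 * D * gform u u" if u: "u \<in> V" for u
    proof -
      have "u \<in> L2 M" using u by (auto simp: V_def sobD)
      from L2_inner_Cauchy_Schwarz[OF gL this]
      have "\<bar>L2_inner M g u\<bar>\<^sup>2 \<le> (L2_norm M g * L2_norm M u)\<^sup>2" by (intro power_mono) auto
      also have "\<dots> \<le> (L2_norm M g)\<^sup>2 * (D * gform u u)"
        unfolding power_mult_distrib by (intro mult_left_mono poincare' u) simp
      finally show ?thesis by (simp add: mult.assoc)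
    qed
    fix f :: "nat \<Rightarrow> 'a \<Rightarrow> real"
    assume fV: "\<And>n. f n \<in> V"
      and cauchy: "\<And>e::real. e > 0 \<Longrightarrow> \<exists>N. \<forall>m\<ge>N. \<forall>n\<ge>N. gform (?lin (f m) (-1) (f n)) (?lin (f m) (-1) (f n)) < e"
    have fs: "f n \<in> sob" for n using fV by (simp add: V_def)
    have gd: "gform (?lin a (-1) b) (?lin a (-1) b) = (L2_norm M (\<lambda>x. weak_grad U a x - weak_grad U b x))\<^sup>2"
      if a: "a \<in> sob" and b: "b \<in> sob" for a b
    proof -
      have "L2_norm M (weak_grad U (?lin a (-1) b)) = L2_norm M (\<lambda>x. weak_grad U a x + (-1) *\<^sub>R weak_grad U b x)"
        using sob_add_scale[OF a b, of "-1"] sobD(2)[OF sob_add_scale(1)[OF a b, of "-1"]]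
          L2_add_scale[OF sobD(2)[OF a] sobD(2)[OF b], of "-1"]
        by (intro L2_norm_cong_AE) (auto simp: L2_def)
      then show ?thesis by (simp add: gform_def L2_norm_square_inner[symmetric])
    qed
    have sq: "\<exists>N. \<forall>m\<ge>N. \<forall>n\<ge>N. X m n < e"
      if e: "e > 0" and le: "\<And>m n. (X m n)\<^sup>2 \<le> K * gform (?lin (f m) (-1) (f n)) (?lin (f m) (-1) (f n))" and K: "K \<ge> 0"
      for X :: "nat \<Rightarrow> nat \<Rightarrow> real" and e K
    proof -
      have "e\<^sup>2 / (K + 1) > 0" using e K by simp
      from cauchy[OF this] obtain N where
        N: "\<And>m n. m \<ge> N \<Longrightarrow> n \<ge> N \<Longrightarrow> gform (?lin (f m) (-1) (f n)) (?lin (f m) (-1) (f n)) < e\<^sup>2 / (K + 1)" by blast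
      have "X m n < e" if "m \<ge> N" "n \<ge> N" for m n
      proof (rule power2_less_imp_less)
        let ?g = "gform (?lin (f m) (-1) (f n)) (?lin (f m) (-1) (f n))"
        have "(X m n)\<^sup>2 \<le> K * ?g" by (rule le)
        also have "\<dots> \<le> (K + 1) * ?g" using gform_nonneg by (intro mult_right_mono) auto
        also have "\<dots> < e\<^sup>2" using N[OF that] K by (simp add: field_simps)
        finally show "(X m n)\<^sup>2 < e\<^sup>2" .
      qed (use e in simp)
      then show ?thesis by blast
    qed
    obtain G where G: "G \<in> L2 M" "(\<lambda>n. L2_norm M (\<lambda>x. weak_grad U (f n) x - G x)) \<longlonglongrightarrow> 0"
    proof (rule L2_complete[of "\<lambda>n. weak_grad U (f n)" M])
      show "weak_grad U (f n) \<in> L2 M" for n by (rule sobD(2)[OF fs])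
      fix e :: real assume "e > 0"
      then show "\<exists>N. \<forall>m\<ge>N. \<forall>n\<ge>N. L2_norm M (\<lambda>x. weak_grad U (f m) x - weak_grad U (f n) x) < e"
      proof (rule sq[of _ _ 1])
        show "(L2_norm M (\<lambda>x. weak_grad U (f m) x - weak_grad U (f n) x))\<^sup>2
            \<le> 1 * gform (?lin (f m) (-1) (f n)) (?lin (f m) (-1) (f n))" for m n
          using gd[OF fs[of m] fs[of n]] by simp
      qed simp
    qed blast
    obtain u where u: "u \<in> L2 M" "(\<lambda>n. L2_norm M (\<lambda>x. f n x - u x)) \<longlonglongrightarrow> 0"
    proof (rule L2_complete[of f M])
      show "f n \<in> L2 M" for n by (rule sobD(1)[OF fs])
      fix e :: real assume "e > 0"
      then show "\<exists>N. \<forall>m\<ge>N. \<forall>n\<ge>N. L2_norm M (\<lambda>x. f m x - f n x) < e"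
      proof (rule sq[of _ _ D])
        show "(L2_norm M (\<lambda>x. f m x - f n x))\<^sup>2 \<le> D * gform (?lin (f m) (-1) (f n)) (?lin (f m) (-1) (f n))" for m n
          using poincare'[OF linV[OF fV fV], of m "-1" n] by simp
      qed (simp add: D_def)
    qed blast
    have wG: "has_weak_gradient U u G"
      by (rule weak_gradient_closed[OF fs u(1) G(1) u(2) G(2)])
    have us: "u \<in> sob" using u(1) G(1) wG by (auto simp: sob_iff)
    have "(\<lambda>n. L2_inner M (f n) (\<lambda>x. 1)) \<longlonglongrightarrow> L2_inner M u (\<lambda>x. 1)"
      by (rule L2_inner_tendsto[OF sobD(1)[OF fs] u(1) L2_M_const u(2)])
    then have "(\<integral>x. u x \<partial>M) = 0"
      using fV by (simp add: L2_inner_def V_def LIMSEQ_const_iff)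
    then have uV: "u \<in> V" using us by (simp add: V_def)
    have "(\<lambda>n. gform (?lin (f n) (-1) u) (?lin (f n) (-1) u)) \<longlonglongrightarrow> 0"
    proof -
      have "L2_norm M (\<lambda>x. weak_grad U (f n) x - weak_grad U u x) = L2_norm M (\<lambda>x. weak_grad U (f n) x - G x)" for n
        using sob_weak_grad_AE[OF u(1) G(1) wG] L2_diff[OF sobD(2)[OF fs[of n]] sobD(2)[OF us]]
          L2_diff[OF sobD(2)[OF fs[of n]] G(1)]
        by (intro L2_norm_cong_AE) (auto simp: L2_def)
      then have "gform (?lin (f n) (-1) u) (?lin (f n) (-1) u) = (L2_norm M (\<lambda>x. weak_grad U (f n) x - G x))\<^sup>2" for n
        using gd[OF fs[of n] us] by simp
      then show ?thesis
        using tendsto_power[OF G(2), of 2] by (simp only: zero_power2)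
    qed
    with uV show "\<exists>u\<in>V. (\<lambda>n. gform (?lin (f n) (-1) u) (?lin (f n) (-1) u)) \<longlonglongrightarrow> 0" by blast
  qed
  then obtain u where u: "u \<in> V" "\<And>z. z \<in> V \<Longrightarrow> gform u z = L2_inner M g z" by blast
  have us: "u \<in> sob" using u by (simp add: V_def)
  have "gform u z = L2_inner M g z" if z: "z \<in> sob" for z
  proof -
    interpret finite_measure M by (rule finite_M)
    show ?thesis
    proof (cases "measure M (space M) = 0")
      case True
      then have "AE x in M. False"
        by (intro AE_I[of _ _ "space M"]) (auto simp: emeasure_eq_measure)
      then have "(\<integral>x. f x \<partial>M) = 0" for f :: "'a \<Rightarrow> real"
        by (intro integral_eq_zero_AE) (elim eventually_mono, simp)
      then show ?thesis by (simp add: gform_def L2_inner_def)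
    next
      case False
      define c where "c = (\<integral>x. z x \<partial>M) / measure M (space M)"
      have z': "?lin z (-c) (\<lambda>x. 1) \<in> V"
        using sob_add_scale(1)[OF z sob_const(1)[of 1], of "-c"] sobD(1)[OF z] False
        by (auto simp: V_def L2_M_integrable c_def)
      have "gform (?lin z (-c) (\<lambda>x. 1)) u = gform z u + (-c) * gform (\<lambda>x. 1) u"
        by (rule gform_add_scale[OF z sob_const(1) us])
      moreover have "gform (\<lambda>x. 1) u = L2_inner M (\<lambda>x. 0) (weak_grad U u)"
        unfolding gform_def using sob_const(2)[of 1] sobD(2)[OF us] sobD(2)[OF sob_const(1)[of 1]]
        by (intro L2_inner_cong_AE) (auto simp: L2_def)
      moreover have "L2_inner M g (?lin z (-c) (\<lambda>x. 1)) = L2_inner M g z"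
        using L2_inner_add_scale[OF sobD(1)[OF z] L2_M_const[of 1] gL, of "-c"] g0
        by (simp add: L2_inner_commute[of M g]) (simp add: L2_inner_def)
      ultimately show ?thesis
        using u(2)[OF z'] by (simp add: gform_commute[of u] L2_inner_def)
    qed
  qed
  with u us show ?thesis by (auto simp: V_def)
qed

end

section \<open>The Poincare inequality on convex sets\<close>

lemma continuous_bounded_on_bounded:
  fixes f :: "'a::euclidean_space \<Rightarrow> 'b::euclidean_space"
  assumes "continuous_on UNIV f" "bounded B"
  obtains C where "C > 0" "\<And>x. x \<in> B \<Longrightarrow> norm (f x) \<le> C"
proof -
  have "compact (f ` closure B)"
    using assms by (intro compact_continuous_image continuous_on_subset[OF assms(1)]) auto
  then have "bounded (f ` closure B)" by (rule compact_imp_bounded)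
  then obtain C where "C > 0" "\<And>y. y \<in> f ` closure B \<Longrightarrow> norm y \<le> C"
    unfolding bounded_pos by auto
  then show ?thesis using closure_subset[of B] that[of C] by auto
qed

lemma continuous_L2:
  fixes f :: "'a::euclidean_space \<Rightarrow> 'b::euclidean_space"
  assumes "continuous_on UNIV f" "bounded B" "B \<in> sets borel"
  shows "f \<in> L2 (lborel_on B)"
proof -
  obtain C where C: "C > 0" "\<And>x. x \<in> B \<Longrightarrow> norm (f x) \<le> C"
    using continuous_bounded_on_bounded[OF assms(1,2)] by blast
  have "emeasure lborel B < \<infinity>" using assms by (intro emeasure_bounded_finite)
  then have "(\<lambda>x. C) \<in> L2 (lborel_on B)"
    using assms(3) by (simp add: L2_def integrable_lborel_on)
  then show ?thesis
  proof (rule L2_dominated)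
    show "f \<in> borel_measurable (lborel_on B)"
      using borel_measurable_continuous_onI[OF assms(1)] by (intro measurable_restrict_space1) simp
  qed (use assms C in auto)
qed

text \<open>The fundamental theorem of calculus on the segment from \<open>x\<close> to \<open>y\<close>, and the Cauchy--Schwarz inequality.\<close>

lemma increment_square_le:
  fixes w :: "'a::euclidean_space \<Rightarrow> real"
  assumes w: "\<And>p. (w has_derivative (\<lambda>h. W p \<bullet> h)) (at p)" and W: "continuous_on UNIV W"
    and d: "norm (y - x) \<le> d"
  shows "ennreal ((w x - w y)\<^sup>2) \<le> ennreal (d\<^sup>2) *
    (\<integral>\<^sup>+t. ennreal ((norm (W ((1 - t) *\<^sub>R x + t *\<^sub>R y)))\<^sup>2) * indicator {0..1} t \<partial>lborel)"
proof -
  let ?c = "\<lambda>t::real. (1 - t) *\<^sub>R x + t *\<^sub>R y"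
  have c: "continuous_on UNIV (\<lambda>t. W (?c t))"
    by (rule continuous_on_compose2[OF W]) (auto intro!: continuous_intros)
  note [measurable] = borel_measurable_continuous_onI[OF c]
  have d0: "d \<ge> 0" using d norm_ge_zero[of "y - x"] by linarith
  have "((\<lambda>t. w (?c t)) has_vector_derivative W (?c t) \<bullet> (y - x)) (at t within {0..1})" for t
  proof -
    have "(?c has_derivative (\<lambda>h. h *\<^sub>R (y - x))) (at t within {0..1})"
      by (auto intro!: derivative_eq_intros simp: algebra_simps)
    from has_derivative_compose[OF this w[of "?c t"]]
    show ?thesis by (simp add: has_vector_derivative_def)
  qed
  then have "(\<integral>t. indicator {0..1} t *\<^sub>R (W (?c t) \<bullet> (y - x)) \<partial>lborel) = w (?c 1) - w (?c 0)"
    by (intro integral_FTC_atLeastAtMost) (auto intro!: continuous_intros continuous_on_subset[OF c])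
  then have eq: "w y - w x = (\<integral>t. indicator {0..1} t *\<^sub>R (W (?c t) \<bullet> (y - x)) \<partial>lborel)" by simp
  have "integrable lborel (\<lambda>t. indicator {0..1} t *\<^sub>R (W (?c t) \<bullet> (y - x)))"
    by (intro borel_integrable_compact continuous_intros continuous_on_subset[OF c]) auto
  from integral_norm_bound_ennreal[OF this, folded eq]
  have "ennreal \<bar>w y - w x\<bar> \<le> (\<integral>\<^sup>+t. ennreal (norm (indicator {0..1} t *\<^sub>R (W (?c t) \<bullet> (y - x)))) \<partial>lborel)"
    by (simp only: real_norm_def)
  also have "\<dots> \<le> (\<integral>\<^sup>+t. (ennreal d * (ennreal (norm (W (?c t))) * indicator {0..1} t)) * indicator {0..1} t \<partial>lborel)"
  proof (rule nn_integral_mono)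
    fix t :: real
    have "\<bar>W (?c t) \<bullet> (y - x)\<bar> \<le> d * norm (W (?c t))"
      using Cauchy_Schwarz_ineq2[of "W (?c t)" "y - x"] mult_left_mono[OF d norm_ge_zero[of "W (?c t)"]]
      by (simp add: mult.commute)
    then have "ennreal \<bar>W (?c t) \<bullet> (y - x)\<bar> \<le> ennreal d * ennreal (norm (W (?c t)))"
      using d0 by (simp add: ennreal_mult[symmetric] ennreal_leI)
    then show "ennreal (norm (indicator {0..1} t *\<^sub>R (W (?c t) \<bullet> (y - x))))
        \<le> (ennreal d * (ennreal (norm (W (?c t))) * indicator {0..1} t)) * indicator {0..1} t"
      by (cases "t \<in> {0..1}") auto
  qed
  finally have "(ennreal \<bar>w y - w x\<bar>)\<^sup>2 \<le> (\<integral>\<^sup>+t. (ennreal d * (ennreal (norm (W (?c t))) * indicator {0..1} t)) * indicator {0..1} t \<partial>lborel)\<^sup>2"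
    by (rule power_mono) simp
  also have "\<dots> \<le> (\<integral>\<^sup>+t. (ennreal d * (ennreal (norm (W (?c t))) * indicator {0..1} t))\<^sup>2 \<partial>lborel) * (\<integral>\<^sup>+t. (indicator {0..1::real} t)\<^sup>2 \<partial>lborel)"
    by (rule Cauchy_Schwarz_nn_integral) measurable
  also have "(\<integral>\<^sup>+t. (indicator {0..1::real} t)\<^sup>2 \<partial>lborel) = (\<integral>\<^sup>+t. indicator {0..1::real} t \<partial>lborel)"
    by (intro nn_integral_cong) (simp split: split_indicator)
  also have "\<dots> = 1" by simp
  also have "(\<integral>\<^sup>+t. (ennreal d * (ennreal (norm (W (?c t))) * indicator {0..1} t))\<^sup>2 \<partial>lborel)
    = (\<integral>\<^sup>+t. ennreal (d\<^sup>2) * (ennreal ((norm (W (?c t)))\<^sup>2) * indicator {0..1} t) \<partial>lborel)"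
    using d0 by (intro nn_integral_cong) (simp add: power_mult_distrib ennreal_power split: split_indicator)
  also have "\<dots> = ennreal (d\<^sup>2) * (\<integral>\<^sup>+t. ennreal ((norm (W (?c t)))\<^sup>2) * indicator {0..1} t \<partial>lborel)"
    by (rule nn_integral_cmult) measurable
  finally show ?thesis by (simp add: ennreal_power power2_commute)
qed

text \<open>
  Contracting towards a point of \<open>D\<close> by a factor of at least \<open>1/2\<close> stays in \<open>D\<close> and costs at most
  the factor \<open>2\<^sup>d\<close> in volume.
\<close>

lemma nn_integral_contract:
  fixes D :: "'a::euclidean_space set"
  assumes D: "convex D" "D \<in> sets borel" and x: "x \<in> D" and c: "1 / 2 \<le> c" "c \<le> 1"
    and [measurable]: "f \<in> borel_measurable borel"
  shows "(\<integral>\<^sup>+y. f ((1 - c) *\<^sub>R x + c *\<^sub>R y) * indicator D y \<partial>lborel)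
    \<le> ennreal (2 ^ DIM('a)) * (\<integral>\<^sup>+y. f y * indicator D y \<partial>lborel)"
proof -
  note [measurable] = D(2)
  let ?G = "\<lambda>q. f q * indicator D q"
  let ?I = "\<integral>\<^sup>+y. ?G ((1 - c) *\<^sub>R x + c *\<^sub>R y) \<partial>lborel"
  have "(\<integral>\<^sup>+y. f ((1 - c) *\<^sub>R x + c *\<^sub>R y) * indicator D y \<partial>lborel) \<le> 1 * ?I"
    unfolding mult_1
  proof (rule nn_integral_mono)
    fix y
    have "(1 - c) *\<^sub>R x + c *\<^sub>R y \<in> D" if "y \<in> D"
      using convexD[OF D(1) x that, of "1 - c" c] c by simp
    then show "f ((1 - c) *\<^sub>R x + c *\<^sub>R y) * indicator D y \<le> ?G ((1 - c) *\<^sub>R x + c *\<^sub>R y)"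
      by (auto split: split_indicator)
  qed
  also have "\<dots> \<le> ennreal (2 ^ DIM('a) * \<bar>c\<bar> ^ DIM('a)) * ?I"
  proof (rule mult_right_mono)
    have "1 ^ DIM('a) \<le> (2 * \<bar>c\<bar>) ^ DIM('a)" using c by (intro power_mono) auto
    then show "1 \<le> ennreal (2 ^ DIM('a) * \<bar>c\<bar> ^ DIM('a))"
      using ennreal_leI[of 1 "2 ^ DIM('a) * \<bar>c\<bar> ^ DIM('a)"] by (simp add: power_mult_distrib)
  qed simp
  also have "\<dots> = ennreal (2 ^ DIM('a)) * (ennreal (\<bar>c\<bar> ^ DIM('a)) * ?I)"
    by (simp only: ennreal_mult[OF zero_le_power zero_le_power] mult.assoc abs_ge_zero zero_le_numeral)
  also have "ennreal (\<bar>c\<bar> ^ DIM('a)) * ?I = (\<integral>\<^sup>+y. ?G y \<partial>lborel)"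
    using c by (intro nn_integral_affine[symmetric]) auto
  finally show ?thesis .
qed

text \<open>
  The integrand at parameter \<open>t\<close> of the segment is contracted towards \<open>x\<close> if \<open>t \<ge> 1/2\<close>, and towards \<open>y\<close>
  otherwise; exchanging \<open>x\<close> and \<open>y\<close> reduces the second case to the first.
\<close>

lemma double_integral_increment_le:
  fixes D :: "'a::euclidean_space set" and w :: "'a \<Rightarrow> real"
  assumes D: "convex D" "D \<in> sets borel" and d: "\<And>x y. x \<in> D \<Longrightarrow> y \<in> D \<Longrightarrow> norm (y - x) \<le> d"
    and w: "\<And>p. (w has_derivative (\<lambda>h. W p \<bullet> h)) (at p)" and W: "continuous_on UNIV W"
  shows "(\<integral>\<^sup>+x. (\<integral>\<^sup>+y. ennreal ((w x - w y)\<^sup>2) * indicator D y \<partial>lborel) * indicator D x \<partial>lborel)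
    \<le> ennreal (d\<^sup>2 * 2 ^ DIM('a)) * (emeasure lborel D * (\<integral>\<^sup>+y. ennreal ((norm (W y))\<^sup>2) * indicator D y \<partial>lborel))"
proof -
  note [measurable] = D(2) borel_measurable_continuous_onI[OF W]
  let ?W = "\<lambda>q. ennreal ((norm (W q))\<^sup>2)"
  let ?F = "\<lambda>x y t. ?W ((1 - t) *\<^sub>R x + t *\<^sub>R y) * indicator {0..1::real} t * indicator D y * indicator D x"
  let ?R = "ennreal (2 ^ DIM('a)) * (emeasure lborel D * (\<integral>\<^sup>+y. ?W y * indicator D y \<partial>lborel))"
  have J: "(\<integral>\<^sup>+x. (\<integral>\<^sup>+y. ?F x y t \<partial>lborel) \<partial>lborel) \<le> ?R * indicator {0..1} t" for t
  proof (cases "t \<in> {0..1}")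
    case t: True
    have "(\<integral>\<^sup>+x. (\<integral>\<^sup>+y. ?W ((1 - c) *\<^sub>R x + c *\<^sub>R y) * indicator D y * indicator D x \<partial>lborel) \<partial>lborel) \<le> ?R"
      if c: "1 / 2 \<le> c" "c \<le> 1" for c
    proof -
      have "(\<integral>\<^sup>+x. (\<integral>\<^sup>+y. ?W ((1 - c) *\<^sub>R x + c *\<^sub>R y) * indicator D y * indicator D x \<partial>lborel) \<partial>lborel)
        \<le> (\<integral>\<^sup>+x. (ennreal (2 ^ DIM('a)) * (\<integral>\<^sup>+y. ?W y * indicator D y \<partial>lborel)) * indicator D x \<partial>lborel)"
      proof (rule nn_integral_mono)
        fix x
        show "(\<integral>\<^sup>+y. ?W ((1 - c) *\<^sub>R x + c *\<^sub>R y) * indicator D y * indicator D x \<partial>lborel)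
          \<le> (ennreal (2 ^ DIM('a)) * (\<integral>\<^sup>+y. ?W y * indicator D y \<partial>lborel)) * indicator D x"
          using nn_integral_contract[OF D _ c, of x ?W] by (cases "x \<in> D") auto
      qed
      also have "\<dots> = ?R" by (subst nn_integral_cmult_indicator) (auto simp: mult_ac)
      finally show ?thesis .
    qed note half = this
    show ?thesis
    proof (cases "t \<ge> 1 / 2")
      case True
      then show ?thesis using half[of t] t by simp
    next
      case False
      have "(\<integral>\<^sup>+x. (\<integral>\<^sup>+y. ?F x y t \<partial>lborel) \<partial>lborel) = (\<integral>\<^sup>+y. (\<integral>\<^sup>+x. ?F x y t \<partial>lborel) \<partial>lborel)"
        by (rule lborel_pair.Fubini'[symmetric]) measurable
      also have "\<dots> = (\<integral>\<^sup>+y. (\<integral>\<^sup>+x. ?W ((1 - (1 - t)) *\<^sub>R y + (1 - t) *\<^sub>R x) * indicator D x * indicator D y \<partial>lborel) \<partial>lborel)"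
        using t by (intro nn_integral_cong) (simp add: add.commute mult_ac)
      also have "\<dots> \<le> ?R" using t False by (intro half) auto
      finally show ?thesis using t by simp
    qed
  qed simp
  have "(\<integral>\<^sup>+x. (\<integral>\<^sup>+y. ennreal ((w x - w y)\<^sup>2) * indicator D y \<partial>lborel) * indicator D x \<partial>lborel)
      \<le> (\<integral>\<^sup>+x. (\<integral>\<^sup>+y. ennreal (d\<^sup>2) * (\<integral>\<^sup>+t. ?F x y t \<partial>lborel) \<partial>lborel) \<partial>lborel)"
  proof (rule nn_integral_mono)
    fix x :: 'a
    show "(\<integral>\<^sup>+y. ennreal ((w x - w y)\<^sup>2) * indicator D y \<partial>lborel) * indicator D x
        \<le> (\<integral>\<^sup>+y. ennreal (d\<^sup>2) * (\<integral>\<^sup>+t. ?F x y t \<partial>lborel) \<partial>lborel)"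
    proof (cases "x \<in> D")
      case x: True
      have "(\<integral>\<^sup>+y. ennreal ((w x - w y)\<^sup>2) * indicator D y \<partial>lborel) \<le> (\<integral>\<^sup>+y. ennreal (d\<^sup>2) * (\<integral>\<^sup>+t. ?F x y t \<partial>lborel) \<partial>lborel)"
      proof (rule nn_integral_mono)
        fix y
        show "ennreal ((w x - w y)\<^sup>2) * indicator D y \<le> ennreal (d\<^sup>2) * (\<integral>\<^sup>+t. ?F x y t \<partial>lborel)"
          using increment_square_le[OF w W d[OF x], of y] x by (cases "y \<in> D") auto
      qed
      then show ?thesis using x by simp
    qed simp
  qed
  also have "\<dots> = ennreal (d\<^sup>2) * (\<integral>\<^sup>+x. (\<integral>\<^sup>+y. (\<integral>\<^sup>+t. ?F x y t \<partial>lborel) \<partial>lborel) \<partial>lborel)"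
    by (simp add: nn_integral_cmult)
  also have "(\<integral>\<^sup>+x. (\<integral>\<^sup>+y. (\<integral>\<^sup>+t. ?F x y t \<partial>lborel) \<partial>lborel) \<partial>lborel)
      = (\<integral>\<^sup>+x. (\<integral>\<^sup>+t. (\<integral>\<^sup>+y. ?F x y t \<partial>lborel) \<partial>lborel) \<partial>lborel)"
    by (intro nn_integral_cong lborel_pair.Fubini') measurable
  also have "\<dots> = (\<integral>\<^sup>+t. (\<integral>\<^sup>+x. (\<integral>\<^sup>+y. ?F x y t \<partial>lborel) \<partial>lborel) \<partial>lborel)"
    by (rule lborel_pair.Fubini') measurable
  also have "ennreal (d\<^sup>2) * \<dots> \<le> ennreal (d\<^sup>2) * ?R"
  proof (rule mult_left_mono)
    have "(\<integral>\<^sup>+t. (\<integral>\<^sup>+x. (\<integral>\<^sup>+y. ?F x y t \<partial>lborel) \<partial>lborel) \<partial>lborel) \<le> (\<integral>\<^sup>+t. ?R * indicator {0..1::real} t \<partial>lborel)"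
      by (intro nn_integral_mono J)
    also have "\<dots> = ?R" by (simp add: nn_integral_cmult)
    finally show "(\<integral>\<^sup>+t. (\<integral>\<^sup>+x. (\<integral>\<^sup>+y. ?F x y t \<partial>lborel) \<partial>lborel) \<partial>lborel) \<le> ?R" .
  qed simp
  finally show ?thesis by (simp add: ennreal_mult mult_ac)
qed

text \<open>The double integral of \<open>(w x - w y)\<^sup>2\<close> over \<open>D \<times> D\<close> is twice the left-hand side.\<close>

lemma Poincare_C1:
  fixes D :: "'a::euclidean_space set" and w :: "'a \<Rightarrow> real"
  assumes D: "convex D" "D \<in> sets borel" "bounded D" and d: "\<And>x y. x \<in> D \<Longrightarrow> y \<in> D \<Longrightarrow> norm (y - x) \<le> d"
    and w: "\<And>p. (w has_derivative (\<lambda>h. W p \<bullet> h)) (at p)" and W: "continuous_on UNIV W"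
  shows "measure lborel D * (\<integral>x. (w x)\<^sup>2 \<partial>lborel_on D) - (\<integral>x. w x \<partial>lborel_on D)\<^sup>2
    \<le> d\<^sup>2 * 2 ^ DIM('a) / 2 * (measure lborel D * (\<integral>x. (norm (W x))\<^sup>2 \<partial>lborel_on D))"
proof -
  have cw: "continuous_on UNIV w"
    using w by (meson continuous_at_imp_continuous_on has_derivative_continuous)
  note [measurable] = D(2) borel_measurable_continuous_onI[OF W] borel_measurable_continuous_onI[OF cw]
  have wL: "w \<in> L2 (lborel_on D)" and WL: "W \<in> L2 (lborel_on D)"
    by (intro continuous_L2 cw W D)+
  have fin: "emeasure lborel D < \<infinity>" using D by (intro emeasure_bounded_finite)
  define V where "V = measure lborel D"
  have V: "emeasure lborel D = ennreal V" "V \<ge> 0"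
    using fin by (simp_all add: V_def emeasure_eq_ennreal_measure less_top)
  define I where "I = (\<integral>x. w x \<partial>lborel_on D)"
  define Q where "Q = (\<integral>x. (w x)\<^sup>2 \<partial>lborel_on D)"
  define R where "R = (\<integral>x. (norm (W x))\<^sup>2 \<partial>lborel_on D)"
  have one: "(\<lambda>x. 1) \<in> L2 (lborel_on D)"
    using fin D(2) by (simp add: L2_def integrable_lborel_on)
  have i1: "integrable (lborel_on D) w"
    using L2_mult_integrable[OF wL one] by simp
  have i2: "integrable (lborel_on D) (\<lambda>x. (w x)\<^sup>2)"
    using L2_integrable_square[OF wL] by simp
  have ic: "integrable (lborel_on D) (\<lambda>x. c)" "(\<integral>x. c \<partial>lborel_on D) = V * c" for c :: real
    using fin D(2) by (auto simp: integrable_lborel_on V_def measure_restrict_space)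
  have mV: "measure (lborel_on D) D = V"
    using D(2) by (simp add: V_def measure_restrict_space)
  have "(\<integral>\<^sup>+y. ennreal ((w x - w y)\<^sup>2) * indicator D y \<partial>lborel) = ennreal (V * (w x)\<^sup>2 - 2 * w x * I + Q)" for x
  proof -
    have "(\<integral>\<^sup>+y. ennreal ((w x - w y)\<^sup>2) * indicator D y \<partial>lborel) = (\<integral>\<^sup>+y. ennreal ((w x - w y)\<^sup>2) \<partial>lborel_on D)"
      by (rule nn_integral_lborel_on[symmetric]) (rule D)
    also have "\<dots> = ennreal (\<integral>y. (w x - w y)\<^sup>2 \<partial>lborel_on D)"
    proof (rule nn_integral_eq_integral)
      show "integrable (lborel_on D) (\<lambda>y. (w x - w y)\<^sup>2)"
        using i1 i2 ic by (simp add: power2_diff mult.assoc)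
    qed simp
    also have "(\<integral>y. (w x - w y)\<^sup>2 \<partial>lborel_on D) = V * (w x)\<^sup>2 - 2 * w x * I + Q"
      using i1 i2 ic(1) mV D(2) by (simp add: power2_diff I_def Q_def)
    finally show ?thesis .
  qed note inner = this
  have pos: "V * (w x)\<^sup>2 - 2 * w x * I + Q \<ge> 0" for x
  proof -
    have "V * (w x)\<^sup>2 - 2 * w x * I + Q = (\<integral>y. (w x - w y)\<^sup>2 \<partial>lborel_on D)"
      using i1 i2 ic(1) mV D(2) by (simp add: power2_diff I_def Q_def)
    then show ?thesis by simp
  qed
  have "(\<integral>\<^sup>+x. (\<integral>\<^sup>+y. ennreal ((w x - w y)\<^sup>2) * indicator D y \<partial>lborel) * indicator D x \<partial>lborel)
      = (\<integral>\<^sup>+x. ennreal (V * (w x)\<^sup>2 - 2 * w x * I + Q) \<partial>lborel_on D)"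
    unfolding inner by (rule nn_integral_lborel_on[symmetric]) (rule D)
  also have "\<dots> = ennreal (\<integral>x. V * (w x)\<^sup>2 - 2 * w x * I + Q \<partial>lborel_on D)"
    using i1 i2 ic pos by (intro nn_integral_eq_integral) auto
  also have "(\<integral>x. V * (w x)\<^sup>2 - 2 * w x * I + Q \<partial>lborel_on D) = 2 * (V * Q - I\<^sup>2)"
    using i1 i2 ic(1) mV D(2) by (simp add: I_def[symmetric] Q_def[symmetric]) (simp add: power2_eq_square algebra_simps)
  finally have "ennreal (2 * (V * Q - I\<^sup>2)) \<le> ennreal (d\<^sup>2 * 2 ^ DIM('a)) * (emeasure lborel D * (\<integral>\<^sup>+y. ennreal ((norm (W y))\<^sup>2) * indicator D y \<partial>lborel))"
    using double_integral_increment_le[OF D(1,2) d w W] by simp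
  also have "(\<integral>\<^sup>+y. ennreal ((norm (W y))\<^sup>2) * indicator D y \<partial>lborel) = ennreal R"
    using nn_integral_eq_integral[OF L2_integrable_square[OF WL]]
    by (simp add: nn_integral_lborel_on[OF D(2)] R_def)
  also have "ennreal (d\<^sup>2 * 2 ^ DIM('a)) * (emeasure lborel D * ennreal R) = ennreal (d\<^sup>2 * 2 ^ DIM('a) * (V * R))"
    using V by (simp add: R_def ennreal_mult)
  finally have "2 * (V * Q - I\<^sup>2) \<le> d\<^sup>2 * 2 ^ DIM('a) * (V * R)"
    by (subst (asm) ennreal_le_iff) (auto intro!: mult_nonneg_nonneg V simp: R_def)
  then show ?thesis by (simp add: V_def I_def Q_def R_def)
qed

lemma H1_smooth_approx_seq:
  fixes B :: "'a::euclidean_space set"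
  assumes B: "open B" "convex B" "bounded B" "B \<noteq> {}" and u: "u \<in> L2 (lborel_on B)"
    and G: "G \<in> L2 (lborel_on B)" and w: "has_weak_gradient B u G"
  obtains z Z where "\<And>n p. (z n has_derivative (\<lambda>h. Z n p \<bullet> h)) (at p)" "\<And>n. continuous_on UNIV (Z n)"
    "\<And>n. z n \<in> L2 (lborel_on B)" "\<And>n. Z n \<in> L2 (lborel_on B)"
    "(\<lambda>n. L2_norm (lborel_on B) (\<lambda>x. z n x - u x)) \<longlonglongrightarrow> 0"
    "(\<lambda>n. L2_norm (lborel_on B) (\<lambda>x. Z n x - G x)) \<longlonglongrightarrow> 0"
proof -
  define Q where "Q n z Z \<longleftrightarrow> (\<forall>p. (z has_derivative (\<lambda>h. Z p \<bullet> h)) (at p)) \<and> continuous_on UNIV Z \<and>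
    L2_norm (lborel_on B) (\<lambda>x. z x - u x) < 1 / real (Suc n) \<and> L2_norm (lborel_on B) (\<lambda>x. Z x - G x) < 1 / real (Suc n)" for n z Z
  have "\<exists>z Z. Q n z Z" for n
    unfolding Q_def
  proof (rule H1_smooth_approx[OF assms, of "1 / real (Suc n)"])
    show "1 / real (Suc n) > 0" by simp
  qed blast
  then obtain z Z where "\<And>n. Q n (z n) (Z n)" by metis
  then have z: "\<And>n p. (z n has_derivative (\<lambda>h. Z n p \<bullet> h)) (at p)" "\<And>n. continuous_on UNIV (Z n)"
    and l: "\<And>n. L2_norm (lborel_on B) (\<lambda>x. z n x - u x) < 1 / real (Suc n)"
       "\<And>n. L2_norm (lborel_on B) (\<lambda>x. Z n x - G x) < 1 / real (Suc n)"
    by (auto simp: Q_def)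
  have lim: "(\<lambda>n. 1 / real (Suc n)) \<longlonglongrightarrow> 0" by (rule LIMSEQ_Suc[OF lim_1_over_n])
  have cz: "continuous_on UNIV (z n)" for n
    using z(1) by (meson continuous_at_imp_continuous_on has_derivative_continuous)
  show ?thesis
  proof (rule that[OF z])
    show "z n \<in> L2 (lborel_on B)" "Z n \<in> L2 (lborel_on B)" for n
      using B by (auto intro!: continuous_L2 cz z)
    show "(\<lambda>n. L2_norm (lborel_on B) (\<lambda>x. z n x - u x)) \<longlonglongrightarrow> 0"
      by (rule Lim_null_comparison[OF _ lim]) (use l(1) in \<open>auto intro!: always_eventually less_imp_le\<close>)
    show "(\<lambda>n. L2_norm (lborel_on B) (\<lambda>x. Z n x - G x)) \<longlonglongrightarrow> 0"
      by (rule Lim_null_comparison[OF _ lim]) (use l(2) in \<open>auto intro!: always_eventually less_imp_le\<close>)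
  qed
qed

lemma Poincare_H1:
  fixes B :: "'a::euclidean_space set"
  assumes B: "open B" "convex B" "bounded B" "B \<noteq> {}" and d: "\<And>x y. x \<in> B \<Longrightarrow> y \<in> B \<Longrightarrow> norm (y - x) \<le> d"
    and u: "u \<in> L2 (lborel_on B)" and G: "G \<in> L2 (lborel_on B)" and w: "has_weak_gradient B u G"
    and 0: "(\<integral>x. u x \<partial>lborel_on B) = 0"
  shows "(L2_norm (lborel_on B) u)\<^sup>2 \<le> d\<^sup>2 * 2 ^ DIM('a) / 2 * (L2_norm (lborel_on B) G)\<^sup>2"
proof -
  have Bb: "B \<in> sets borel" using B by simp
  obtain z Z where z: "\<And>n p. (z n has_derivative (\<lambda>h. Z n p \<bullet> h)) (at p)" "\<And>n. continuous_on UNIV (Z n)"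
    "\<And>n. z n \<in> L2 (lborel_on B)" "\<And>n. Z n \<in> L2 (lborel_on B)"
    "(\<lambda>n. L2_norm (lborel_on B) (\<lambda>x. z n x - u x)) \<longlonglongrightarrow> 0"
    "(\<lambda>n. L2_norm (lborel_on B) (\<lambda>x. Z n x - G x)) \<longlonglongrightarrow> 0"
    using H1_smooth_approx_seq[OF B u G w] by blast
  define V where "V = measure lborel B"
  have fin: "emeasure lborel B < \<infinity>" using B by (intro emeasure_bounded_finite)
  have "V \<noteq> 0"
  proof
    assume "V = 0"
    then have "emeasure lborel B = 0"
      using fin by (simp add: V_def emeasure_eq_ennreal_measure less_top)
    then have "negligible B" using B by (simp add: negligible_iff_emeasure0 emeasure_completion)
    then show False using open_not_negligible[OF B(1,4)] by simp
  qed
  then have V: "V > 0" by (simp add: V_def less_le)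
  have one: "(\<lambda>x. 1::real) \<in> L2 (lborel_on B)"
    using fin Bb by (simp add: L2_def integrable_lborel_on)
  have l1: "(\<lambda>n. V * (L2_norm (lborel_on B) (z n))\<^sup>2 - (L2_inner (lborel_on B) (z n) (\<lambda>x. 1))\<^sup>2) \<longlonglongrightarrow>
      V * (L2_norm (lborel_on B) u)\<^sup>2 - (L2_inner (lborel_on B) u (\<lambda>x. 1))\<^sup>2"
    by (intro tendsto_intros L2_norm_tendsto L2_inner_tendsto z u one)
  have l2: "(\<lambda>n. d\<^sup>2 * 2 ^ DIM('a) / 2 * (V * (L2_norm (lborel_on B) (Z n))\<^sup>2)) \<longlonglongrightarrow>
      d\<^sup>2 * 2 ^ DIM('a) / 2 * (V * (L2_norm (lborel_on B) G)\<^sup>2)"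
    by (intro tendsto_intros L2_norm_tendsto z G)
  have "V * (L2_norm (lborel_on B) (z n))\<^sup>2 - (L2_inner (lborel_on B) (z n) (\<lambda>x. 1))\<^sup>2
      \<le> d\<^sup>2 * 2 ^ DIM('a) / 2 * (V * (L2_norm (lborel_on B) (Z n))\<^sup>2)" for n
    using Poincare_C1[OF B(2) Bb B(3) d z(1,2)] by (simp add: L2_norm_square L2_inner_def V_def)
  then have "V * (L2_norm (lborel_on B) u)\<^sup>2 - (L2_inner (lborel_on B) u (\<lambda>x. 1))\<^sup>2
     \<le> d\<^sup>2 * 2 ^ DIM('a) / 2 * (V * (L2_norm (lborel_on B) G)\<^sup>2)"
    using LIMSEQ_le[OF l1 l2] by blast
  then have "V * (L2_norm (lborel_on B) u)\<^sup>2 \<le> V * (d\<^sup>2 * 2 ^ DIM('a) / 2 * (L2_norm (lborel_on B) G)\<^sup>2)"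
    using 0 by (simp add: L2_inner_def mult_ac)
  then show ?thesis using V by (simp only: mult_le_cancel_left_pos)
qed

section \<open>Slices of a convex domain\<close>

lemma nn_integral_lborel_pair:
  fixes f :: "'a::euclidean_space \<times> 'b::euclidean_space \<Rightarrow> ennreal"
  assumes "f \<in> borel_measurable borel"
  shows "(\<integral>\<^sup>+p. f p \<partial>lborel) = (\<integral>\<^sup>+x. (\<integral>\<^sup>+y. f (x, y) \<partial>lborel) \<partial>lborel)"
  using lborel.nn_integral_fst[of f lborel] assms by (simp add: lborel_prod)

lemma integral_lborel_pair:
  fixes f :: "'a::euclidean_space \<times> 'b::euclidean_space \<Rightarrow> real"
  assumes "integrable lborel f"
  shows "(\<integral>p. f p \<partial>lborel) = (\<integral>x. (\<integral>y. f (x, y) \<partial>lborel) \<partial>lborel)"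
    and "(\<integral>p. f p \<partial>lborel) = (\<integral>y. (\<integral>x. f (x, y) \<partial>lborel) \<partial>lborel)"
    and "AE x in lborel. integrable lborel (\<lambda>y. f (x, y))"
proof -
  have f: "integrable (lborel \<Otimes>\<^sub>M lborel) f" using assms by (simp add: lborel_prod)
  have f': "integrable (lborel \<Otimes>\<^sub>M lborel) (\<lambda>(x, y). f (x, y))" using f by simp
  show "(\<integral>p. f p \<partial>lborel) = (\<integral>x. (\<integral>y. f (x, y) \<partial>lborel) \<partial>lborel)"
    using lborel_pair.integral_fst'[OF f] by (simp add: lborel_prod)
  then show "(\<integral>p. f p \<partial>lborel) = (\<integral>y. (\<integral>x. f (x, y) \<partial>lborel) \<partial>lborel)"
    using lborel_pair.Fubini_integral[OF f'] by simp
  show "AE x in lborel. integrable lborel (\<lambda>y. f (x, y))"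
    by (rule lborel_pair.AE_integrable_fst'[OF f])
qed

lemma pd_slice1:
  assumes "f differentiable (at (x, y))"
  shows "((\<lambda>x. f (x, y)) has_derivative (\<lambda>h. pd f (h, 0) (x, y))) (at x)"
proof -
  have "((\<lambda>x. (x, y)) has_derivative (\<lambda>h. (h, 0))) (at x)"
    by (auto intro!: derivative_eq_intros)
  from has_derivative_compose[OF this has_derivative_pd[OF assms]] show ?thesis .
qed

lemma pd_slice2:
  assumes "f differentiable (at (x, y))"
  shows "((\<lambda>y. f (x, y)) has_derivative (\<lambda>h. pd f (0, h) (x, y))) (at y)"
proof -
  have "((\<lambda>y. (x, y)) has_derivative (\<lambda>h. (0, h))) (at y)"
    by (auto intro!: derivative_eq_intros)
  from has_derivative_compose[OF this has_derivative_pd[OF assms]] show ?thesis .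
qed

lemma C_k_slice1: "C_k k f \<Longrightarrow> C_k k (\<lambda>x. f (x, y))"
  for f :: "'a::euclidean_space \<times> 'b::euclidean_space \<Rightarrow> real"
proof (induction k arbitrary: f)
  case 0
  then show ?case by (auto intro!: continuous_on_compose2[of UNIV f] continuous_intros)
next
  case (Suc k)
  have d: "((\<lambda>x. f (x, y)) has_derivative (\<lambda>h. pd f (h, 0) (x, y))) (at x)" for x
    by (rule pd_slice1) (use Suc.prems in simp)
  have "C_k k (\<lambda>x. pd f (i, 0) (x, y))" if "i \<in> Basis" for i
    by (rule Suc.IH) (use Suc.prems that in \<open>auto simp: Basis_prod_def\<close>)
  moreover have "(\<lambda>x. f (x, y)) differentiable (at x)" for x
    using d unfolding differentiable_def by blast
  ultimately show ?case by (simp add: pd_eqI[OF d])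
qed

lemma C_k_slice2: "C_k k f \<Longrightarrow> C_k k (\<lambda>y. f (x, y))"
  for f :: "'a::euclidean_space \<times> 'b::euclidean_space \<Rightarrow> real"
proof (induction k arbitrary: f)
  case 0
  then show ?case by (auto intro!: continuous_on_compose2[of UNIV f] continuous_intros)
next
  case (Suc k)
  have d: "((\<lambda>y. f (x, y)) has_derivative (\<lambda>h. pd f (0, h) (x, y))) (at y)" for y
    by (rule pd_slice2) (use Suc.prems in simp)
  have "C_k k (\<lambda>y. pd f (0, i) (x, y))" if "i \<in> Basis" for i
    by (rule Suc.IH) (use Suc.prems that in \<open>auto simp: Basis_prod_def\<close>)
  moreover have "(\<lambda>y. f (x, y)) differentiable (at y)" for y
    using d unfolding differentiable_def by blast
  ultimately show ?case by (simp add: pd_eqI[OF d])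
qed

lemma test_function_slice1:
  fixes \<phi> :: "'a::euclidean_space \<times> 'b::euclidean_space \<Rightarrow> real"
  assumes \<phi>: "\<phi> \<in> test_functions U" and U: "U \<subseteq> A \<times> UNIV"
  shows "(\<lambda>x. \<phi> (x, y)) \<in> test_functions A"
proof -
  let ?K = "closure {p. \<phi> p \<noteq> 0}"
  let ?S = "{x. (x, y) \<in> ?K}"
  have "closed ((\<lambda>x. (x, y)) -` ?K)"
    by (intro closed_vimage continuous_intros) auto
  then have cS: "closed ?S" by (simp add: vimage_def)
  have "bounded (fst ` ?K)"
    using test_functionsD(5)[OF \<phi>] by (intro compact_imp_bounded compact_continuous_image continuous_intros)
  then have bS: "bounded ?S" by (rule bounded_subset) force
  have sub: "closure {x. \<phi> (x, y) \<noteq> 0} \<subseteq> ?S"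
    by (rule closure_minimal[OF _ cS]) (use closure_subset[of "{p. \<phi> p \<noteq> 0}"] in auto)
  have "?S \<subseteq> A" using test_functionsD(6)[OF \<phi>] U by auto
  moreover have "compact (closure {x. \<phi> (x, y) \<noteq> 0})"
    using sub bS by (auto simp: compact_eq_bounded_closed intro: bounded_subset)
  ultimately show ?thesis
    using sub C_k_slice1[OF test_functionsD(1)[OF \<phi>]] by (auto simp: test_functions_def)
qed

lemma test_function_slice2:
  fixes \<phi> :: "'a::euclidean_space \<times> 'b::euclidean_space \<Rightarrow> real"
  assumes \<phi>: "\<phi> \<in> test_functions U"
  shows "(\<lambda>y. \<phi> (x, y)) \<in> test_functions UNIV"
proof -
  let ?K = "closure {p. \<phi> p \<noteq> 0}"
  have "bounded (snd ` ?K)"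
    using test_functionsD(5)[OF \<phi>] by (intro compact_imp_bounded compact_continuous_image continuous_intros)
  then have "bounded {y. \<phi> (x, y) \<noteq> 0}"
    by (rule bounded_subset) (use closure_subset[of "{p. \<phi> p \<noteq> 0}"] in force)
  then show ?thesis
    using C_k_slice2[OF test_functionsD(1)[OF \<phi>]] by (auto simp: test_functions_def)
qed

text \<open>
  The geometric situation of the theorem, with any Euclidean space for the fibres. Convexity is used through
  the two end points: scaling towards \<open>(0, 0)\<close> or \<open>(1, 0)\<close> maps every slice into the slices nearer to
  that end.
\<close>

locale slab =
  fixes \<Omega> :: "(real \<times> 'b::euclidean_space) set" and \<epsilon> :: real
  assumes open_\<Omega>: "open \<Omega>" and convex_\<Omega>: "convex \<Omega>" and bounded_\<Omega>: "bounded \<Omega>"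
    and nonempty: "\<Omega> \<noteq> {}"
    and left_end: "(0, 0) \<in> closure \<Omega>" and right_end: "(1, 0) \<in> closure \<Omega>"
    and sub: "\<Omega> \<subseteq> {0<..<1} \<times> ball 0 \<epsilon>" and \<epsilon>_pos: "\<epsilon> > 0"
begin

abbreviation h :: "real \<Rightarrow> real" where "h \<equiv> slice_vol \<Omega>"
abbreviation \<rho> :: "real \<Rightarrow> real" where "\<rho> x \<equiv> min x (1 - x)"

lemma \<Omega>_borel[measurable]: "\<Omega> \<in> sets borel"
  using open_\<Omega> by simp

lemma towards_closure_point:
  assumes "p \<in> \<Omega>" "q \<in> closure \<Omega>" "0 < e" "e \<le> 1"
  shows "(1 - e) *\<^sub>R q + e *\<^sub>R p \<in> \<Omega>"
proof -
  have "q - e *\<^sub>R (q - p) \<in> interior \<Omega>"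
    using assms by (intro mem_interior_closure_convex_shrink convex_\<Omega>) (auto simp: interior_open open_\<Omega>)
  then show ?thesis using interior_subset by (auto simp: algebra_simps)
qed

lemma towards_left: "(x, y) \<in> \<Omega> \<Longrightarrow> 0 < e \<Longrightarrow> e \<le> 1 \<Longrightarrow> (e * x, e *\<^sub>R y) \<in> \<Omega>"
  using towards_closure_point[OF _ left_end, of "(x, y)" e] by simp

lemma towards_right: "(x, y) \<in> \<Omega> \<Longrightarrow> 0 < e \<Longrightarrow> e \<le> 1 \<Longrightarrow> (1 - e * (1 - x), e *\<^sub>R y) \<in> \<Omega>"
  using towards_closure_point[OF _ right_end, of "(x, y)" e] by (simp add: algebra_simps)

text \<open>The segment between the two end points lies in the closure, so each slice is star-shaped about zero.\<close>

lemma towards_axis: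
  assumes "(x, y) \<in> \<Omega>" "0 < e" "e \<le> 1"
  shows "(x, e *\<^sub>R y) \<in> \<Omega>"
proof -
  have x: "0 < x" "x < 1" using assms(1) sub by auto
  have "(1 - x) *\<^sub>R (0, 0) + x *\<^sub>R (1, 0) \<in> closure \<Omega>"
    using x by (intro convexD convex_closure convex_\<Omega> left_end right_end) auto
  then have "(x, 0) \<in> closure \<Omega>" by simp
  from towards_closure_point[OF assms(1) this assms(2,3)] show ?thesis by (simp flip: scaleR_add_left distrib_right)
qed

lemma slice_props:
  shows slice_open: "open (slice \<Omega> x)" and slice_convex: "convex (slice \<Omega> x)"
    and slice_sub: "slice \<Omega> x \<subseteq> ball 0 \<epsilon>" and slice_bounded: "bounded (slice \<Omega> x)"
    and slice_borel[measurable]: "slice \<Omega> x \<in> sets borel"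
    and slice_outside: "x \<notin> {0<..<1} \<Longrightarrow> slice \<Omega> x = {}"
proof -
  have "open (Pair x -` \<Omega>)"
    by (intro open_vimage open_\<Omega> continuous_intros)
  then show o: "open (slice \<Omega> x)" by (simp add: slice_def vimage_def)
  then show "slice \<Omega> x \<in> sets borel" by simp
  show "convex (slice \<Omega> x)"
  proof (rule convexI)
    fix y z u v assume *: "y \<in> slice \<Omega> x" "z \<in> slice \<Omega> x" "0 \<le> u" "0 \<le> v" "u + v = (1::real)"
    have "u *\<^sub>R (x, y) + v *\<^sub>R (x, z) \<in> \<Omega>"
      using * by (intro convexD[OF convex_\<Omega>]) (auto simp: slice_def)
    then show "u *\<^sub>R y + v *\<^sub>R z \<in> slice \<Omega> x"
      using *(5) by (simp add: slice_def flip: distrib_right)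
  qed
  show s: "slice \<Omega> x \<subseteq> ball 0 \<epsilon>" using sub by (auto simp: slice_def)
  then show "bounded (slice \<Omega> x)" by (rule bounded_subset[rotated]) simp
  show "x \<notin> {0<..<1} \<Longrightarrow> slice \<Omega> x = {}" using sub by (auto simp: slice_def)
qed

lemma slice_nonempty:
  assumes "0 < x" "x < 1"
  shows "slice \<Omega> x \<noteq> {}"
proof -
  obtain a b where ab: "(a, b) \<in> \<Omega>" using nonempty by auto
  then have a: "0 < a" "a < 1" using sub by auto
  show ?thesis
  proof (cases "x \<le> a")
    case True
    have "(x / a * a, (x / a) *\<^sub>R b) \<in> \<Omega>"
      by (rule towards_left[OF ab]) (use assms a True in auto)
    then show ?thesis using a by (auto simp: slice_def)
  next
    case False
    have "(1 - (1 - x) / (1 - a) * (1 - a), ((1 - x) / (1 - a)) *\<^sub>R b) \<in> \<Omega>"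
      by (rule towards_right[OF ab]) (use assms a False in auto)
    then show ?thesis using a by (auto simp: slice_def)
  qed
qed

lemma emeasure_slice: "emeasure lborel (slice \<Omega> x) = ennreal (h x)"
  unfolding slice_vol_def using emeasure_bounded_finite[OF slice_bounded]
  by (simp add: emeasure_eq_ennreal_measure less_top)

lemma h_nonneg[simp]: "h x \<ge> 0"
  by (simp add: slice_vol_def)

lemma h_outside: "x \<notin> {0<..<1} \<Longrightarrow> h x = 0"
  by (simp add: slice_vol_def slice_outside)

lemma h_pos:
  assumes "0 < x" "x < 1"
  shows "h x > 0"
proof -
  have "h x \<noteq> 0"
  proof
    assume "h x = 0"
    then have "negligible (slice \<Omega> x)"
      using emeasure_slice[of x] slice_open[of x] by (simp add: negligible_iff_emeasure0 emeasure_completion)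
    then show False using open_not_negligible[OF slice_open slice_nonempty[OF assms]] by simp
  qed
  then show ?thesis using h_nonneg[of x] by linarith
qed

lemma h_measurable[measurable]: "h \<in> borel_measurable borel"
proof -
  have "(\<lambda>x. emeasure lborel (Pair x -` \<Omega>)) \<in> borel_measurable (lborel :: real measure)"
    by (rule lborel.measurable_emeasure_Pair) (simp only: lborel_prod sets_lborel \<Omega>_borel)
  then have "(\<lambda>x. enn2real (emeasure lborel (slice \<Omega> x))) \<in> borel_measurable borel"
    by (simp add: slice_def vimage_def)
  then show ?thesis by (simp add: emeasure_slice)
qed

lemma slice_indicator: "indicator (slice \<Omega> x) y = indicator \<Omega> (x, y)"
  by (simp add: slice_def indicator_def)

text \<open>Scaling a slice by \<open>e\<close> multiplies its volume by \<open>e\<close> to the power \<open>m\<close>, the dimension of the fibres.\<close>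

lemma h_scale:
  assumes "0 < e" and incl: "\<And>y. y \<in> slice \<Omega> s \<Longrightarrow> e *\<^sub>R y \<in> slice \<Omega> t"
  shows "e ^ DIM('b) * h s \<le> h t"
proof -
  have "ennreal (h t) = (\<integral>\<^sup>+y. indicator (slice \<Omega> t) y \<partial>lborel)"
    by (simp add: emeasure_slice)
  also have "\<dots> = ennreal (\<bar>e\<bar> ^ DIM('b)) * (\<integral>\<^sup>+y. indicator (slice \<Omega> t) (0 + e *\<^sub>R y) \<partial>lborel)"
    using assms(1) by (intro nn_integral_affine) auto
  also have "\<dots> \<ge> ennreal (\<bar>e\<bar> ^ DIM('b)) * (\<integral>\<^sup>+y. indicator (slice \<Omega> s) y \<partial>lborel)"
    using incl by (intro mult_left_mono nn_integral_mono) (auto split: split_indicator)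
  also have "(\<integral>\<^sup>+y. indicator (slice \<Omega> s) y \<partial>lborel) = ennreal (h s)"
    by (simp add: emeasure_slice)
  finally have "ennreal (e ^ DIM('b) * h s) \<le> ennreal (h t)"
    using assms(1) by (simp add: ennreal_mult)
  then show ?thesis by simp
qed

lemma h_scale_right: "0 < s \<Longrightarrow> s \<le> t \<Longrightarrow> t < 1 \<Longrightarrow> ((1 - t) / (1 - s)) ^ DIM('b) * h s \<le> h t"
proof (rule h_scale)
  fix y assume *: "0 < s" "s \<le> t" "t < 1" "y \<in> slice \<Omega> s"
  have "(1 - (1 - t) / (1 - s) * (1 - s), ((1 - t) / (1 - s)) *\<^sub>R y) \<in> \<Omega>"
    by (rule towards_right) (use * in \<open>auto simp: slice_def\<close>)
  then show "((1 - t) / (1 - s)) *\<^sub>R y \<in> slice \<Omega> t" using * by (simp add: slice_def)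
qed auto

lemma h_scale_left: "0 < t \<Longrightarrow> t \<le> s \<Longrightarrow> s < 1 \<Longrightarrow> (t / s) ^ DIM('b) * h s \<le> h t"
proof (rule h_scale)
  fix y assume *: "0 < t" "t \<le> s" "s < 1" "y \<in> slice \<Omega> s"
  have "(t / s * s, (t / s) *\<^sub>R y) \<in> \<Omega>"
    by (rule towards_left) (use * in \<open>auto simp: slice_def\<close>)
  then show "(t / s) *\<^sub>R y \<in> slice \<Omega> t" using * by (simp add: slice_def)
qed auto

text \<open>So \<open>h\<close> is bounded below on compact subsets of the unit interval, as weak solutions require.\<close>

lemma h_lower:
  assumes "0 < x" "x < 1"
  shows "\<rho> x ^ DIM('b) * h (1 / 2) \<le> h x"
proof (cases "x \<le> 1 / 2")
  case True
  have "\<rho> x ^ DIM('b) * h (1 / 2) \<le> (x / (1 / 2)) ^ DIM('b) * h (1 / 2)"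
    using assms by (intro mult_right_mono power_mono) auto
  also have "\<dots> \<le> h x" using assms True by (intro h_scale_left) auto
  finally show ?thesis .
next
  case False
  have "\<rho> x ^ DIM('b) * h (1 / 2) \<le> ((1 - x) / (1 - 1 / 2)) ^ DIM('b) * h (1 / 2)"
    using assms by (intro mult_right_mono power_mono) auto
  also have "\<dots> \<le> h x" using assms False by (intro h_scale_right) auto
  finally show ?thesis .
qed

lemma nn_integral_\<Omega>:
  fixes f :: "real \<times> 'b \<Rightarrow> ennreal"
  assumes "(\<lambda>p. f p * indicator \<Omega> p) \<in> borel_measurable borel"
  shows "(\<integral>\<^sup>+p. f p \<partial>lborel_on \<Omega>) = (\<integral>\<^sup>+x. (\<integral>\<^sup>+y. f (x, y) * indicator (slice \<Omega> x) y \<partial>lborel) \<partial>lborel)"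
  unfolding nn_integral_lborel_on[OF \<Omega>_borel] nn_integral_lborel_pair[OF assms] slice_indicator ..

lemma nn_integral_h: "(\<integral>\<^sup>+x. ennreal (h x) \<partial>lborel_on {0<..<1}) = emeasure lborel \<Omega>"
proof -
  have "emeasure lborel \<Omega> = (\<integral>\<^sup>+p. 1 \<partial>lborel_on \<Omega>)"
    by (simp add: emeasure_restrict_space)
  also have "\<dots> = (\<integral>\<^sup>+x. ennreal (h x) \<partial>lborel)"
    by (subst nn_integral_\<Omega>) (auto simp: emeasure_slice)
  also have "\<dots> = (\<integral>\<^sup>+x. ennreal (h x) \<partial>lborel_on {0<..<1})"
    unfolding nn_integral_lborel_on[OF borel_open[OF open_greaterThanLessThan]]
    by (intro nn_integral_cong) (auto simp: h_outside split: split_indicator)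
  finally show ?thesis by simp
qed

sublocale N: weighted_domain "{0<..<1::real}" h
proof
  show "open {0<..<1::real}" by simp
  show "h \<in> borel_measurable (lborel_on {0<..<1})" by (intro measurable_restrict_space1) simp
  show "\<And>x. x \<in> {0<..<1} \<Longrightarrow> 0 < h x" using h_pos by simp
  show "(\<integral>\<^sup>+x. ennreal (h x) \<partial>lborel_on {0<..<1}) < \<infinity>"
    unfolding nn_integral_h using emeasure_bounded_finite[OF bounded_\<Omega>] by simp
  fix K :: "real set" assume K: "compact K" "K \<subseteq> {0<..<1}"
  show "\<exists>c>0. \<forall>x\<in>K. c \<le> h x"
  proof (cases "K = {}")
    case False
    have "continuous_on K \<rho>" by (intro continuous_intros)
    then obtain x0 where x0: "x0 \<in> K" "\<And>x. x \<in> K \<Longrightarrow> \<rho> x0 \<le> \<rho> x"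
      using continuous_attains_inf[OF K(1) False] by blast
    have p: "\<rho> x0 > 0" using x0(1) K(2) by auto
    have "\<rho> x0 ^ DIM('b) * h (1 / 2) \<le> h x" if "x \<in> K" for x
    proof -
      have "\<rho> x0 ^ DIM('b) * h (1 / 2) \<le> \<rho> x ^ DIM('b) * h (1 / 2)"
        using p x0(2)[OF that] by (intro mult_right_mono power_mono) auto
      also have "\<dots> \<le> h x" using that K(2) by (intro h_lower) auto
      finally show ?thesis .
    qed
    moreover have "\<rho> x0 ^ DIM('b) * h (1 / 2) > 0" using p h_pos[of "1 / 2"] by simp
    ultimately show ?thesis by blast
  qed (auto intro: exI[of _ 1])
qed

sublocale O: weighted_domain \<Omega> "\<lambda>_. 1"
proof
  show "(\<integral>\<^sup>+x. ennreal 1 \<partial>lborel_on \<Omega>) < \<infinity>"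
    using emeasure_bounded_finite[OF bounded_\<Omega>] by (simp add: emeasure_restrict_space)
qed (auto intro: open_\<Omega> exI[of _ 1])

lemma O_M: "O.M = lborel_on \<Omega>"
  unfolding O.M_def by (simp add: density_1)

lemma N_M: "N.M = weighted \<Omega>"
  by (simp add: N.M_def weighted_def)

lemma H1_eq: "H1 \<Omega> = O.sob"
  by (auto simp: H1_def O.sob_iff O_M)

lemma V_h_eq: "V_h \<Omega> = N.sob"
proof -
  have "(\<integral>\<^sup>+x. ennreal (\<bar>v x\<bar>\<^sup>2 + \<bar>weak_grad {0<..<1} v x\<bar>\<^sup>2) \<partial>weighted \<Omega>) < \<infinity> \<longleftrightarrow>
      v \<in> L2 (weighted \<Omega>) \<and> weak_grad {0<..<1} v \<in> L2 (weighted \<Omega>)" if v: "v \<in> W12_loc {0<..<1}" for v :: "real \<Rightarrow> real"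
  proof -
    have m: "v \<in> borel_measurable (weighted \<Omega>)" "weak_grad {0<..<1} v \<in> borel_measurable (weighted \<Omega>)"
      using L2_locD(2)[OF weak_grad_works(1)[OF v]] v L2_locD(2)[of v "{0<..<1}"] N.measurable_M
      unfolding N_M[symmetric] W12_loc_def by auto
    have "(\<integral>\<^sup>+x. ennreal (\<bar>v x\<bar>\<^sup>2 + \<bar>weak_grad {0<..<1} v x\<bar>\<^sup>2) \<partial>weighted \<Omega>)
      = (\<integral>\<^sup>+x. ennreal ((norm (v x))\<^sup>2) \<partial>weighted \<Omega>) + (\<integral>\<^sup>+x. ennreal ((norm (weak_grad {0<..<1} v x))\<^sup>2) \<partial>weighted \<Omega>)"
      using m by (simp add: nn_integral_add)
    then show ?thesis using m by (auto simp: L2_iff_nn)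
  qed
  then show ?thesis by (auto simp: V_h_def N.sob_def N_M)
qed

section \<open>Functions of the first coordinate\<close>

lemma coord_measurable:
  fixes f :: "real \<Rightarrow> 'c::euclidean_space"
  assumes "f \<in> borel_measurable (lborel_on {0<..<1})"
  shows "(\<lambda>p. f (fst p)) \<in> borel_measurable (lborel_on \<Omega>)"
proof -
  have [measurable]: "(\<lambda>x. indicator {0<..<1} x *\<^sub>R f x) \<in> borel_measurable borel"
    using assms by (subst (asm) borel_measurable_lborel_on_iff) auto
  have fst_m: "fst \<in> borel_measurable (borel :: (real \<times> 'b) measure)"
    by (intro borel_measurable_continuous_onI continuous_intros)
  have [measurable]: "(\<lambda>p::real \<times> 'b. indicator {0<..<1} (fst p) *\<^sub>R f (fst p)) \<in> borel_measurable borel"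
    by (rule measurable_compose[OF fst_m]) measurable
  have "(\<lambda>p. indicator \<Omega> p *\<^sub>R (indicator {0<..<1} (fst p) *\<^sub>R f (fst p))) \<in> borel_measurable borel"
    by measurable
  moreover have "(\<lambda>p. indicator \<Omega> p *\<^sub>R (indicator {0<..<1} (fst p) *\<^sub>R f (fst p))) = (\<lambda>p. indicator \<Omega> p *\<^sub>R f (fst p))"
    using sub by (auto simp: fun_eq_iff split: split_indicator)
  ultimately show ?thesis by (subst borel_measurable_lborel_on_iff) auto
qed

text \<open>\<open>J\<close> is an isometry, by Fubini; vector-valued functions are allowed in order to cover gradients.\<close>

lemma coord_L2:
  fixes f :: "real \<Rightarrow> 'c::euclidean_space"
  assumes f: "f \<in> L2 N.M"
  shows "(\<lambda>p. f (fst p)) \<in> L2 (lborel_on \<Omega>)" "L2_norm (lborel_on \<Omega>) (\<lambda>p. f (fst p)) = L2_norm N.M f"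
proof -
  have m: "f \<in> borel_measurable (lborel_on {0<..<1})" using f by (simp add: L2_def)
  note m' = coord_measurable[OF m]
  have I01: "{0<..<1::real} \<in> sets borel" by simp
  have [measurable]: "(\<lambda>x. indicator {0<..<1} x *\<^sub>R f x) \<in> borel_measurable borel"
    using m by (subst (asm) borel_measurable_lborel_on_iff) auto
  have fst_m: "fst \<in> borel_measurable (borel :: (real \<times> 'b) measure)"
    by (intro borel_measurable_continuous_onI continuous_intros)
  have [measurable]: "(\<lambda>p::real \<times> 'b. indicator {0<..<1} (fst p) *\<^sub>R f (fst p)) \<in> borel_measurable borel"
    by (rule measurable_compose[OF fst_m]) measurable
  have "(\<lambda>p. ennreal ((norm (indicator {0<..<1} (fst p) *\<^sub>R f (fst p)))\<^sup>2) * indicator \<Omega> p) \<in> borel_measurable borel"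
    by measurable
  moreover have "(\<lambda>p. ennreal ((norm (indicator {0<..<1} (fst p) *\<^sub>R f (fst p)))\<^sup>2) * indicator \<Omega> p)
      = (\<lambda>p. ennreal ((norm (f (fst p)))\<^sup>2) * indicator \<Omega> p)"
    using sub by (auto simp: fun_eq_iff split: split_indicator)
  ultimately have mm: "(\<lambda>p. ennreal ((norm (f (fst p)))\<^sup>2) * indicator \<Omega> p) \<in> borel_measurable borel" by simp
  have "(\<integral>\<^sup>+p. ennreal ((norm (f (fst p)))\<^sup>2) \<partial>lborel_on \<Omega>)
      = (\<integral>\<^sup>+x. (\<integral>\<^sup>+y. ennreal ((norm (f x))\<^sup>2) * indicator (slice \<Omega> x) y \<partial>lborel) \<partial>lborel)"
    by (subst nn_integral_\<Omega>[OF mm]) simp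
  also have "\<dots> = (\<integral>\<^sup>+x. ennreal (h x) * ennreal ((norm (f x))\<^sup>2) * indicator {0<..<1} x \<partial>lborel)"
    by (intro nn_integral_cong, subst nn_integral_cmult_indicator)
      (auto simp: emeasure_slice h_outside mult.commute split: split_indicator)
  also have "\<dots> = (\<integral>\<^sup>+x. ennreal (h x) * ennreal ((norm (f x))\<^sup>2) \<partial>lborel_on {0<..<1})"
    by (rule nn_integral_lborel_on[symmetric]) simp
  also have "\<dots> = (\<integral>\<^sup>+x. ennreal ((norm (f x))\<^sup>2) \<partial>N.M)"
    using m by (subst N.nn_integral_M) auto
  finally have eq: "(\<integral>\<^sup>+p. ennreal ((norm (f (fst p)))\<^sup>2) \<partial>lborel_on \<Omega>) = (\<integral>\<^sup>+x. ennreal ((norm (f x))\<^sup>2) \<partial>N.M)" .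
  then show L: "(\<lambda>p. f (fst p)) \<in> L2 (lborel_on \<Omega>)"
    using f m' by (simp add: L2_iff_nn)
  have "ennreal ((L2_norm (lborel_on \<Omega>) (\<lambda>p. f (fst p)))\<^sup>2) = ennreal ((L2_norm N.M f)\<^sup>2)"
    using eq by (simp add: L2_norm_nn L f)
  then show "L2_norm (lborel_on \<Omega>) (\<lambda>p. f (fst p)) = L2_norm N.M f" by simp
qed

lemma J_eq: "J v = (\<lambda>p. v (fst p))"
  by (auto simp: J_def fun_eq_iff)

lemma P_eq: "P \<Omega> g x = 1 / h x * (\<integral>y. indicator \<Omega> (x, y) * g (x, y) \<partial>lborel)"
  by (simp add: P_def integral_lborel_on slice_indicator)

lemma P_measurable:
  assumes "g \<in> borel_measurable (lborel_on \<Omega>)"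
  shows "P \<Omega> g \<in> borel_measurable borel"
proof -
  have [measurable]: "(\<lambda>p. indicator \<Omega> p *\<^sub>R g p) \<in> borel_measurable borel"
    using assms by (simp add: borel_measurable_lborel_on_iff)
  have "(\<lambda>x. \<integral>y. indicator \<Omega> (x, y) *\<^sub>R g (x, y) \<partial>lborel) \<in> borel_measurable borel"
    by measurable
  then show ?thesis unfolding P_eq[abs_def] by simp
qed

text \<open>The Cauchy--Schwarz inequality on a slice; integration over \<open>x\<close> then shows that \<open>P\<close> is a contraction.\<close>

lemma h_P_square_le:
  assumes "g \<in> borel_measurable (lborel_on \<Omega>)"
  shows "ennreal (h x) * ennreal ((P \<Omega> g x)\<^sup>2) \<le> (\<integral>\<^sup>+y. ennreal ((g (x, y))\<^sup>2) * indicator (slice \<Omega> x) y \<partial>lborel)"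
proof -
  have G[measurable]: "(\<lambda>p. indicator \<Omega> p *\<^sub>R g p) \<in> borel_measurable borel"
    using assms by (simp add: borel_measurable_lborel_on_iff)
  have [measurable]: "(\<lambda>y. indicator \<Omega> (x, y) * g (x, y)) \<in> borel_measurable borel"
    using measurable_compose[OF _ G, of "Pair x" borel] by simp
  let ?I = "\<integral>y. indicator \<Omega> (x, y) * g (x, y) \<partial>lborel"
  let ?R = "\<integral>\<^sup>+y. ennreal ((g (x, y))\<^sup>2) * indicator (slice \<Omega> x) y \<partial>lborel"
  show ?thesis
  proof (cases "x \<in> {0<..<1}")
    case True
    then have hx: "h x > 0" using h_pos by simp
    have "ennreal \<bar>?I\<bar> \<le> (\<integral>\<^sup>+y. ennreal \<bar>indicator \<Omega> (x, y) * g (x, y)\<bar> \<partial>lborel)"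
      using integral_norm_bound_ennreal[of lborel "\<lambda>y. indicator \<Omega> (x, y) * g (x, y)"]
      by (cases "integrable lborel (\<lambda>y. indicator \<Omega> (x, y) * g (x, y))") (auto simp: not_integrable_integral_eq)
    also have "\<dots> = (\<integral>\<^sup>+y. ennreal \<bar>indicator \<Omega> (x, y) * g (x, y)\<bar> * indicator (slice \<Omega> x) y \<partial>lborel)"
      by (intro nn_integral_cong) (auto simp: slice_indicator split: split_indicator)
    finally have "(ennreal \<bar>?I\<bar>)\<^sup>2 \<le> (\<integral>\<^sup>+y. ennreal \<bar>indicator \<Omega> (x, y) * g (x, y)\<bar> * indicator (slice \<Omega> x) y \<partial>lborel)\<^sup>2"
      by (rule power_mono) simp
    also have "\<dots> \<le> (\<integral>\<^sup>+y. (ennreal \<bar>indicator \<Omega> (x, y) * g (x, y)\<bar>)\<^sup>2 \<partial>lborel) * (\<integral>\<^sup>+y. (indicator (slice \<Omega> x) y)\<^sup>2 \<partial>lborel)"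
      by (rule Cauchy_Schwarz_nn_integral) measurable
    also have "(\<integral>\<^sup>+y. (indicator (slice \<Omega> x) y)\<^sup>2 \<partial>lborel) = (\<integral>\<^sup>+y. indicator (slice \<Omega> x) y \<partial>lborel)"
      by (intro nn_integral_cong) (simp split: split_indicator)
    also have "\<dots> = ennreal (h x)" by (simp add: emeasure_slice)
    also have "(\<integral>\<^sup>+y. (ennreal \<bar>indicator \<Omega> (x, y) * g (x, y)\<bar>)\<^sup>2 \<partial>lborel) = ?R"
      by (intro nn_integral_cong) (auto simp: slice_def ennreal_power split: split_indicator)
    finally have I: "ennreal (?I\<^sup>2) \<le> ?R * ennreal (h x)" by (simp add: ennreal_power)
    have "ennreal (h x) * ennreal ((P \<Omega> g x)\<^sup>2) = ennreal (1 / h x) * ennreal (?I\<^sup>2)"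
      unfolding P_eq using hx by (simp add: ennreal_mult[symmetric] power_mult_distrib power2_eq_square)
    also have "\<dots> \<le> ennreal (1 / h x) * (?R * ennreal (h x))" by (intro mult_left_mono I) simp
    also have "\<dots> = ?R * ennreal (1 / h x * h x)" using hx by (subst ennreal_mult) (auto simp: mult_ac)
    also have "\<dots> = ?R" using hx by simp
    finally show ?thesis .
  qed (simp add: h_outside)
qed

lemma P_L2:
  assumes g: "g \<in> L2 (lborel_on \<Omega>)"
  shows "P \<Omega> g \<in> L2 N.M"
proof -
  have m: "g \<in> borel_measurable (lborel_on \<Omega>)" using g by (simp add: L2_def)
  have G[measurable]: "(\<lambda>p. indicator \<Omega> p *\<^sub>R g p) \<in> borel_measurable borel"
    using m by (simp add: borel_measurable_lborel_on_iff)
  have Pm: "P \<Omega> g \<in> borel_measurable (lborel_on {0<..<1})"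
    using P_measurable[OF m] by (intro measurable_restrict_space1) simp
  have "(\<lambda>p. ennreal ((indicator \<Omega> p *\<^sub>R g p)\<^sup>2)) \<in> borel_measurable borel" by measurable
  also have "(\<lambda>p. ennreal ((indicator \<Omega> p *\<^sub>R g p)\<^sup>2)) = (\<lambda>p. ennreal ((g p)\<^sup>2) * indicator \<Omega> p)"
    by (auto simp: fun_eq_iff split: split_indicator)
  finally have mm: "(\<lambda>p. ennreal ((g p)\<^sup>2) * indicator \<Omega> p) \<in> borel_measurable borel" .
  have "(\<integral>\<^sup>+x. ennreal ((norm (P \<Omega> g x))\<^sup>2) \<partial>N.M) = (\<integral>\<^sup>+x. ennreal (h x) * ennreal ((P \<Omega> g x)\<^sup>2) \<partial>lborel_on {0<..<1})"
    using Pm by (subst N.nn_integral_M) auto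
  also have "\<dots> = (\<integral>\<^sup>+x. ennreal (h x) * ennreal ((P \<Omega> g x)\<^sup>2) * indicator {0<..<1} x \<partial>lborel)"
    by (rule nn_integral_lborel_on) simp
  also have "\<dots> \<le> (\<integral>\<^sup>+x. (\<integral>\<^sup>+y. ennreal ((g (x, y))\<^sup>2) * indicator (slice \<Omega> x) y \<partial>lborel) \<partial>lborel)"
  proof (rule nn_integral_mono)
    fix x
    show "ennreal (h x) * ennreal ((P \<Omega> g x)\<^sup>2) * indicator {0<..<1} x \<le> (\<integral>\<^sup>+y. ennreal ((g (x, y))\<^sup>2) * indicator (slice \<Omega> x) y \<partial>lborel)"
      using h_P_square_le[OF m, of x] by (cases "x \<in> {0<..<1}") auto
  qed
  also have "\<dots> = (\<integral>\<^sup>+p. ennreal ((g p)\<^sup>2) \<partial>lborel_on \<Omega>)"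
    by (rule nn_integral_\<Omega>[OF mm, symmetric])
  also have "\<dots> < \<infinity>" using g by (simp add: L2_iff_nn)
  finally show ?thesis using Pm by (simp add: L2_iff_nn)
qed

text \<open>Fubini: the factor \<open>h\<close> of the weighted measure cancels the normalisation of the slice average.\<close>

lemma J_P_adjoint:
  assumes v: "v \<in> L2 N.M" and g: "g \<in> L2 (lborel_on \<Omega>)"
  shows "L2_inner (lborel_on \<Omega>) (J v) g = L2_inner N.M v (P \<Omega> g)"
proof -
  have mv: "v \<in> borel_measurable (lborel_on {0<..<1})" using v by (simp add: L2_def)
  have mP: "P \<Omega> g \<in> borel_measurable (lborel_on {0<..<1})" using P_L2[OF g] by (simp add: L2_def)
  have "integrable (lborel_on \<Omega>) (\<lambda>p. v (fst p) * g p)"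
    by (rule L2_mult_integrable[OF coord_L2(1)[OF v] g])
  then have I: "integrable lborel (\<lambda>p. indicator \<Omega> p * (v (fst p) * g p))"
    by (simp add: integrable_lborel_on)
  have "L2_inner (lborel_on \<Omega>) (J v) g = (\<integral>p. indicator \<Omega> p * (v (fst p) * g p) \<partial>lborel)"
    by (simp add: L2_inner_def J_eq integral_lborel_on)
  also have "\<dots> = (\<integral>x. (\<integral>y. indicator \<Omega> (x, y) * (v x * g (x, y)) \<partial>lborel) \<partial>lborel)"
    by (simp add: integral_lborel_pair(1)[OF I])
  also have "\<dots> = (\<integral>x. indicator {0<..<1} x *\<^sub>R (h x * (v x * P \<Omega> g x)) \<partial>lborel)"
  proof (rule Bochner_Integration.integral_cong[OF refl])
    fix x
    have e: "(\<lambda>y. indicator \<Omega> (x, y) * (v x * g (x, y))) = (\<lambda>y. v x * (indicator \<Omega> (x, y) * g (x, y)))"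
      by (simp add: mult_ac)
    show "(\<integral>y. indicator \<Omega> (x, y) * (v x * g (x, y)) \<partial>lborel) = indicator {0<..<1} x *\<^sub>R (h x * (v x * P \<Omega> g x))"
    proof (cases "x \<in> {0<..<1}")
      case True
      then show ?thesis using h_pos[of x] by (simp add: e P_eq)
    next
      case False
      then have "indicator \<Omega> (x, y) = (0::real)" for y using sub by (auto split: split_indicator)
      then show ?thesis using False by simp
    qed
  qed
  also have "\<dots> = (\<integral>x. h x * (v x * P \<Omega> g x) \<partial>lborel_on {0<..<1})"
    by (rule integral_lborel_on[symmetric]) simp
  also have "\<dots> = L2_inner N.M v (P \<Omega> g)"
    unfolding L2_inner_def inner_real_def using mv mP by (intro N.integral_M[symmetric]) auto
  finally show ?thesis .
qed

lemma P_mean_zero: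
  assumes "g \<in> H_Omega \<Omega>"
  shows "P \<Omega> g \<in> L2_mean_zero N.M"
proof -
  have g: "g \<in> L2 (lborel_on \<Omega>)" "(\<integral>p. g p \<partial>lborel_on \<Omega>) = 0"
    using assms by (auto simp: H_Omega_def L2_mean_zero_def)
  have "L2_inner N.M (\<lambda>x. 1) (P \<Omega> g) = L2_inner (lborel_on \<Omega>) (J (\<lambda>x. 1)) g"
    by (rule J_P_adjoint[OF N.L2_M_const g(1), symmetric])
  then show ?thesis
    using P_L2[OF g(1)] g(2) by (simp add: L2_mean_zero_def L2_inner_def J_def)
qed

text \<open>
  The weak gradient of a function of the first coordinate: a test function restricted to a line
  parallel to the first axis is a test function on \<open>(0, 1)\<close>, and one restricted to a slice
  integrates to zero after differentiation.
\<close>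

lemma J_weak_gradient:
  assumes v: "v \<in> N.sob"
  defines "v' \<equiv> weak_grad {0<..<1} v"
  shows "has_weak_gradient \<Omega> (J v) (\<lambda>p. (v' (fst p), 0))"
    and "(\<lambda>p. (v' (fst p), 0::'b)) \<in> L2 (lborel_on \<Omega>)"
proof -
  have vL: "v \<in> L2 N.M" "v' \<in> L2 N.M" "has_weak_gradient {0<..<1} v v'"
    using N.sobD[OF v] by (auto simp: v'_def)
  have v'L: "(\<lambda>p. v' (fst p)) \<in> L2 (lborel_on \<Omega>)" by (rule coord_L2(1)[OF vL(2)])
  show "(\<lambda>p. (v' (fst p), 0::'b)) \<in> L2 (lborel_on \<Omega>)"
    using v'L by (auto simp: L2_def norm_Pair)
  show "has_weak_gradient \<Omega> (J v) (\<lambda>p. (v' (fst p), 0))"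
    unfolding has_weak_gradient_def
  proof (intro ballI)
    fix \<phi> and i :: "real \<times> 'b" assume \<phi>: "\<phi> \<in> test_functions \<Omega>" and i: "i \<in> Basis"
    note p = pd_test_function[OF \<phi> i]
    have glob: "(\<integral>p. f p * \<psi> p \<partial>lborel_on \<Omega>) = (\<integral>p. f p * \<psi> p \<partial>lborel)"
      "integrable lborel (\<lambda>p. f p * \<psi> p)"
      if \<psi>: "\<psi> \<in> test_functions \<Omega>" and f: "f \<in> L2 (lborel_on \<Omega>)" for f \<psi> :: "real \<times> 'b \<Rightarrow> real"
    proof -
      have e: "(\<lambda>p. indicator \<Omega> p *\<^sub>R (f p * \<psi> p)) = (\<lambda>p. f p * \<psi> p)"
        using test_function_outside[OF \<psi>] by (auto simp: fun_eq_iff split: split_indicator)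
      show "(\<integral>p. f p * \<psi> p \<partial>lborel_on \<Omega>) = (\<integral>p. f p * \<psi> p \<partial>lborel)"
        by (simp only: integral_lborel_on[OF \<Omega>_borel] e)
      have "integrable (lborel_on \<Omega>) (\<lambda>p. f p * \<psi> p)"
        by (rule L2_loc_mult_test_integrable[OF L2_imp_L2_loc[OF f \<Omega>_borel] \<psi> \<Omega>_borel])
      then show "integrable lborel (\<lambda>p. f p * \<psi> p)"
        by (simp only: integrable_lborel_on[OF \<Omega>_borel] e)
    qed
    note vO = coord_L2(1)[OF vL(1)]
    from i consider "i = (1, 0)" | j where "i = (0, j)" "j \<in> Basis"
      by (auto simp: Basis_prod_def)
    then show "(\<integral>x. J v x * pd \<phi> i x \<partial>lborel_on \<Omega>) = - (\<integral>x. ((v' (fst x), 0) \<bullet> i) * \<phi> x \<partial>lborel_on \<Omega>)"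
    proof cases
      case 1
      have on01: "(\<integral>x. f x * \<psi> x \<partial>lborel) = (\<integral>x. f x * \<psi> x \<partial>lborel_on {0<..<1})"
        if \<psi>: "\<psi> \<in> test_functions {0<..<1}" for f \<psi> :: "real \<Rightarrow> real"
      proof -
        have "(\<lambda>x. indicator {0<..<1} x *\<^sub>R (f x * \<psi> x)) = (\<lambda>x. f x * \<psi> x)"
          using test_function_outside[OF \<psi>] by (auto simp: fun_eq_iff split: split_indicator)
        then show ?thesis by (simp only: integral_lborel_on[OF borel_open[OF open_greaterThanLessThan]])
      qed
      have "(\<integral>x. J v x * pd \<phi> i x \<partial>lborel_on \<Omega>) = (\<integral>y. (\<integral>x. v x * pd \<phi> i (x, y) \<partial>lborel) \<partial>lborel)"
        unfolding J_eq glob(1)[OF p vO] integral_lborel_pair(2)[OF glob(2)[OF p vO]] by simp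
      also have "\<dots> = (\<integral>y. - (\<integral>x. v' x * \<phi> (x, y) \<partial>lborel) \<partial>lborel)"
      proof (rule Bochner_Integration.integral_cong[OF refl])
        fix y
        have t: "(\<lambda>x. \<phi> (x, y)) \<in> test_functions {0<..<1}"
          by (rule test_function_slice1[OF \<phi>]) (use sub in auto)
        have pds: "pd \<phi> i (x, y) = pd (\<lambda>x. \<phi> (x, y)) 1 x" for x
          using pd_eqI[OF pd_slice1[OF test_functionsD(2)[OF \<phi>, of "(x, y)"]], of 1] 1 by simp
        have "(\<integral>x. v x * pd \<phi> i (x, y) \<partial>lborel) = (\<integral>x. v x * pd (\<lambda>x. \<phi> (x, y)) 1 x \<partial>lborel_on {0<..<1})"
          unfolding pds by (rule on01[OF pd_test_function[OF t]]) simp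
        also have "\<dots> = - (\<integral>x. (v' x \<bullet> 1) * \<phi> (x, y) \<partial>lborel_on {0<..<1})"
          using vL(3) t unfolding has_weak_gradient_def by auto
        also have "\<dots> = - (\<integral>x. v' x * \<phi> (x, y) \<partial>lborel)"
          by (simp add: on01[OF t])
        finally show "(\<integral>x. v x * pd \<phi> i (x, y) \<partial>lborel) = - (\<integral>x. v' x * \<phi> (x, y) \<partial>lborel)" .
      qed
      also have "\<dots> = - (\<integral>x. v' (fst x) * \<phi> x \<partial>lborel_on \<Omega>)"
        unfolding glob(1)[OF \<phi> v'L] integral_lborel_pair(2)[OF glob(2)[OF \<phi> v'L]] by simp
      finally show ?thesis using 1 by simp
    next
      case 2
      have "(\<integral>x. J v x * pd \<phi> i x \<partial>lborel_on \<Omega>) = (\<integral>x. (\<integral>y. v x * pd \<phi> i (x, y) \<partial>lborel) \<partial>lborel)"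
        unfolding J_eq glob(1)[OF p vO] integral_lborel_pair(1)[OF glob(2)[OF p vO]] by simp
      also have "\<dots> = (\<integral>x. 0 \<partial>(lborel::real measure))"
      proof (rule Bochner_Integration.integral_cong[OF refl])
        fix x
        have "pd \<phi> i (x, y) = pd (\<lambda>y. \<phi> (x, y)) j y" for y
          using pd_eqI[OF pd_slice2[OF test_functionsD(2)[OF \<phi>, of "(x, y)"]], of j] 2 by simp
        then show "(\<integral>y. v x * pd \<phi> i (x, y) \<partial>lborel) = 0"
          using integral_pd_test_function[OF test_function_slice2[OF \<phi>] 2(2), of x] by simp
      qed
      finally show ?thesis using 2 by simp
    qed
  qed
qed

end

section \<open>How slice averages vary\<close>

lemma indicator_continuous_integrable:
  fixes f :: "'a::euclidean_space \<Rightarrow> real"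
  assumes "continuous_on UNIV f" "bounded A" "A \<in> sets borel"
  shows "integrable lborel (\<lambda>y. indicator A y * f y)"
proof -
  have "emeasure lborel A < \<infinity>" using assms by (intro emeasure_bounded_finite)
  then have "(\<lambda>x. 1::real) \<in> L2 (lborel_on A)"
    using assms(3) by (simp add: L2_def integrable_lborel_on)
  from L2_mult_integrable[OF continuous_L2[OF assms] this] show ?thesis
    using assms(3) by (simp add: integrable_lborel_on)
qed

text \<open>
  If scaling by \<open>c\<close> maps \<open>D \<union> D'\<close> into \<open>D \<inter> D'\<close>, then the symmetric difference lies in the shell between
  \<open>D \<union> D'\<close> and its scaled copy, and integrals over that shell are computed by a change of variables.
\<close>

lemma integral_shell_le:
  fixes D D' :: "'b::euclidean_space set"
  assumes D: "D \<in> sets borel" "D' \<in> sets borel" "bounded D" "bounded D'"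
    and c: "0 < c" and scale: "\<And>y. y \<in> D \<union> D' \<Longrightarrow> c *\<^sub>R y \<in> D \<inter> D'"
    and k: "continuous_on UNIV k" and \<kappa>: "continuous_on UNIV \<kappa>"
    and le: "\<And>y. y \<in> D \<union> D' \<Longrightarrow> \<bar>k y\<bar> \<le> \<kappa> y"
  shows "\<bar>(\<integral>y. indicator D' y * k y \<partial>lborel) - (\<integral>y. indicator D y * k y \<partial>lborel)\<bar>
    \<le> (\<integral>y. indicator (D \<union> D') y * (\<kappa> y - c ^ DIM('b) * \<kappa> (c *\<^sub>R y)) \<partial>lborel)"
proof -
  let ?U = "D \<union> D'"
  let ?V = "\<lambda>y. indicator ?U ((1 / c) *\<^sub>R y) * \<kappa> y"
  note [measurable] = D(1,2) borel_measurable_continuous_onI[OF \<kappa>] borel_measurable_continuous_onI[OF k]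
  have U: "?U \<in> sets borel" "bounded ?U" using D by auto
  have \<kappa>c: "continuous_on UNIV (\<lambda>y. \<kappa> (c *\<^sub>R y))"
    by (rule continuous_on_compose2[OF \<kappa>]) (auto intro!: continuous_intros)
  have I: "integrable lborel (\<lambda>y. indicator D' y * k y)" "integrable lborel (\<lambda>y. indicator D y * k y)"
    "integrable lborel (\<lambda>y. indicator ?U y * \<kappa> y)" "integrable lborel (\<lambda>y. indicator ?U y * \<kappa> (c *\<^sub>R y))"
    by (intro indicator_continuous_integrable k \<kappa> \<kappa>c D U)+
  have V: "?V y = indicator ((\<lambda>y. c *\<^sub>R y) ` ?U) y * \<kappa> y" for y
  proof -
    have "(1 / c) *\<^sub>R y \<in> ?U \<longleftrightarrow> y \<in> (\<lambda>y. c *\<^sub>R y) ` ?U"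
      using c by (auto simp: image_iff intro!: bexI[of _ "(1 / c) *\<^sub>R y"])
    then show ?thesis by (simp add: indicator_def)
  qed
  have \<kappa>0: "0 \<le> \<kappa> y" if "y \<in> ?U" for y
    using le[OF that] by (rule order_trans[OF abs_ge_zero])
  have scaled: "?V y \<le> indicator (D \<inter> D') y * \<kappa> y" for y
  proof (cases "(1 / c) *\<^sub>R y \<in> ?U")
    case True
    then have "y \<in> D \<inter> D'" using scale[OF True] c by simp
    then show ?thesis using True by simp
  next
    case False
    then show ?thesis using \<kappa>0[of y] by (auto split: split_indicator)
  qed
  have bV: "?V y \<ge> 0" for y
  proof (cases "(1 / c) *\<^sub>R y \<in> ?U")
    case True
    then have "y \<in> ?U" using scale[OF True] c by simp
    then show ?thesis using \<kappa>0[of y] True by simp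
  qed simp
  have IV: "integrable lborel ?V"
  proof (rule Bochner_Integration.integrable_bound[OF I(3)])
    have "norm (?V y) \<le> norm (indicator ?U y * \<kappa> y)" for y
    proof -
      have "indicator (D \<inter> D') y * \<kappa> y \<le> \<bar>indicator ?U y * \<kappa> y\<bar>"
        by (cases "y \<in> D"; cases "y \<in> D'") auto
      then show ?thesis using scaled[of y] bV[of y] unfolding real_norm_def by linarith
    qed
    then show "AE y in lborel. norm (?V y) \<le> norm (indicator ?U y * \<kappa> y)" by simp
  qed measurable
  have "\<bar>(\<integral>y. indicator D' y * k y \<partial>lborel) - (\<integral>y. indicator D y * k y \<partial>lborel)\<bar>
      = \<bar>\<integral>y. indicator D' y * k y - indicator D y * k y \<partial>lborel\<bar>"
    using I by simp
  also have "\<dots> \<le> (\<integral>y. indicator ?U y * \<kappa> y - ?V y \<partial>lborel)"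
  proof (rule order_trans[OF integral_abs_bound], rule integral_mono)
    fix y
    show "\<bar>indicator D' y * k y - indicator D y * k y\<bar> \<le> indicator ?U y * \<kappa> y - ?V y"
      using scaled[of y] le[of y] by (cases "y \<in> D"; cases "y \<in> D'") auto
  qed (use I IV in auto)
  also have "\<dots> = (\<integral>y. indicator ?U y * \<kappa> y \<partial>lborel) - (\<integral>y. ?V y \<partial>lborel)"
    using I IV by simp
  also have "(\<integral>y. ?V y \<partial>lborel) = c ^ DIM('b) * (\<integral>y. indicator ?U y * \<kappa> (c *\<^sub>R y) \<partial>lborel)"
    using c by (subst integral_affine[of c _ 0]) auto
  also have "(\<integral>y. indicator ?U y * \<kappa> y \<partial>lborel) - c ^ DIM('b) * (\<integral>y. indicator ?U y * \<kappa> (c *\<^sub>R y) \<partial>lborel)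
     = (\<integral>y. indicator ?U y * \<kappa> y - c ^ DIM('b) * (indicator ?U y * \<kappa> (c *\<^sub>R y)) \<partial>lborel)"
    using I by simp
  also have "\<dots> = (\<integral>y. indicator ?U y * (\<kappa> y - c ^ DIM('b) * \<kappa> (c *\<^sub>R y)) \<partial>lborel)"
    by (intro Bochner_Integration.integral_cong refl) (simp add: algebra_simps)
  finally show ?thesis .
qed

lemma one_minus_power_le: "1 - c ^ n \<le> real n * (1 - c)" if "0 \<le> c" for c :: real
proof -
  have "1 + real n * (c - 1) \<le> (1 + (c - 1)) ^ n" by (rule Bernoulli_inequality) (use that in simp)
  then show ?thesis by (simp add: algebra_simps)
qed

lemma first_order_Taylor_le:
  fixes z :: "'a::euclidean_space \<Rightarrow> real"
  assumes z: "\<And>p. (z has_derivative (\<lambda>h. Z p \<bullet> h)) (at p)"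
    and e: "\<And>\<xi>. \<xi> \<in> closed_segment p q \<Longrightarrow> norm (Z \<xi> - Z p) \<le> e"
  shows "\<bar>z q - z p - Z p \<bullet> (q - p)\<bar> \<le> e * norm (q - p)"
proof -
  have "norm ((z q - Z p \<bullet> q) - (z p - Z p \<bullet> p)) \<le> e * norm (q - p)"
  proof (rule differentiable_bound[of "closed_segment p q"])
    fix \<xi> assume \<xi>: "\<xi> \<in> closed_segment p q"
    show "((\<lambda>q. z q - Z p \<bullet> q) has_derivative (\<lambda>h. (Z \<xi> - Z p) \<bullet> h)) (at \<xi> within closed_segment p q)"
      by (auto intro!: derivative_eq_intros z[THEN has_derivative_at_withinI] simp: inner_diff_left)
    have "e \<ge> 0" using e[OF \<xi>] norm_ge_zero order_trans by blast
    then show "onorm (\<lambda>h. (Z \<xi> - Z p) \<bullet> h) \<le> e"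
      using order_trans[OF Cauchy_Schwarz_ineq2 mult_right_mono[OF e[OF \<xi>]]] by (intro onorm_bound) auto
  qed auto
  then show ?thesis by (simp add: inner_diff_right algebra_simps)
qed

context slab
begin

text \<open>
  Seen from \<open>(0, 0)\<close>, the slice at \<open>x\<close> scaled by \<open>(x - t) / x\<close> lies in the slice at \<open>x - t\<close>; seen from
  \<open>(1, 0)\<close>, the slice at \<open>x - t\<close> scaled by \<open>(1 - x) / (1 - x + t)\<close> lies in the slice at \<open>x\<close>. Both factors
  are at least \<open>1 - t / \<rho> x\<close>, and slices are star-shaped about zero.
\<close>

lemma slice_scale_both:
  assumes x: "0 < x" "x < 1" and t: "0 < t" "t < \<rho> x"
    and y: "y \<in> slice \<Omega> x \<union> slice \<Omega> (x - t)"
  shows "(1 - t / \<rho> x) *\<^sub>R y \<in> slice \<Omega> x \<inter> slice \<Omega> (x - t)"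
proof -
  define c where "c = 1 - t / \<rho> x"
  have r: "\<rho> x > 0" "\<rho> x \<le> x" "\<rho> x \<le> 1 - x" using x by auto
  have c: "0 < c" "c \<le> 1" using t r by (auto simp: c_def field_simps)
  have xt: "x - t > 0" using t r by linarith
  have shrink: "c *\<^sub>R y \<in> slice \<Omega> s" if "e *\<^sub>R y \<in> slice \<Omega> s" "c \<le> e" for e s
  proof -
    have "(s, (c / e) *\<^sub>R (e *\<^sub>R y)) \<in> \<Omega>"
      by (rule towards_axis) (use that c in \<open>auto simp: slice_def\<close>)
    then show ?thesis using that c by (simp add: slice_def)
  qed
  have 1: "c *\<^sub>R y \<in> slice \<Omega> x \<and> c *\<^sub>R y \<in> slice \<Omega> (x - t)" if "y \<in> slice \<Omega> x"
  proof
    show "c *\<^sub>R y \<in> slice \<Omega> x" using shrink[of 1 x] that c by simp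
    have e: "0 < (x - t) / x" "(x - t) / x \<le> 1" using x t xt by auto
    have "((x - t) / x * x, ((x - t) / x) *\<^sub>R y) \<in> \<Omega>"
      by (rule towards_left) (use that e in \<open>auto simp: slice_def\<close>)
    then have "((x - t) / x) *\<^sub>R y \<in> slice \<Omega> (x - t)" using x by (simp add: slice_def)
    moreover have "t / x \<le> t / \<rho> x" using r t x by (intro divide_left_mono) auto
    then have "c \<le> (x - t) / x" using x by (simp add: c_def diff_divide_distrib)
    ultimately show "c *\<^sub>R y \<in> slice \<Omega> (x - t)" by (rule shrink)
  qed
  have 2: "c *\<^sub>R y \<in> slice \<Omega> x \<and> c *\<^sub>R y \<in> slice \<Omega> (x - t)" if "y \<in> slice \<Omega> (x - t)"
  proof
    show "c *\<^sub>R y \<in> slice \<Omega> (x - t)" using shrink[of 1 "x - t"] that c by simp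
    let ?e = "(1 - x) / (1 - x + t)"
    have e: "0 < ?e" "?e \<le> 1" using x t by auto
    have "(1 - ?e * (1 - (x - t)), ?e *\<^sub>R y) \<in> \<Omega>"
      by (rule towards_right) (use that e in \<open>auto simp: slice_def\<close>)
    moreover have "1 - ?e * (1 - (x - t)) = x" using x t by (simp add: field_simps)
    ultimately have "?e *\<^sub>R y \<in> slice \<Omega> x" by (simp add: slice_def)
    moreover have "t / (1 - x + t) \<le> t / \<rho> x" using r t x by (intro divide_left_mono mult_pos_pos) auto
    then have "c \<le> ?e" using x t by (simp add: c_def field_simps)
    ultimately show "c *\<^sub>R y \<in> slice \<Omega> x" by (rule shrink)
  qed
  show ?thesis using y 1 2 unfolding c_def by blast
qed

abbreviation slice_int :: "real \<Rightarrow> ('b \<Rightarrow> real) \<Rightarrow> real" where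
  "slice_int x f \<equiv> \<integral>y. indicator (slice \<Omega> x) y * f y \<partial>lborel"

lemma continuous_slice: "continuous_on UNIV f \<Longrightarrow> continuous_on UNIV (\<lambda>y. f (x, y))"
  for f :: "real \<times> 'b \<Rightarrow> 'c::topological_space"
  by (rule continuous_on_compose2) (auto intro!: continuous_intros)

lemma slice_int_const: "slice_int x (\<lambda>y. c) = h x * c"
  using emeasure_bounded_finite[OF slice_bounded, of x] by (simp add: slice_vol_def)

lemma slice_integrable: "continuous_on UNIV f \<Longrightarrow> integrable lborel (\<lambda>y. indicator (slice \<Omega> x) y * f y)"
  for f :: "'b \<Rightarrow> real"
  by (rule indicator_continuous_integrable[OF _ slice_bounded slice_borel])

lemma slice_int_abs_le:
  assumes "continuous_on UNIV f" "\<And>y. y \<in> slice \<Omega> x \<Longrightarrow> \<bar>f y\<bar> \<le> C"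
  shows "\<bar>slice_int x f\<bar> \<le> h x * C"
proof -
  have "\<bar>slice_int x f\<bar> \<le> slice_int x (\<lambda>y. C)"
    by (rule order_trans[OF integral_abs_bound], rule integral_mono)
      (use assms(2) slice_integrable[OF assms(1), of x] slice_integrable[of "\<lambda>_. C" x] in \<open>auto split: split_indicator\<close>)
  then show ?thesis by (simp only: slice_int_const)
qed

lemma P_slice_int: "P \<Omega> z x = 1 / h x * slice_int x (\<lambda>y. z (x, y))"
  by (simp add: P_eq slice_indicator)

definition ballvol :: real where "ballvol = measure lborel (ball (0::'b) \<epsilon>)"

lemma ballvol_pos: "ballvol > 0"
  unfolding ballvol_def using content_ball_pos[OF \<epsilon>_pos, of "0::'b"] by simp

lemma h_le_ballvol: "h x \<le> ballvol"
  unfolding slice_vol_def ballvol_def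
  by (rule measure_mono_fmeasurable[OF slice_sub]) (auto intro!: fmeasurableI emeasure_bounded_finite)

text \<open>
  The boundary contribution to the derivative of a slice average. Comparing the slices at \<open>x\<close> and
  \<open>x - t\<close> through the shell of relative thickness \<open>t / \<rho> x\<close> needs no boundary integral, and
  subtracting the average over the slice leaves only the oscillation of \<open>z\<close> along the slice.
\<close>

lemma slice_average_difference:
  fixes z :: "real \<times> 'b \<Rightarrow> real" and Z :: "real \<times> 'b \<Rightarrow> real \<times> 'b"
  assumes z: "\<And>p. (z has_derivative (\<lambda>h. Z p \<bullet> h)) (at p)" and Z: "continuous_on UNIV Z"
    and x: "0 < x" "x < 1" and t: "0 < t" "t < \<rho> x"
    and C0: "\<And>y. y \<in> ball 0 \<epsilon> \<Longrightarrow> \<bar>z (x, y)\<bar> \<le> C0"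
    and C1: "\<And>y. y \<in> ball 0 \<epsilon> \<Longrightarrow> norm (Z (x, y)) \<le> C1"
    and e0: "e \<ge> 0"
    and ex: "\<And>y s. y \<in> ball 0 \<epsilon> \<Longrightarrow> 0 \<le> s \<Longrightarrow> s \<le> t \<Longrightarrow> norm (Z (x - s, y) - Z (x, y)) \<le> e"
    and ey: "\<And>y s. y \<in> ball 0 \<epsilon> \<Longrightarrow> 0 \<le> s \<Longrightarrow> s \<le> t / \<rho> x \<Longrightarrow> norm (Z (x, (1 - s) *\<^sub>R y) - Z (x, y)) \<le> e"
  defines "N \<equiv> P \<Omega> z"
  defines "g \<equiv> \<lambda>y. real DIM('b) * \<bar>z (x, y) - N x\<bar> + \<epsilon> * norm (snd (Z (x, y)))"
  shows "\<bar>h (x - t) * (N (x - t) - N x) + t * slice_int x (\<lambda>y. fst (Z (x, y)))\<bar>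
    \<le> t / \<rho> x * slice_int x g + t * (e * (ballvol + \<epsilon> * ballvol / \<rho> x))
      + t * (t / \<rho> x) * (real DIM('b) * ballvol * (C1 + (real DIM('b) * (2 * C0) + \<epsilon> * C1) / \<rho> x))"
    and "\<bar>h (x - t) - h x\<bar> \<le> t / \<rho> x * (real DIM('b) * ballvol)"
proof -
  define m where "m = real DIM('b)"
  define D where "D = slice \<Omega> x"
  define D' where "D' = slice \<Omega> (x - t)"
  define U where "U = D \<union> D'"
  define \<tau> where "\<tau> = t / \<rho> x"
  define c where "c = N x"
  let ?I = "\<lambda>A f. \<integral>y. indicator A y * f y \<partial>lborel"
  have r: "\<rho> x > 0" "\<rho> x \<le> x" using x by auto
  have \<tau>: "0 < \<tau>" "\<tau> < 1" using t r by (auto simp: \<tau>_def)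
  have m0: "m \<ge> 1" by (simp add: m_def)
  have Db[measurable]: "D \<in> sets borel" "D' \<in> sets borel" by (auto simp: D_def D'_def)
  have Dbd: "bounded D" "bounded D'" by (auto simp: D_def D'_def slice_bounded)
  have sub: "D \<subseteq> ball 0 \<epsilon>" "D' \<subseteq> ball 0 \<epsilon>" "U \<subseteq> ball 0 \<epsilon>" using slice_sub by (auto simp: D_def D'_def U_def)
  have UB: "U \<in> sets borel" "bounded U" using Db Dbd by (auto simp: U_def)
  have scale: "(1 - \<tau>) *\<^sub>R y \<in> D \<inter> D'" if "y \<in> D \<union> D'" for y
    using slice_scale_both[OF x t, of y] that by (simp add: D_def D'_def \<tau>_def)
  have scaleU: "(1 - \<tau>) *\<^sub>R y \<in> D \<inter> U" if "y \<in> D \<union> U" for y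
    using scale[of y] that by (auto simp: U_def)
  have cz: "continuous_on UNIV z"
    using z by (meson continuous_at_imp_continuous_on has_derivative_continuous)
  note czs = continuous_slice[OF cz] and cZs = continuous_slice[OF Z]
  have U_vol: "?I U (\<lambda>y. a) \<le> ballvol * a" "?I U (\<lambda>y. a) \<ge> 0" if "a \<ge> 0" for a
  proof -
    have "measure lborel U \<le> ballvol"
      unfolding ballvol_def using UB
      by (intro measure_mono_fmeasurable[OF sub(3)]) (auto intro!: fmeasurableI emeasure_bounded_finite)
    moreover have "?I U (\<lambda>y. a) = measure lborel U * a"
      using emeasure_bounded_finite[OF UB(2)] UB(1) by simp
    ultimately show "?I U (\<lambda>y. a) \<le> ballvol * a" "?I U (\<lambda>y. a) \<ge> 0"
      using that by (auto intro: mult_right_mono)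
  qed
  have IU: "integrable lborel (\<lambda>y. indicator U y * f y)" if "continuous_on UNIV f" for f :: "'b \<Rightarrow> real"
    by (rule indicator_continuous_integrable[OF that UB(2,1)])
  have volume_shell: "\<bar>?I D2 k - ?I D k\<bar> \<le> \<tau> * (m * ballvol * K)"
    if D2: "D2 = D' \<or> D2 = U" and k: "continuous_on UNIV k" and K: "K \<ge> 0" "\<And>y. y \<in> U \<Longrightarrow> \<bar>k y\<bar> \<le> K" for D2 k K
  proof -
    have UU: "D \<union> D2 = U" using D2 by (auto simp: U_def)
    have "\<bar>?I D2 k - ?I D k\<bar> \<le> ?I (D \<union> D2) (\<lambda>y. K - (1 - \<tau>) ^ DIM('b) * K)"
    proof (rule integral_shell_le)
      show "(1 - \<tau>) *\<^sub>R y \<in> D \<inter> D2" if "y \<in> D \<union> D2" for y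
        using D2 scale[of y] scaleU[of y] that by auto
    qed (use D2 Db Dbd UB \<tau> k K in \<open>auto simp: U_def\<close>)
    also have "\<dots> = ?I U (\<lambda>y. (1 - (1 - \<tau>) ^ DIM('b)) * K)" by (simp add: UU algebra_simps)
    also have "\<dots> \<le> ballvol * ((1 - (1 - \<tau>) ^ DIM('b)) * K)"
      using \<tau> K by (intro U_vol mult_nonneg_nonneg) (auto simp: power_le_one)
    also have "\<dots> \<le> ballvol * ((m * \<tau>) * K)"
      using one_minus_power_le[of "1 - \<tau>" "DIM('b)"] \<tau> K ballvol_pos
      by (intro mult_left_mono mult_right_mono) (auto simp: m_def)
    finally show ?thesis by (simp add: mult_ac)
  qed
  have hD: "?I D (\<lambda>y. a) = h x * a" "?I D' (\<lambda>y. a) = h (x - t) * a" for a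
    unfolding D_def D'_def by (rule slice_int_const)+
  show "\<bar>h (x - t) - h x\<bar> \<le> t / \<rho> x * (real DIM('b) * ballvol)"
    using volume_shell[of D' "\<lambda>_. 1" 1] hD[of 1] by (simp add: m_def \<tau>_def)
  have hx: "h x > 0" "h (x - t) > 0" using x t r by (auto intro!: h_pos)
  have Nx: "?I D (\<lambda>y. z (x, y)) = h x * c"
    using hx unfolding c_def N_def P_slice_int D_def by simp
  have Nxt: "?I D' (\<lambda>y. z (x - t, y)) = h (x - t) * N (x - t)"
    using hx unfolding N_def P_slice_int D'_def by simp
  have ID: "integrable lborel (\<lambda>y. indicator D y * f y)" "integrable lborel (\<lambda>y. indicator D' y * f y)"
    if "continuous_on UNIV f" for f :: "'b \<Rightarrow> real"
    unfolding D_def D'_def by (intro slice_integrable that)+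
  have cC0: "\<bar>c\<bar> \<le> C0"
  proof -
    have "\<bar>?I D (\<lambda>y. z (x, y))\<bar> \<le> h x * C0"
      unfolding D_def by (rule slice_int_abs_le[OF czs]) (use C0 slice_sub[of x] in blast)
    then have "h x * \<bar>c\<bar> \<le> h x * C0" using hx by (simp add: Nx abs_mult)
    then show ?thesis using hx by (simp only: mult_le_cancel_left_pos)
  qed
  have "norm (Z (x, 0)) \<le> C1" using C1[of 0] \<epsilon>_pos by simp
  then have C1': "C1 \<ge> 0" using norm_ge_zero[of "Z (x, 0)"] by linarith
  have C0': "C0 \<ge> 0" using cC0 by linarith
  let ?zx = "\<lambda>y. fst (Z (x, y))"
  have czx: "continuous_on UNIV ?zx" by (intro continuous_intros cZs)
  \<comment> \<open>The change of \<open>z\<close> itself.\<close>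
  have T1: "\<bar>?I D' (\<lambda>y. z (x - t, y) - z (x, y)) + t * ?I D' ?zx\<bar> \<le> t * (e * ballvol)"
  proof -
    have eq: "?I D' (\<lambda>y. z (x - t, y) - z (x, y)) + t * ?I D' ?zx = ?I D' (\<lambda>y. z (x - t, y) - z (x, y) + t * ?zx y)"
      using ID(2)[OF czs, of "x - t"] ID(2)[OF czs, of x] ID(2)[OF czx]
      by (simp add: algebra_simps)
    have "\<bar>?I D' (\<lambda>y. z (x - t, y) - z (x, y)) + t * ?I D' ?zx\<bar> \<le> h (x - t) * (e * t)"
      unfolding eq unfolding D'_def
    proof (rule slice_int_abs_le)
      show "continuous_on UNIV (\<lambda>y. z (x - t, y) - z (x, y) + t * ?zx y)"
        by (intro continuous_intros czs czx)
      fix y assume "y \<in> slice \<Omega> (x - t)"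
      then have y: "y \<in> ball 0 \<epsilon>" using slice_sub[of "x - t"] by blast
      have "\<bar>z (x - t, y) - z (x, y) - Z (x, y) \<bullet> ((x - t, y) - (x, y))\<bar> \<le> e * norm ((x - t, y) - (x, y))"
      proof (rule first_order_Taylor_le[OF z])
        fix \<xi> assume "\<xi> \<in> closed_segment (x, y) (x - t, y)"
        then obtain u where u: "0 \<le> u" "u \<le> 1" "\<xi> = (1 - u) *\<^sub>R (x, y) + u *\<^sub>R (x - t, y)"
          by (auto simp: closed_segment_def)
        then have "\<xi> = (x - u * t, y)" by (simp add: algebra_simps flip: scaleR_add_left)
        moreover have "u * t \<le> t" using u t by (simp add: mult_left_le_one_le)
        ultimately show "norm (Z \<xi> - Z (x, y)) \<le> e" using ex[OF y, of "u * t"] u t by simp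
      qed
      then show "\<bar>z (x - t, y) - z (x, y) + t * ?zx y\<bar> \<le> e * t"
        using t by (cases "Z (x, y)") (simp add: norm_Pair mult.commute)
    qed
    also have "\<dots> \<le> ballvol * (e * t)" using h_le_ballvol e0 t by (intro mult_right_mono) auto
    finally show ?thesis by (simp add: mult_ac)
  qed
  have T2: "\<bar>?I D' ?zx - ?I D ?zx\<bar> \<le> \<tau> * (m * ballvol * C1)"
  proof (rule volume_shell)
    fix y assume "y \<in> U"
    then have "norm (Z (x, y)) \<le> C1" using sub by (intro C1) auto
    then show "\<bar>?zx y\<bar> \<le> C1" using norm_fst_le[of "fst (Z (x, y))" "snd (Z (x, y))"] by simp
  qed (use czx C1' in auto)
  \<comment> \<open>The change of the slice, seen by the deviation from the average.\<close>
  let ?k = "\<lambda>y. z (x, y) - c"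
  have ck: "continuous_on UNIV ?k" by (intro continuous_intros czs)
  have cg: "continuous_on UNIV g" unfolding g_def by (intro continuous_intros czs cZs)
  have g0: "g y \<ge> 0" for y using \<epsilon>_pos by (simp add: g_def)
  have T3: "\<bar>?I D' ?k - ?I D ?k\<bar> \<le> \<tau> * (?I U g + \<epsilon> * e * ballvol)"
  proof -
    have "\<bar>?I D' ?k - ?I D ?k\<bar> \<le> ?I (D \<union> D') (\<lambda>y. \<bar>?k y\<bar> - (1 - \<tau>) ^ DIM('b) * \<bar>?k ((1 - \<tau>) *\<^sub>R y)\<bar>)"
      using Db Dbd \<tau> ck scale by (intro integral_shell_le) (auto intro!: continuous_intros)
    also have "\<dots> \<le> ?I U (\<lambda>y. \<tau> * (g y + \<epsilon> * e))"
      unfolding U_def[symmetric]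
    proof (rule integral_mono)
      have ck': "continuous_on UNIV (\<lambda>y. ?k ((1 - \<tau>) *\<^sub>R y))"
        by (rule continuous_on_compose2[OF ck]) (auto intro!: continuous_intros)
      show "integrable lborel (\<lambda>y. indicator U y * (\<bar>?k y\<bar> - (1 - \<tau>) ^ DIM('b) * \<bar>?k ((1 - \<tau>) *\<^sub>R y)\<bar>))"
        by (intro IU continuous_intros ck ck' czs)
      show "integrable lborel (\<lambda>y. indicator U y * (\<tau> * (g y + \<epsilon> * e)))"
        by (intro IU continuous_intros cg)
      fix y
      show "indicator U y * (\<bar>?k y\<bar> - (1 - \<tau>) ^ DIM('b) * \<bar>?k ((1 - \<tau>) *\<^sub>R y)\<bar>) \<le> indicator U y * (\<tau> * (g y + \<epsilon> * e))"
      proof (cases "y \<in> U")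
        case True
        then have y: "y \<in> ball 0 \<epsilon>" using sub by auto
        define q where "q = \<bar>?k y\<bar>"
        define q' where "q' = \<bar>?k ((1 - \<tau>) *\<^sub>R y)\<bar>"
        define s where "s = norm (snd (Z (x, y)))"
        have "\<bar>z (x, (1 - \<tau>) *\<^sub>R y) - z (x, y) - Z (x, y) \<bullet> ((x, (1 - \<tau>) *\<^sub>R y) - (x, y))\<bar>
            \<le> e * norm ((x, (1 - \<tau>) *\<^sub>R y) - (x, y))"
        proof (rule first_order_Taylor_le[OF z])
          fix \<xi> assume "\<xi> \<in> closed_segment (x, y) (x, (1 - \<tau>) *\<^sub>R y)"
          then obtain u where u: "0 \<le> u" "u \<le> 1" "\<xi> = (1 - u) *\<^sub>R (x, y) + u *\<^sub>R (x, (1 - \<tau>) *\<^sub>R y)"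
            by (auto simp: closed_segment_def)
          then have "\<xi> = (x, (1 - u * \<tau>) *\<^sub>R y)" by (simp add: algebra_simps)
          moreover have "u * \<tau> \<le> t / \<rho> x" using u \<tau> unfolding \<tau>_def[symmetric] by (simp add: mult_left_le_one_le)
          ultimately show "norm (Z \<xi> - Z (x, y)) \<le> e" using ey[OF y, of "u * \<tau>"] u \<tau> by simp
        qed
        moreover have d: "(x, (1 - \<tau>) *\<^sub>R y) - (x, y) = (0, - (\<tau> *\<^sub>R y))" by (simp add: algebra_simps)
        moreover have "\<bar>Z (x, y) \<bullet> (0, - (\<tau> *\<^sub>R y))\<bar> \<le> s * (\<tau> * norm y)"
          using Cauchy_Schwarz_ineq2[of "snd (Z (x, y))" "\<tau> *\<^sub>R y"] \<tau>
          by (cases "Z (x, y)") (simp add: s_def)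
        ultimately have "\<bar>z (x, (1 - \<tau>) *\<^sub>R y) - z (x, y)\<bar> \<le> s * (\<tau> * norm y) + e * (\<tau> * norm y)"
          using \<tau> by (simp add: norm_Pair)
        also have "\<dots> = (s + e) * (\<tau> * norm y)" by (simp add: algebra_simps)
        also have "\<dots> \<le> (s + e) * (\<tau> * \<epsilon>)"
          using y \<tau> e0 by (intro mult_left_mono) (auto simp: s_def)
        finally have qq': "q - q' \<le> \<tau> * (\<epsilon> * (s + e))" by (simp add: q_def q'_def mult_ac)
        have p: "0 \<le> (1 - \<tau>) ^ DIM('b)" "(1 - \<tau>) ^ DIM('b) \<le> 1" using \<tau> by (auto simp: power_le_one)
        have "q - (1 - \<tau>) ^ DIM('b) * q' = (1 - (1 - \<tau>) ^ DIM('b)) * q + (1 - \<tau>) ^ DIM('b) * (q - q')"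
          by (simp add: algebra_simps)
        also have "\<dots> \<le> (m * \<tau>) * q + 1 * (\<tau> * (\<epsilon> * (s + e)))"
        proof (rule add_mono)
          show "(1 - (1 - \<tau>) ^ DIM('b)) * q \<le> (m * \<tau>) * q"
            using one_minus_power_le[of "1 - \<tau>" "DIM('b)"] \<tau> by (intro mult_right_mono) (auto simp: m_def q_def)
          have "(1 - \<tau>) ^ DIM('b) * (q - q') \<le> (1 - \<tau>) ^ DIM('b) * (\<tau> * (\<epsilon> * (s + e)))"
            using p qq' by (intro mult_left_mono)
          also have "\<dots> \<le> 1 * (\<tau> * (\<epsilon> * (s + e)))"
            using p \<tau> \<epsilon>_pos e0 by (intro mult_right_mono mult_nonneg_nonneg) (auto simp: s_def)
          finally show "(1 - \<tau>) ^ DIM('b) * (q - q') \<le> 1 * (\<tau> * (\<epsilon> * (s + e)))" .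
        qed
        also have "\<dots> = \<tau> * (g y + \<epsilon> * e)"
          by (simp add: g_def q_def s_def m_def c_def algebra_simps)
        finally show ?thesis using True by (simp add: q_def q'_def)
      qed simp
    qed
    also have "\<dots> = \<tau> * (?I U g + ?I U (\<lambda>y. \<epsilon> * e))"
    proof -
      have "?I U (\<lambda>y. \<tau> * (g y + \<epsilon> * e)) = (\<integral>y. \<tau> * (indicator U y * g y + indicator U y * (\<epsilon> * e)) \<partial>lborel)"
        by (intro Bochner_Integration.integral_cong refl) (simp add: algebra_simps)
      also have "\<dots> = \<tau> * (?I U g + ?I U (\<lambda>y. \<epsilon> * e))"
        using IU[OF cg] IU[of "\<lambda>_. \<epsilon> * e"] by simp
      finally show ?thesis .
    qed
    also have "\<dots> \<le> \<tau> * (?I U g + \<epsilon> * e * ballvol)"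
      using U_vol(1)[of "\<epsilon> * e"] \<epsilon>_pos e0 \<tau> by (intro mult_left_mono add_left_mono) (auto simp: mult_ac)
    finally show ?thesis .
  qed
  have T4: "?I U g \<le> ?I D g + \<tau> * (m * ballvol * (m * (2 * C0) + \<epsilon> * C1))"
  proof -
    have "\<bar>?I U g - ?I D g\<bar> \<le> \<tau> * (m * ballvol * (m * (2 * C0) + \<epsilon> * C1))"
    proof (rule volume_shell)
      show "0 \<le> m * (2 * C0) + \<epsilon> * C1" using m0 C0' C1' \<epsilon>_pos by simp
      fix y assume "y \<in> U"
      then have y: "y \<in> ball 0 \<epsilon>" using sub by auto
      have "norm (snd (Z (x, y))) \<le> C1"
        using C1[OF y] norm_snd_le[of "snd (Z (x, y))" "fst (Z (x, y))"] by simp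
      moreover have "\<bar>z (x, y) - c\<bar> \<le> 2 * C0" using C0[OF y] cC0 by linarith
      ultimately have "g y \<le> m * (2 * C0) + \<epsilon> * C1"
        unfolding g_def m_def[symmetric] c_def[symmetric]
        using m0 \<epsilon>_pos by (intro add_mono mult_left_mono) auto
      then show "\<bar>g y\<bar> \<le> m * (2 * C0) + \<epsilon> * C1" using g0[of y] by simp
    qed (use cg in auto)
    then show ?thesis by linarith
  qed
  have "h (x - t) * (N (x - t) - N x) = ?I D' (\<lambda>y. z (x - t, y) - z (x, y)) + (?I D' ?k - ?I D ?k)"
  proof -
    have "?I D' (\<lambda>y. z (x - t, y) - z (x, y)) = h (x - t) * N (x - t) - ?I D' (\<lambda>y. z (x, y))"
      using ID(2)[OF czs, of "x - t"] ID(2)[OF czs, of x] by (simp add: right_diff_distrib Nxt)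
    moreover have "?I D' ?k = ?I D' (\<lambda>y. z (x, y)) - ?I D' (\<lambda>y. c)"
      unfolding right_diff_distrib
      by (intro Bochner_Integration.integral_diff ID continuous_on_const czs)
    moreover have "?I D ?k = ?I D (\<lambda>y. z (x, y)) - ?I D (\<lambda>y. c)"
      unfolding right_diff_distrib
      by (intro Bochner_Integration.integral_diff ID continuous_on_const czs)
    ultimately show ?thesis unfolding hD Nx c_def[symmetric] by (simp add: algebra_simps)
  qed
  note main = this
  have decomp: "h (x - t) * (N (x - t) - N x) + t * ?I D ?zx
     = (?I D' (\<lambda>y. z (x - t, y) - z (x, y)) + t * ?I D' ?zx) - t * (?I D' ?zx - ?I D ?zx) + (?I D' ?k - ?I D ?k)"
  proof -
    have "A = B + E \<Longrightarrow> A + t * X = (B + t * Y) - t * (Y - X) + E" for A B E X Y :: real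
      by (simp add: algebra_simps)
    from this[OF main] show ?thesis .
  qed
  have "\<bar>t * (?I D' ?zx - ?I D ?zx)\<bar> \<le> t * (\<tau> * (m * ballvol * C1))"
    using T2 t by (simp add: abs_mult)
  with T1 T3 have "\<bar>h (x - t) * (N (x - t) - N x) + t * ?I D ?zx\<bar>
      \<le> t * (e * ballvol) + t * (\<tau> * (m * ballvol * C1)) + \<tau> * (?I U g + \<epsilon> * e * ballvol)"
    unfolding decomp by linarith
  also have "\<dots> \<le> t * (e * ballvol) + t * (\<tau> * (m * ballvol * C1))
      + \<tau> * ((?I D g + \<tau> * (m * ballvol * (m * (2 * C0) + \<epsilon> * C1))) + \<epsilon> * e * ballvol)"
    using T4 \<tau> by (intro add_left_mono mult_left_mono add_right_mono) auto
  also have "\<dots> = \<tau> * ?I D g + t * (e * (ballvol + \<epsilon> * ballvol / \<rho> x))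
      + t * \<tau> * (m * ballvol * (C1 + (m * (2 * C0) + \<epsilon> * C1) / \<rho> x))"
  proof -
    have alg: "t * (e * b) + t * (\<tau> * (m * b * C1)) + \<tau> * ((X + \<tau> * (m * b * G)) + \<epsilon> * e * b)
        = \<tau> * X + t * (e * (b + \<epsilon> * b / R)) + t * \<tau> * (m * b * (C1 + G / R))"
      if "R > 0" "t = \<tau> * R" for R X b G
      using that(1) unfolding that(2) by (simp add: field_simps)
    have "t = t / R * R" if "R > 0" for R using that by simp
    from this[OF r(1)] have "t = \<tau> * \<rho> x" unfolding \<tau>_def .
    from alg[OF r(1) this] show ?thesis .
  qed
  finally show "\<bar>h (x - t) * (N (x - t) - N x) + t * slice_int x (\<lambda>y. fst (Z (x, y)))\<bar>
    \<le> t / \<rho> x * slice_int x g + t * (e * (ballvol + \<epsilon> * ballvol / \<rho> x))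
      + t * (t / \<rho> x) * (real DIM('b) * ballvol * (C1 + (real DIM('b) * (2 * C0) + \<epsilon> * C1) / \<rho> x))"
    unfolding D_def \<tau>_def m_def .
qed

end

lemma bounded_support_integrable:
  fixes f :: "'a::euclidean_space \<Rightarrow> real"
  assumes f: "f \<in> borel_measurable borel" and C: "\<And>x. \<bar>f x\<bar> \<le> C" and S: "bounded S" "S \<in> sets borel"
    and 0: "\<And>x. x \<notin> S \<Longrightarrow> f x = 0"
  shows "integrable lborel f"
proof -
  have "integrable lborel (\<lambda>x. indicator S x * C)"
    using S emeasure_bounded_finite[OF S(1)] by simp
  then show ?thesis
  proof (rule Bochner_Integration.integrable_bound)
    have "\<bar>f x\<bar> \<le> \<bar>indicator S x * C\<bar>" for x
      using C[of x] 0[of x] by (cases "x \<in> S") auto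
    then show "AE x in lborel. norm (f x) \<le> norm (indicator S x * C)" by simp
  qed (use f in simp)
qed

lemma abs_integral_le_integral:
  fixes f g :: "'a \<Rightarrow> real"
  assumes "integrable M f" "integrable M g" "\<And>x. \<bar>f x\<bar> \<le> g x"
  shows "\<bar>\<integral>x. f x \<partial>M\<bar> \<le> (\<integral>x. g x \<partial>M)"
  by (rule order_trans[OF integral_abs_bound], rule integral_mono) (use assms in auto)

text \<open>
  Pairing the increments of \<open>N\<close> over \<open>t\<close> with a primitive of \<open>\<phi>\<close> gives, by Fubini, the local averages of
  \<open>N\<close> paired with \<open>\<phi>\<close>: a summation by parts that asks no differentiability of \<open>N\<close>.
\<close>

lemma pairing_with_primitive:
  fixes \<phi> N F :: "real \<Rightarrow> real"
  assumes \<phi>: "\<phi> \<in> borel_measurable borel" "\<And>x. \<bar>\<phi> x\<bar> \<le> C" "\<And>x. x \<notin> {a..b} \<Longrightarrow> \<phi> x = 0"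
    and N: "N \<in> borel_measurable borel" "\<And>x. \<bar>N x\<bar> \<le> C'"
    and F: "\<And>x. F x = (\<integral>s. indicator {..x} s * \<phi> s \<partial>lborel)"
    and Fm: "F \<in> borel_measurable borel" and FC: "\<And>x. \<bar>F x\<bar> \<le> CF" and F0: "\<And>x. x \<notin> {a..b} \<Longrightarrow> F x = 0"
    and t: "0 < t" "t \<le> 1"
    and L: "\<And>x s. x \<in> {a..b} \<Longrightarrow> 0 < s \<Longrightarrow> s \<le> t \<Longrightarrow> \<bar>N (x - s) - N x\<bar> \<le> L * s" "L \<ge> 0"
  shows "\<bar>(\<integral>x. F x * (N (x - t) - N x) \<partial>lborel) - t * (\<integral>x. \<phi> x * N x \<partial>lborel)\<bar> \<le> t * (t * L * (\<integral>x. \<bar>\<phi> x\<bar> \<partial>lborel))"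
proof -
  note [measurable] = \<phi>(1) N(1) Fm
  have C: "C \<ge> 0" "C' \<ge> 0" "CF \<ge> 0"
    using \<phi>(2)[of 0] N(2)[of 0] FC[of 0] by linarith+
  have pm: "\<bar>x * y\<bar> \<le> c * d" if "\<bar>x\<bar> \<le> c" "\<bar>y\<bar> \<le> d" for x y c d :: real
    unfolding abs_mult using that by (intro mult_mono) auto
  have I\<phi>: "integrable lborel \<phi>"
    by (rule bounded_support_integrable[OF \<phi>(1,2), of "{a..b}"]) (use \<phi>(3) in auto)
  have I1: "integrable lborel (\<lambda>x. F x * N (x - u))" for u
    by (rule bounded_support_integrable[of _ "CF * C'" "{a..b}"]) (use F0 pm[OF FC N(2)] in auto)
  have I2: "integrable lborel (\<lambda>x. F (x + u) * N x)" for u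
  proof (rule bounded_support_integrable[of _ "CF * C'" "{a - u..b - u}"])
    show "F (x + u) * N x = 0" if "x \<notin> {a - u..b - u}" for x
      using F0[of "x + u"] that by auto
  qed (use pm[OF FC N(2)] in auto)
  have I3: "integrable lborel (\<lambda>s. indicator {..x} s * \<phi> s)" for x
    by (rule Bochner_Integration.integrable_bound[OF I\<phi>]) (auto simp: indicator_def)
  let ?G = "\<lambda>p::real \<times> real. indicator {fst p<..fst p + t} (snd p) * \<phi> (snd p) * N (fst p)"
  have Gm: "?G \<in> borel_measurable borel"
  proof -
    have "(\<lambda>p::real \<times> real. of_bool (fst p < snd p \<and> snd p \<le> fst p + t) * \<phi> (snd p) * N (fst p)) \<in> borel_measurable (borel \<Otimes>\<^sub>M borel)"
      by measurable
    then show ?thesis by (simp add: borel_prod indicator_def)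
  qed
  have IG: "integrable lborel ?G"
  proof (rule bounded_support_integrable[OF Gm, of "C * C'" "{a - 1..b} \<times> {a..b}"])
    fix p :: "real \<times> real"
    show "\<bar>?G p\<bar> \<le> C * C'" using pm[OF \<phi>(2)[of "snd p"] N(2)[of "fst p"]] C by (auto simp: indicator_def)
    assume "p \<notin> {a - 1..b} \<times> {a..b}"
    then show "?G p = 0" using \<phi>(3)[of "snd p"] t by (cases p) (auto simp: indicator_def)
  qed (auto intro: bounded_Times borel_closed closed_Times)
  have Fd: "F (x + t) - F x = (\<integral>s. indicator {x<..x + t} s * \<phi> s \<partial>lborel)" for x
  proof -
    have "F (x + t) - F x = (\<integral>s. indicator {..x + t} s * \<phi> s - indicator {..x} s * \<phi> s \<partial>lborel)"
      unfolding F using I3 by simp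
    also have "\<dots> = (\<integral>s. indicator {x<..x + t} s * \<phi> s \<partial>lborel)"
      using t by (intro Bochner_Integration.integral_cong) (auto simp: indicator_def)
    finally show ?thesis .
  qed
  have "(\<integral>x. F x * N (x - t) \<partial>lborel) = (\<integral>x. F (x + t) * N x \<partial>lborel)"
    using integral_affine[of 1 "\<lambda>x. F x * N (x - t)" t] by (simp add: add.commute)
  then have "(\<integral>x. F x * (N (x - t) - N x) \<partial>lborel) = (\<integral>x. (F (x + t) - F x) * N x \<partial>lborel)"
    using I1[of t] I1[of 0] I2[of t] by (simp add: right_diff_distrib left_diff_distrib)
  also have "\<dots> = (\<integral>x. (\<integral>s. ?G (x, s) \<partial>lborel) \<partial>lborel)"
    by (simp add: Fd)
  also have "\<dots> = (\<integral>s. (\<integral>x. ?G (x, s) \<partial>lborel) \<partial>lborel)"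
    using integral_lborel_pair(1)[OF IG] integral_lborel_pair(2)[OF IG] by simp
  also have "\<dots> = (\<integral>s. \<phi> s * (\<integral>x. indicator {s - t..<s} x * N x \<partial>lborel) \<partial>lborel)"
  proof (intro Bochner_Integration.integral_cong refl)
    fix s
    have "(\<integral>x. ?G (x, s) \<partial>lborel) = (\<integral>x. \<phi> s * (indicator {s - t..<s} x * N x) \<partial>lborel)"
      by (intro Bochner_Integration.integral_cong refl) (auto simp: indicator_def)
    then show "(\<integral>x. ?G (x, s) \<partial>lborel) = \<phi> s * (\<integral>x. indicator {s - t..<s} x * N x \<partial>lborel)" by simp
  qed
  finally have S: "(\<integral>x. F x * (N (x - t) - N x) \<partial>lborel) = (\<integral>s. \<phi> s * (\<integral>x. indicator {s - t..<s} x * N x \<partial>lborel) \<partial>lborel)" .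
  have IN: "integrable lborel (\<lambda>x. indicator {s - t..<s} x * N x)" for s
    by (rule bounded_support_integrable[of _ "C'" "{s - t..<s}"])
      (use N(2) C in \<open>auto simp: indicator_def bounded_subset[OF bounded_closed_interval[of "s - t" s]] subset_iff\<close>)
  let ?M = "\<lambda>s. \<integral>x. indicator {s - t..<s} x * N x \<partial>lborel"
  have loc: "\<bar>?M s - t * N s\<bar> \<le> t * (t * L)" if s: "s \<in> {a..b}" for s
  proof -
    have c: "integrable lborel (\<lambda>x. indicator {s - t..<s} x * c)" "(\<integral>x. indicator {s - t..<s} x * c \<partial>lborel) = t * c" for c :: real
      using t by auto
    have eq: "?M s - t * N s = (\<integral>x. indicator {s - t..<s} x * N x - indicator {s - t..<s} x * N s \<partial>lborel)"
      unfolding c(2)[of "N s", symmetric] by (rule Bochner_Integration.integral_diff[OF IN c(1), symmetric])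
    have "\<bar>?M s - t * N s\<bar> \<le> (\<integral>x. indicator {s - t..<s} x * (t * L) \<partial>lborel)"
      unfolding eq
    proof (rule abs_integral_le_integral)
      fix x
      show "\<bar>indicator {s - t..<s} x * N x - indicator {s - t..<s} x * N s\<bar> \<le> indicator {s - t..<s} x * (t * L)"
      proof (cases "x \<in> {s - t..<s}")
        case True
        then have "\<bar>N (s - (s - x)) - N s\<bar> \<le> L * (s - x)" by (intro L s) auto
        also have "\<dots> \<le> L * t" using True L(2) by (intro mult_left_mono) auto
        finally show ?thesis using True by (simp add: mult.commute)
      qed simp
    qed (use IN c in auto)
    also have "\<dots> = t * (t * L)" by (rule c)
    finally show ?thesis .
  qed
  have Mm[measurable]: "?M \<in> borel_measurable borel"
  proof -
    have "(\<lambda>s. \<integral>x. of_bool (s - t \<le> x \<and> x < s) * N x \<partial>lborel) \<in> borel_measurable borel" by measurable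
    then show ?thesis by (simp add: indicator_def)
  qed
  have MC: "\<bar>?M s\<bar> \<le> t * C'" for s
  proof -
    have "\<bar>?M s\<bar> \<le> (\<integral>x. indicator {s - t..<s} x * C' \<partial>lborel)"
    proof (rule abs_integral_le_integral[OF IN])
      show "integrable lborel (\<lambda>x. indicator {s - t..<s} x * C')" using t by auto
    qed (use N(2) in \<open>auto split: split_indicator\<close>)
    also have "\<dots> = t * C'" using t by simp
    finally show ?thesis .
  qed
  have J1: "integrable lborel (\<lambda>s. \<phi> s * ?M s)"
    by (rule bounded_support_integrable[of _ "C * (t * C')" "{a..b}"]) (use \<phi>(3) pm[OF \<phi>(2) MC] in auto)
  have J2: "integrable lborel (\<lambda>s. \<phi> s * N s)"
    by (rule bounded_support_integrable[of _ "C * C'" "{a..b}"]) (use \<phi>(3) pm[OF \<phi>(2) N(2)] in auto)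
  have eq: "(\<integral>s. \<phi> s * ?M s \<partial>lborel) - t * (\<integral>x. \<phi> x * N x \<partial>lborel) = (\<integral>s. \<phi> s * ?M s - t * (\<phi> s * N s) \<partial>lborel)"
    using J1 J2 by simp
  have "\<bar>(\<integral>s. \<phi> s * ?M s \<partial>lborel) - t * (\<integral>x. \<phi> x * N x \<partial>lborel)\<bar> \<le> (\<integral>s. t * (t * L) * \<bar>\<phi> s\<bar> \<partial>lborel)"
    unfolding eq
  proof (rule abs_integral_le_integral)
    fix s
    have "\<phi> s * ?M s - t * (\<phi> s * N s) = \<phi> s * (?M s - t * N s)" by (simp add: algebra_simps)
    then show "\<bar>\<phi> s * ?M s - t * (\<phi> s * N s)\<bar> \<le> t * (t * L) * \<bar>\<phi> s\<bar>"
      using loc[of s] \<phi>(3)[of s] mult_left_mono[OF loc[of s], of "\<bar>\<phi> s\<bar>"]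
      by (cases "s \<in> {a..b}") (auto simp: abs_mult mult.commute)
  qed (use J1 J2 I\<phi> in auto)
  then show ?thesis unfolding S by (simp add: mult_ac)
qed

context slab
begin

lemma slice_average_measurable:
  assumes "continuous_on UNIV z"
  shows "P \<Omega> z \<in> borel_measurable borel"
  by (rule P_measurable, intro measurable_restrict_space1) (simp add: borel_measurable_continuous_onI assms)

lemma slice_int_measurable:
  fixes k :: "real \<Rightarrow> 'b \<Rightarrow> real"
  assumes [measurable]: "(\<lambda>p. k (fst p) (snd p)) \<in> borel_measurable borel"
  shows "(\<lambda>x. slice_int x (k x)) \<in> borel_measurable borel"
proof -
  have [measurable]: "(\<lambda>p. indicator \<Omega> p * k (fst p) (snd p)) \<in> borel_measurable borel" by measurable
  have "(\<lambda>x. \<integral>y. indicator \<Omega> (x, y) * k (fst (x, y)) (snd (x, y)) \<partial>lborel) \<in> borel_measurable borel"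
    by measurable
  then show ?thesis by (simp add: slice_indicator)
qed

text \<open>
  The difference quotients of a slice average, uniformly on a compact subinterval: the average of the
  derivative in the first coordinate, up to the oscillation along the slice.
\<close>

lemma slice_average_difference_uniform:
  fixes z :: "real \<times> 'b \<Rightarrow> real" and Z :: "real \<times> 'b \<Rightarrow> real \<times> 'b"
  assumes z: "\<And>p. (z has_derivative (\<lambda>h. Z p \<bullet> h)) (at p)" and Z: "continuous_on UNIV Z"
    and \<alpha>\<beta>: "0 < \<alpha>" "\<beta> < 1"
  defines "N \<equiv> P \<Omega> z"
  defines "g \<equiv> \<lambda>x y. real DIM('b) * \<bar>z (x, y) - N x\<bar> + \<epsilon> * norm (snd (Z (x, y)))"
  obtains C L t1 where "L \<ge> 0" "t1 > 0" "\<And>x. \<bar>N x\<bar> \<le> C" "\<And>x. \<bar>slice_int x (\<lambda>y. fst (Z (x, y)))\<bar> \<le> C"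
      "\<And>x. \<bar>slice_int x (g x)\<bar> \<le> C"
      "\<And>x t. x \<in> {\<alpha>..\<beta>} \<Longrightarrow> 0 < t \<Longrightarrow> t < t1 \<Longrightarrow> \<bar>N (x - t) - N x\<bar> \<le> L * t"
      "\<And>e. e > 0 \<Longrightarrow> \<exists>t0>0. \<forall>x t. x \<in> {\<alpha>..\<beta>} \<longrightarrow> 0 < t \<longrightarrow> t < t0 \<longrightarrow>
        \<bar>h x * (N (x - t) - N x) + t * slice_int x (\<lambda>y. fst (Z (x, y)))\<bar> \<le> t / \<rho> x * slice_int x (g x) + t * e"
proof -
  define m where "m = real DIM('b)"
  define r0 where "r0 = min 1 (min (\<alpha> / 2) (1 - \<beta>))"
  have m0: "m \<ge> 1" by (simp add: m_def)
  have r0: "0 < r0" "r0 \<le> 1" "r0 \<le> \<alpha> / 2" "r0 \<le> 1 - \<beta>" using \<alpha>\<beta> unfolding r0_def by (simp_all add: min_def)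
  have \<rho>: "r0 \<le> \<rho> x" "0 < x" "x < 1" "\<alpha> / 2 \<le> x - t" if "x \<in> {\<alpha>..\<beta>}" "t < r0" for x t
    using that r0 \<alpha>\<beta> by auto
  have cz: "continuous_on UNIV z"
    using z by (meson continuous_at_imp_continuous_on has_derivative_continuous)
  let ?K = "{0..1::real} \<times> cball (0::'b) \<epsilon>"
  have K: "compact ?K" "bounded ?K" by (auto intro: compact_Times bounded_Times)
  obtain C0 where C0: "C0 > 0" "\<And>p. p \<in> ?K \<Longrightarrow> \<bar>z p\<bar> \<le> C0"
    using continuous_bounded_on_bounded[OF cz K(2)] by (metis real_norm_def)
  obtain C1 where C1: "C1 > 0" "\<And>p. p \<in> ?K \<Longrightarrow> norm (Z p) \<le> C1"
    using continuous_bounded_on_bounded[OF Z K(2)] by blast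
  have inK: "(x, y) \<in> ?K" if "0 < x" "x < 1" "y \<in> ball 0 \<epsilon>" for x y using that by auto
  have uc: "uniformly_continuous_on ?K Z"
    by (rule compact_uniformly_continuous[OF continuous_on_subset[OF Z] K(1)]) simp
  have czs: "continuous_on UNIV (\<lambda>y. z (x, y))" and cZs: "continuous_on UNIV (\<lambda>y. Z (x, y))" for x
    by (intro continuous_slice cz Z)+
  have cg: "continuous_on UNIV (g x)" for x unfolding g_def by (intro continuous_intros czs cZs)
  define G where "G = m * (2 * C0) + \<epsilon> * C1"
  have G: "G > 0" using m0 C0 C1 \<epsilon>_pos by (simp add: G_def add_pos_pos)
  have NC: "\<bar>N x\<bar> \<le> C0" for x
  proof (cases "x \<in> {0<..<1}")
    case True
    have "\<bar>slice_int x (\<lambda>y. z (x, y))\<bar> \<le> h x * C0"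
    proof (rule slice_int_abs_le[OF czs])
      fix y assume "y \<in> slice \<Omega> x"
      then show "\<bar>z (x, y)\<bar> \<le> C0" using slice_sub[of x] True by (intro C0 inK) auto
    qed
    then show ?thesis using h_pos[of x] True by (simp add: N_def P_slice_int abs_mult field_simps)
  next
    case False
    then show ?thesis using C0(1) by (simp add: N_def P_slice_int h_outside)
  qed
  have AC: "\<bar>slice_int x (\<lambda>y. fst (Z (x, y)))\<bar> \<le> ballvol * C1" for x
  proof (cases "x \<in> {0<..<1}")
    case True
    have "\<bar>slice_int x (\<lambda>y. fst (Z (x, y)))\<bar> \<le> h x * C1"
    proof (rule slice_int_abs_le)
      fix y assume "y \<in> slice \<Omega> x"
      then have "norm (Z (x, y)) \<le> C1" using slice_sub[of x] True by (intro C1 inK) auto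
      then show "\<bar>fst (Z (x, y))\<bar> \<le> C1" using norm_fst_le[of "fst (Z (x, y))" "snd (Z (x, y))"] by simp
    qed (intro continuous_intros cZs)
    also have "\<dots> \<le> ballvol * C1" using h_le_ballvol C1 by (intro mult_right_mono) auto
    finally show ?thesis .
  qed (use C1 ballvol_pos in \<open>simp add: slice_outside\<close>)
  have gC: "\<bar>slice_int x (g x)\<bar> \<le> ballvol * G" for x
  proof (cases "x \<in> {0<..<1}")
    case True
    have "\<bar>slice_int x (g x)\<bar> \<le> h x * G"
    proof (rule slice_int_abs_le[OF cg])
      fix y assume "y \<in> slice \<Omega> x"
      then have y: "(x, y) \<in> ?K" using slice_sub[of x] True by (intro inK) auto
      have "norm (snd (Z (x, y))) \<le> C1" using C1(2)[OF y] norm_snd_le[of "snd (Z (x, y))" "fst (Z (x, y))"] by simp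
      moreover have "\<bar>z (x, y) - N x\<bar> \<le> 2 * C0" using C0(2)[OF y] NC[of x] by linarith
      ultimately have "g x y \<le> G" unfolding g_def G_def m_def using \<epsilon>_pos by (intro add_mono mult_left_mono) auto
      moreover have "g x y \<ge> 0" using \<epsilon>_pos by (simp add: g_def)
      ultimately show "\<bar>g x y\<bar> \<le> G" by simp
    qed
    also have "\<dots> \<le> ballvol * G" using h_le_ballvol G by (intro mult_right_mono) auto
    finally show ?thesis .
  qed (use G ballvol_pos in \<open>simp add: slice_outside\<close>)
  obtain hm where hm: "hm > 0" "\<And>x. x \<in> {\<alpha> / 2..\<beta>} \<Longrightarrow> hm \<le> h x"
  proof -
    have "{\<alpha> / 2..\<beta>} \<subseteq> {0<..<1}" using \<alpha>\<beta> by auto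
    then show thesis using N.w_locally_bounded_below[OF compact_Icc] that by blast
  qed
  define K1 where "K1 = ballvol + \<epsilon> * ballvol / r0"
  define K2 where "K2 = (m * ballvol * (C1 + G / r0)) / r0"
  have K12: "K1 > 0" "K2 > 0"
    using ballvol_pos \<epsilon>_pos r0 m0 C1 G by (auto simp: K1_def K2_def add_pos_pos)
  \<comment> \<open>The pointwise estimate with constants uniform in \<open>x\<close>.\<close>
  have base: "\<exists>t2>0. t2 \<le> r0 \<and> (\<forall>x t. x \<in> {\<alpha>..\<beta>} \<longrightarrow> 0 < t \<longrightarrow> t < t2 \<longrightarrow>
      \<bar>h (x - t) * (N (x - t) - N x) + t * slice_int x (\<lambda>y. fst (Z (x, y)))\<bar>
        \<le> t / \<rho> x * slice_int x (g x) + t * (e * K1 + t * K2) \<and>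
      \<bar>h (x - t) - h x\<bar> \<le> t * (m * ballvol / r0))" if e: "e > 0" for e
  proof -
    obtain d where d: "d > 0" "\<And>p q. p \<in> ?K \<Longrightarrow> q \<in> ?K \<Longrightarrow> dist q p < d \<Longrightarrow> dist (Z q) (Z p) < e"
      using uc e unfolding uniformly_continuous_on_def by metis
    define t2 where "t2 = min r0 (min d (d * r0 / \<epsilon>))"
    have t2: "t2 > 0" "t2 \<le> r0" "t2 \<le> d" "t2 \<le> d * r0 / \<epsilon>" using r0 d(1) \<epsilon>_pos by (auto simp: t2_def)
    have "\<bar>h (x - t) * (N (x - t) - N x) + t * slice_int x (\<lambda>y. fst (Z (x, y)))\<bar>
        \<le> t / \<rho> x * slice_int x (g x) + t * (e * K1 + t * K2) \<and>
      \<bar>h (x - t) - h x\<bar> \<le> t * (m * ballvol / r0)"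
      if x: "x \<in> {\<alpha>..\<beta>}" and t: "0 < t" "t < t2" for x t
    proof -
      have tr: "t < r0" using t t2 by linarith
      note \<rho>' = \<rho>[OF x tr]
      have rx: "\<rho> x > 0" using \<rho>'(1) r0(1) by linarith
      have ex: "norm (Z (x - s, y) - Z (x, y)) \<le> e" if "y \<in> ball 0 \<epsilon>" "0 \<le> s" "s \<le> t" for y s
      proof -
        have "0 < x - s" "x - s < 1" using that \<rho>' \<alpha>\<beta> by auto
        moreover have "dist (x - s, y) (x, y) < d" using that t t2 by (simp add: dist_Pair_Pair dist_norm)
        ultimately have "dist (Z (x - s, y)) (Z (x, y)) < e" using that \<rho>' by (intro d(2) inK) auto
        then show ?thesis by (simp add: dist_norm)
      qed
      have ey: "norm (Z (x, (1 - s) *\<^sub>R y) - Z (x, y)) \<le> e" if "y \<in> ball 0 \<epsilon>" "0 \<le> s" "s \<le> t / \<rho> x" for y s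
      proof -
        have "t / \<rho> x \<le> t / r0" using \<rho>'(1) r0(1) rx t by (intro divide_left_mono mult_pos_pos) auto
        then have s: "s \<le> t / r0" using that by linarith
        also have "\<dots> < 1" using tr r0 by simp
        finally have s1: "s < 1" .
        have "norm ((1 - s) *\<^sub>R y) \<le> norm y" using that s1 by (simp add: mult_left_le_one_le)
        then have "(1 - s) *\<^sub>R y \<in> ball 0 \<epsilon>" using that by simp
        moreover have "dist (x, (1 - s) *\<^sub>R y) (x, y) < d"
        proof -
          have "(1 - s) *\<^sub>R y - y = - (s *\<^sub>R y)" by (simp add: algebra_simps)
          then have "dist (x, (1 - s) *\<^sub>R y) (x, y) = s * norm y" using that by (simp add: dist_Pair_Pair dist_norm)
          also have "\<dots> \<le> (t / r0) * \<epsilon>" using s that by (intro mult_mono) auto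
          also have "\<dots> < d"
          proof -
            have "t < d * r0 / \<epsilon>" using t t2(4) by linarith
            then show ?thesis using r0 \<epsilon>_pos by (simp add: field_simps)
          qed
          finally show ?thesis .
        qed
        ultimately have "dist (Z (x, (1 - s) *\<^sub>R y)) (Z (x, y)) < e" using that \<rho>' by (intro d(2) inK) auto
        then show ?thesis by (simp add: dist_norm)
      qed
      have C0x: "\<bar>z (x, y)\<bar> \<le> C0" "norm (Z (x, y)) \<le> C1" if "y \<in> ball 0 \<epsilon>" for y
        using C0(2) C1(2) inK[OF \<rho>'(2,3) that] by auto
      have t\<rho>: "t < \<rho> x" using tr \<rho>'(1) by linarith
      note D = slice_average_difference[OF z Z \<rho>'(2,3) t(1) t\<rho> C0x less_imp_le[OF e] ex ey, folded N_def, folded m_def, folded G_def]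
      have le: "a / \<rho> x \<le> a / r0" if "a \<ge> 0" for a
        using \<rho>'(1) r0(1) rx that by (intro divide_left_mono mult_pos_pos) auto
      have 1: "t * (e * (ballvol + \<epsilon> * ballvol / \<rho> x)) \<le> t * (e * K1)"
        unfolding K1_def using t e le[of "\<epsilon> * ballvol"] \<epsilon>_pos ballvol_pos by (intro mult_left_mono add_left_mono) auto
      have "C1 + G / \<rho> x \<le> C1 + G / r0" using le[of G] G by simp
      then have "(t / \<rho> x) * (m * ballvol * (C1 + G / \<rho> x)) \<le> (t / r0) * (m * ballvol * (C1 + G / r0))"
        using le[of t] t m0 ballvol_pos C1(1) G rx r0(1)
        by (intro mult_mono mult_left_mono) (auto intro!: mult_nonneg_nonneg add_nonneg_nonneg)
      also have "\<dots> = t * K2" by (simp add: K2_def)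
      finally have "t * ((t / \<rho> x) * (m * ballvol * (C1 + G / \<rho> x))) \<le> t * (t * K2)"
        using t by (intro mult_left_mono) auto
      then have 2: "t * (t / \<rho> x) * (m * ballvol * (C1 + G / \<rho> x)) \<le> t * (t * K2)" by (simp only: mult.assoc)
      have g_eq: "g x = (\<lambda>y. m * \<bar>z (x, y) - N x\<bar> + \<epsilon> * norm (snd (Z (x, y))))"
        by (simp add: g_def m_def)
      have 3: "t / \<rho> x * (m * ballvol) \<le> t * (m * ballvol / r0)"
        using mult_right_mono[OF le[of t], of "m * ballvol"] t m0 ballvol_pos by simp
      show ?thesis
        using D(1) D(2) 1 2 3 unfolding g_eq distrib_left by linarith
    qed
    then show ?thesis using t2 by blast
  qed
  \<comment> \<open>The Lipschitz bound.\<close>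
  obtain t1 where t1: "t1 > 0" "t1 \<le> r0" and B1: "\<And>x t. x \<in> {\<alpha>..\<beta>} \<Longrightarrow> 0 < t \<Longrightarrow> t < t1 \<Longrightarrow>
      \<bar>h (x - t) * (N (x - t) - N x) + t * slice_int x (\<lambda>y. fst (Z (x, y)))\<bar>
        \<le> t / \<rho> x * slice_int x (g x) + t * (1 * K1 + t * K2)"
    using base[of 1] by auto
  define L where "L = (ballvol * C1 + ballvol * G / r0 + K1 + K2) / hm"
  have L: "L > 0" using hm K12 ballvol_pos C1 G r0 by (auto simp: L_def add_pos_pos)
  have Lip: "\<bar>N (x - t) - N x\<bar> \<le> L * t" if x: "x \<in> {\<alpha>..\<beta>}" and t: "0 < t" "t < t1" for x t
  proof -
    have tr: "t < r0" using t t1 by linarith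
    note \<rho>' = \<rho>[OF x tr]
    have rx: "\<rho> x > 0" using \<rho>'(1) r0(1) by linarith
    have hx: "hm \<le> h (x - t)" by (rule hm(2)) (use x t \<rho>' in auto)
    have "t / \<rho> x * slice_int x (g x) \<le> t / r0 * (ballvol * G)"
      using gC[of x] \<rho>'(1) r0(1) rx t G ballvol_pos
      by (intro mult_mono' order_trans[OF abs_ge_self gC] divide_left_mono mult_pos_pos)
        (auto intro!: integral_nonneg_AE simp: g_def \<epsilon>_pos less_imp_le)
    moreover have "\<bar>t * slice_int x (\<lambda>y. fst (Z (x, y)))\<bar> \<le> t * (ballvol * C1)"
      using AC[of x] t by (simp add: abs_mult)
    moreover have "t * (1 * K1 + t * K2) \<le> t * (K1 + K2)"
      using t tr r0 K12 by (intro mult_left_mono) (auto simp: mult_left_le_one_le)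
    ultimately have "\<bar>h (x - t) * (N (x - t) - N x)\<bar> \<le> t / r0 * (ballvol * G) + t * (K1 + K2) + t * (ballvol * C1)"
      using B1[OF x t] by linarith
    also have "\<dots> = (L * t) * hm"
      using hm(1) r0 by (simp add: L_def field_simps)
    finally have "h (x - t) * \<bar>N (x - t) - N x\<bar> \<le> (L * t) * hm"
      by (simp add: abs_mult)
    moreover have "hm * \<bar>N (x - t) - N x\<bar> \<le> h (x - t) * \<bar>N (x - t) - N x\<bar>"
      using hx by (intro mult_right_mono) auto
    ultimately have "hm * \<bar>N (x - t) - N x\<bar> \<le> hm * (L * t)" by (simp add: mult.commute)
    then show ?thesis using hm(1) by (simp only: mult_le_cancel_left_pos)
  qed
  have lim: "\<exists>t0>0. \<forall>x t. x \<in> {\<alpha>..\<beta>} \<longrightarrow> 0 < t \<longrightarrow> t < t0 \<longrightarrow>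
        \<bar>h x * (N (x - t) - N x) + t * slice_int x (\<lambda>y. fst (Z (x, y)))\<bar> \<le> t / \<rho> x * slice_int x (g x) + t * e"
    if e: "e > 0" for e
  proof -
    define e1 where "e1 = e / (2 * K1)"
    define Q where "Q = K2 + (m * ballvol / r0) * L"
    have e1: "e1 > 0" "e1 * K1 = e / 2" using e K12 by (auto simp: e1_def)
    have Q: "Q > 0" using K12 m0 ballvol_pos r0 L by (auto simp: Q_def intro!: add_pos_nonneg mult_nonneg_nonneg)
    obtain t2 where t2: "t2 > 0" "t2 \<le> r0" and B2: "\<And>x t. x \<in> {\<alpha>..\<beta>} \<Longrightarrow> 0 < t \<Longrightarrow> t < t2 \<Longrightarrow>
      \<bar>h (x - t) * (N (x - t) - N x) + t * slice_int x (\<lambda>y. fst (Z (x, y)))\<bar>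
        \<le> t / \<rho> x * slice_int x (g x) + t * (e1 * K1 + t * K2)"
      "\<And>x t. x \<in> {\<alpha>..\<beta>} \<Longrightarrow> 0 < t \<Longrightarrow> t < t2 \<Longrightarrow> \<bar>h (x - t) - h x\<bar> \<le> t * (m * ballvol / r0)"
      using base[OF e1(1)] by auto
    define t0 where "t0 = min (min t1 t2) (e / (2 * Q))"
    have t0: "t0 > 0" "t0 \<le> t1" "t0 \<le> t2" "t0 \<le> e / (2 * Q)" using t1 t2 e Q by (auto simp: t0_def)
    have "\<bar>h x * (N (x - t) - N x) + t * slice_int x (\<lambda>y. fst (Z (x, y)))\<bar> \<le> t / \<rho> x * slice_int x (g x) + t * e"
      if x: "x \<in> {\<alpha>..\<beta>}" and t: "0 < t" "t < t0" for x t
    proof -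
      have tt: "t < t1" "t < t2" using t t0 by auto
      let ?\<Delta> = "N (x - t) - N x"
      have "\<bar>(h (x - t) - h x) * ?\<Delta>\<bar> \<le> (t * (m * ballvol / r0)) * (L * t)"
        unfolding abs_mult by (intro mult_mono B2(2) Lip x t tt) (use t m0 ballvol_pos r0 in auto)
      moreover have "h x * ?\<Delta> = h (x - t) * ?\<Delta> - (h (x - t) - h x) * ?\<Delta>" by (simp add: algebra_simps)
      ultimately have "\<bar>h x * ?\<Delta> + t * slice_int x (\<lambda>y. fst (Z (x, y)))\<bar>
          \<le> t / \<rho> x * slice_int x (g x) + t * (e1 * K1 + t * K2) + (t * (m * ballvol / r0)) * (L * t)"
        using B2(1)[OF x t(1) tt(2)] by linarith
      also have "\<dots> = t / \<rho> x * slice_int x (g x) + t * (e / 2 + t * Q)"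
        unfolding e1(2) Q_def by (simp add: algebra_simps)
      also have "\<dots> \<le> t / \<rho> x * slice_int x (g x) + t * e"
      proof (intro add_left_mono mult_left_mono)
        have "t * Q \<le> e / (2 * Q) * Q" using t t0 Q by (intro mult_right_mono) auto
        also have "\<dots> = e / 2" using Q by simp
        finally show "e / 2 + t * Q \<le> e" by simp
      qed (use t in simp)
      finally show ?thesis .
    qed
    then show ?thesis using t0(1) by blast
  qed
  define C where "C = C0 + ballvol * C1 + ballvol * G"
  have pos: "ballvol * C1 > 0" "ballvol * G > 0" using ballvol_pos C1 G by auto
  have C': "C0 \<le> C" "ballvol * C1 \<le> C" "ballvol * G \<le> C"
    unfolding C_def using pos C0(1) by linarith+
  show thesis
  proof (rule that[OF less_imp_le[OF L] t1(1)])
    show "\<bar>N x\<bar> \<le> C" "\<bar>slice_int x (\<lambda>y. fst (Z (x, y)))\<bar> \<le> C" "\<bar>slice_int x (g x)\<bar> \<le> C" for x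
      by (rule order_trans[OF NC C'(1)], rule order_trans[OF AC C'(2)], rule order_trans[OF gC C'(3)])
  qed (fact Lip, fact lim)
qed

end

text \<open>Mean zero makes the primitive vanish to the right of the support as well.\<close>

lemma primitive_props:
  fixes \<phi> :: "real \<Rightarrow> real"
  assumes [measurable]: "\<phi> \<in> borel_measurable borel" and C: "\<And>x. \<bar>\<phi> x\<bar> \<le> C" and 0: "\<forall>x. x \<notin> {a..b} \<longrightarrow> \<phi> x = 0"
    and mean: "(\<integral>x. \<phi> x \<partial>lborel) = 0"
  defines "F \<equiv> \<lambda>x. \<integral>s. indicator {..x} s * \<phi> s \<partial>lborel"
  shows "F \<in> borel_measurable borel" "\<And>x. x \<notin> {a..b} \<Longrightarrow> F x = 0" "\<And>x. \<bar>F x\<bar> \<le> (\<integral>x. \<bar>\<phi> x\<bar> \<partial>lborel)"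
    "\<And>x. F x = - (\<integral>s. indicator {x<..} s * \<phi> s \<partial>lborel)"
proof -
  have I: "integrable lborel \<phi>"
    by (rule bounded_support_integrable[OF assms(1) C, of "{a..b}"]) (use 0 in auto)
  have I': "integrable lborel (\<lambda>s. indicator A s * \<phi> s)" if "A \<in> sets borel" for A
    by (rule Bochner_Integration.integrable_bound[OF I]) (use that in \<open>auto simp: indicator_def\<close>)
  have "(\<lambda>x. \<integral>s. of_bool (s \<le> x) * \<phi> s \<partial>lborel) \<in> borel_measurable borel" by measurable
  then show "F \<in> borel_measurable borel" by (simp add: F_def indicator_def)
  show "F x = - (\<integral>s. indicator {x<..} s * \<phi> s \<partial>lborel)" for x
  proof -
    have "F x + (\<integral>s. indicator {x<..} s * \<phi> s \<partial>lborel) = (\<integral>s. indicator {..x} s * \<phi> s + indicator {x<..} s * \<phi> s \<partial>lborel)"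
      unfolding F_def using I' by simp
    also have "\<dots> = (\<integral>s. \<phi> s \<partial>lborel)"
      by (intro Bochner_Integration.integral_cong) (auto simp: indicator_def)
    finally show ?thesis using mean by simp
  qed
  show "F x = 0" if x: "x \<notin> {a..b}" for x
  proof (cases "x < a")
    case True
    then have "(\<lambda>s. indicator {..x} s * \<phi> s) = (\<lambda>s. 0)" using 0 by (auto simp: indicator_def fun_eq_iff)
    then show ?thesis by (simp only: F_def Bochner_Integration.integral_zero)
  next
    case False
    then have "(\<lambda>s. indicator {..x} s * \<phi> s) = \<phi>" using 0 x by (auto simp: indicator_def fun_eq_iff)
    then show ?thesis using mean by (simp only: F_def)
  qed
  show "\<bar>F x\<bar> \<le> (\<integral>x. \<bar>\<phi> x\<bar> \<partial>lborel)" for x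
    unfolding F_def by (rule abs_integral_le_integral) (use I I'[of "{..x}"] in \<open>auto simp: indicator_def\<close>)
qed

section \<open>A weighted Hardy inequality\<close>

lemma nn_integral_powr_from_0: "x > 0 \<Longrightarrow> (\<integral>\<^sup>+s. ennreal (s powr (- 1 / 2)) * indicator {0<..x} s \<partial>lborel) = ennreal (2 * x powr (1 / 2))"
proof -
  assume x: "x > 0"
  have "((\<lambda>s. s powr (- 1 / 2)) has_integral (x powr (- 1 / 2 + 1) / (- 1 / 2 + 1))) {0..x}"
    by (rule has_integral_powr_from_0) (use x in auto)
  then have "(\<integral>\<^sup>+s. ennreal (indicator {0..x} s * s powr (- 1 / 2)) \<partial>lborel) = ennreal (x powr (- 1 / 2 + 1) / (- 1 / 2 + 1))"
    by (intro nn_integral_has_integral_lebesgue) auto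
  moreover have "(\<integral>\<^sup>+s. ennreal (s powr (- 1 / 2)) * indicator {0<..x} s \<partial>lborel) = (\<integral>\<^sup>+s. ennreal (indicator {0..x} s * s powr (- 1 / 2)) \<partial>lborel)"
    by (intro nn_integral_cong) (auto split: split_indicator)
  ultimately show ?thesis by (simp add: mult.commute)
qed

lemma nn_integral_powr_to_inf: "s > 0 \<Longrightarrow> (\<integral>\<^sup>+x. ennreal (x powr (- 3 / 2)) * indicator {s..} x \<partial>lborel) = ennreal (2 * s powr (- 1 / 2))"
proof -
  assume s: "s > 0"
  have "((\<lambda>x. x powr (- 3 / 2)) has_integral (- (s powr (- 3 / 2 + 1)) / (- 3 / 2 + 1))) {s..}"
    by (rule has_integral_powr_to_inf) (use s in auto)
  then have "(\<integral>\<^sup>+x. ennreal (indicator {s..} x * x powr (- 3 / 2)) \<partial>lborel) = ennreal (- (s powr (- 3 / 2 + 1)) / (- 3 / 2 + 1))"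
    by (intro nn_integral_has_integral_lebesgue) auto
  moreover have "(\<integral>\<^sup>+x. ennreal (x powr (- 3 / 2)) * indicator {s..} x \<partial>lborel) = (\<integral>\<^sup>+x. ennreal (indicator {s..} x * x powr (- 3 / 2)) \<partial>lborel)"
    by (intro nn_integral_cong) (auto split: split_indicator)
  ultimately show ?thesis by (simp add: mult.commute)
qed

text \<open>
  Hardy's inequality for a weight that, up to the factor \<open>C\<close>, increases away from the end point. The
  Cauchy--Schwarz inequality with the weights \<open>s\<^sup>1\<^sup>/\<^sup>2\<close> and \<open>s\<^sup>-\<^sup>1\<^sup>/\<^sup>2\<close> is Schur's test; it gives \<open>C\<close>
  times the classical constant \<open>4\<close>.
\<close>

lemma Hardy_half_interval:
  fixes w f F :: "real \<Rightarrow> real"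
  assumes [measurable]: "w \<in> borel_measurable borel" "f \<in> borel_measurable borel" "F \<in> borel_measurable borel"
    and w0: "\<And>x. w x \<ge> 0" and wpos: "\<And>x. 0 < x \<Longrightarrow> x \<le> 1 / 2 \<Longrightarrow> w x > 0"
    and wC: "\<And>s x. 0 < s \<Longrightarrow> s \<le> x \<Longrightarrow> x \<le> 1 / 2 \<Longrightarrow> w s \<le> C * w x" and C: "C \<ge> 0"
    and F: "\<And>x. 0 < x \<Longrightarrow> x \<le> 1 / 2 \<Longrightarrow> ennreal \<bar>F x\<bar> \<le> (\<integral>\<^sup>+s. ennreal (w s * \<bar>f s\<bar>) * indicator {0<..x} s \<partial>lborel)"
  shows "(\<integral>\<^sup>+x. ennreal ((F x)\<^sup>2 / (w x * x\<^sup>2)) * indicator {0<..1 / 2} x \<partial>lborel)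
    \<le> ennreal (4 * C) * (\<integral>\<^sup>+s. ennreal (w s * (f s)\<^sup>2) * indicator {0<..1 / 2} s \<partial>lborel)"
proof -
  let ?X = "\<lambda>x. \<integral>\<^sup>+s. ennreal (w s * (f s)\<^sup>2 * s powr (1 / 2)) * indicator {0<..x} s \<partial>lborel"
  have pw: "s powr (1 / 4) * s powr (- 1 / 4) = 1" "(s powr (1 / 4))\<^sup>2 = s powr (1 / 2)" "(s powr (- 1 / 4))\<^sup>2 = s powr (- 1 / 2)"
    if "s > 0" for s :: real
    using that by (simp_all add: power2_eq_square flip: powr_add)
  have pt: "ennreal ((F x)\<^sup>2 / (w x * x\<^sup>2)) \<le> ennreal (2 * C * x powr (- 3 / 2)) * ?X x" if x: "0 < x" "x \<le> 1 / 2" for x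
  proof -
    let ?a = "\<lambda>s. ennreal (sqrt (w s) * \<bar>f s\<bar> * s powr (1 / 4)) * indicator {0<..x} s"
    let ?b = "\<lambda>s. ennreal (sqrt (w s) * s powr (- 1 / 4)) * indicator {0<..x} s"
    have wx: "w x > 0" using wpos x by simp
    have "ennreal \<bar>F x\<bar> \<le> (\<integral>\<^sup>+s. ?a s * ?b s \<partial>lborel)"
    proof (rule order_trans[OF F[OF x]], rule nn_integral_mono)
      fix s
      show "ennreal (w s * \<bar>f s\<bar>) * indicator {0<..x} s \<le> ?a s * ?b s"
      proof (cases "s \<in> {0<..x}")
        case True
        have "w s * \<bar>f s\<bar> = (sqrt (w s) * \<bar>f s\<bar> * s powr (1 / 4)) * (sqrt (w s) * s powr (- 1 / 4))"
        proof -
          have "(sqrt (w s) * \<bar>f s\<bar> * s powr (1 / 4)) * (sqrt (w s) * s powr (- 1 / 4))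
            = (sqrt (w s) * sqrt (w s)) * \<bar>f s\<bar> * (s powr (1 / 4) * s powr (- 1 / 4))" by (simp only: mult_ac)
          also have "\<dots> = w s * \<bar>f s\<bar>"
            using True by (simp only: real_sqrt_mult_self abs_of_nonneg[OF w0] mult_1_right pw(1) greaterThanAtMost_iff)
          finally show ?thesis ..
        qed
        then have "ennreal (w s * \<bar>f s\<bar>)
            = ennreal (sqrt (w s) * \<bar>f s\<bar> * s powr (1 / 4)) * ennreal (sqrt (w s) * s powr (- 1 / 4))"
          using w0[of s] by (simp only: ennreal_mult[symmetric] mult_nonneg_nonneg real_sqrt_ge_zero powr_ge_zero abs_ge_zero)
        then show ?thesis using True by (simp only: indicator_simps mult_1_right order_refl)
      qed simp
    qed
    then have "(ennreal \<bar>F x\<bar>)\<^sup>2 \<le> (\<integral>\<^sup>+s. ?a s * ?b s \<partial>lborel)\<^sup>2" by (rule power_mono) simp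
    also have "\<dots> \<le> (\<integral>\<^sup>+s. (?a s)\<^sup>2 \<partial>lborel) * (\<integral>\<^sup>+s. (?b s)\<^sup>2 \<partial>lborel)"
      by (rule Cauchy_Schwarz_nn_integral) measurable
    also have "(\<integral>\<^sup>+s. (?a s)\<^sup>2 \<partial>lborel) = ?X x"
      using w0 pw(2) by (intro nn_integral_cong) (auto simp: ennreal_power power_mult_distrib split: split_indicator)
    also have "(\<integral>\<^sup>+s. (?b s)\<^sup>2 \<partial>lborel) \<le> (\<integral>\<^sup>+s. ennreal (C * w x) * (ennreal (s powr (- 1 / 2)) * indicator {0<..x} s) \<partial>lborel)"
    proof (rule nn_integral_mono)
      fix s
      show "(?b s)\<^sup>2 \<le> ennreal (C * w x) * (ennreal (s powr (- 1 / 2)) * indicator {0<..x} s)"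
      proof (cases "s \<in> {0<..x}")
        case True
        then have "w s * s powr (- 1 / 2) \<le> (C * w x) * s powr (- 1 / 2)" using x by (intro mult_right_mono wC) auto
        then have "ennreal (w s * s powr (- 1 / 2)) \<le> ennreal (C * w x) * ennreal (s powr (- 1 / 2))"
          using C wx by (subst ennreal_mult[symmetric]) (auto intro: ennreal_leI)
        then show ?thesis using True w0[of s] pw(3)[of s] by (simp add: ennreal_power power_mult_distrib)
      qed simp
    qed
    also have "\<dots> = ennreal (C * w x) * ennreal (2 * x powr (1 / 2))"
      using x by (subst nn_integral_cmult) (simp_all only: nn_integral_powr_from_0, measurable)
    finally have Fx: "ennreal ((F x)\<^sup>2) \<le> ?X x * (ennreal (C * w x) * ennreal (2 * x powr (1 / 2)))"
      by (simp add: ennreal_power mult_left_mono)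
    have "ennreal ((F x)\<^sup>2 / (w x * x\<^sup>2)) = ennreal (1 / (w x * x\<^sup>2)) * ennreal ((F x)\<^sup>2)"
      using wx by (simp add: ennreal_mult[symmetric])
    also have "\<dots> \<le> ennreal (1 / (w x * x\<^sup>2)) * (?X x * (ennreal (C * w x) * ennreal (2 * x powr (1 / 2))))"
      by (intro mult_left_mono Fx) simp
    also have "\<dots> = ennreal (1 / (w x * x\<^sup>2) * (C * w x) * (2 * x powr (1 / 2))) * ?X x"
    proof -
      have "ennreal a * (X * (ennreal b * ennreal c)) = ennreal (a * b * c) * X"
        if "a \<ge> 0" "b \<ge> 0" "c \<ge> 0" for a b c X
        using that by (simp add: ennreal_mult mult_ac)
      then show ?thesis using wx C x by simp
    qed
    also have "1 / (w x * x\<^sup>2) * (C * w x) * (2 * x powr (1 / 2)) = 2 * C * x powr (- 3 / 2)"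
    proof -
      have "x powr (1 / 2) = x powr (- 3 / 2) * x powr 2" by (subst powr_add[symmetric]) simp
      moreover have "x powr 2 = x\<^sup>2" using x by simp
      ultimately have "x powr (1 / 2) = x powr (- 3 / 2) * x\<^sup>2" by (simp only:)
      then show ?thesis using wx x by (simp add: field_simps)
    qed
    finally show ?thesis .
  qed
  let ?H = "\<lambda>x s. ennreal (2 * C * x powr (- 3 / 2)) * (ennreal (w s * (f s)\<^sup>2 * s powr (1 / 2)) * of_bool (0 < s \<and> s \<le> x \<and> x \<le> 1 / 2))"
  have "(\<integral>\<^sup>+x. ennreal ((F x)\<^sup>2 / (w x * x\<^sup>2)) * indicator {0<..1 / 2} x \<partial>lborel) \<le> (\<integral>\<^sup>+x. (\<integral>\<^sup>+s. ?H x s \<partial>lborel) \<partial>lborel)"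
  proof (rule nn_integral_mono)
    fix x
    show "ennreal ((F x)\<^sup>2 / (w x * x\<^sup>2)) * indicator {0<..1 / 2} x \<le> (\<integral>\<^sup>+s. ?H x s \<partial>lborel)"
    proof (cases "x \<in> {0<..1 / 2}")
      case True
      have "(\<integral>\<^sup>+s. ?H x s \<partial>lborel) = ennreal (2 * C * x powr (- 3 / 2)) * ?X x"
        using True by (subst nn_integral_cmult) (auto intro!: arg_cong2[where f="(*)"] nn_integral_cong simp: indicator_def)
      then show ?thesis using pt[of x] True by simp
    qed simp
  qed
  also have "\<dots> = (\<integral>\<^sup>+s. (\<integral>\<^sup>+x. ?H x s \<partial>lborel) \<partial>lborel)"
    by (rule lborel_pair.Fubini'[symmetric]) measurable
  also have "\<dots> \<le> (\<integral>\<^sup>+s. ennreal (4 * C) * (ennreal (w s * (f s)\<^sup>2) * indicator {0<..1 / 2} s) \<partial>lborel)"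
  proof (rule nn_integral_mono)
    fix s :: real
    show "(\<integral>\<^sup>+x. ?H x s \<partial>lborel) \<le> ennreal (4 * C) * (ennreal (w s * (f s)\<^sup>2) * indicator {0<..1 / 2} s)"
    proof (cases "s \<in> {0<..1 / 2}")
      case True
      have "(\<integral>\<^sup>+x. ?H x s \<partial>lborel) \<le> (\<integral>\<^sup>+x. ennreal (2 * C * (w s * (f s)\<^sup>2 * s powr (1 / 2))) * (ennreal (x powr (- 3 / 2)) * indicator {s..} x) \<partial>lborel)"
        using C w0[of s] by (intro nn_integral_mono) (auto simp: ennreal_mult[symmetric] mult_ac indicator_def)
      also have "\<dots> = ennreal (2 * C * (w s * (f s)\<^sup>2 * s powr (1 / 2))) * ennreal (2 * s powr (- 1 / 2))"
      proof -
        have sp: "s > 0" using True by simp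
        show ?thesis by (subst nn_integral_cmult) (measurable, simp only: nn_integral_powr_to_inf[OF sp])
      qed
      also have "\<dots> = ennreal (4 * C * (w s * (f s)\<^sup>2))"
      proof -
        have "s powr (1 / 2) * s powr (- 1 / 2) = 1" using True by (simp flip: powr_add)
        then have "2 * C * (w s * (f s)\<^sup>2 * s powr (1 / 2)) * (2 * s powr (- 1 / 2)) = 4 * C * (w s * (f s)\<^sup>2)"
          by (simp add: mult_ac)
        then show ?thesis using C w0[of s] by (subst ennreal_mult[symmetric]) auto
      qed
      finally show ?thesis using True C w0[of s] by (simp add: ennreal_mult)
    next
      case False
      then have "(\<integral>\<^sup>+x. ?H x s \<partial>lborel) = (\<integral>\<^sup>+x. 0 \<partial>(lborel :: real measure))"
        by (intro nn_integral_cong) auto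
      then show ?thesis by (simp only: nn_integral_const mult_zero_left zero_le)
    qed
  qed
  also have "\<dots> = ennreal (4 * C) * (\<integral>\<^sup>+s. ennreal (w s * (f s)\<^sup>2) * indicator {0<..1 / 2} s \<partial>lborel)"
    by (rule nn_integral_cmult) measurable
  finally show ?thesis .
qed

context slab
begin

text \<open>
  Scaling the slice at \<open>s\<close> towards the far end point into the slice at \<open>x\<close> takes a factor of at least \<open>1/2\<close>;
  so, up to \<open>2\<close> to the dimension of the fibres, \<open>h\<close> increases on the left half and decreases on the right half.
\<close>

lemma h_doubling_left: "0 < s \<Longrightarrow> s \<le> x \<Longrightarrow> x \<le> 1 / 2 \<Longrightarrow> h s \<le> 2 ^ DIM('b) * h x"
proof -
  assume sx: "0 < s" "s \<le> x" "x \<le> 1 / 2"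
  have "(1 / 2) ^ DIM('b) * h s \<le> ((1 - x) / (1 - s)) ^ DIM('b) * h s"
    using sx by (intro mult_right_mono power_mono) (auto simp: field_simps)
  also have "\<dots> \<le> h x" using sx by (intro h_scale_right) auto
  finally show ?thesis by (simp add: field_simps)
qed

lemma h_doubling_right: "x \<le> s \<Longrightarrow> s < 1 \<Longrightarrow> 1 / 2 \<le> x \<Longrightarrow> h s \<le> 2 ^ DIM('b) * h x"
proof -
  assume sx: "x \<le> s" "s < 1" "1 / 2 \<le> x"
  have "(1 / 2) ^ DIM('b) * h s \<le> (x / s) ^ DIM('b) * h s"
    using sx by (intro mult_right_mono power_mono) (auto simp: field_simps)
  also have "\<dots> \<le> h x" using sx by (intro h_scale_left) auto
  finally show ?thesis by (simp add: field_simps)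
qed

text \<open>
  Hardy's inequality on either half; reflection turns the right half into the left one. The mean of \<open>f\<close> is
  zero, so \<open>F\<close> is controlled from both end points.
\<close>

lemma Hardy_slab:
  fixes f :: "real \<Rightarrow> real"
  assumes fm[measurable]: "f \<in> borel_measurable borel" and f: "\<And>x. \<bar>f x\<bar> \<le> C" "\<And>x. x \<notin> {\<alpha>..\<beta>} \<Longrightarrow> f x = 0"
    and mean: "(\<integral>x. h x * f x \<partial>lborel) = 0"
  defines "F \<equiv> \<lambda>x. \<integral>s. indicator {..x} s * (h s * f s) \<partial>lborel"
  shows "(\<integral>\<^sup>+x. ennreal ((F x)\<^sup>2 / (h x * (\<rho> x)\<^sup>2)) * indicator {0<..<1} x \<partial>lborel)
    \<le> ennreal (4 * 2 ^ DIM('b)) * (\<integral>\<^sup>+x. ennreal (h x * (f x)\<^sup>2) \<partial>lborel)"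
proof -
  have hf: "\<bar>h x * f x\<bar> \<le> ballvol * C" for x
    unfolding abs_mult using h_le_ballvol[of x] f(1)[of x] ballvol_pos by (intro mult_mono) auto
  have hf0: "h x * f x = 0" if "x \<notin> {\<alpha>..\<beta>}" for x using f(2)[OF that] by simp
  then have hf0': "\<forall>x. x \<notin> {\<alpha>..\<beta>} \<longrightarrow> h x * f x = 0" by blast
  have hfm: "(\<lambda>x. h x * f x) \<in> borel_measurable borel" by measurable
  have Fx: "F x = (\<integral>s. indicator {..x} s * (h s * f s) \<partial>lborel)" for x by (simp add: F_def)
  note pp = primitive_props[OF hfm hf hf0' mean, folded Fx]
  note [measurable] = pp(1)
  let ?Q = "ennreal (4 * 2 ^ DIM('b))"
  have "(\<integral>\<^sup>+x. ennreal ((F x)\<^sup>2 / (h x * x\<^sup>2)) * indicator {0<..1 / 2} x \<partial>lborel)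
      \<le> ?Q * (\<integral>\<^sup>+s. ennreal (h s * (f s)\<^sup>2) * indicator {0<..1 / 2} s \<partial>lborel)"
  proof (rule Hardy_half_interval)
    fix x :: real assume x: "0 < x" "x \<le> 1 / 2"
    have I: "integrable lborel (\<lambda>s. indicator {..x} s * (h s * f s))"
      by (rule bounded_support_integrable[of _ "ballvol * C" "{\<alpha>..\<beta>}"])
        (use hf hf0 order_trans[OF abs_ge_zero hf[of x]] in \<open>auto simp: indicator_def\<close>)
    have "ennreal \<bar>F x\<bar> \<le> (\<integral>\<^sup>+s. ennreal (norm (indicator {..x} s * (h s * f s))) \<partial>lborel)"
      using integral_norm_bound_ennreal[OF I] by (simp only: F_def real_norm_def)
    also have "\<dots> = (\<integral>\<^sup>+s. ennreal (h s * \<bar>f s\<bar>) * indicator {0<..x} s \<partial>lborel)"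
      by (intro nn_integral_cong) (auto simp: h_outside abs_mult split: split_indicator)
    finally show "ennreal \<bar>F x\<bar> \<le> (\<integral>\<^sup>+s. ennreal (h s * \<bar>f s\<bar>) * indicator {0<..x} s \<partial>lborel)" .
  qed (auto intro: h_pos h_doubling_left)
  also have "(\<integral>\<^sup>+x. ennreal ((F x)\<^sup>2 / (h x * x\<^sup>2)) * indicator {0<..1 / 2} x \<partial>lborel)
      = (\<integral>\<^sup>+x. ennreal ((F x)\<^sup>2 / (h x * (\<rho> x)\<^sup>2)) * indicator {0<..1 / 2} x \<partial>lborel)"
    by (intro nn_integral_cong) (auto simp: min_def split: split_indicator)
  finally have left: "(\<integral>\<^sup>+x. ennreal ((F x)\<^sup>2 / (h x * (\<rho> x)\<^sup>2)) * indicator {0<..1 / 2} x \<partial>lborel)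
      \<le> ?Q * (\<integral>\<^sup>+s. ennreal (h s * (f s)\<^sup>2) * indicator {0<..1 / 2} s \<partial>lborel)" .
  have refl: "(\<integral>\<^sup>+x. k x \<partial>lborel) = (\<integral>\<^sup>+x. k (1 - x) \<partial>lborel)" if "k \<in> borel_measurable borel" for k :: "real \<Rightarrow> ennreal"
    using nn_integral_affine[of "-1::real" k 1] that by simp
  have "(\<integral>\<^sup>+x. ennreal ((F (1 - x))\<^sup>2 / (h (1 - x) * x\<^sup>2)) * indicator {0<..1 / 2} x \<partial>lborel)
      \<le> ?Q * (\<integral>\<^sup>+s. ennreal (h (1 - s) * (f (1 - s))\<^sup>2) * indicator {0<..1 / 2} s \<partial>lborel)"
  proof (rule Hardy_half_interval)
    fix x :: real assume x: "0 < x" "x \<le> 1 / 2"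
    have I: "integrable lborel (\<lambda>s. indicator {1 - x<..} s * (h s * f s))"
      by (rule bounded_support_integrable[of _ "ballvol * C" "{\<alpha>..\<beta>}"])
        (use hf hf0 order_trans[OF abs_ge_zero hf[of x]] in \<open>auto simp: indicator_def\<close>)
    have "ennreal \<bar>F (1 - x)\<bar> \<le> (\<integral>\<^sup>+s. ennreal (norm (indicator {1 - x<..} s * (h s * f s))) \<partial>lborel)"
      using integral_norm_bound_ennreal[OF I] by (simp only: pp(4) real_norm_def abs_minus_cancel)
    also have "\<dots> = (\<integral>\<^sup>+s. ennreal (norm (indicator {1 - x<..} (1 - s) * (h (1 - s) * f (1 - s)))) \<partial>lborel)"
      by (rule refl) measurable
    also have "\<dots> \<le> (\<integral>\<^sup>+s. ennreal (h (1 - s) * \<bar>f (1 - s)\<bar>) * indicator {0<..x} s \<partial>lborel)"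
      by (intro nn_integral_mono) (auto simp: h_outside abs_mult split: split_indicator)
    finally show "ennreal \<bar>F (1 - x)\<bar> \<le> (\<integral>\<^sup>+s. ennreal (h (1 - s) * \<bar>f (1 - s)\<bar>) * indicator {0<..x} s \<partial>lborel)" .
  qed (auto intro: h_pos h_doubling_right)
  also have "(\<integral>\<^sup>+x. ennreal ((F (1 - x))\<^sup>2 / (h (1 - x) * x\<^sup>2)) * indicator {0<..1 / 2} x \<partial>lborel)
      = (\<integral>\<^sup>+x. ennreal ((F x)\<^sup>2 / (h x * (\<rho> x)\<^sup>2)) * indicator {1 / 2..<1} x \<partial>lborel)"
    by (subst (2) refl, measurable, intro nn_integral_cong) (auto simp: min_def split: split_indicator)
  also have "(\<integral>\<^sup>+s. ennreal (h (1 - s) * (f (1 - s))\<^sup>2) * indicator {0<..1 / 2} s \<partial>lborel)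
      = (\<integral>\<^sup>+s. ennreal (h s * (f s)\<^sup>2) * indicator {1 / 2..<1} s \<partial>lborel)"
    by (subst (2) refl, measurable, intro nn_integral_cong) (auto split: split_indicator)
  finally have right: "(\<integral>\<^sup>+x. ennreal ((F x)\<^sup>2 / (h x * (\<rho> x)\<^sup>2)) * indicator {1 / 2..<1} x \<partial>lborel)
      \<le> ?Q * (\<integral>\<^sup>+s. ennreal (h s * (f s)\<^sup>2) * indicator {1 / 2..<1} s \<partial>lborel)" .
  have "(\<integral>\<^sup>+x. ennreal ((F x)\<^sup>2 / (h x * (\<rho> x)\<^sup>2)) * indicator {0<..<1} x \<partial>lborel)
     \<le> (\<integral>\<^sup>+x. ennreal ((F x)\<^sup>2 / (h x * (\<rho> x)\<^sup>2)) * indicator {0<..1 / 2} x + ennreal ((F x)\<^sup>2 / (h x * (\<rho> x)\<^sup>2)) * indicator {1 / 2..<1} x \<partial>lborel)"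
    by (intro nn_integral_mono) (auto split: split_indicator)
  also have "\<dots> = (\<integral>\<^sup>+x. ennreal ((F x)\<^sup>2 / (h x * (\<rho> x)\<^sup>2)) * indicator {0<..1 / 2} x \<partial>lborel)
      + (\<integral>\<^sup>+x. ennreal ((F x)\<^sup>2 / (h x * (\<rho> x)\<^sup>2)) * indicator {1 / 2..<1} x \<partial>lborel)"
    by (rule nn_integral_add) measurable
  also have "\<dots> \<le> ?Q * (\<integral>\<^sup>+s. ennreal (h s * (f s)\<^sup>2) * indicator {0<..1 / 2} s \<partial>lborel)
      + ?Q * (\<integral>\<^sup>+s. ennreal (h s * (f s)\<^sup>2) * indicator {1 / 2..<1} s \<partial>lborel)"
    by (rule add_mono[OF left right])
  also have "\<dots> = ?Q * (\<integral>\<^sup>+s. ennreal (h s * (f s)\<^sup>2) * indicator {0<..1 / 2} s + ennreal (h s * (f s)\<^sup>2) * indicator {1 / 2..<1} s \<partial>lborel)"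
    by (subst nn_integral_add) (measurable, simp add: distrib_left)
  also have "\<dots> \<le> ?Q * (\<integral>\<^sup>+s. ennreal (h s * (f s)\<^sup>2) \<partial>lborel)"
  proof (rule mult_left_mono[OF nn_integral_mono_AE])
    have "AE s in lborel. s \<noteq> (1 / 2 :: real)" by (rule AE_lborel_singleton)
    then show "AE s in lborel. ennreal (h s * (f s)\<^sup>2) * indicator {0<..1 / 2} s + ennreal (h s * (f s)\<^sup>2) * indicator {1 / 2..<1} s
        \<le> ennreal (h s * (f s)\<^sup>2)"
      by eventually_elim (auto split: split_indicator)
  qed simp
  finally show ?thesis .
qed

section \<open>Slice averages paired with primitives\<close>

text \<open>
  The central estimate. Pairing the difference quotients of the slice averages with the primitive of
  \<open>h f\<close> bounds \<open>\<langle>f, P z\<rangle>\<close> by the derivative of \<open>z\<close> in the first coordinate, up to its oscillation along the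
  slices weighted by \<open>\<psi> / \<rho>\<close>.
\<close>

lemma slice_average_pairing:
  fixes z :: "real \<times> 'b \<Rightarrow> real" and Z :: "real \<times> 'b \<Rightarrow> real \<times> 'b"
  assumes z: "\<And>p. (z has_derivative (\<lambda>h. Z p \<bullet> h)) (at p)" and Z: "continuous_on UNIV Z"
    and \<alpha>\<beta>: "0 < \<alpha>" "\<beta> < 1"
    and fm[measurable]: "f \<in> borel_measurable borel" and f: "\<And>x. \<bar>f x\<bar> \<le> Cf" "\<And>x. x \<notin> {\<alpha>..\<beta>} \<Longrightarrow> f x = 0"
    and mean: "(\<integral>x. h x * f x \<partial>lborel) = 0"
  defines "F \<equiv> \<lambda>x. \<integral>s. indicator {..x} s * (h s * f s) \<partial>lborel"
  defines "N \<equiv> P \<Omega> z"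
  defines "g \<equiv> \<lambda>x y. real DIM('b) * \<bar>z (x, y) - N x\<bar> + \<epsilon> * norm (snd (Z (x, y)))"
  shows "\<bar>(\<integral>x. h x * f x * N x \<partial>lborel) + (\<integral>x. F x / h x * slice_int x (\<lambda>y. fst (Z (x, y))) \<partial>lborel)\<bar>
    \<le> (\<integral>x. \<bar>F x / h x\<bar> / \<rho> x * slice_int x (g x) \<partial>lborel)"
proof -
  let ?A = "\<lambda>x. slice_int x (\<lambda>y. fst (Z (x, y)))"
  let ?E = "\<lambda>x. slice_int x (g x)"
  let ?\<phi> = "\<lambda>x. h x * f x"
  let ?\<psi> = "\<lambda>x. F x / h x"
  have gx: "g x y = real DIM('b) * \<bar>z (x, y) - N x\<bar> + \<epsilon> * norm (snd (Z (x, y)))" for x y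
    by (simp add: g_def)
  show ?thesis
  proof (rule slice_average_difference_uniform[OF z Z \<alpha>\<beta>, folded N_def, folded gx])
  fix C L t1 assume L: "L \<ge> 0" and t1: "t1 > 0" and NC: "\<And>x. \<bar>N x\<bar> \<le> C" and AC: "\<And>x. \<bar>?A x\<bar> \<le> C"
    and EC: "\<And>x. \<bar>?E x\<bar> \<le> C"
    and Lip: "\<And>x t. x \<in> {\<alpha>..\<beta>} \<Longrightarrow> 0 < t \<Longrightarrow> t < t1 \<Longrightarrow> \<bar>N (x - t) - N x\<bar> \<le> L * t"
    and quot: "\<And>e. e > 0 \<Longrightarrow> \<exists>t0>0. \<forall>x t. x \<in> {\<alpha>..\<beta>} \<longrightarrow> 0 < t \<longrightarrow> t < t0 \<longrightarrow>
        \<bar>h x * (N (x - t) - N x) + t * ?A x\<bar> \<le> t / \<rho> x * ?E x + t * e"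
  have cz: "continuous_on UNIV z"
    using z by (meson continuous_at_imp_continuous_on has_derivative_continuous)
  have Nm[measurable]: "N \<in> borel_measurable borel" unfolding N_def by (rule slice_average_measurable[OF cz])
  have [measurable]: "z \<in> borel_measurable borel" "Z \<in> borel_measurable borel"
    by (intro borel_measurable_continuous_onI cz Z)+
  have [measurable]: "(fst :: real \<times> 'b \<Rightarrow> real) \<in> borel_measurable borel" "(snd :: real \<times> 'b \<Rightarrow> 'b) \<in> borel_measurable borel"
    by (intro borel_measurable_continuous_onI continuous_intros)+
  have fZ: "(\<lambda>p. fst (Z p)) \<in> borel_measurable borel" "(\<lambda>p. norm (snd (Z p))) \<in> borel_measurable borel"
    by (intro borel_measurable_continuous_onI continuous_intros Z)+
  have Nf: "(\<lambda>p::real \<times> 'b. N (fst p)) \<in> borel_measurable borel"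
    by (rule measurable_compose[OF _ Nm]) (intro borel_measurable_continuous_onI continuous_intros)
  have Am[measurable]: "?A \<in> borel_measurable borel"
    by (rule slice_int_measurable) (use fZ in simp)
  have Em[measurable]: "?E \<in> borel_measurable borel"
  proof (rule slice_int_measurable)
    have "(\<lambda>p. real DIM('b) * \<bar>z p - N (fst p)\<bar> + \<epsilon> * norm (snd (Z p))) \<in> borel_measurable borel"
      using fZ Nf by (intro borel_measurable_add borel_measurable_times borel_measurable_abs borel_measurable_diff borel_measurable_const) auto
    then show "(\<lambda>p. g (fst p) (snd p)) \<in> borel_measurable borel" by (simp add: g_def)
  qed
  have E0: "?E x \<ge> 0" for x
    using \<epsilon>_pos by (intro integral_nonneg_AE AE_I2) (auto simp: g_def)
  have \<phi>C: "\<bar>?\<phi> x\<bar> \<le> ballvol * Cf" for x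
    unfolding abs_mult using h_le_ballvol[of x] f(1)[of x] ballvol_pos by (intro mult_mono) auto
  have \<phi>0: "?\<phi> x = 0" if "x \<notin> {\<alpha>..\<beta>}" for x using f(2)[OF that] by simp
  then have \<phi>0': "\<forall>x. x \<notin> {\<alpha>..\<beta>} \<longrightarrow> ?\<phi> x = 0" by blast
  have \<phi>m: "?\<phi> \<in> borel_measurable borel" by measurable
  have Fx: "F x = (\<integral>s. indicator {..x} s * ?\<phi> s \<partial>lborel)" for x by (simp add: F_def)
  note pp = primitive_props[OF \<phi>m \<phi>C \<phi>0' mean, folded Fx]
  note [measurable] = pp(1)
  define CF where "CF = (\<integral>x. \<bar>?\<phi> x\<bar> \<partial>lborel)"
  have CF: "CF \<ge> 0" by (simp add: CF_def)
  obtain hm where hm: "hm > 0" "\<And>x. x \<in> {\<alpha>..\<beta>} \<Longrightarrow> hm \<le> h x"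
  proof -
    have "{\<alpha>..\<beta>} \<subseteq> {0<..<1}" using \<alpha>\<beta> by auto
    then show thesis using N.w_locally_bounded_below[OF compact_Icc] that by blast
  qed
  define r0 where "r0 = min \<alpha> (1 - \<beta>)"
  have r0: "r0 > 0" "\<And>x. x \<in> {\<alpha>..\<beta>} \<Longrightarrow> r0 \<le> \<rho> x" using \<alpha>\<beta> by (auto simp: r0_def)
  have \<psi>C: "\<bar>?\<psi> x\<bar> \<le> CF / hm" for x
  proof (cases "x \<in> {\<alpha>..\<beta>}")
    case True
    then show ?thesis using pp(3)[of x] hm(1) hm(2)[OF True] CF
      unfolding CF_def abs_divide by (intro frac_le) auto
  qed (use pp(2)[of x] CF hm in simp)
  have \<psi>\<rho>C: "\<bar>\<bar>?\<psi> x\<bar> / \<rho> x\<bar> \<le> CF / hm / r0" for x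
  proof (cases "x \<in> {\<alpha>..\<beta>}")
    case True
    have "0 < \<rho> x" using r0(1) r0(2)[OF True] by linarith
    moreover have "\<bar>?\<psi> x\<bar> / \<rho> x \<le> CF / hm / r0"
      by (rule frac_le[OF _ \<psi>C r0(1) r0(2)[OF True]]) (use CF hm(1) in simp)
    ultimately show ?thesis by (simp only: abs_divide abs_abs abs_of_pos)
  qed (use pp(2)[of x] CF hm r0 in simp)
  have supp: "integrable lborel k" if "k \<in> borel_measurable borel" "\<And>x. \<bar>k x\<bar> \<le> c" "\<And>x. x \<notin> {\<alpha>..\<beta>} \<Longrightarrow> k x = 0" for k :: "real \<Rightarrow> real" and c
    by (rule bounded_support_integrable[OF that(1,2), of "{\<alpha>..\<beta>}"]) (use that(3) in auto)
  have C0: "C \<ge> 0" using order_trans[OF abs_ge_zero NC[of 0]] .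
  have pm: "\<bar>x * y\<bar> \<le> c * d" if "\<bar>x\<bar> \<le> c" "\<bar>y\<bar> \<le> d" for x y c d :: real
    unfolding abs_mult using that by (intro mult_mono) auto
  have I\<psi>A: "integrable lborel (\<lambda>x. ?\<psi> x * ?A x)"
    by (rule supp[of _ "(CF / hm) * C"]) (measurable, rule pm[OF \<psi>C AC], simp add: pp(2))
  have I\<psi>E: "integrable lborel (\<lambda>x. \<bar>?\<psi> x\<bar> / \<rho> x * ?E x)"
    by (rule supp[of _ "(CF / hm / r0) * C"]) (measurable, rule pm[OF \<psi>\<rho>C EC], simp add: pp(2))
  have I\<psi>: "integrable lborel (\<lambda>x. \<bar>?\<psi> x\<bar>)"
    by (rule supp[of _ "CF / hm"]) (measurable, use \<psi>C pp(2) in auto)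
  have IFN: "integrable lborel (\<lambda>x. F x * (N (x - t) - N x))" for t
  proof (rule supp[of _ "CF * (C + C)"])
    show "\<bar>F x * (N (x - t) - N x)\<bar> \<le> CF * (C + C)" for x
      using NC[of "x - t"] NC[of x] pp(3)[of x, folded CF_def] by (intro pm) (auto simp: abs_le_iff)
  qed (measurable, simp add: pp(2))
  let ?X = "(\<integral>x. ?\<phi> x * N x \<partial>lborel) + (\<integral>x. ?\<psi> x * ?A x \<partial>lborel)"
  let ?R = "\<integral>x. \<bar>?\<psi> x\<bar> / \<rho> x * ?E x \<partial>lborel"
  define I where "I = (\<integral>x. \<bar>?\<psi> x\<bar> \<partial>lborel)"
  have I0: "I \<ge> 0" by (simp add: I_def)
  have "\<bar>?X\<bar> \<le> ?R + e * (I + 1)" if e: "e > 0" for e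
  proof -
    obtain t0 where t0: "t0 > 0" and qq: "\<And>x t. x \<in> {\<alpha>..\<beta>} \<Longrightarrow> 0 < t \<Longrightarrow> t < t0 \<Longrightarrow>
        \<bar>h x * (N (x - t) - N x) + t * ?A x\<bar> \<le> t / \<rho> x * ?E x + t * e"
      using quot[OF e] by blast
    define q where "q = e / (L * CF + 1)"
    define t where "t = min (min 1 (t1 / 2)) (min (t0 / 2) q)"
    have LC: "L * CF \<ge> 0" using L CF by simp
    have e': "e / (L * CF + 1) > 0" using e LC by simp
    have t: "0 < t" "t \<le> 1" "t < t1" "t < t0" "t \<le> q"
      using t1 t0 e'[folded q_def] unfolding t_def by (auto simp: min_def)
    have S1: "\<bar>(\<integral>x. F x * (N (x - t) - N x) \<partial>lborel) - t * (\<integral>x. ?\<phi> x * N x \<partial>lborel)\<bar> \<le> t * (t * L * CF)"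
      unfolding CF_def
    proof (rule pairing_with_primitive[OF \<phi>m \<phi>C \<phi>0 Nm NC _ pp(1) pp(3) pp(2) t(1,2) _ L])
      show "\<bar>N (x - s) - N x\<bar> \<le> L * s" if "x \<in> {\<alpha>..\<beta>}" "0 < s" "s \<le> t" for x s
        using that t by (intro Lip) auto
    qed (auto simp: F_def)
    have eq: "(\<integral>x. F x * (N (x - t) - N x) \<partial>lborel) + t * (\<integral>x. ?\<psi> x * ?A x \<partial>lborel)
        = (\<integral>x. F x * (N (x - t) - N x) + t * (?\<psi> x * ?A x) \<partial>lborel)"
    proof -
      have "integrable lborel (\<lambda>x. t * (?\<psi> x * ?A x))" by (rule integrable_mult_right[OF I\<psi>A])
      from Bochner_Integration.integral_add[OF IFN[of t] this] show ?thesis by (simp only: integral_mult_right_zero)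
    qed
    have "\<bar>(\<integral>x. F x * (N (x - t) - N x) \<partial>lborel) + t * (\<integral>x. ?\<psi> x * ?A x \<partial>lborel)\<bar>
        \<le> (\<integral>x. t * (\<bar>?\<psi> x\<bar> / \<rho> x * ?E x) + t * e * \<bar>?\<psi> x\<bar> \<partial>lborel)"
      unfolding eq
    proof (rule abs_integral_le_integral)
      fix x
      show "\<bar>F x * (N (x - t) - N x) + t * (?\<psi> x * ?A x)\<bar> \<le> t * (\<bar>?\<psi> x\<bar> / \<rho> x * ?E x) + t * e * \<bar>?\<psi> x\<bar>"
      proof (cases "x \<in> {\<alpha>..\<beta>}")
        case True
        have "h x > 0" using hm(1) hm(2)[OF True] by linarith
        then have "F x = ?\<psi> x * h x" by simp
        then have "F x * (N (x - t) - N x) + t * (?\<psi> x * ?A x) = ?\<psi> x * (h x * (N (x - t) - N x) + t * ?A x)"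
        proof -
          have "a * d + t * (p * A) = p * (b * d + t * A)" if "a = p * b" for a p b d A :: real
            unfolding that by (simp add: algebra_simps)
          then show ?thesis using \<open>F x = ?\<psi> x * h x\<close> by blast
        qed
        then have "\<bar>F x * (N (x - t) - N x) + t * (?\<psi> x * ?A x)\<bar> = \<bar>?\<psi> x\<bar> * \<bar>h x * (N (x - t) - N x) + t * ?A x\<bar>"
          by (simp only: abs_mult)
        also have "\<dots> \<le> \<bar>?\<psi> x\<bar> * (t / \<rho> x * ?E x + t * e)"
          by (intro mult_left_mono qq True t) auto
        also have "\<dots> = t * (\<bar>?\<psi> x\<bar> / \<rho> x * ?E x) + t * e * \<bar>?\<psi> x\<bar>"
          by (simp add: distrib_left mult_ac)
        finally show ?thesis .
      qed (simp add: pp(2))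
    qed (intro Bochner_Integration.integrable_add IFN integrable_mult_right[OF I\<psi>A]
        integrable_mult_right[OF I\<psi>E] integrable_mult_right[OF I\<psi>])+
    also have "\<dots> = t * (?R + e * I)"
    proof -
      have "integrable lborel (\<lambda>x. t * (\<bar>?\<psi> x\<bar> / \<rho> x * ?E x))" "integrable lborel (\<lambda>x. t * e * \<bar>?\<psi> x\<bar>)"
        by (rule integrable_mult_right[OF I\<psi>E], rule integrable_mult_right[OF I\<psi>])
      from Bochner_Integration.integral_add[OF this] show ?thesis
        by (simp only: integral_mult_right_zero I_def distrib_left mult.assoc)
    qed
    finally have S2: "\<bar>(\<integral>x. F x * (N (x - t) - N x) \<partial>lborel) + t * (\<integral>x. ?\<psi> x * ?A x \<partial>lborel)\<bar> \<le> t * (?R + e * I)" .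
    have "t * \<bar>?X\<bar> = \<bar>t * (\<integral>x. ?\<phi> x * N x \<partial>lborel) + t * (\<integral>x. ?\<psi> x * ?A x \<partial>lborel)\<bar>"
      using t(1) by (simp add: abs_mult flip: distrib_left)
    also have "\<dots> \<le> t * (t * L * CF) + t * (?R + e * I)"
      using S1 S2 by linarith
    also have "\<dots> = t * (t * (L * CF) + (?R + e * I))" by (simp add: distrib_left mult.assoc)
    finally have "\<bar>?X\<bar> \<le> t * (L * CF) + (?R + e * I)" using t(1) by (simp only: mult_le_cancel_left_pos)
    moreover have "t * (L * CF) \<le> e"
    proof -
      have "t * (L * CF) \<le> q * (L * CF + 1)" using t LC e'[folded q_def] by (intro mult_mono) auto
      then show ?thesis using LC by (simp add: q_def)
    qed
    ultimately show ?thesis by (simp add: algebra_simps)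
  qed note bound = this
  have "\<bar>?X\<bar> \<le> ?R + e" if "e > 0" for e
    using bound[of "e / (I + 1)"] that I0 by (simp add: add_nonneg_eq_0_iff)
  then show "\<bar>?X\<bar> \<le> ?R" by (rule field_le_epsilon)
  qed
qed

end

section \<open>The dual estimate\<close>

text \<open>
  The constants of the dual estimate: for fibres of dimension \<open>n\<close>, the first term comes from the Poincare
  inequality on slices, the second from Hardy's inequality and the variation of slice averages. The bound
  rests on \<open>n\<^sup>2 \<le> 4\<^sup>n / 4\<close>.
\<close>

lemma sixteen_power_bound:
  assumes "n \<ge> 1"
  shows "2 * 2 ^ n + 4 * 2 ^ n * (1 + real n * sqrt (2 * 2 ^ n))\<^sup>2 \<le> 16 ^ Suc n"
proof -
  have sq: "(real n)\<^sup>2 \<le> 4 ^ n / 4" using assms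
  proof (induction n rule: nat_induct_at_least)
    case (Suc n)
    have "1 \<le> real n" using Suc by simp
    then have "2 * real n + 1 \<le> 3 * (real n)\<^sup>2" using mult_mono[of 1 "real n" 1 "real n"]
      by (simp add: power2_eq_square) (smt (verit) mult_le_cancel_left1 mult_left_mono)
    then have "(real (Suc n))\<^sup>2 \<le> 4 * (real n)\<^sup>2" by (simp add: power2_eq_square algebra_simps)
    then show ?case using Suc by simp
  qed simp
  define a where "a = (2::real) ^ n"
  have a: "a \<ge> 2" using power_increasing[of 1 n "2::real"] assms by (simp add: a_def)
  have a2: "4 ^ n = a\<^sup>2" "16 ^ n = (a\<^sup>2)\<^sup>2" 
  proof -
    show "4 ^ n = a\<^sup>2" unfolding a_def power2_eq_square power_mult_distrib[symmetric] by simp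
    show "16 ^ n = (a\<^sup>2)\<^sup>2" unfolding a_def power2_eq_square power_mult_distrib[symmetric] by simp
  qed
  have "(1 + real n * sqrt (2 * a))\<^sup>2 \<le> 2 + 2 * ((real n)\<^sup>2 * (2 * a))"
    using sum_squares_bound[of 1 "real n * sqrt (2 * a)"] a by (simp add: power2_sum power_mult_distrib algebra_simps)
  also have "\<dots> \<le> 2 + 2 * ((a\<^sup>2 / 4) * (2 * a))"
    using sq a unfolding a2(1) by (intro add_left_mono mult_left_mono mult_right_mono) auto
  finally have "2 * a + 4 * a * (1 + real n * sqrt (2 * a))\<^sup>2 \<le> 2 * a + 4 * a * (2 + 2 * ((a\<^sup>2 / 4) * (2 * a)))"
    using a by (intro add_left_mono mult_left_mono) auto
  also have "\<dots> = 10 * a + 4 * (a\<^sup>2)\<^sup>2" by (simp add: power2_eq_square algebra_simps)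
  also have "\<dots> \<le> 16 * (a\<^sup>2)\<^sup>2"
  proof -
    have "a * 2 ^ 3 \<le> a * a ^ 3" using a by (intro mult_left_mono power_mono) auto
    moreover have "a * a ^ 3 = (a\<^sup>2)\<^sup>2" by (simp add: power2_eq_square power3_eq_cube)
    ultimately have "8 * a \<le> (a\<^sup>2)\<^sup>2" by simp
    moreover have "0 \<le> a" using a by simp
    ultimately show ?thesis by linarith
  qed
  finally show ?thesis by (simp add: a2 a_def[symmetric])
qed

lemma two_term_Cauchy_Schwarz: "a * x + b * y \<le> sqrt (a\<^sup>2 + b\<^sup>2) * sqrt (x\<^sup>2 + y\<^sup>2)" for a b x y :: real
proof -
  have "(a * x + b * y)\<^sup>2 + (a * y - b * x)\<^sup>2 = (a\<^sup>2 + b\<^sup>2) * (x\<^sup>2 + y\<^sup>2)"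
    by (simp add: power2_eq_square algebra_simps)
  then have "(a * x + b * y)\<^sup>2 \<le> (a\<^sup>2 + b\<^sup>2) * (x\<^sup>2 + y\<^sup>2)"
    using zero_le_power2[of "a * y - b * x"] by linarith
  then have "a * x + b * y \<le> sqrt ((a\<^sup>2 + b\<^sup>2) * (x\<^sup>2 + y\<^sup>2))" by (rule real_le_rsqrt)
  then show ?thesis by (simp add: real_sqrt_mult)
qed

lemma L2_norm_mono:
  assumes "g \<in> L2 M" "f \<in> borel_measurable M" "\<And>x. x \<in> space M \<Longrightarrow> norm (f x) \<le> norm (g x)"
  shows "f \<in> L2 M" "L2_norm M f \<le> L2_norm M g"
proof -
  show f: "f \<in> L2 M" by (rule L2_dominated[OF assms])
  show "L2_norm M f \<le> L2_norm M g"
    unfolding L2_norm_def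
    by (intro real_sqrt_le_mono integral_mono L2_integrable_square f assms(1) power_mono assms(3)) auto
qed

context slab
begin

lemma N_inner_lborel:
  assumes [measurable]: "u \<in> borel_measurable borel" "v \<in> borel_measurable borel"
  shows "L2_inner N.M u v = (\<integral>x. h x * (u x * v x) \<partial>lborel)"
proof -
  have m: "(\<lambda>x. u x * v x) \<in> borel_measurable (lborel_on {0<..<1})"
    by (intro measurable_restrict_space1) simp
  have "L2_inner N.M u v = (\<integral>x. h x * (u x * v x) \<partial>lborel_on {0<..<1})"
    unfolding L2_inner_def inner_real_def by (rule N.integral_M[OF m])
  also have "\<dots> = (\<integral>x. indicator {0<..<1} x *\<^sub>R (h x * (u x * v x)) \<partial>lborel)"
    by (rule integral_lborel_on) simp
  also have "\<dots> = (\<integral>x. h x * (u x * v x) \<partial>lborel)"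
    by (intro Bochner_Integration.integral_cong refl) (auto simp: h_outside split: split_indicator)
  finally show ?thesis .
qed

lemma bounded_N_L2:
  fixes u :: "real \<Rightarrow> real"
  assumes m: "u \<in> borel_measurable borel" and C: "\<And>x. \<bar>u x\<bar> \<le> C"
  shows "u \<in> L2 N.M"
proof (rule L2_dominated[OF N.L2_M_const[of C]])
  show "u \<in> borel_measurable N.M" using m by (simp add: measurable_restrict_space1)
  show "norm (u x) \<le> norm C" for x using C[of x] unfolding real_norm_def by linarith
qed

text \<open>The Poincare inequality on each slice; a slice lies in a ball of radius \<open>\<epsilon>\<close>, so its diameter is at most \<open>2 \<epsilon>\<close>.\<close>

lemma slice_oscillation_le:
  fixes z :: "real \<times> 'b \<Rightarrow> real" and Z :: "real \<times> 'b \<Rightarrow> real \<times> 'b"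
  assumes z: "\<And>p. (z has_derivative (\<lambda>h. Z p \<bullet> h)) (at p)" and Z: "continuous_on UNIV Z"
  shows "(\<lambda>p. z p - P \<Omega> z (fst p)) \<in> L2 (lborel_on \<Omega>)"
    and "(L2_norm (lborel_on \<Omega>) (\<lambda>p. z p - P \<Omega> z (fst p)))\<^sup>2 \<le> 2 * 2 ^ DIM('b) * \<epsilon>\<^sup>2 * (L2_norm (lborel_on \<Omega>) (\<lambda>p. snd (Z p)))\<^sup>2"
proof -
  have cz: "continuous_on UNIV z"
    using z by (meson continuous_at_imp_continuous_on has_derivative_continuous)
  have zL: "z \<in> L2 (lborel_on \<Omega>)" by (intro continuous_L2 cz bounded_\<Omega> \<Omega>_borel)
  have sL: "(\<lambda>p. snd (Z p)) \<in> L2 (lborel_on \<Omega>)" by (intro continuous_L2 continuous_intros Z bounded_\<Omega> \<Omega>_borel)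
  have JN: "(\<lambda>p. P \<Omega> z (fst p)) \<in> L2 (lborel_on \<Omega>)" by (rule coord_L2(1)[OF P_L2[OF zL]])
  show L: "(\<lambda>p. z p - P \<Omega> z (fst p)) \<in> L2 (lborel_on \<Omega>)" by (rule L2_diff[OF zL JN])
  let ?N = "P \<Omega> z"
  let ?K = "2 * 2 ^ DIM('b) * \<epsilon>\<^sup>2"
  have [measurable]: "z \<in> borel_measurable borel" "Z \<in> borel_measurable borel"
    by (intro borel_measurable_continuous_onI cz Z)+
  have Nf: "(\<lambda>p::real \<times> 'b. ?N (fst p)) \<in> borel_measurable borel"
    by (rule measurable_compose[OF _ slice_average_measurable[OF cz]]) (intro borel_measurable_continuous_onI continuous_intros)
  have fZ[measurable]: "(\<lambda>p. norm (snd (Z p))) \<in> borel_measurable borel"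
    by (intro borel_measurable_continuous_onI continuous_intros Z)
  have m1: "(\<lambda>p. ennreal ((norm (z p - ?N (fst p)))\<^sup>2) * indicator \<Omega> p) \<in> borel_measurable borel"
    using Nf by measurable
  have m2: "(\<lambda>p. ennreal ((norm (snd (Z p)))\<^sup>2) * indicator \<Omega> p) \<in> borel_measurable borel"
    by measurable
  have slice: "(\<integral>\<^sup>+y. ennreal ((norm (z (x, y) - ?N x))\<^sup>2) * indicator (slice \<Omega> x) y \<partial>lborel)
      \<le> ennreal ?K * (\<integral>\<^sup>+y. ennreal ((norm (snd (Z (x, y))))\<^sup>2) * indicator (slice \<Omega> x) y \<partial>lborel)" for x
  proof (cases "x \<in> {0<..<1}")
    case True
    let ?D = "slice \<Omega> x"
    let ?w = "\<lambda>y. z (x, y)"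
    let ?W = "\<lambda>y. snd (Z (x, y))"
    have hx: "h x > 0" using h_pos True by simp
    have w: "(?w has_derivative (\<lambda>k. ?W y \<bullet> k)) (at y)" for y
    proof -
      have "((\<lambda>y. (x, y)) has_derivative (\<lambda>h. (0, h))) (at y)" by (auto intro!: derivative_eq_intros)
      from has_derivative_compose[OF this z] show ?thesis by (simp add: inner_prod_def)
    qed
    have cW: "continuous_on UNIV ?W" by (intro continuous_intros continuous_slice Z)
    have cw: "continuous_on UNIV ?w" by (rule continuous_slice[OF cz])
    have d: "norm (y - y') \<le> 2 * \<epsilon>" if "y' \<in> ?D" "y \<in> ?D" for y y'
    proof -
      have "norm y < \<epsilon>" "norm y' < \<epsilon>" using subsetD[OF slice_sub that(2)] subsetD[OF slice_sub that(1)] by simp_all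
      then show ?thesis using norm_triangle_ineq4[of y y'] by linarith
    qed
    define Q where "Q = (\<integral>y. (?w y)\<^sup>2 \<partial>lborel_on ?D)"
    define R where "R = (\<integral>y. (norm (?W y))\<^sup>2 \<partial>lborel_on ?D)"
    have I: "(\<integral>y. ?w y \<partial>lborel_on ?D) = h x * ?N x"
      using hx by (simp add: P_slice_int integral_lborel_on)
    have "h x * Q - (h x * ?N x)\<^sup>2 \<le> (2 * \<epsilon>)\<^sup>2 * 2 ^ DIM('b) / 2 * (h x * R)"
      using Poincare_C1[OF slice_convex[of x] slice_borel[of x] slice_bounded[of x] d w cW] unfolding I Q_def R_def slice_vol_def .
    then have "h x * (Q - h x * (?N x)\<^sup>2) \<le> h x * (?K * R)"
      by (simp add: power2_eq_square algebra_simps)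
    then have QR: "Q - h x * (?N x)\<^sup>2 \<le> ?K * R" using hx by (simp only: mult_le_cancel_left_pos)
    have wL: "?w \<in> L2 (lborel_on ?D)" and WL: "?W \<in> L2 (lborel_on ?D)"
      by (intro continuous_L2 cw cW slice_bounded slice_borel)+
    have kL: "(\<lambda>y. ?w y - ?N x) \<in> L2 (lborel_on ?D)"
      by (intro continuous_L2 continuous_intros cw slice_bounded slice_borel)
    have cL: "(\<lambda>y. 1::real) \<in> L2 (lborel_on ?D)"
      by (intro continuous_L2 continuous_intros slice_bounded slice_borel)
    have i: "integrable (lborel_on ?D) ?w" "integrable (lborel_on ?D) (\<lambda>y. (?w y)\<^sup>2)" "integrable (lborel_on ?D) (\<lambda>y. c)" for c :: real
      using L2_mult_integrable[OF wL cL] L2_integrable_square[OF wL]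
        integrable_mult_right[OF L2_mult_integrable[OF cL cL], of c] by simp_all
    have mD: "(\<integral>y. c \<partial>lborel_on ?D) = h x * c" for c :: real
      using slice_int_const[of x c] unfolding integral_lborel_on[OF slice_borel] by (simp only: real_scaleR_def)
    have "(\<integral>y. (?w y - ?N x)\<^sup>2 \<partial>lborel_on ?D) = Q - 2 * ?N x * (h x * ?N x) + h x * (?N x)\<^sup>2"
    proof -
      have "(\<integral>y. (?w y - ?N x)\<^sup>2 \<partial>lborel_on ?D) = (\<integral>y. (?w y)\<^sup>2 - 2 * ?N x * ?w y + (?N x)\<^sup>2 \<partial>lborel_on ?D)"
        by (intro Bochner_Integration.integral_cong refl) (simp add: power2_eq_square algebra_simps)
      also have "\<dots> = (\<integral>y. (?w y)\<^sup>2 - 2 * ?N x * ?w y \<partial>lborel_on ?D) + (\<integral>y. (?N x)\<^sup>2 \<partial>lborel_on ?D)"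
        by (intro Bochner_Integration.integral_add Bochner_Integration.integrable_diff integrable_mult_right i)
      also have "(\<integral>y. (?w y)\<^sup>2 - 2 * ?N x * ?w y \<partial>lborel_on ?D) = Q - (\<integral>y. 2 * ?N x * ?w y \<partial>lborel_on ?D)"
        unfolding Q_def by (intro Bochner_Integration.integral_diff integrable_mult_right i)
      finally show ?thesis by (simp only: integral_mult_right_zero I mD)
    qed
    then have eq: "(\<integral>y. (norm (?w y - ?N x))\<^sup>2 \<partial>lborel_on ?D) = Q - h x * (?N x)\<^sup>2"
      by (simp add: power2_eq_square algebra_simps)
    have "(\<integral>\<^sup>+y. ennreal ((norm (?w y - ?N x))\<^sup>2) * indicator ?D y \<partial>lborel) = ennreal (Q - h x * (?N x)\<^sup>2)"
      unfolding nn_integral_lborel_on[OF slice_borel, symmetric] eq[symmetric]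
      by (rule nn_integral_eq_integral[OF L2_integrable_square[OF kL]]) simp
    also have "\<dots> \<le> ennreal (?K * R)" by (rule ennreal_leI[OF QR])
    also have "\<dots> = ennreal ?K * ennreal R" by (rule ennreal_mult) (auto simp: R_def)
    also have "ennreal R = (\<integral>\<^sup>+y. ennreal ((norm (?W y))\<^sup>2) * indicator ?D y \<partial>lborel)"
      unfolding nn_integral_lborel_on[OF slice_borel, symmetric] R_def
      by (rule nn_integral_eq_integral[OF L2_integrable_square[OF WL], symmetric]) simp
    finally show ?thesis .
  qed (simp add: slice_outside)
  have "ennreal ((L2_norm (lborel_on \<Omega>) (\<lambda>p. z p - ?N (fst p)))\<^sup>2) = (\<integral>\<^sup>+p. ennreal ((norm (z p - ?N (fst p)))\<^sup>2) \<partial>lborel_on \<Omega>)"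
    by (rule L2_norm_nn[OF L])
  also have "\<dots> = (\<integral>\<^sup>+x. (\<integral>\<^sup>+y. ennreal ((norm (z (x, y) - ?N x))\<^sup>2) * indicator (slice \<Omega> x) y \<partial>lborel) \<partial>lborel)"
    by (subst nn_integral_\<Omega>[OF m1]) (simp only: fst_conv)
  also have "\<dots> \<le> (\<integral>\<^sup>+x. ennreal ?K * (\<integral>\<^sup>+y. ennreal ((norm (snd (Z (x, y))))\<^sup>2) * indicator (slice \<Omega> x) y \<partial>lborel) \<partial>lborel)"
    by (intro nn_integral_mono slice)
  also have "\<dots> = ennreal ?K * (\<integral>\<^sup>+x. (\<integral>\<^sup>+y. ennreal ((norm (snd (Z (x, y))))\<^sup>2) * indicator (slice \<Omega> x) y \<partial>lborel) \<partial>lborel)"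
  proof (rule nn_integral_cmult)
    have "(\<lambda>x. \<integral>\<^sup>+y. ennreal ((norm (snd (Z (x, y))))\<^sup>2) * indicator \<Omega> (x, y) \<partial>lborel) \<in> borel_measurable lborel"
      using m2 by measurable
    then show "(\<lambda>x. \<integral>\<^sup>+y. ennreal ((norm (snd (Z (x, y))))\<^sup>2) * indicator (slice \<Omega> x) y \<partial>lborel) \<in> borel_measurable lborel"
      by (simp only: slice_indicator)
  qed
  also have "(\<integral>\<^sup>+x. (\<integral>\<^sup>+y. ennreal ((norm (snd (Z (x, y))))\<^sup>2) * indicator (slice \<Omega> x) y \<partial>lborel) \<partial>lborel)
      = (\<integral>\<^sup>+p. ennreal ((norm (snd (Z p)))\<^sup>2) \<partial>lborel_on \<Omega>)"
    by (rule nn_integral_\<Omega>[OF m2, symmetric])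
  also have "\<dots> = ennreal ((L2_norm (lborel_on \<Omega>) (\<lambda>p. snd (Z p)))\<^sup>2)"
    by (rule L2_norm_nn[OF sL, symmetric])
  also have "ennreal ?K * \<dots> = ennreal (?K * (L2_norm (lborel_on \<Omega>) (\<lambda>p. snd (Z p)))\<^sup>2)"
    by (rule ennreal_mult[symmetric]) auto
  finally show "(L2_norm (lborel_on \<Omega>) (\<lambda>p. z p - P \<Omega> z (fst p)))\<^sup>2 \<le> ?K * (L2_norm (lborel_on \<Omega>) (\<lambda>p. snd (Z p)))\<^sup>2"
    by (subst (asm) ennreal_le_iff) auto
qed

text \<open>
  The estimate for smooth functions. The part \<open>g0\<close> orthogonal to functions of the first coordinate sees
  only the oscillation of \<open>z\<close> along slices; the other part is handled by the pairing above together with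
  Hardy's inequality for \<open>\<psi> / \<rho>\<close>.
\<close>

lemma dual_estimate_C1:
  fixes z :: "real \<times> 'b \<Rightarrow> real" and Z :: "real \<times> 'b \<Rightarrow> real \<times> 'b"
  assumes z: "\<And>p. (z has_derivative (\<lambda>h. Z p \<bullet> h)) (at p)" and Z: "continuous_on UNIV Z"
    and \<alpha>\<beta>: "0 < \<alpha>" "\<beta> < 1"
    and fm[measurable]: "f \<in> borel_measurable borel" and f: "\<And>x. \<bar>f x\<bar> \<le> Cf" "\<And>x. x \<notin> {\<alpha>..\<beta>} \<Longrightarrow> f x = 0"
    and mean: "(\<integral>x. h x * f x \<partial>lborel) = 0"
    and g0: "g0 \<in> L2 (lborel_on \<Omega>)" and orth: "\<And>v. v \<in> L2 N.M \<Longrightarrow> L2_inner (lborel_on \<Omega>) (J v) g0 = 0"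
  defines "\<psi> \<equiv> \<lambda>x. (\<integral>s. indicator {..x} s * (h s * f s) \<partial>lborel) / h x"
  shows "\<bar>L2_inner (lborel_on \<Omega>) (\<lambda>p. g0 p + f (fst p)) z + L2_inner (lborel_on \<Omega>) (J \<psi>) (\<lambda>p. fst (Z p))\<bar>
    \<le> 4 ^ Suc DIM('b) * \<epsilon> * sqrt ((L2_norm (lborel_on \<Omega>) g0)\<^sup>2 + (L2_norm N.M f)\<^sup>2) * L2_norm (lborel_on \<Omega>) Z"
    and "\<psi> \<in> borel_measurable borel" "\<exists>C. \<forall>x. \<bar>\<psi> x\<bar> \<le> C" "\<And>x. x \<notin> {\<alpha>..\<beta>} \<Longrightarrow> \<psi> x = 0"
proof -
  let ?O = "lborel_on \<Omega>"
  define m where "m = real DIM('b)"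
  define F where "F x = (\<integral>s. indicator {..x} s * (h s * f s) \<partial>lborel)" for x
  have \<psi>F: "\<psi> x = F x / h x" for x by (simp add: \<psi>_def F_def)
  \<comment> \<open>\<open>K\<close> is the constant of \<open>slice_oscillation_le\<close>, and \<open>b\<close> the one of the part that depends on \<open>x\<close> only.\<close>
  define K where "K = sqrt (2 * 2 ^ DIM('b))"
  define b where "b = 2 * sqrt (2 ^ DIM('b)) * (1 + m * K)"
  have m1: "m \<ge> 1" by (simp add: m_def)
  have K0: "K \<ge> 0" by (simp add: K_def)
  have b0: "b \<ge> 0" using K0 m1 by (simp add: b_def)
  have hf: "\<bar>h x * f x\<bar> \<le> ballvol * Cf" for x
    unfolding abs_mult using h_le_ballvol[of x] f(1)[of x] ballvol_pos by (intro mult_mono) auto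
  have hf0: "\<forall>x. x \<notin> {\<alpha>..\<beta>} \<longrightarrow> h x * f x = 0" using f(2) by simp
  have hfm: "(\<lambda>x. h x * f x) \<in> borel_measurable borel" by measurable
  note pp = primitive_props[OF hfm hf hf0 mean, folded F_def]
  note [measurable] = pp(1)
  show \<psi>m[measurable]: "\<psi> \<in> borel_measurable borel" unfolding \<psi>F[abs_def] by measurable
  show \<psi>0: "\<psi> x = 0" if "x \<notin> {\<alpha>..\<beta>}" for x using pp(2)[OF that] by (simp add: \<psi>F)
  obtain hm where hm: "hm > 0" "\<And>x. x \<in> {\<alpha>..\<beta>} \<Longrightarrow> hm \<le> h x"
  proof -
    have "{\<alpha>..\<beta>} \<subseteq> {0<..<1}" using \<alpha>\<beta> by auto
    then show thesis using N.w_locally_bounded_below[OF compact_Icc] that by blast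
  qed
  define r0 where "r0 = min \<alpha> (1 - \<beta>)"
  have r0: "r0 > 0" "\<And>x. x \<in> {\<alpha>..\<beta>} \<Longrightarrow> r0 \<le> \<rho> x" using \<alpha>\<beta> by (auto simp: r0_def)
  define CF where "CF = (\<integral>x. \<bar>h x * f x\<bar> \<partial>lborel)"
  have CF: "CF \<ge> 0" by (simp add: CF_def)
  have \<psi>C: "\<bar>\<psi> x\<bar> \<le> CF / hm" for x
  proof (cases "x \<in> {\<alpha>..\<beta>}")
    case True
    then show ?thesis using pp(3)[of x] hm(1) hm(2)[OF True] CF
      unfolding CF_def \<psi>F abs_divide by (intro frac_le) auto
  qed (use \<psi>0[of x] CF hm in simp)
  then show "\<exists>C. \<forall>x. \<bar>\<psi> x\<bar> \<le> C" by blast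
  define a where "a x = \<bar>\<psi> x\<bar> / \<rho> x" for x
  have am[measurable]: "a \<in> borel_measurable borel" unfolding a_def by measurable
  have aC: "\<bar>a x\<bar> \<le> CF / hm / r0" for x
  proof (cases "x \<in> {\<alpha>..\<beta>}")
    case True
    have "0 < \<rho> x" using r0(1) r0(2)[OF True] by linarith
    moreover have "\<bar>\<psi> x\<bar> / \<rho> x \<le> CF / hm / r0"
      by (rule frac_le[OF _ \<psi>C r0(1) r0(2)[OF True]]) (use CF hm(1) in simp)
    ultimately show ?thesis unfolding a_def by (simp only: abs_divide abs_abs abs_of_pos)
  qed (use \<psi>0[of x] CF hm r0 in \<open>simp add: a_def\<close>)
  have fL: "f \<in> L2 N.M" by (rule bounded_N_L2[OF fm f(1)])
  have \<psi>L: "\<psi> \<in> L2 N.M" by (rule bounded_N_L2[OF \<psi>m \<psi>C])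
  have aL: "a \<in> L2 N.M" by (rule bounded_N_L2[OF am aC])
  have cz: "continuous_on UNIV z"
    using z by (meson continuous_at_imp_continuous_on has_derivative_continuous)
  have zL: "z \<in> L2 ?O" and ZL: "Z \<in> L2 ?O" and Z1L: "(\<lambda>p. fst (Z p)) \<in> L2 ?O" and Z2L: "(\<lambda>p. snd (Z p)) \<in> L2 ?O"
    by (intro continuous_L2 continuous_intros cz Z bounded_\<Omega> \<Omega>_borel)+
  let ?N = "P \<Omega> z"
  have NL: "?N \<in> L2 N.M" by (rule P_L2[OF zL])
  have Nm: "?N \<in> borel_measurable borel" by (rule slice_average_measurable[OF cz])
  define s where "s = L2_norm ?O (\<lambda>p. snd (Z p))"
  have s0: "s \<ge> 0" by (simp add: s_def)
  let ?Gz = "\<lambda>p. z p - ?N (fst p)"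
  have G0L: "?Gz \<in> L2 ?O" by (rule slice_oscillation_le(1)[OF z Z])
  have G0s: "L2_norm ?O ?Gz \<le> K * \<epsilon> * s"
  proof (rule power2_le_imp_le)
    show "(L2_norm ?O ?Gz)\<^sup>2 \<le> (K * \<epsilon> * s)\<^sup>2"
      using slice_oscillation_le(2)[OF z Z] by (simp add: K_def s_def power_mult_distrib)
  qed (use K0 s0 \<epsilon>_pos in simp)
  let ?G = "\<lambda>p. m * \<bar>?Gz p\<bar> + \<epsilon> * norm (snd (Z p))"
  have absL: "(\<lambda>p. \<bar>?Gz p\<bar>) \<in> L2 ?O" "L2_norm ?O (\<lambda>p. \<bar>?Gz p\<bar>) = L2_norm ?O ?Gz"
    using G0L by (auto simp: L2_def L2_norm_def)
  have nrmL: "(\<lambda>p. norm (snd (Z p))) \<in> L2 ?O" "L2_norm ?O (\<lambda>p. norm (snd (Z p))) = s"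
    using Z2L by (auto simp: L2_def L2_norm_def s_def)
  have GL: "?G \<in> L2 ?O" using L2_add[OF L2_scale[OF absL(1), of m] L2_scale[OF nrmL(1), of \<epsilon>]] by simp
  have Gs: "L2_norm ?O ?G \<le> (1 + m * K) * \<epsilon> * s"
  proof -
    have "L2_norm ?O ?G \<le> m * L2_norm ?O ?Gz + \<epsilon> * s"
      using L2_norm_triangle[OF L2_scale[OF absL(1), of m] L2_scale[OF nrmL(1), of \<epsilon>]] m1 \<epsilon>_pos
      unfolding L2_norm_scale absL(2) nrmL(2) by simp
    also have "\<dots> \<le> m * (K * \<epsilon> * s) + \<epsilon> * s" using G0s m1 by (intro add_right_mono mult_left_mono) auto
    finally show ?thesis by (simp add: algebra_simps)
  qed
  \<comment> \<open>Hardy's inequality, as a bound for the norm of \<open>\<psi> / \<rho>\<close>.\<close>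
  have a_norm: "L2_norm N.M a \<le> 2 * sqrt (2 ^ DIM('b)) * L2_norm N.M f"
  proof (rule power2_le_imp_le)
    have nn: "(\<integral>\<^sup>+x. ennreal ((norm (u x))\<^sup>2) \<partial>N.M) = (\<integral>\<^sup>+x. ennreal (h x * (u x)\<^sup>2) * indicator {0<..<1} x \<partial>lborel)"
      if u: "u \<in> borel_measurable borel" for u :: "real \<Rightarrow> real"
    proof -
      have "(\<integral>\<^sup>+x. ennreal ((norm (u x))\<^sup>2) \<partial>N.M) = (\<integral>\<^sup>+x. ennreal (h x) * ennreal ((norm (u x))\<^sup>2) \<partial>lborel_on {0<..<1})"
        using u by (intro N.nn_integral_M measurable_restrict_space1) simp
      also have "\<dots> = (\<integral>\<^sup>+x. ennreal (h x) * ennreal ((norm (u x))\<^sup>2) * indicator {0<..<1} x \<partial>lborel)"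
        by (rule nn_integral_lborel_on) simp
      finally show ?thesis by (simp add: ennreal_mult)
    qed
    have "ennreal ((L2_norm N.M a)\<^sup>2) = (\<integral>\<^sup>+x. ennreal (h x * (a x)\<^sup>2) * indicator {0<..<1} x \<partial>lborel)"
      by (simp only: L2_norm_nn[OF aL] nn[OF am])
    also have "\<dots> = (\<integral>\<^sup>+x. ennreal ((F x)\<^sup>2 / (h x * (\<rho> x)\<^sup>2)) * indicator {0<..<1} x \<partial>lborel)"
    proof (intro nn_integral_cong)
      fix x
      show "ennreal (h x * (a x)\<^sup>2) * indicator {0<..<1} x = ennreal ((F x)\<^sup>2 / (h x * (\<rho> x)\<^sup>2)) * indicator {0<..<1} x"
      proof (cases "x \<in> {0<..<1}")
        case True
        then have "h x > 0" using h_pos by simp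
        then have "h x * (a x)\<^sup>2 = (F x)\<^sup>2 / (h x * (\<rho> x)\<^sup>2)"
          by (simp add: a_def \<psi>F power_divide power2_eq_square)
        then show ?thesis by (simp only:)
      qed simp
    qed
    also have "\<dots> \<le> ennreal (4 * 2 ^ DIM('b)) * (\<integral>\<^sup>+x. ennreal (h x * (f x)\<^sup>2) \<partial>lborel)"
      unfolding F_def by (rule Hardy_slab[OF fm f mean])
    also have "(\<integral>\<^sup>+x. ennreal (h x * (f x)\<^sup>2) \<partial>lborel) = (\<integral>\<^sup>+x. ennreal (h x * (f x)\<^sup>2) * indicator {0<..<1} x \<partial>lborel)"
      by (intro nn_integral_cong) (auto simp: h_outside split: split_indicator)
    also have "\<dots> = ennreal ((L2_norm N.M f)\<^sup>2)"
      by (simp only: L2_norm_nn[OF fL] nn[OF fm])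
    also have "ennreal (4 * 2 ^ DIM('b)) * \<dots> = ennreal ((2 * sqrt (2 ^ DIM('b)) * L2_norm N.M f)\<^sup>2)"
      by (subst ennreal_mult[symmetric]) (auto simp: power_mult_distrib)
    finally show "(L2_norm N.M a)\<^sup>2 \<le> (2 * sqrt (2 ^ DIM('b)) * L2_norm N.M f)\<^sup>2"
      by (subst (asm) ennreal_le_iff) auto
  qed simp
  \<comment> \<open>The part that depends on the first coordinate only.\<close>
  have part1: "\<bar>L2_inner ?O (J f) z + L2_inner ?O (J \<psi>) (\<lambda>p. fst (Z p))\<bar> \<le> b * L2_norm N.M f * (\<epsilon> * s)"
  proof -
    have pairing: "\<bar>(\<integral>x. h x * f x * ?N x \<partial>lborel) + (\<integral>x. F x / h x * slice_int x (\<lambda>y. fst (Z (x, y))) \<partial>lborel)\<bar>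
        \<le> (\<integral>x. \<bar>F x / h x\<bar> / \<rho> x * slice_int x (\<lambda>y. real DIM('b) * \<bar>z (x, y) - ?N x\<bar> + \<epsilon> * norm (snd (Z (x, y)))) \<partial>lborel)"
      by (rule slice_average_pairing[OF z Z \<alpha>\<beta> fm f(1) _ mean, folded F_def]) (rule f(2))
    have P1m: "P \<Omega> (\<lambda>p. fst (Z p)) \<in> borel_measurable borel" and PGm: "P \<Omega> ?G \<in> borel_measurable borel"
      using P_measurable L2_measurable[OF Z1L] L2_measurable[OF GL] by auto
    have "L2_inner ?O (J f) z = (\<integral>x. h x * f x * ?N x \<partial>lborel)"
      unfolding J_P_adjoint[OF fL zL] N_inner_lborel[OF fm Nm] by (simp only: mult.assoc)
    moreover have "L2_inner ?O (J \<psi>) (\<lambda>p. fst (Z p)) = (\<integral>x. F x / h x * slice_int x (\<lambda>y. fst (Z (x, y))) \<partial>lborel)"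
      unfolding J_P_adjoint[OF \<psi>L Z1L] N_inner_lborel[OF \<psi>m P1m]
    proof (intro Bochner_Integration.integral_cong refl)
      fix x
      show "h x * (\<psi> x * P \<Omega> (\<lambda>p. fst (Z p)) x) = F x / h x * slice_int x (\<lambda>y. fst (Z (x, y)))"
        by (cases "h x = 0") (simp_all add: P_slice_int \<psi>F)
    qed
    moreover have "L2_inner ?O (J a) ?G = (\<integral>x. \<bar>F x / h x\<bar> / \<rho> x * slice_int x (\<lambda>y. real DIM('b) * \<bar>z (x, y) - ?N x\<bar> + \<epsilon> * norm (snd (Z (x, y)))) \<partial>lborel)"
      unfolding J_P_adjoint[OF aL GL] N_inner_lborel[OF am PGm]
    proof (intro Bochner_Integration.integral_cong refl)
      fix x
      show "h x * (a x * P \<Omega> ?G x) = \<bar>F x / h x\<bar> / \<rho> x * slice_int x (\<lambda>y. real DIM('b) * \<bar>z (x, y) - ?N x\<bar> + \<epsilon> * norm (snd (Z (x, y))))"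
      proof (cases "h x = 0")
        case False
        have "h x * (a x * P \<Omega> ?G x) = a x * (h x * P \<Omega> ?G x)" by (simp only: mult_ac)
        also have "h x * P \<Omega> ?G x = slice_int x (\<lambda>y. m * \<bar>z (x, y) - ?N x\<bar> + \<epsilon> * norm (snd (Z (x, y))))"
          unfolding P_slice_int[of ?G] by (simp only: fst_conv times_divide_eq_left mult_1_left times_divide_eq_right nonzero_mult_div_cancel_left[OF False])
        finally show ?thesis by (simp only: a_def \<psi>F m_def)
      qed (simp add: a_def \<psi>F)
    qed
    ultimately have "\<bar>L2_inner ?O (J f) z + L2_inner ?O (J \<psi>) (\<lambda>p. fst (Z p))\<bar> \<le> L2_inner ?O (J a) ?G"
      using pairing by (simp only:)
    also have "\<dots> \<le> L2_norm ?O (J a) * L2_norm ?O ?G"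
      using L2_inner_Cauchy_Schwarz[OF coord_L2(1)[OF aL, folded J_eq] GL] by linarith
    also have "L2_norm ?O (J a) = L2_norm N.M a" unfolding J_eq by (rule coord_L2(2)[OF aL])
    also have "L2_norm N.M a * L2_norm ?O ?G \<le> (2 * sqrt (2 ^ DIM('b)) * L2_norm N.M f) * ((1 + m * K) * \<epsilon> * s)"
      by (rule mult_mono[OF a_norm Gs]) simp_all
    finally show ?thesis by (simp add: b_def mult_ac)
  qed
  \<comment> \<open>The part orthogonal to functions of the first coordinate.\<close>
  have part0: "\<bar>L2_inner ?O g0 z\<bar> \<le> K * L2_norm ?O g0 * (\<epsilon> * s)"
  proof -
    have "L2_inner ?O ?Gz g0 = L2_inner ?O z g0 - L2_inner ?O (J ?N) g0"
      unfolding J_eq by (rule L2_inner_diff[OF zL coord_L2(1)[OF NL] g0])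
    then have "L2_inner ?O g0 z = L2_inner ?O ?Gz g0" using orth[OF NL] by (simp add: L2_inner_commute)
    also have "\<bar>\<dots>\<bar> \<le> L2_norm ?O ?Gz * L2_norm ?O g0" by (rule L2_inner_Cauchy_Schwarz[OF G0L g0])
    also have "\<dots> \<le> (K * \<epsilon> * s) * L2_norm ?O g0" by (rule mult_right_mono[OF G0s]) simp
    finally show ?thesis by (simp add: mult_ac)
  qed
  have "L2_inner ?O (\<lambda>p. g0 p + f (fst p)) z = L2_inner ?O g0 z + L2_inner ?O (J f) z"
    using L2_inner_add_scale[OF g0 coord_L2(1)[OF fL] zL, of 1] by (simp add: J_eq)
  then have "\<bar>L2_inner ?O (\<lambda>p. g0 p + f (fst p)) z + L2_inner ?O (J \<psi>) (\<lambda>p. fst (Z p))\<bar>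
      \<le> K * L2_norm ?O g0 * (\<epsilon> * s) + b * L2_norm N.M f * (\<epsilon> * s)"
    using part0 part1 by linarith
  also have "\<dots> = (K * L2_norm ?O g0 + b * L2_norm N.M f) * (\<epsilon> * s)" by (simp add: algebra_simps)
  also have "\<dots> \<le> (sqrt (K\<^sup>2 + b\<^sup>2) * sqrt ((L2_norm ?O g0)\<^sup>2 + (L2_norm N.M f)\<^sup>2)) * (\<epsilon> * L2_norm ?O Z)"
  proof (intro mult_mono)
    show "K * L2_norm ?O g0 + b * L2_norm N.M f \<le> sqrt (K\<^sup>2 + b\<^sup>2) * sqrt ((L2_norm ?O g0)\<^sup>2 + (L2_norm N.M f)\<^sup>2)"
      by (rule two_term_Cauchy_Schwarz)
    show "s \<le> L2_norm ?O Z" unfolding s_def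
    proof (rule L2_norm_mono(2)[OF ZL])
      show "norm (snd (Z p)) \<le> norm (Z p)" for p
        using norm_snd_le[of "snd (Z p)" "fst (Z p)"] by simp
    qed (use Z2L in \<open>simp add: L2_def\<close>)
  qed (use \<epsilon>_pos s0 in auto)
  also have "\<dots> \<le> (4 ^ Suc DIM('b) * sqrt ((L2_norm ?O g0)\<^sup>2 + (L2_norm N.M f)\<^sup>2)) * (\<epsilon> * L2_norm ?O Z)"
  proof (intro mult_right_mono)
    have "K\<^sup>2 + b\<^sup>2 \<le> 16 ^ Suc DIM('b)"
      using sixteen_power_bound[of "DIM('b)"] by (simp add: K_def b_def m_def power_mult_distrib)
    also have "\<dots> = (4 ^ Suc DIM('b))\<^sup>2" by (simp add: power2_eq_square flip: power_mult_distrib)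
    finally show "sqrt (K\<^sup>2 + b\<^sup>2) \<le> 4 ^ Suc DIM('b)" by (intro real_le_lsqrt) auto
  qed (use \<epsilon>_pos in auto)
  finally show "\<bar>L2_inner ?O (\<lambda>p. g0 p + f (fst p)) z + L2_inner ?O (J \<psi>) (\<lambda>p. fst (Z p))\<bar>
    \<le> 4 ^ Suc DIM('b) * \<epsilon> * sqrt ((L2_norm ?O g0)\<^sup>2 + (L2_norm N.M f)\<^sup>2) * L2_norm ?O Z"
    by (simp add: mult_ac)
qed

text \<open>
  Passage to \<open>H\<^sup>1\<close> by density, for functions whose weak derivative in the first coordinate is orthogonal to
  all bounded functions of that coordinate supported inside \<open>(0, 1)\<close>.
\<close>

lemma dual_estimate_H1:
  assumes u: "u \<in> L2 (lborel_on \<Omega>)" and G: "G \<in> L2 (lborel_on \<Omega>)" "has_weak_gradient \<Omega> u G"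
    and G1: "\<And>\<psi> C \<alpha> \<beta>. \<psi> \<in> borel_measurable borel \<Longrightarrow> (\<And>x. \<bar>\<psi> x\<bar> \<le> C) \<Longrightarrow> 0 < \<alpha> \<Longrightarrow> \<beta> < 1 \<Longrightarrow>
      (\<And>x. x \<notin> {\<alpha>..\<beta>} \<Longrightarrow> \<psi> x = 0) \<Longrightarrow> L2_inner (lborel_on \<Omega>) (J \<psi>) (\<lambda>p. fst (G p)) = 0"
    and \<alpha>\<beta>: "0 < \<alpha>" "\<beta> < 1"
    and fm: "f \<in> borel_measurable borel" and f: "\<And>x. \<bar>f x\<bar> \<le> Cf" "\<And>x. x \<notin> {\<alpha>..\<beta>} \<Longrightarrow> f x = 0"
    and mean: "(\<integral>x. h x * f x \<partial>lborel) = 0"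
    and g0: "g0 \<in> L2 (lborel_on \<Omega>)" and orth: "\<And>v. v \<in> L2 N.M \<Longrightarrow> L2_inner (lborel_on \<Omega>) (J v) g0 = 0"
  shows "\<bar>L2_inner (lborel_on \<Omega>) (\<lambda>p. g0 p + f (fst p)) u\<bar>
    \<le> 4 ^ Suc DIM('b) * \<epsilon> * sqrt ((L2_norm (lborel_on \<Omega>) g0)\<^sup>2 + (L2_norm N.M f)\<^sup>2) * L2_norm (lborel_on \<Omega>) G"
proof -
  let ?O = "lborel_on \<Omega>"
  obtain z Z where z: "\<And>n p. (z n has_derivative (\<lambda>h. Z n p \<bullet> h)) (at p)" "\<And>n. continuous_on UNIV (Z n)"
    "\<And>n. z n \<in> L2 ?O" "\<And>n. Z n \<in> L2 ?O"
    "(\<lambda>n. L2_norm ?O (\<lambda>x. z n x - u x)) \<longlonglongrightarrow> 0" "(\<lambda>n. L2_norm ?O (\<lambda>x. Z n x - G x)) \<longlonglongrightarrow> 0"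
    using H1_smooth_approx_seq[OF open_\<Omega> convex_\<Omega> bounded_\<Omega> nonempty u G] by blast
  define \<psi> where "\<psi> x = (\<integral>s. indicator {..x} s * (h s * f s) \<partial>lborel) / h x" for x
  note est = dual_estimate_C1[OF z(1,2) \<alpha>\<beta> fm f mean g0 orth, folded \<psi>_def]
  obtain C where C: "\<And>x. \<bar>\<psi> x\<bar> \<le> C" using est(3) by blast
  have \<psi>L: "J \<psi> \<in> L2 ?O" unfolding J_eq by (rule coord_L2(1)[OF bounded_N_L2[OF est(2) C]])
  have \<psi>G: "L2_inner ?O (J \<psi>) (\<lambda>p. fst (G p)) = 0"
    by (rule G1[OF est(2) C \<alpha>\<beta> est(4)])
  have fL: "(\<lambda>p. g0 p + f (fst p)) \<in> L2 ?O"
    by (rule L2_add[OF g0 coord_L2(1)[OF bounded_N_L2[OF fm f(1)]]])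
  have fst_L2: "(\<lambda>p. fst (H p)) \<in> L2 ?O" "L2_norm ?O (\<lambda>p. fst (H p)) \<le> L2_norm ?O H" if H: "H \<in> L2 ?O" for H :: "real \<times> 'b \<Rightarrow> real \<times> 'b"
  proof -
    have "(\<lambda>p. H p \<bullet> (1, 0)) \<in> borel_measurable ?O" using L2_measurable[OF H] by measurable
    then have m: "(\<lambda>p. fst (H p)) \<in> borel_measurable ?O" by (simp add: inner_prod_def)
    have le: "norm (fst (H p)) \<le> norm (H p)" for p using norm_fst_le[of "fst (H p)" "snd (H p)"] by simp
    show "(\<lambda>p. fst (H p)) \<in> L2 ?O" "L2_norm ?O (\<lambda>p. fst (H p)) \<le> L2_norm ?O H"
      by (rule L2_norm_mono[OF H m le])+
  qed
  have lim1: "(\<lambda>n. L2_inner ?O (\<lambda>p. g0 p + f (fst p)) (z n)) \<longlonglongrightarrow> L2_inner ?O (\<lambda>p. g0 p + f (fst p)) u"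
    unfolding L2_inner_commute[of ?O "\<lambda>p. g0 p + f (fst p)"] by (rule L2_inner_tendsto[OF z(3) u fL z(5)])
  have lim2: "(\<lambda>n. L2_inner ?O (J \<psi>) (\<lambda>p. fst (Z n p))) \<longlonglongrightarrow> L2_inner ?O (J \<psi>) (\<lambda>p. fst (G p))"
    unfolding L2_inner_commute[of ?O "J \<psi>"]
  proof (rule L2_inner_tendsto[OF fst_L2(1)[OF z(4)] fst_L2(1)[OF G(1)] \<psi>L])
    show "(\<lambda>n. L2_norm ?O (\<lambda>x. fst (Z n x) - fst (G x))) \<longlonglongrightarrow> 0"
    proof (rule Lim_null_comparison[OF _ z(6)])
      show "\<forall>\<^sub>F n in sequentially. norm (L2_norm ?O (\<lambda>x. fst (Z n x) - fst (G x))) \<le> L2_norm ?O (\<lambda>x. Z n x - G x)"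
        using fst_L2(2)[OF L2_diff[OF z(4) G(1)]] by (simp add: fst_diff)
    qed
  qed
  let ?c = "4 ^ Suc DIM('b) * \<epsilon> * sqrt ((L2_norm ?O g0)\<^sup>2 + (L2_norm N.M f)\<^sup>2)"
  have l: "(\<lambda>n. \<bar>L2_inner ?O (\<lambda>p. g0 p + f (fst p)) (z n) + L2_inner ?O (J \<psi>) (\<lambda>p. fst (Z n p))\<bar>)
      \<longlonglongrightarrow> \<bar>L2_inner ?O (\<lambda>p. g0 p + f (fst p)) u + L2_inner ?O (J \<psi>) (\<lambda>p. fst (G p))\<bar>"
    by (intro tendsto_intros lim1 lim2)
  have r: "(\<lambda>n. ?c * L2_norm ?O (Z n)) \<longlonglongrightarrow> ?c * L2_norm ?O G"
    by (intro tendsto_intros L2_norm_tendsto z G)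
  have "\<bar>L2_inner ?O (\<lambda>p. g0 p + f (fst p)) u + L2_inner ?O (J \<psi>) (\<lambda>p. fst (G p))\<bar> \<le> ?c * L2_norm ?O G"
    by (rule LIMSEQ_le[OF l r]) (use est(1) in blast)
  then show ?thesis unfolding \<psi>G by simp
qed

end

context slab
begin

text \<open>
  Truncation in height and near the end points of the interval keeps the convergence but not the mean, which
  is restored by a small multiple of the indicator of \<open>[1/4, 3/4]\<close>.
\<close>

lemma mean_zero_approx:
  assumes "f \<in> L2_mean_zero N.M"
  shows "\<exists>F. (\<forall>k. F k \<in> borel_measurable borel \<and> (\<exists>C. \<forall>x. \<bar>F k x\<bar> \<le> C) \<and>
      (\<exists>\<alpha>>0. \<exists>\<beta><1. \<forall>x. x \<notin> {\<alpha>..\<beta>} \<longrightarrow> F k x = 0) \<and> (\<integral>x. h x * F k x \<partial>lborel) = 0) \<and>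
    (\<lambda>k. L2_norm N.M (\<lambda>x. F k x - f x)) \<longlonglongrightarrow> 0"
proof -
  have f: "f \<in> L2 N.M" and f0: "(\<integral>x. f x \<partial>N.M) = 0" using assms by (auto simp: L2_mean_zero_def)
  \<comment> \<open>The summand 4 keeps \<open>[1/4, 3/4]\<close> inside every \<open>[a k, 1 - a k]\<close>.\<close>
  define a where "a k = 1 / (real k + 4)" for k
  have a: "0 < a k" "a k \<le> 1 / 4" for k by (auto simp: a_def field_simps)
  define w where "w x = indicator {0<..<1} x * f x" for x
  have wm[measurable]: "w \<in> borel_measurable borel"
    using L2_measurable[OF f] by (simp add: borel_measurable_lborel_on_iff w_def[abs_def])
  define u where "u k x = indicator {a k..1 - a k} x * max (- real k) (min (real k) (w x))" for k x
  have um[measurable]: "u k \<in> borel_measurable borel" for k unfolding u_def by measurable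
  have uC: "\<bar>u k x\<bar> \<le> real k" for k x by (auto simp: u_def split: split_indicator)
  have uL: "u k \<in> L2 N.M" for k by (rule bounded_N_L2[OF um uC])
  have uf: "\<bar>u k x - f x\<bar> \<le> \<bar>f x\<bar>" if "x \<in> {0<..<1}" for k x
    using that by (auto simp: u_def w_def split: split_indicator)
  have lim: "(\<lambda>k. u k x) \<longlonglongrightarrow> f x" if x: "x \<in> {0<..<1}" for x
  proof (rule tendsto_eventually)
    have "(\<lambda>k. a k) \<longlonglongrightarrow> 0" unfolding a_def by real_asymp
    moreover have "0 < min x (1 - x)" using x by auto
    ultimately have e1: "\<forall>\<^sub>F k in sequentially. a k < min x (1 - x)" by (rule order_tendstoD(2))
    have e2: "\<forall>\<^sub>F k in sequentially. \<bar>f x\<bar> \<le> real k"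
      using filterlim_real_sequentially by (simp add: filterlim_at_top)
    show "\<forall>\<^sub>F k in sequentially. u k x = f x"
      using e1 e2 by eventually_elim (use x in \<open>auto simp: u_def w_def\<close>)
  qed
  have sq: "(\<lambda>k. \<integral>x. (norm (u k x - f x))\<^sup>2 \<partial>N.M) \<longlonglongrightarrow> (\<integral>x. 0 \<partial>N.M)"
  proof (rule integral_dominated_convergence)
    show "integrable N.M (\<lambda>x. (norm (f x))\<^sup>2)" by (rule L2_integrable_square[OF f])
    show "AE x in N.M. (\<lambda>k. (norm (u k x - f x))\<^sup>2) \<longlonglongrightarrow> 0"
    proof (rule AE_I2)
      fix x assume "x \<in> space N.M"
      then have "(\<lambda>k. u k x) \<longlonglongrightarrow> f x" using lim by (simp add: N.space_M)
      then have "(\<lambda>k. (norm (u k x - f x))\<^sup>2) \<longlonglongrightarrow> (norm (f x - f x))\<^sup>2" by (intro tendsto_intros)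
      then show "(\<lambda>k. (norm (u k x - f x))\<^sup>2) \<longlonglongrightarrow> 0" by simp
    qed
    show "AE x in N.M. norm ((norm (u k x - f x))\<^sup>2) \<le> (norm (f x))\<^sup>2" for k
      using uf by (intro AE_I2) (simp add: N.space_M abs_le_square_iff[symmetric])
    show "(\<lambda>x. (norm (u k x - f x))\<^sup>2) \<in> borel_measurable N.M" for k
      using L2_measurable[OF uL] L2_measurable[OF f] by measurable
  qed simp
  have ulim: "(\<lambda>k. L2_norm N.M (\<lambda>x. u k x - f x)) \<longlonglongrightarrow> 0"
    using tendsto_real_sqrt[OF sq] unfolding L2_norm_def by simp
  define c where "c k = L2_inner N.M (u k) (\<lambda>x. 1)" for k
  have c0: "c \<longlonglongrightarrow> 0"
    using L2_inner_tendsto[OF uL f N.L2_M_const[of 1] ulim] f0 by (simp add: c_def[abs_def] L2_inner_def)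
  define \<kappa> :: "real \<Rightarrow> real" where "\<kappa> = indicator {1 / 4..3 / 4}"
  have \<kappa>m[measurable]: "\<kappa> \<in> borel_measurable borel" unfolding \<kappa>_def by measurable
  have \<kappa>L: "\<kappa> \<in> L2 N.M" by (rule bounded_N_L2[OF \<kappa>m, of 1]) (simp add: \<kappa>_def split: split_indicator)
  define \<mu> where "\<mu> = L2_inner N.M \<kappa> (\<lambda>x. 1)"
  have \<mu>: "\<mu> > 0"
  proof -
    obtain c where c: "c > 0" "\<And>x. x \<in> {1 / 4..3 / 4} \<Longrightarrow> c \<le> h x"
    proof -
      have "{1 / 4..3 / 4::real} \<subseteq> {0<..<1}" by auto
      from N.w_locally_bounded_below[OF compact_Icc this] that show thesis by blast
    qed
    have "0 < c * (1 / 2)" using c by simp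
    also have "c * (1 / 2) = (\<integral>x. c * \<kappa> x \<partial>lborel)" by (simp add: \<kappa>_def)
    also have "\<dots> \<le> (\<integral>x. h x * (\<kappa> x * 1) \<partial>lborel)"
    proof (rule integral_mono)
      show "integrable lborel (\<lambda>x. c * \<kappa> x)"
        by (rule bounded_support_integrable[of _ "c" "{1 / 4..3 / 4}"]) (use c in \<open>auto simp: \<kappa>_def split: split_indicator\<close>)
      show "integrable lborel (\<lambda>x. h x * (\<kappa> x * 1))"
        by (rule bounded_support_integrable[of _ "ballvol" "{1 / 4..3 / 4}"])
          (use h_le_ballvol ballvol_pos in \<open>auto simp: \<kappa>_def less_imp_le split: split_indicator\<close>)
      show "c * \<kappa> x \<le> h x * (\<kappa> x * 1)" for x using c(2)[of x] by (auto simp: \<kappa>_def split: split_indicator)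
    qed
    also have "\<dots> = \<mu>" unfolding \<mu>_def by (rule N_inner_lborel[symmetric]) simp_all
    finally show ?thesis .
  qed
  define F where "F k x = u k x + (- (c k / \<mu>)) *\<^sub>R \<kappa> x" for k x
  have Fm: "F k \<in> borel_measurable borel" for k unfolding F_def by measurable
  have FC: "\<bar>F k x\<bar> \<le> real k + \<bar>c k / \<mu>\<bar>" for k x
  proof -
    have "\<bar>\<kappa> x\<bar> \<le> 1" by (simp add: \<kappa>_def split: split_indicator)
    then have "\<bar>c k / \<mu>\<bar> * \<bar>\<kappa> x\<bar> \<le> \<bar>c k / \<mu>\<bar>" by (rule mult_left_le) simp
    then have "\<bar>- (c k / \<mu>) * \<kappa> x\<bar> \<le> \<bar>c k / \<mu>\<bar>" by (simp only: abs_mult abs_minus_cancel)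
    then show ?thesis using uC[of k x] abs_triangle_ineq[of "u k x" "- (c k / \<mu>) * \<kappa> x"]
      unfolding F_def real_scaleR_def by linarith
  qed
  have F0: "F k x = 0" if "x \<notin> {a k..1 - a k}" for k x
  proof -
    have "x \<notin> {1 / 4..3 / 4}" using that a(2)[of k] by auto
    then show ?thesis using that by (simp add: F_def u_def \<kappa>_def)
  qed
  have Fh: "(\<integral>x. h x * F k x \<partial>lborel) = 0" for k
  proof -
    have "(\<integral>x. h x * F k x \<partial>lborel) = L2_inner N.M (F k) (\<lambda>x. 1)"
      using N_inner_lborel[OF Fm[of k], of "\<lambda>x. 1"] by simp
    also have "\<dots> = c k + (- (c k / \<mu>)) * \<mu>"
      unfolding F_def c_def \<mu>_def by (rule L2_inner_add_scale[OF uL \<kappa>L N.L2_M_const])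
    finally show ?thesis using \<mu> by simp
  qed
  show ?thesis
  proof (intro exI[of _ F] conjI allI)
    fix k
    show "F k \<in> borel_measurable borel" by (rule Fm)
    show "(\<integral>x. h x * F k x \<partial>lborel) = 0" by (rule Fh)
    show "\<exists>C. \<forall>x. \<bar>F k x\<bar> \<le> C" using FC by blast
    show "\<exists>\<alpha>>0. \<exists>\<beta><1. \<forall>x. x \<notin> {\<alpha>..\<beta>} \<longrightarrow> F k x = 0"
      using a(1)[of k] F0[of _ k] by (intro exI[of _ "a k"] conjI exI[of _ "1 - a k"] allI impI) auto
  next
    show "(\<lambda>k. L2_norm N.M (\<lambda>x. F k x - f x)) \<longlonglongrightarrow> 0"
    proof (rule Lim_null_comparison)
      show "\<forall>\<^sub>F k in sequentially. norm (L2_norm N.M (\<lambda>x. F k x - f x)) \<le> L2_norm N.M (\<lambda>x. u k x - f x) + \<bar>c k / \<mu>\<bar> * L2_norm N.M \<kappa>"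
      proof (rule always_eventually, rule allI)
        fix k
        have "(\<lambda>x. F k x - f x) = (\<lambda>x. (u k x - f x) + (- (c k / \<mu>)) *\<^sub>R \<kappa> x)" by (auto simp: F_def)
        then show "norm (L2_norm N.M (\<lambda>x. F k x - f x)) \<le> L2_norm N.M (\<lambda>x. u k x - f x) + \<bar>c k / \<mu>\<bar> * L2_norm N.M \<kappa>"
          using L2_norm_triangle[OF L2_diff[OF uL f] L2_scale[OF \<kappa>L], of k "- (c k / \<mu>)"]
          unfolding L2_norm_scale by simp
      qed
      have "(\<lambda>k. L2_norm N.M (\<lambda>x. u k x - f x) + \<bar>c k / \<mu>\<bar> * L2_norm N.M \<kappa>) \<longlonglongrightarrow> 0 + \<bar>0 / \<mu>\<bar> * L2_norm N.M \<kappa>"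
        using \<mu> by (intro tendsto_intros ulim c0) auto
      then show "(\<lambda>k. L2_norm N.M (\<lambda>x. u k x - f x) + \<bar>c k / \<mu>\<bar> * L2_norm N.M \<kappa>) \<longlonglongrightarrow> 0" by simp
    qed
  qed
qed

lemma P_J:
  assumes "x \<in> {0<..<1}"
  shows "P \<Omega> (J w) x = w x"
proof -
  have *: "(\<integral>y. indicator \<Omega> (x, y) * w x \<partial>lborel) = h x * w x"
    using slice_int_const[of x "w x"] unfolding slice_indicator .
  show ?thesis using h_pos[of x] assms unfolding P_eq J_eq fst_conv * by simp
qed

lemma J_inner:
  assumes "v \<in> L2 N.M" "w \<in> L2 N.M"
  shows "L2_inner (lborel_on \<Omega>) (J v) (J w) = L2_inner N.M v w"
proof -
  have "L2_inner (lborel_on \<Omega>) (J v) (J w) = L2_inner N.M v (P \<Omega> (J w))"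
    by (rule J_P_adjoint[OF assms(1)]) (use coord_L2(1)[OF assms(2)] in \<open>simp add: J_eq\<close>)
  also have "\<dots> = L2_inner N.M v w"
    unfolding L2_inner_def by (intro Bochner_Integration.integral_cong refl) (simp add: N.space_M P_J)
  finally show ?thesis .
qed

text \<open>
  Every \<open>g\<close> splits orthogonally into \<open>J (P \<Omega> g)\<close> and a part orthogonal to the range of \<open>J\<close>; approximating
  \<open>P \<Omega> g\<close> removes the conditions on \<open>f\<close> in the preceding estimate.
\<close>

lemma dual_estimate:
  assumes u: "u \<in> L2 (lborel_on \<Omega>)" and G: "G \<in> L2 (lborel_on \<Omega>)" "has_weak_gradient \<Omega> u G"
    and G1: "\<And>\<psi> C \<alpha> \<beta>. \<psi> \<in> borel_measurable borel \<Longrightarrow> (\<And>x. \<bar>\<psi> x\<bar> \<le> C) \<Longrightarrow> 0 < \<alpha> \<Longrightarrow> \<beta> < 1 \<Longrightarrow>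
      (\<And>x. x \<notin> {\<alpha>..\<beta>} \<Longrightarrow> \<psi> x = 0) \<Longrightarrow> L2_inner (lborel_on \<Omega>) (J \<psi>) (\<lambda>p. fst (G p)) = 0"
    and g: "g \<in> H_Omega \<Omega>"
  shows "\<bar>L2_inner (lborel_on \<Omega>) g u\<bar> \<le> 4 ^ Suc DIM('b) * \<epsilon> * L2_norm (lborel_on \<Omega>) g * L2_norm (lborel_on \<Omega>) G"
proof -
  let ?O = "lborel_on \<Omega>"
  have gL: "g \<in> L2 ?O" using g by (simp add: H_Omega_def L2_mean_zero_def)
  define f where "f = P \<Omega> g"
  have f0: "f \<in> L2_mean_zero N.M" unfolding f_def by (rule P_mean_zero[OF g])
  then have fL: "f \<in> L2 N.M" by (simp add: L2_mean_zero_def)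
  have JfL: "J f \<in> L2 ?O" using coord_L2(1)[OF fL] by (simp add: J_eq)
  define g0 where "g0 p = g p - J f p" for p
  have g0L: "g0 \<in> L2 ?O" unfolding g0_def by (rule L2_diff[OF gL JfL])
  have orth: "L2_inner ?O (J v) g0 = 0" if v: "v \<in> L2 N.M" for v
  proof -
    have JvL: "J v \<in> L2 ?O" using coord_L2(1)[OF v] by (simp add: J_eq)
    have "L2_inner ?O (J v) g0 = L2_inner ?O (J v) g - L2_inner ?O (J v) (J f)"
      unfolding L2_inner_commute[of ?O "J v"] g0_def by (rule L2_inner_diff[OF gL JfL JvL])
    then show ?thesis unfolding J_P_adjoint[OF v gL] J_inner[OF v fL] by (simp add: f_def)
  qed
  have "L2_inner ?O g0 g0 = L2_inner ?O g g0 - L2_inner ?O (J f) g0"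
    unfolding g0_def by (rule L2_inner_diff[OF gL JfL g0L[unfolded g0_def]])
  then have "L2_inner ?O g0 g0 = L2_inner ?O g0 g" using orth[OF fL] by (simp add: L2_inner_commute)
  also have "\<dots> = L2_inner ?O g g - L2_inner ?O (J f) g"
    unfolding g0_def by (rule L2_inner_diff[OF gL JfL gL])
  also have "L2_inner ?O (J f) g = L2_inner N.M f f" unfolding J_P_adjoint[OF fL gL] by (simp only: f_def)
  finally have pyth: "(L2_norm ?O g0)\<^sup>2 + (L2_norm N.M f)\<^sup>2 = (L2_norm ?O g)\<^sup>2"
    by (simp add: L2_norm_square_inner)
  obtain F where F: "\<And>k. F k \<in> borel_measurable borel" "\<And>k. \<exists>C. \<forall>x. \<bar>F k x\<bar> \<le> C"
    "\<And>k. \<exists>\<alpha>>0. \<exists>\<beta><1. \<forall>x. x \<notin> {\<alpha>..\<beta>} \<longrightarrow> F k x = 0" "\<And>k. (\<integral>x. h x * F k x \<partial>lborel) = 0"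
    and lim: "(\<lambda>k. L2_norm N.M (\<lambda>x. F k x - f x)) \<longlonglongrightarrow> 0"
    using mean_zero_approx[OF f0] by (elim exE conjE) (rule that; simp)
  have FL: "F k \<in> L2 N.M" for k
  proof -
    obtain C where "\<And>x. \<bar>F k x\<bar> \<le> C" using F(2)[of k] by blast
    then show ?thesis by (rule bounded_N_L2[OF F(1)])
  qed
  let ?S = "\<lambda>s. 4 ^ Suc DIM('b) * \<epsilon> * sqrt ((L2_norm ?O g0)\<^sup>2 + s\<^sup>2) * L2_norm ?O G"
  have est: "\<bar>L2_inner ?O (\<lambda>p. g0 p + F k (fst p)) u\<bar> \<le> ?S (L2_norm N.M (F k))" for k
  proof -
    obtain C where C: "\<And>x. \<bar>F k x\<bar> \<le> C" using F(2)[of k] by blast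
    obtain \<alpha> \<beta> where "0 < \<alpha>" "\<beta> < 1" "\<And>x. x \<notin> {\<alpha>..\<beta>} \<Longrightarrow> F k x = 0" using F(3)[of k] by blast
    then show ?thesis by (intro dual_estimate_H1[OF u G G1 _ _ F(1) C _ F(4) g0L orth])
  qed
  have gF: "(\<lambda>p. g0 p + F k (fst p)) \<in> L2 ?O" for k by (rule L2_add[OF g0L coord_L2(1)[OF FL]])
  have "L2_norm ?O (\<lambda>p. g0 p + F k (fst p) - g p) = L2_norm N.M (\<lambda>x. F k x - f x)" for k
    using coord_L2(2)[OF L2_diff[OF FL fL], of k] by (simp add: g0_def J_eq)
  then have lg: "(\<lambda>k. L2_norm ?O (\<lambda>p. g0 p + F k (fst p) - g p)) \<longlonglongrightarrow> 0" using lim by simp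
  have l: "(\<lambda>k. \<bar>L2_inner ?O (\<lambda>p. g0 p + F k (fst p)) u\<bar>) \<longlonglongrightarrow> \<bar>L2_inner ?O g u\<bar>"
    by (intro tendsto_intros L2_inner_tendsto[OF gF gL u lg])
  have r: "(\<lambda>k. ?S (L2_norm N.M (F k))) \<longlonglongrightarrow> ?S (L2_norm N.M f)"
    by (intro tendsto_intros L2_norm_tendsto[OF FL fL lim])
  have "\<bar>L2_inner ?O g u\<bar> \<le> ?S (L2_norm N.M f)"
    by (rule LIMSEQ_le[OF l r]) (use est in blast)
  then show ?thesis unfolding pyth by simp
qed

section \<open>Comparison of the solution operators\<close>

text \<open>
  Every bounded function supported inside the interval is thus the weak derivative of an admissible test
  function for the reduced problem; by Fubini, the weak form of the derivative is the fundamental theorem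
  of calculus for the test function.
\<close>

lemma primitive_weak_derivative:
  assumes \<psi>[measurable]: "\<psi> \<in> borel_measurable borel" and C: "\<And>x. \<bar>\<psi> x\<bar> \<le> C" and supp: "\<forall>x. x \<notin> {\<alpha>..\<beta>} \<longrightarrow> \<psi> x = 0"
  defines "\<phi> \<equiv> \<lambda>x. \<integral>s. indicator {..x} s * \<psi> s \<partial>lborel"
  shows "\<phi> \<in> N.sob" and "AE x in N.M. weak_grad {0<..<1} \<phi> x = \<psi> x"
proof -
  have C0: "C \<ge> 0" using C[of 0] by linarith
  have I\<psi>: "integrable lborel \<psi>"
    by (rule bounded_support_integrable[OF \<psi> C, of "{\<alpha>..\<beta>}"]) (use supp in auto)
  have Ii: "integrable lborel (\<lambda>s. indicator {..x} s * \<psi> s)" for x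
    by (rule Bochner_Integration.integrable_bound[OF I\<psi>]) (auto simp: indicator_def)
  have "(\<lambda>x. \<integral>s. of_bool (s \<le> x) * \<psi> s \<partial>lborel) \<in> borel_measurable borel" by measurable
  then have \<phi>m: "\<phi> \<in> borel_measurable borel" by (simp add: \<phi>_def indicator_def)
  have \<phi>C: "\<bar>\<phi> x\<bar> \<le> (\<integral>s. \<bar>\<psi> s\<bar> \<partial>lborel)" for x
  proof -
    have "\<bar>\<phi> x\<bar> \<le> (\<integral>s. \<bar>indicator {..x} s * \<psi> s\<bar> \<partial>lborel)"
      unfolding \<phi>_def by (rule integral_abs_bound)
    also have "\<dots> \<le> (\<integral>s. \<bar>\<psi> s\<bar> \<partial>lborel)"
      by (intro integral_mono integrable_abs Ii I\<psi>) (auto simp: indicator_def)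
    finally show ?thesis .
  qed
  have L: "\<phi> \<in> L2 N.M" "\<psi> \<in> L2 N.M" by (rule bounded_N_L2[OF \<phi>m \<phi>C], rule bounded_N_L2[OF \<psi> C])
  have weak: "has_weak_gradient {0<..<1} \<phi> \<psi>"
    unfolding has_weak_gradient_def
  proof (intro ballI)
    fix \<eta> :: "real \<Rightarrow> real" and i :: real assume \<eta>: "\<eta> \<in> test_functions {0<..<1}" and "i \<in> Basis"
    then have i: "i = 1" by simp
    let ?d = "pd \<eta> 1"
    have d: "?d \<in> test_functions {0<..<1}" by (rule pd_test_function[OF \<eta>]) simp
    have \<eta>0: "\<eta> x = 0" "?d x = 0" if "x \<notin> {0<..<1}" for x
      using test_function_outside[OF \<eta> that] test_function_outside[OF d that] by auto
    have dm[measurable]: "?d \<in> borel_measurable borel"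
      using test_functionsD(1)[OF d, of 0] by (intro borel_measurable_continuous_onI) simp
    have dc: "continuous_on UNIV ?d" using test_functionsD(1)[OF d, of 0] by simp
    obtain D where D: "\<And>x. \<bar>?d x\<bar> \<le> D" using test_function_bounded[OF d] by (auto simp: real_norm_def)
    have D0: "D \<ge> 0" using D[of 0] by linarith
    have der: "(\<eta> has_real_derivative ?d x) (at x)" for x
    proof -
      have d1: "(\<eta> has_derivative (\<lambda>k. pd \<eta> k x)) (at x)" by (rule has_derivative_pd[OF test_functionsD(2)[OF \<eta>]])
      have e: "(\<lambda>k. pd \<eta> k x) = (*) (pd \<eta> 1 x)"
      proof
        fix k
        have "linear (\<lambda>k. pd \<eta> k x)" by (rule has_derivative_linear[OF d1])
        from linear_scale[OF this, of k 1] show "pd \<eta> k x = pd \<eta> 1 x * k" by (simp add: mult.commute)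
      qed
      show ?thesis unfolding has_field_derivative_def by (rule has_derivative_eq_rhs[OF d1 e])
    qed
    have on01: "(\<integral>x. f x * \<theta> x \<partial>lborel_on {0<..<1}) = (\<integral>x. f x * \<theta> x \<partial>lborel)"
      if "\<And>x. x \<notin> {0<..<1} \<Longrightarrow> \<theta> x = 0" for f \<theta> :: "real \<Rightarrow> real"
    proof -
      have "(\<lambda>x. indicator {0<..<1} x *\<^sub>R (f x * \<theta> x)) = (\<lambda>x. f x * \<theta> x)"
        using that by (auto simp: fun_eq_iff split: split_indicator)
      then show ?thesis by (simp only: integral_lborel_on[OF borel_open[OF open_greaterThanLessThan]])
    qed
    have tail: "(\<integral>x. indicator {s..} x * ?d x \<partial>lborel) = - \<eta> s" for s
    proof (cases "s \<le> 1")
      case True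
      have "(\<integral>x. ?d x * indicator {s..1} x \<partial>lborel) = \<eta> 1 - \<eta> s"
        by (rule integral_FTC_Icc_real[OF True]) (use der dc in \<open>auto simp: continuous_on_eq_continuous_at\<close>)
      moreover have "(\<lambda>x. indicator {s..} x * ?d x) = (\<lambda>x. ?d x * indicator {s..1} x)"
        using \<eta>0(2) by (auto simp: fun_eq_iff split: split_indicator)
      ultimately show ?thesis using \<eta>0(1)[of 1] by simp
    next
      case False
      then have "(\<lambda>x. indicator {s..} x * ?d x) = (\<lambda>x. 0)"
        using \<eta>0(2) by (auto simp: fun_eq_iff split: split_indicator)
      then show ?thesis using False \<eta>0(1)[of s] by simp
    qed
    let ?K = "\<lambda>p::real \<times> real. indicator {fst p..} (snd p) * (\<psi> (fst p) * ?d (snd p))"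
    have Km: "?K \<in> borel_measurable borel"
    proof -
      have "(\<lambda>p::real \<times> real. of_bool (fst p \<le> snd p) * (\<psi> (fst p) * ?d (snd p))) \<in> borel_measurable (borel \<Otimes>\<^sub>M borel)"
        by measurable
      then show ?thesis by (simp add: borel_prod indicator_def)
    qed
    have K: "integrable lborel ?K"
    proof (rule bounded_support_integrable[OF Km, of "C * D" "{\<alpha>..\<beta>} \<times> {0..1}"])
      fix p :: "real \<times> real"
      have "\<bar>\<psi> (fst p) * ?d (snd p)\<bar> \<le> C * D" unfolding abs_mult using C D C0 by (intro mult_mono) auto
      then show "\<bar>?K p\<bar> \<le> C * D" using C0 D0 by (auto simp: indicator_def)
      assume "p \<notin> {\<alpha>..\<beta>} \<times> {0..1}"
      then show "?K p = 0" using supp \<eta>0(2)[of "snd p"] by (cases p) auto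
    qed (auto intro: bounded_Times borel_closed closed_Times)
    have "(\<integral>x. \<phi> x * ?d x \<partial>lborel) = (\<integral>x. (\<integral>s. ?K (s, x) \<partial>lborel) \<partial>lborel)"
    proof (intro Bochner_Integration.integral_cong refl)
      fix x
      have "(\<lambda>s. ?K (s, x)) = (\<lambda>s. (indicator {..x} s * \<psi> s) * ?d x)" by (auto simp: fun_eq_iff indicator_def)
      then show "\<phi> x * ?d x = (\<integral>s. ?K (s, x) \<partial>lborel)" unfolding \<phi>_def by (simp only: integral_mult_left_zero)
    qed
    also have "\<dots> = (\<integral>s. (\<integral>x. ?K (s, x) \<partial>lborel) \<partial>lborel)"
      using integral_lborel_pair(1,2)[OF K] by simp
    also have "\<dots> = (\<integral>s. - (\<psi> s * \<eta> s) \<partial>lborel)"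
    proof (intro Bochner_Integration.integral_cong refl)
      fix s
      have "?K (s, x) = \<psi> s * (indicator {s..} x * ?d x)" for x by simp
      then have "(\<integral>x. ?K (s, x) \<partial>lborel) = \<psi> s * (\<integral>x. indicator {s..} x * ?d x \<partial>lborel)"
        by (simp only: integral_mult_right_zero)
      then show "(\<integral>x. ?K (s, x) \<partial>lborel) = - (\<psi> s * \<eta> s)" unfolding tail by simp
    qed
    finally have "(\<integral>x. \<phi> x * ?d x \<partial>lborel) = - (\<integral>s. \<psi> s * \<eta> s \<partial>lborel)" by simp
    then show "(\<integral>x. \<phi> x * pd \<eta> i x \<partial>lborel_on {0<..<1}) = - (\<integral>x. (\<psi> x \<bullet> i) * \<eta> x \<partial>lborel_on {0<..<1})"
      using on01[of ?d \<phi>] on01[of \<eta> \<psi>] \<eta>0 by (simp add: i)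
  qed
  show "\<phi> \<in> N.sob" using L weak by (auto simp: N.sob_iff)
  show "AE x in N.M. weak_grad {0<..<1} \<phi> x = \<psi> x" by (rule N.sob_weak_grad_AE[OF L weak])
qed

lemma J_sob:
  assumes v: "v \<in> N.sob"
  shows "J v \<in> O.sob" and "AE p in lborel_on \<Omega>. weak_grad \<Omega> (J v) p = (weak_grad {0<..<1} v (fst p), 0)"
    and "L2_norm (lborel_on \<Omega>) (\<lambda>p. (weak_grad {0<..<1} v (fst p), 0::'b)) = L2_norm N.M (weak_grad {0<..<1} v)"
proof -
  have L: "J v \<in> L2 (lborel_on \<Omega>)" using coord_L2(1)[OF N.sobD(1)[OF v]] by (simp add: J_eq)
  note g = J_weak_gradient[OF v]
  show "J v \<in> O.sob" using L g by (auto simp: O.sob_iff O_M)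
  show "AE p in lborel_on \<Omega>. weak_grad \<Omega> (J v) p = (weak_grad {0<..<1} v (fst p), 0)"
    by (rule O.sob_weak_grad_AE[OF _ _ g(1), unfolded O_M, OF L g(2)])
  show "L2_norm (lborel_on \<Omega>) (\<lambda>p. (weak_grad {0<..<1} v (fst p), 0::'b)) = L2_norm N.M (weak_grad {0<..<1} v)"
    using coord_L2(2)[OF N.sobD(2)[OF v]] by (simp add: L2_norm_def norm_Pair)
qed

lemma Poincare_\<Omega>:
  assumes "u \<in> L2 (lborel_on \<Omega>)" "G \<in> L2 (lborel_on \<Omega>)" "has_weak_gradient \<Omega> u G" "(\<integral>p. u p \<partial>lborel_on \<Omega>) = 0"
  shows "(L2_norm (lborel_on \<Omega>) u)\<^sup>2 \<le> (diameter \<Omega>)\<^sup>2 * 2 ^ DIM(real \<times> 'b) / 2 * (L2_norm (lborel_on \<Omega>) G)\<^sup>2"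
  using diameter_bounded_bound[OF bounded_\<Omega>]
  by (intro Poincare_H1 open_\<Omega> convex_\<Omega> bounded_\<Omega> nonempty assms) (auto simp: dist_norm norm_minus_commute)

lemma A_Omega_inv_solves:
  assumes g: "g \<in> H_Omega \<Omega>"
  defines "u \<equiv> A_Omega_inv \<Omega> g"
  shows "u \<in> O.sob" and "\<And>z. z \<in> O.sob \<Longrightarrow> L2_inner (lborel_on \<Omega>) (weak_grad \<Omega> u) (weak_grad \<Omega> z) = L2_inner (lborel_on \<Omega>) g z"
proof -
  have "\<exists>u\<in>O.sob. (\<integral>x. u x \<partial>O.M) = 0 \<and> (\<forall>z\<in>O.sob. O.gform u z = L2_inner O.M g z)"
  proof (rule O.Neumann_solvable)
    show "(L2_norm O.M u)\<^sup>2 \<le> ((diameter \<Omega>)\<^sup>2 * 2 ^ DIM(real \<times> 'b) / 2) * O.gform u u"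
      if "u \<in> O.sob" "(\<integral>x. u x \<partial>O.M) = 0" for u
      using Poincare_\<Omega>[of u "weak_grad \<Omega> u"] O.sobD[OF that(1)] that(2)
      unfolding O.gform_def O_M L2_norm_square_inner by blast
    show "g \<in> L2_mean_zero O.M" using g by (simp add: H_Omega_def O_M)
  qed
  then have "\<exists>u. u \<in> H1 \<Omega> \<inter> H_Omega \<Omega> \<and>
     (\<forall>z\<in>H1 \<Omega>. L2_inner (lborel_on \<Omega>) (weak_grad \<Omega> u) (weak_grad \<Omega> z) = L2_inner (lborel_on \<Omega>) g z)"
    using O.sobD(1) unfolding H1_eq H_Omega_def L2_mean_zero_def O.gform_def O_M by blast
  from someI_ex[OF this, folded A_Omega_inv_def]
  show "u \<in> O.sob" and "\<And>z. z \<in> O.sob \<Longrightarrow> L2_inner (lborel_on \<Omega>) (weak_grad \<Omega> u) (weak_grad \<Omega> z) = L2_inner (lborel_on \<Omega>) g z"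
    unfolding u_def H1_eq by auto
qed

text \<open>
  The Poincare inequality for the weight \<open>h\<close> is the one on \<open>\<Omega>\<close> applied to \<open>J v\<close>: this \<open>J\<close> preserves norms,
  means and the norm of the gradient.
\<close>

lemma A_N_inv_solves:
  assumes f: "f \<in> L2_mean_zero N.M"
  defines "v \<equiv> A_N_inv \<Omega> f"
  shows "v \<in> N.sob" and "\<And>\<phi>. \<phi> \<in> N.sob \<Longrightarrow> L2_inner N.M (weak_grad {0<..<1} v) (weak_grad {0<..<1} \<phi>) = L2_inner N.M f \<phi>"
proof -
  have "\<exists>v\<in>N.sob. (\<integral>x. v x \<partial>N.M) = 0 \<and> (\<forall>\<phi>\<in>N.sob. N.gform v \<phi> = L2_inner N.M f \<phi>)"
  proof (rule N.Neumann_solvable[OF _ f])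
    fix v assume v: "v \<in> N.sob" "(\<integral>x. v x \<partial>N.M) = 0"
    have L: "v \<in> L2 N.M" by (rule N.sobD(1)[OF v(1)])
    have JL: "J v \<in> L2 (lborel_on \<Omega>)" "L2_norm (lborel_on \<Omega>) (J v) = L2_norm N.M v"
      using coord_L2[OF L] by (simp_all add: J_eq)
    have "(\<integral>p. J v p \<partial>lborel_on \<Omega>) = 0"
      using J_inner[OF L N.L2_M_const[of 1]] v(2) by (simp add: L2_inner_def J_eq)
    from Poincare_\<Omega>[OF JL(1) J_weak_gradient(2,1)[OF v(1)] this]
    show "(L2_norm N.M v)\<^sup>2 \<le> ((diameter \<Omega>)\<^sup>2 * 2 ^ DIM(real \<times> 'b) / 2) * N.gform v v"
      unfolding JL(2) J_sob(3)[OF v(1)] N.gform_def L2_norm_square_inner .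
  qed
  then have "\<exists>v. v \<in> V_h \<Omega> \<inter> H_N \<Omega> \<and>
     (\<forall>\<phi>\<in>V_h \<Omega>. L2_inner (weighted \<Omega>) (weak_grad {0<..<1} v) (weak_grad {0<..<1} \<phi>) = L2_inner (weighted \<Omega>) f \<phi>)"
    using N.sobD(1) unfolding V_h_eq H_N_def L2_mean_zero_def N.gform_def N_M by blast
  from someI_ex[OF this, folded A_N_inv_def]
  show "v \<in> N.sob" and "\<And>\<phi>. \<phi> \<in> N.sob \<Longrightarrow> L2_inner N.M (weak_grad {0<..<1} v) (weak_grad {0<..<1} \<phi>) = L2_inner N.M f \<phi>"
    unfolding v_def V_h_eq N_M by auto
qed

text \<open>
  With \<open>R\<close> the weak gradient of \<open>r\<close>, the two weak formulations tested with functions of the first coordinate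
  say that \<open>R\<close> is orthogonal to all \<open>(\<phi>', 0)\<close>. Hence the energy identity \<open>\<parallel>R\<parallel>\<^sup>2 = \<langle>g, r\<rangle>\<close>, which proves
  the lower bound; the upper bound follows by applying the dual estimate to \<open>r\<close> and cancelling \<open>\<parallel>R\<parallel>\<close>.
\<close>

lemma solution_operators_close:
  assumes g: "g \<in> H_Omega \<Omega>"
  defines "r \<equiv> \<lambda>p. A_Omega_inv \<Omega> g p - J (A_N_inv \<Omega> (P \<Omega> g)) p"
  shows "0 \<le> L2_inner (lborel_on \<Omega>) r g"
    and "L2_inner (lborel_on \<Omega>) r g \<le> 16 ^ Suc DIM('b) * \<epsilon>\<^sup>2 * L2_inner (lborel_on \<Omega>) g g"
proof -
  let ?O = "lborel_on \<Omega>"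
  define u where "u = A_Omega_inv \<Omega> g"
  define v where "v = A_N_inv \<Omega> (P \<Omega> g)"
  have gL: "g \<in> L2 ?O" using g by (simp add: H_Omega_def L2_mean_zero_def)
  note u = A_Omega_inv_solves[OF g, folded u_def]
  note v = A_N_inv_solves[OF P_mean_zero[OF g], folded v_def]
  define G where "G = weak_grad \<Omega> u"
  define lift :: "(real \<Rightarrow> real) \<Rightarrow> real \<times> 'b \<Rightarrow> real \<times> 'b" where "lift \<phi> = (\<lambda>p. (weak_grad {0<..<1} \<phi> (fst p), 0))" for \<phi>
  have uL: "u \<in> L2 ?O" "G \<in> L2 ?O" "has_weak_gradient \<Omega> u G"
    using O.sobD[OF u(1)] by (simp_all add: G_def O_M)
  have liftL: "lift \<phi> \<in> L2 ?O" if "\<phi> \<in> N.sob" for \<phi> unfolding lift_def by (rule J_weak_gradient(2)[OF that])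
  have JL: "J \<phi> \<in> L2 ?O" if "\<phi> \<in> L2 N.M" for \<phi> using coord_L2(1)[OF that] by (simp add: J_eq)
  have vL: "v \<in> L2 N.M" by (rule N.sobD(1)[OF v(1)])
  have r: "r = (\<lambda>p. u p - J v p)" by (simp add: r_def u_def v_def)
  define R where "R p = G p - lift v p" for p
  have rL: "r \<in> L2 ?O" unfolding r by (rule L2_diff[OF uL(1) JL[OF vL]])
  have RL: "R \<in> L2 ?O" unfolding R_def by (rule L2_diff[OF uL(2) liftL[OF v(1)]])
  have rR: "has_weak_gradient \<Omega> r R"
    using has_weak_gradient_add_scale[OF \<Omega>_borel L2_imp_L2_loc[OF uL(1) \<Omega>_borel] L2_imp_L2_loc[OF JL[OF vL] \<Omega>_borel]
        L2_imp_L2_loc[OF uL(2) \<Omega>_borel] L2_imp_L2_loc[OF liftL[OF v(1)] \<Omega>_borel] uL(3)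
        J_weak_gradient(1)[OF v(1), folded lift_def], of "-1"]
    by (simp add: r R_def[abs_def])
  \<comment> \<open>Lifts of derivatives are admissible in the weak form of the equation for \<open>u\<close>.\<close>
  have uJ: "L2_inner ?O G (lift \<phi>) = L2_inner ?O g (J \<phi>)" if \<phi>: "\<phi> \<in> N.sob" for \<phi>
  proof -
    have "L2_inner ?O G (lift \<phi>) = L2_inner ?O G (weak_grad \<Omega> (J \<phi>))"
    proof (rule L2_inner_cong_AE)
      show "AE p in ?O. lift \<phi> p = weak_grad \<Omega> (J \<phi>) p"
        using J_sob(2)[OF \<phi>] by (auto simp: lift_def)
      show "weak_grad \<Omega> (J \<phi>) \<in> borel_measurable ?O"
        by (rule O.weak_grad_measurable[OF J_sob(1)[OF \<phi>]])
    qed (use L2_measurable[OF uL(2)] L2_measurable[OF liftL[OF \<phi>]] in auto)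
    then show ?thesis using u(2)[OF J_sob(1)[OF \<phi>]] by (simp add: G_def)
  qed
  have lift_lift: "L2_inner ?O (lift v) (lift \<phi>) = L2_inner ?O g (J \<phi>)" if \<phi>: "\<phi> \<in> N.sob" for \<phi>
  proof -
    have "L2_inner ?O (lift v) (lift \<phi>) = L2_inner ?O (J (weak_grad {0<..<1} v)) (J (weak_grad {0<..<1} \<phi>))"
      by (simp add: L2_inner_def lift_def J_eq)
    also have "\<dots> = L2_inner N.M (P \<Omega> g) \<phi>"
      unfolding J_inner[OF N.sobD(2)[OF v(1)] N.sobD(2)[OF \<phi>]] by (rule v(2)[OF \<phi>])
    also have "\<dots> = L2_inner ?O g (J \<phi>)"
      using J_P_adjoint[OF N.sobD(1)[OF \<phi>] gL] by (simp add: L2_inner_commute)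
    finally show ?thesis .
  qed
  have R_orth: "L2_inner ?O R (lift \<phi>) = 0" if \<phi>: "\<phi> \<in> N.sob" for \<phi>
    unfolding R_def L2_inner_diff[OF uL(2) liftL[OF v(1)] liftL[OF \<phi>]] uJ[OF \<phi>] lift_lift[OF \<phi>] by simp
  have fstR: "(\<lambda>p. fst (R p)) \<in> L2 ?O"
  proof (rule L2_dominated[OF RL])
    have "(\<lambda>p. R p \<bullet> (1, 0)) \<in> borel_measurable ?O" using L2_measurable[OF RL] by measurable
    then show "(\<lambda>p. fst (R p)) \<in> borel_measurable ?O" by (simp add: inner_prod_def)
    show "norm (fst (R p)) \<le> norm (R p)" for p using norm_fst_le[of "fst (R p)" "snd (R p)"] by simp
  qed
  have R1: "L2_inner ?O (J \<psi>) (\<lambda>p. fst (R p)) = 0"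
    if \<psi>: "\<psi> \<in> borel_measurable borel" "\<And>x. \<bar>\<psi> x\<bar> \<le> C" "\<And>x. x \<notin> {\<alpha>..\<beta>} \<Longrightarrow> \<psi> x = 0" for \<psi> C \<alpha> \<beta>
  proof -
    define \<phi> where "\<phi> x = (\<integral>s. indicator {..x} s * \<psi> s \<partial>lborel)" for x
    have "\<forall>x. x \<notin> {\<alpha>..\<beta>} \<longrightarrow> \<psi> x = 0" using \<psi>(3) by blast
    note \<phi> = primitive_weak_derivative[OF \<psi>(1,2) this, folded \<phi>_def]
    have \<psi>L: "\<psi> \<in> L2 N.M" by (rule bounded_N_L2[OF \<psi>(1,2)])
    note \<phi>' = N.sobD(2)[OF \<phi>(1)]
    have "L2_inner ?O (J \<psi>) (\<lambda>p. fst (R p)) = L2_inner N.M \<psi> (P \<Omega> (\<lambda>p. fst (R p)))"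
      by (rule J_P_adjoint[OF \<psi>L fstR])
    also have "\<dots> = L2_inner N.M (weak_grad {0<..<1} \<phi>) (P \<Omega> (\<lambda>p. fst (R p)))"
    proof (rule L2_inner_cong_AE)
      show "AE x in N.M. \<psi> x = weak_grad {0<..<1} \<phi> x" using \<phi>(2) by auto
    qed (use L2_measurable[OF \<psi>L] L2_measurable[OF \<phi>'] L2_measurable[OF P_L2[OF fstR]] in auto)
    also have "\<dots> = L2_inner ?O (J (weak_grad {0<..<1} \<phi>)) (\<lambda>p. fst (R p))"
      by (rule J_P_adjoint[OF \<phi>' fstR, symmetric])
    also have "\<dots> = L2_inner ?O R (lift \<phi>)"
      by (simp add: L2_inner_def J_eq lift_def inner_prod_def mult.commute)
    finally show ?thesis using R_orth[OF \<phi>(1)] by simp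
  qed
  have energy: "(L2_norm ?O R)\<^sup>2 = L2_inner ?O g r"
  proof -
    have "L2_inner ?O R R = L2_inner ?O G R - L2_inner ?O (lift v) R"
      using L2_inner_diff[OF uL(2) liftL[OF v(1)] RL] by (simp add: R_def[abs_def])
    also have "\<dots> = L2_inner ?O R G" using R_orth[OF v(1)] by (simp add: L2_inner_commute)
    also have "\<dots> = L2_inner ?O G G - L2_inner ?O (lift v) G"
      unfolding R_def by (rule L2_inner_diff[OF uL(2) liftL[OF v(1)] uL(2)])
    also have "\<dots> = L2_inner ?O g u - L2_inner ?O g (J v)"
      using u(2)[OF u(1)] uJ[OF v(1)] by (simp add: L2_inner_commute G_def)
    also have "\<dots> = L2_inner ?O g r"
      unfolding r L2_inner_commute[of ?O g] by (rule L2_inner_diff[OF uL(1) JL[OF vL] gL, symmetric])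
    finally show ?thesis by (simp add: L2_norm_square_inner)
  qed
  let ?c = "4 ^ Suc DIM('b) * \<epsilon> * L2_norm ?O g"
  show "0 \<le> L2_inner ?O r g" unfolding L2_inner_commute[of ?O r] energy[symmetric] by simp
  have "(L2_norm ?O R)\<^sup>2 \<le> ?c * L2_norm ?O R"
    unfolding energy
  proof (rule order_trans[OF abs_ge_self dual_estimate[OF rL RL rR _ g]])
    fix \<psi> :: "real \<Rightarrow> real" and C \<alpha> \<beta> :: real
    assume "\<psi> \<in> borel_measurable borel" "\<And>x. \<bar>\<psi> x\<bar> \<le> C" "\<And>x. x \<notin> {\<alpha>..\<beta>} \<Longrightarrow> \<psi> x = 0"
    then show "L2_inner ?O (J \<psi>) (\<lambda>p. fst (R p)) = 0" by (rule R1)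
  qed
  then have "L2_norm ?O R \<le> ?c"
  proof (cases "L2_norm ?O R = 0")
    case False
    then have "L2_norm ?O R > 0" using L2_norm_nonneg[of ?O R] by linarith
    then show ?thesis using \<open>(L2_norm ?O R)\<^sup>2 \<le> ?c * L2_norm ?O R\<close> by (simp add: power2_eq_square)
  qed (use \<epsilon>_pos in simp)
  then have "(L2_norm ?O R)\<^sup>2 \<le> ?c\<^sup>2" by (rule power_mono) simp
  also have "?c\<^sup>2 = (4 ^ Suc DIM('b))\<^sup>2 * \<epsilon>\<^sup>2 * L2_inner ?O g g"
    by (simp only: power_mult_distrib L2_norm_square_inner)
  also have "((4::real) ^ Suc DIM('b))\<^sup>2 = 16 ^ Suc DIM('b)"
    unfolding power2_eq_square power_mult_distrib[symmetric] by simp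
  finally show "L2_inner ?O r g \<le> 16 ^ Suc DIM('b) * \<epsilon>\<^sup>2 * L2_inner ?O g g"
    unfolding energy L2_inner_commute[of ?O r] .
qed

end

theorem theorem7p1:
  fixes \<Omega> :: "(real \<times> (real ^ 'm)) set"
    and n :: nat
    and \<epsilon> :: real
    and T S :: "(real \<times> (real ^ 'm) \<Rightarrow> real) \<Rightarrow> real \<times> (real ^ 'm) \<Rightarrow> real"
  assumes "n \<ge> 2" and "CARD('m) = n - 1"
    and "bounded \<Omega>" and "open \<Omega>" and "convex \<Omega>" and "interior \<Omega> \<noteq> {}"
    and "diameter \<Omega> = 1"
    and "(0, 0) \<in> closure \<Omega>" and "(1, 0) \<in> closure \<Omega>"
    and "\<epsilon> > 0" and "\<Omega> \<subseteq> {0<..<1} \<times> ball 0 \<epsilon>"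
    and "T = A_Omega_inv \<Omega>"
    and "S = (\<lambda>g. J (A_N_inv \<Omega> (P \<Omega> g)))"
  shows "form_le \<Omega> (\<lambda>g p. 0) (\<lambda>g p. T g p - S g p) \<and>
         form_le \<Omega> (\<lambda>g p. T g p - S g p) (\<lambda>g p. 16 ^ n * \<epsilon>\<^sup>2 * g p)"
proof -
  interpret slab \<Omega> \<epsilon>
    using assms by unfold_locales auto
  have n: "Suc DIM(real ^ 'm) = n" using assms(1,2) by simp
  show ?thesis
    using solution_operators_close unfolding form_le_def assms(12,13) n
    by (simp add: L2_inner_def mult.assoc)
qed

end
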